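(* Let $P$ be a rank $d$ Buchsbaum simplicial poset (over $\mathbf{k}$) and let $\theta_1,\dots,\theta_d$ be a linear system of parameters for $A_P$. Then for all $0\le j\le d$, $$\dim_{\mathbf{k}}\left(\operatorname{Soc}\,A_P/(\theta_1,\dots,\theta_d)A_P\right)_j\;\ge\;\binom{d}{j}\beta_{j-1}(\Delta(\overline P)).$$ Hence $h'_j(P)\ge\binom{d}{j}\beta_{j-1}(\Delta(\overline P))$, or, equivalently, $h_j(P)\ge\binom{d}{j}\sum_{i=0}^{j}(-1)^{j-i}\beta_{i-1}(\Delta(\overline P))$.
   Context: $\mathbf{k}$ is an infinite field. A simplicial poset is a finite poset $P$ with a unique minimal element $\hat0$ such that every interval $[\hat0,\tau]$ is a Boolean algebra; it is graded, and $\rk P=d$ is its rank. $f_i(P)$ is the number of elements of rank $i+1$, and $h(P)=(h_0,\dots,h_d)$ is defined by $\sum_{i=0}^d h_ix^{d-i}=\sum_{i=0}^d f_{i-1}(x-1)^{d-i}$. Here $\rk$ denotes rank. $\overline P=P\setminus\{\hat0\}$, $\Delta(\overline P)$ is its order complex, $\beta_i$ denotes reduced Betti numbers over $\mathbf{k}$, and $$h'_j(P)=h_j(P)+\binom{d}{j}\sum_{i=0}^{j-1}(-1)^{j-i-1}\beta_{i-1}(\Delta(\overline P)).$$ $P$ is Buchsbaum (over $\mathbf{k}$) if the simplicial complex $\Delta=\Delta(\overline P)$ is Buchsbaum, meaning that its Stanley–Reisner ring is a Buchsbaum module; equivalently (Schenzel) $\Delta$ is pure and for each vertex $v$ the link $L$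 of $v$ satisfies $\widetilde H_i(\operatorname{lk}_LF;\mathbf{k})=0$ for all $F\in L$ (including $\emptyset$) and all $i<\dim L-|F|$. Let the atoms of $P$ be $[n]$, $\tilde S=\mathbf{k}[x_\tau:\tau\in P]$, and $S=\mathbf{k}[x_1,\dots,x_n]\subseteq\tilde S$, $\mathfrak{M}=(x_1,\dots,x_n)\subset S$. The face ring is $A_P=\tilde S/I_P$, where $I_P$ is generated by: $x_\tau x_\sigma$ for $\tau,\sigma$ with no common upper bound in $P$; $x_\tau x_\sigma-x_{\tau\wedge\sigma}\sum_\rho x_\rho$ for incomparable $\tau,\sigma$ with a common upper bound, the sum over all minimal upper bounds $\rho$ of $\tau$ and $\sigma$; and $x_{\hat0}-1$. $A_P$ is $\mathbb{Z}$-graded by letting $\deg x_\tau$ be the rank of $\tau$; it is a Noetherian graded $S$-module of Krull dimension $d$. A linear system of parameters for $A_P$ is a sequence $\theta_1,\dots,\theta_d$ of degree-one elements of $S$ with $A_P/(\theta_1,\dots,\theta_d)A_P$ finite-dimensional over $\mathbf{k}$. $\operatorname{Soc} M=\{y\in M:\mathfrak{M}y=0\}$ for an $S$-module $M$, and the subscript $j$ denotes the degree-$j$ component. *)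

theory Defs
  imports
    "HOL-Library.Poly_Mapping"
    "HOL-Computational_Algebra.Polynomial"
    "HOL-Algebra.QuotRing"
    "HOL-Algebra.Embedded_Algebras"
begin

section \<open>Polynomial rings, their quotients, and ideals generated by sequences\<close>

type_synonym ('v, 'k) mpoly = "('v \<Rightarrow>\<^sub>0 nat) \<Rightarrow>\<^sub>0 'k"

text \<open>\<open>polys V\<close> is the polynomial ring \<open>k[x\<^sub>v : v \<in> V]\<close>.\<close>

definition polys :: "'v set \<Rightarrow> ('v, 'k::field) mpoly ring" where
  "polys V = \<lparr>carrier = {p. \<forall>m \<in> Poly_Mapping.keys p. Poly_Mapping.keys m \<subseteq> V},
     mult = (*), one = 1, zero = 0, add = (+)\<rparr>"

definition var :: "'v \<Rightarrow> ('v, 'k::field) mpoly" where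
  "var v = Poly_Mapping.single (Poly_Mapping.single v 1) 1"

definition const :: "'k \<Rightarrow> ('v, 'k::field) mpoly" where
  "const c = Poly_Mapping.single 0 c"

text \<open>\<open>homogeneous w j p\<close>: every monomial of \<open>p\<close> has degree \<open>j\<close> when \<open>deg x\<^sub>v = w v\<close>
  (so \<open>0\<close> is homogeneous of every degree).\<close>

definition homogeneous :: "('v \<Rightarrow> nat) \<Rightarrow> nat \<Rightarrow> ('v, 'k::field) mpoly \<Rightarrow> bool" where
  "homogeneous w j p \<longleftrightarrow> (\<forall>m \<in> Poly_Mapping.keys p.
     (\<Sum>v \<in> Poly_Mapping.keys m. Poly_Mapping.lookup m v * w v) = j)"

definition irrelevant_ideal :: "'v set \<Rightarrow> ('v, 'k::field) mpoly set" where
  "irrelevant_ideal V = Idl\<^bsub>polys V\<^esub> (var ` V)"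

text \<open>In the following, \<open>R\<close> is a polynomial ring, \<open>I\<close> an ideal of \<open>R\<close> and \<open>A = R Quot I\<close>.
  Polynomials \<open>p\<close> act on \<open>A\<close> as multiplication by \<open>I +>\<^bsub>R\<^esub> p\<close>.
  \<open>seq_ideal R I fs\<close> is \<open>(f\<^sub>1, \<dots>, f\<^sub>r)A\<close>, \<open>seq_quot R I fs\<close> is \<open>A/(f\<^sub>1, \<dots>, f\<^sub>r)A\<close>, and
  \<open>seq_class R I fs\<close> is the composite \<open>R \<rightarrow> A \<rightarrow> A/(f\<^sub>1, \<dots>, f\<^sub>r)A\<close>.\<close>

definition seq_ideal ::
  "('v, 'k::field) mpoly ring \<Rightarrow> ('v, 'k) mpoly set \<Rightarrow> ('v, 'k) mpoly list
    \<Rightarrow> ('v, 'k) mpoly set set" where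
  "seq_ideal R I fs = Idl\<^bsub>R Quot I\<^esub> ((\<lambda>f. I +>\<^bsub>R\<^esub> f) ` set fs)"

definition seq_quot ::
  "('v, 'k::field) mpoly ring \<Rightarrow> ('v, 'k) mpoly set \<Rightarrow> ('v, 'k) mpoly list
    \<Rightarrow> ('v, 'k) mpoly set set ring" where
  "seq_quot R I fs = (R Quot I) Quot (seq_ideal R I fs)"

definition seq_class ::
  "('v, 'k::field) mpoly ring \<Rightarrow> ('v, 'k) mpoly set \<Rightarrow> ('v, 'k) mpoly list
    \<Rightarrow> ('v, 'k) mpoly \<Rightarrow> ('v, 'k) mpoly set set" where
  "seq_class R I fs p = seq_ideal R I fs +>\<^bsub>R Quot I\<^esub> (I +>\<^bsub>R\<^esub> p)"

text \<open>The image of the ground field in \<open>A/(f\<^sub>1, \<dots>, f\<^sub>r)A\<close>; all dimensions of subspaces of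
  this quotient are taken over it.\<close>

definition scalars ::
  "('v, 'k::field) mpoly ring \<Rightarrow> ('v, 'k) mpoly set \<Rightarrow> ('v, 'k) mpoly list
    \<Rightarrow> ('v, 'k) mpoly set set set" where
  "scalars R I fs = range (\<lambda>c. seq_class R I fs (const c))"

definition finite_dim_quot ::
  "('v, 'k::field) mpoly ring \<Rightarrow> ('v, 'k) mpoly set \<Rightarrow> ('v, 'k) mpoly list \<Rightarrow> bool" where
  "finite_dim_quot R I fs \<longleftrightarrow>
     ring.finite_dimension (seq_quot R I fs) (scalars R I fs) (carrier (seq_quot R I fs))"

text \<open>\<open>seq_colon R I fs T\<close> is \<open>(f\<^sub>1, \<dots>, f\<^sub>r)A :\<^sub>A T\<close>.\<close>

definition seq_colon ::
  "('v, 'k::field) mpoly ring \<Rightarrow> ('v, 'k) mpoly set \<Rightarrow> ('v, 'k) mpoly list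
    \<Rightarrow> ('v, 'k) mpoly set \<Rightarrow> ('v, 'k) mpoly set set" where
  "seq_colon R I fs T =
     {y \<in> carrier (R Quot I). \<forall>p \<in> T. (I +>\<^bsub>R\<^esub> p) \<otimes>\<^bsub>R Quot I\<^esub> y \<in> seq_ideal R I fs}"


section \<open>Simplicial complexes\<close>

text \<open>A finite simplicial complex is given by its set \<open>K\<close> of faces, including \<open>{}\<close>; its
  vertices are \<open>\<Union>K\<close>.\<close>

subsection \<open>Reduced Betti numbers\<close>

text \<open>Faces are oriented by an order on the vertices that is assumed to be total on every face.
  This is the case for order complexes.\<close>

definition chain_space :: "'k::field itself \<Rightarrow> 'v set set \<Rightarrow> int \<Rightarrow> ('v set \<Rightarrow>\<^sub>0 'k) set" where
  "chain_space _ K i = {c. \<forall>F \<in> Poly_Mapping.keys c. F \<in> K \<and> int (card F) = i + 1}"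

definition boundary_map :: "('v::order set \<Rightarrow>\<^sub>0 'k::field) \<Rightarrow> ('v set \<Rightarrow>\<^sub>0 'k)" where
  "boundary_map c = (\<Sum>F \<in> Poly_Mapping.keys c. \<Sum>v \<in> F.
     Poly_Mapping.single (F - {v}) ((- 1) ^ card {u \<in> F. u < v} * Poly_Mapping.lookup c F))"

definition cycle_space ::
  "'k::field itself \<Rightarrow> 'v::order set set \<Rightarrow> int \<Rightarrow> ('v set \<Rightarrow>\<^sub>0 'k) set" where
  "cycle_space k K i = {c \<in> chain_space k K i. boundary_map c = 0}"

definition boundary_space ::
  "'k::field itself \<Rightarrow> 'v::order set set \<Rightarrow> int \<Rightarrow> ('v set \<Rightarrow>\<^sub>0 'k) set" where
  "boundary_space k K i = boundary_map ` chain_space k K (i + 1)"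

definition chain_scale :: "'k::field \<Rightarrow> ('b \<Rightarrow>\<^sub>0 'k) \<Rightarrow> ('b \<Rightarrow>\<^sub>0 'k)" where
  "chain_scale a = Poly_Mapping.map ((*) a)"

text \<open>The difference is the dimension of \<open>cycle_space k K i / boundary_space k K i\<close>, both spaces
  being finite-dimensional when \<open>K\<close> is finite.\<close>

definition betti :: "'k::field itself \<Rightarrow> 'v::order set set \<Rightarrow> int \<Rightarrow> nat" where
  "betti k K i =
     vector_space.dim chain_scale (cycle_space k K i)
     - vector_space.dim chain_scale (boundary_space k K i)"

subsection \<open>Buchsbaum complexes\<close>

definition stanley_reisner_ideal :: "'v set set \<Rightarrow> ('v, 'k::field) mpoly set" where
  "stanley_reisner_ideal K =
     Idl\<^bsub>polys (\<Union>K)\<^esub> {\<Prod>v\<in>F. var v | F. F \<subseteq> \<Union>K \<and> finite F \<and> F \<notin> K}"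

text \<open>Homogeneous systems of parameters of the Stanley-Reisner ring; its Krull dimension is
  \<open>dim K + 1\<close>, the largest cardinality of a face.\<close>

definition sr_hsop :: "'v set set \<Rightarrow> ('v, 'k::field) mpoly list \<Rightarrow> bool" where
  "sr_hsop K fs \<longleftrightarrow>
     length fs = Max (card ` K) \<and>
     (\<forall>f \<in> set fs. f \<in> carrier (polys (\<Union>K)) \<and> (\<exists>j>0. homogeneous (\<lambda>_. 1) j f)) \<and>
     finite_dim_quot (polys (\<Union>K)) (stanley_reisner_ideal K) fs"

text \<open>\<open>M = R Quot stanley_reisner_ideal K\<close> is a Buchsbaum module: every homogeneous system of
  parameters \<open>f\<^sub>1, \<dots>, f\<^sub>d\<close> is a weak \<open>M\<close>-sequence, i.e.
  \<open>(f\<^sub>1, \<dots>, f\<^sub>i)M : f\<^bsub>i+1\<^esub> = (f\<^sub>1, \<dots>, f\<^sub>i)M : m\<close> for \<open>0 \<le> i < d\<close>,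
  with \<open>m\<close> the irrelevant ideal.\<close>

definition buchsbaum_complex :: "'k::field itself \<Rightarrow> 'v set set \<Rightarrow> bool" where
  "buchsbaum_complex _ K \<longleftrightarrow>
     (\<forall>fs :: ('v, 'k) mpoly list. sr_hsop K fs \<longrightarrow>
        (\<forall>i < length fs.
           seq_colon (polys (\<Union>K)) (stanley_reisner_ideal K) (take i fs) {fs ! i} =
           seq_colon (polys (\<Union>K)) (stanley_reisner_ideal K) (take i fs)
             (irrelevant_ideal (\<Union>K))))"


section \<open>Simplicial posets\<close>

text \<open>Posets are subsets \<open>P\<close> of a partially ordered type, with the induced order.\<close>

definition minimal_in :: "'a::order set \<Rightarrow> 'a \<Rightarrow> bool" where
  "minimal_in X x \<longleftrightarrow> x \<in> X \<and> (\<forall>y \<in> X. y \<le> x \<longrightarrow> y = x)"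

definition zero_hat :: "'a::order set \<Rightarrow> 'a" where
  "zero_hat P = (THE z. minimal_in P z)"

definition boolean_interval :: "'a::order set \<Rightarrow> 'a \<Rightarrow> 'a \<Rightarrow> bool" where
  "boolean_interval P a b \<longleftrightarrow>
     (\<exists>(X::nat set) f. finite X \<and> bij_betw f {x \<in> P. a \<le> x \<and> x \<le> b} (Pow X) \<and>
        (\<forall>x \<in> {x \<in> P. a \<le> x \<and> x \<le> b}. \<forall>y \<in> {x \<in> P. a \<le> x \<and> x \<le> b}.
           x \<le> y \<longleftrightarrow> f x \<subseteq> f y))"

definition simplicial_poset :: "'a::order set \<Rightarrow> bool" where
  "simplicial_poset P \<longleftrightarrow>
     finite P \<and> (\<exists>!z. minimal_in P z) \<and> (\<forall>t \<in> P. boolean_interval P (zero_hat P) t)"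

definition atoms :: "'a::order set \<Rightarrow> 'a set" where
  "atoms P = {x. minimal_in (P - {zero_hat P}) x}"

text \<open>The rank of \<open>t\<close> is the length of the longest chain of \<open>P\<close> ending in \<open>t\<close>.\<close>

definition rk :: "'a::order set \<Rightarrow> 'a \<Rightarrow> nat" where
  "rk P t = Max {card C | C. C \<subseteq> {x \<in> P. x < t} \<and> Complete_Partial_Order.chain (\<le>) C}"

definition poset_rank :: "'a::order set \<Rightarrow> nat" where
  "poset_rank P = Max (rk P ` P)"

text \<open>The order complex of \<open>P\<close> without its minimal element.\<close>

definition order_complex_bar :: "'a::order set \<Rightarrow> 'a set set" where
  "order_complex_bar P =
     {C. C \<subseteq> P - {zero_hat P} \<and> finite C \<and> Complete_Partial_Order.chain (\<le>) C}"

definition buchsbaum_poset :: "'k::field itself \<Rightarrow> 'a::order set \<Rightarrow> bool" where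
  "buchsbaum_poset k P \<longleftrightarrow> buchsbaum_complex k (order_complex_bar P)"

subsection \<open>f-, h- and h'-numbers\<close>

definition fnum :: "'a::order set \<Rightarrow> int \<Rightarrow> nat" where
  "fnum P i = card {t \<in> P. int (rk P t) = i + 1}"

text \<open>\<open>hnum P j\<close> is the coefficient of \<open>x\<^bsup>d-j\<^esup>\<close> in \<open>\<Sum>i\<le>d. f\<^bsub>i-1\<^esub> (x - 1)\<^bsup>d-i\<^esup>\<close>; it is used for
  \<open>j \<le> d\<close> only.\<close>

definition hnum :: "'a::order set \<Rightarrow> nat \<Rightarrow> int" where
  "hnum P j = (let d = poset_rank P in
     Polynomial.coeff (\<Sum>i\<le>d. Polynomial.smult (int (fnum P (int i - 1))) ([:- 1, 1:] ^ (d - i))) (d - j))"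

definition hprime :: "'k::field itself \<Rightarrow> 'a::order set \<Rightarrow> nat \<Rightarrow> int" where
  "hprime k P j = hnum P j + int (poset_rank P choose j) *
     (\<Sum>i<j. (- 1) ^ (j - i - 1) * int (betti k (order_complex_bar P) (int i - 1)))"

subsection \<open>The face ring\<close>

definition upper_bounds :: "'a::order set \<Rightarrow> 'a \<Rightarrow> 'a \<Rightarrow> 'a set" where
  "upper_bounds P s t = {r \<in> P. s \<le> r \<and> t \<le> r}"

text \<open>The meet exists whenever \<open>P\<close> is simplicial and \<open>s\<close>, \<open>t\<close> have a common upper bound.\<close>

definition meet :: "'a::order set \<Rightarrow> 'a \<Rightarrow> 'a \<Rightarrow> 'a" where
  "meet P s t = (THE m. m \<in> P \<and> m \<le> s \<and> m \<le> t \<and> (\<forall>x \<in> P. x \<le> s \<and> x \<le> t \<longrightarrow> x \<le> m))"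

definition face_ideal :: "'a::order set \<Rightarrow> ('a, 'k::field) mpoly set" where
  "face_ideal P = Idl\<^bsub>polys P\<^esub>
     ({var t * var s | t s. t \<in> P \<and> s \<in> P \<and> upper_bounds P t s = {}} \<union>
      {var t * var s - var (meet P t s) * (\<Sum>r | minimal_in (upper_bounds P t s) r. var r) | t s.
         t \<in> P \<and> s \<in> P \<and> \<not> t \<le> s \<and> \<not> s \<le> t \<and> upper_bounds P t s \<noteq> {}} \<union>
      {var (zero_hat P) - 1})"

text \<open>The face ring is \<open>polys P Quot face_ideal P\<close>, and \<open>S = polys (atoms P)\<close>.\<close>

definition face_ring_lsop :: "'a::order set \<Rightarrow> ('a, 'k::field) mpoly list \<Rightarrow> bool" where
  "face_ring_lsop P \<theta>s \<longleftrightarrow>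
     length \<theta>s = poset_rank P \<and>
     (\<forall>\<theta> \<in> set \<theta>s. \<theta> \<in> carrier (polys (atoms P)) \<and> homogeneous (rk P) 1 \<theta>) \<and>
     finite_dim_quot (polys P) (face_ideal P) \<theta>s"

text \<open>The socle of \<open>A\<^sub>P/(\<theta>\<^sub>1, \<dots>, \<theta>\<^sub>r)A\<^sub>P\<close> as an \<open>S\<close>-module.\<close>

definition face_ring_socle ::
  "'a::order set \<Rightarrow> ('a, 'k::field) mpoly list \<Rightarrow> ('a, 'k) mpoly set set set" where
  "face_ring_socle P \<theta>s =
     (let Q = seq_quot (polys P) (face_ideal P) \<theta>s in
      {y \<in> carrier Q. \<forall>p \<in> irrelevant_ideal (atoms P).
         seq_class (polys P) (face_ideal P) \<theta>s p \<otimes>\<^bsub>Q\<^esub> y = \<zero>\<^bsub>Q\<^esub>})"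

definition face_ring_component ::
  "'a::order set \<Rightarrow> ('a, 'k::field) mpoly list \<Rightarrow> nat \<Rightarrow> ('a, 'k) mpoly set set set" where
  "face_ring_component P \<theta>s j =
     seq_class (polys P) (face_ideal P) \<theta>s ` {p \<in> carrier (polys P). homogeneous (rk P) j p}"

definition socle_dim :: "'a::order set \<Rightarrow> ('a, 'k::field) mpoly list \<Rightarrow> nat \<Rightarrow> nat" where
  "socle_dim P \<theta>s j =
     ring.dim (seq_quot (polys P) (face_ideal P) \<theta>s) (scalars (polys P) (face_ideal P) \<theta>s)
       (face_ring_socle P \<theta>s \<inter> face_ring_component P \<theta>s j)"

end

theory Submission
  imports Defs "HOL-Library.Function_Algebras" "HOL-Computational_Algebra.Formal_Power_Series"
begin

text \<open>The face ring has a basis of pairs \<open>(r, m)\<close>, with \<open>m\<close> a monomial whose support is the vertex set of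
  \<open>r\<close>. Combining the Koszul complex of \<open>\<theta>\<^sub>1, \<dots>, \<theta>\<^sub>d\<close> with the cochains on chains of \<open>P\<close> at or above \<open>r\<close>
  gives a double complex. For \<open>m \<noteq> 1\<close> its rows are cochains of a cone with apex \<open>r\<close>, hence exact, while
  for \<open>m = 1\<close> they are the augmented cochains of the order complex. Over a chain with least element \<open>t\<close>
  the column is the Koszul complex of \<open>\<theta>\<close> on the polynomial ring in the vertices of \<open>t\<close>; its homology is
  the common kernel of contractions, and the resulting row of kernels is exact in the relevant range
  because links have vanishing cohomology. A zigzag therefore turns \<open>\<Lambda>\<^sup>j k\<^sup>d \<otimes> H\<^sup>j\<^sup>-\<^sup>1\<close> of the order complex
  into independent classes of degree \<open>j\<close> in \<open>A\<^sub>P/(\<theta>)A\<^sub>P\<close>; multiplied by \<open>x\<^sub>v\<close> the zigzag moves to degree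
  \<open>j + 1\<close>, where its top row is exact too, so these classes lie in the socle. The same zigzags compute
  the Koszul homology in degree \<open>j\<close>, and comparing Euler characteristics bounds \<open>h\<^sub>j\<close>.

  The vanishing of link cohomology is extracted from the Buchsbaum property applied to the parameters
  of the Stanley-Reisner ring formed by the sums of all vertices of a given rank, with the ranks above
  that of \<open>t\<close> first: in suitable multidegrees weak regularity says that the cochain complex of the link of
  \<open>t\<close> stays exact as one colour after another is added.\<close>

section \<open>Koszul complexes\<close>

text \<open>For a merely Buchsbaum \<open>P\<close> the Koszul complex of \<theta> on the face ring
  has homology; the double complex locates it. A chain with least element t sees the face ring only
  through the polynomial ring on the vertices of t. There the parameter property makes the
  coefficient vectors of \<theta> at these vertices independent, so a column over a nonempty chain
  is exact in positive polynomial degree. In total degree J the trivial monomial occurs only in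
  Koszul degree J, so homology in Koszul degree p has to travel q = J - p steps, each raising both
  the Koszul degree and the size of the chain by one. Hence the Betti number of index q - 1 meets
  the binomial coefficient of J. The bound q < J in the exactness of the kernels arises as follows:
  a nonzero kernel over t forces J + card (V t) \<le> d, so q stays below d - card (V t), the range
  where the link of t is acyclic. For p > 0 all Koszul homology is obtained this way; for p = 0 only
  independent classes are, and this is the one place where the count of dimensions yields an
  inequality.\<close>

definition sg :: "'b::order \<Rightarrow> 'b set \<Rightarrow> 'k::comm_ring_1" where
  "sg v F = (- 1) ^ card {u \<in> F. u < v}"

lemma sg_remove_less:
  assumes "finite F" "u \<in> F" "u < v"
  shows "(sg v (F - {u}) :: 'k::comm_ring_1) = - sg v F"
proof -
  have "{x \<in> F. x < v} = insert u {x \<in> F - {u}. x < v}" using assms by auto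
  then have "card {x \<in> F. x < v} = Suc (card {x \<in> F - {u}. x < v})" using assms by simp
  then show ?thesis by (simp add: sg_def)
qed

lemma sg_remove_nless: "\<not> u < v \<Longrightarrow> sg v (F - {u}) = sg v F"
  by (simp add: sg_def) (metis (no_types, lifting) Diff_iff singletonD)

lemma sg_insert_less:
  assumes "finite F" "u \<notin> F" "u < v"
  shows "(sg v (insert u F) :: 'k::comm_ring_1) = - sg v F"
  using sg_remove_less[of "insert u F" u v, where 'k='k] assms by simp

lemma sg_insert_nless: "\<not> u < v \<Longrightarrow> sg v (insert u F) = sg v F"
  by (simp add: sg_def) (metis insert_iff)

lemma sg_square: "sg v F * (sg v F * x) = x" "sg v F * sg v F = 1"
  by (simp_all add: sg_def flip: mult.assoc power_add)

text \<open>In characteristic 2 antisymmetry does not force the diagonal to vanish, so the diagonal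
  is a separate assumption.\<close>

lemma alternating_sum_0:
  fixes a :: "'b \<Rightarrow> 'b \<Rightarrow> 'k::comm_ring_1"
  assumes "finite A" "\<And>x. x \<in> A \<Longrightarrow> a x x = 0" "\<And>x y. x \<in> A \<Longrightarrow> y \<in> A \<Longrightarrow> a x y = - a y x"
  shows "(\<Sum>x\<in>A. \<Sum>y\<in>A. a x y) = 0"
  using assms
proof (induction A rule: finite_induct)
  case (insert z A)
  have 1: "(\<Sum>x\<in>A. a x z) = (\<Sum>x\<in>A. - a z x)" by (intro sum.cong refl insert.prems(2)) auto
  have 2: "(\<Sum>x\<in>A. \<Sum>y\<in>A. a x y) = 0" by (intro insert.IH insert.prems) auto
  have 3: "a z z = 0" by (intro insert.prems) auto
  show ?case using insert.hyps by (simp add: sum.distrib 1 2 3 sum_negf)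
qed (rule sum.empty)

text \<open>An element of the exterior algebra on e_0, ..., e_(d-1) is given by its coefficients:
  \<phi> T x is the coefficient of e_T, and x is a spectator. This is the interior product with the
  functional that sends e_i to u i.\<close>

definition iota :: "nat \<Rightarrow> (nat \<Rightarrow> 'k) \<Rightarrow> (nat set \<Rightarrow> 'x \<Rightarrow> 'k::field) \<Rightarrow> nat set \<Rightarrow> 'x \<Rightarrow> 'k" where
  "iota d u \<phi> T x = (\<Sum>i\<in>{..<d} - T. u i * sg i T * \<phi> (insert i T) x)"

text \<open>Left exterior multiplication by the vector with coordinates a k. The guard keeps the
  result supported on subsets of {..<d}.\<close>

definition eps :: "nat \<Rightarrow> (nat \<Rightarrow> 'k) \<Rightarrow> (nat set \<Rightarrow> 'x \<Rightarrow> 'k::field) \<Rightarrow> nat set \<Rightarrow> 'x \<Rightarrow> 'k" where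
  "eps d a \<phi> T x = (if T \<subseteq> {..<d} then \<Sum>k\<in>T. a k * sg k T * \<phi> (T - {k}) x else 0)"

text \<open>Inserting i and k in the two possible orders produces opposite signs. The vanishing of
  the square is proved separately, because anticommutation gives only twice the square.\<close>

lemma iota_iota:
  assumes T: "T \<subseteq> {..<d}"
  shows "iota d u (iota d w \<phi>) T x = - iota d w (iota d u \<phi>) T x" (is ?A)
    and "iota d u (iota d u \<phi>) T x = 0" (is ?B)
proof -
  have fT: "finite T" using T finite_subset by blast
  let ?N = "{..<d} - T"
  let ?s = "\<lambda>i k. sg i T * sg k (insert i T) * \<phi> (insert k (insert i T)) x"
  let ?a = "\<lambda>u w i k. if i = k then 0 else u i * w k * ?s i k"
  have sw: "?s i k = - ?s k i" if "i \<in> ?N" "k \<in> ?N" "i \<noteq> k" for i k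
  proof -
    have *: "?s i k = - ?s k i" if "i \<in> ?N" "k \<in> ?N" "i < k" for i k
      using that fT by (simp add: sg_insert_less sg_insert_nless insert_commute mult.commute mult.left_commute)
    show ?thesis using *[of i k] *[of k i] that by (cases "i < k") (auto simp: linorder_neq_iff)
  qed
  have e: "iota d u (iota d w \<phi>) T x = (\<Sum>i\<in>?N. \<Sum>k\<in>?N. ?a u w i k)" for u w
  proof -
    have "u i * sg i T * iota d w \<phi> (insert i T) x = (\<Sum>k\<in>?N. ?a u w i k)" if "i \<in> ?N" for i
    proof -
      have N: "{..<d} - insert i T = ?N - {i}" by auto
      show ?thesis unfolding iota_def N sum_distrib_left
        using that by (subst (2) sum.remove[of _ i]) (auto simp: mult_ac intro!: sum.cong)
    qed
    then show ?thesis by (simp add: iota_def[of d u])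
  qed
  show ?A unfolding e
  proof -
    have "(\<Sum>i\<in>?N. \<Sum>k\<in>?N. ?a u w i k) = (\<Sum>i\<in>?N. \<Sum>k\<in>?N. - ?a w u k i)"
    proof (intro sum.cong refl)
      fix i k assume ik: "i \<in> ?N" "k \<in> ?N"
      show "?a u w i k = - ?a w u k i"
      proof (cases "i = k")
        case False
        have "u i * w k * ?s i k = u i * w k * - ?s k i" by (simp only: sw[OF ik False])
        with False show ?thesis by (simp add: mult_ac)
      qed simp
    qed
    also have "\<dots> = - (\<Sum>i\<in>?N. \<Sum>k\<in>?N. ?a w u k i)" by (simp only: sum_negf)
    also have "(\<Sum>i\<in>?N. \<Sum>k\<in>?N. ?a w u k i) = (\<Sum>k\<in>?N. \<Sum>i\<in>?N. ?a w u k i)" by (rule sum.swap)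
    finally show "(\<Sum>i\<in>?N. \<Sum>k\<in>?N. ?a u w i k) = - (\<Sum>i\<in>?N. \<Sum>k\<in>?N. ?a w u i k)" .
  qed
  show ?B unfolding e
  proof (rule alternating_sum_0)
    fix i k assume ik: "i \<in> ?N" "k \<in> ?N"
    show "?a u u i k = - ?a u u k i"
    proof (cases "i = k")
      case False
      have "u i * u k * ?s i k = u i * u k * - ?s k i" by (simp only: sw[OF ik False])
      with False show ?thesis by (simp add: mult_ac)
    qed simp
  qed auto
qed

text \<open>The Clifford relation. The mixed terms, i outside T and k inside T, cancel; of the
  diagonal terms those with i outside T come from inserting and removing i, those with i in T from
  removing and inserting it.\<close>

lemma iota_eps:
  assumes T: "T \<subseteq> {..<d}"
  shows "iota d u (eps d a \<phi>) T x + eps d a (iota d u \<phi>) T x = (\<Sum>i<d. u i * a i) * \<phi> T x"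
proof -
  have fT: "finite T" using T finite_subset by blast
  let ?N = "{..<d} - T"
  let ?X = "\<lambda>i k. u i * a k * (sg i T * sg k (insert i T) * \<phi> (insert i (T - {k})) x)"
  let ?Y = "\<lambda>i k. u i * a k * (sg k T * sg i (T - {k}) * \<phi> (insert i (T - {k})) x)"
  have 1: "iota d u (eps d a \<phi>) T x = (\<Sum>i\<in>?N. u i * a i * \<phi> T x) + (\<Sum>i\<in>?N. \<Sum>k\<in>T. ?X i k)"
  proof -
    have "u i * sg i T * eps d a \<phi> (insert i T) x = u i * a i * \<phi> T x + (\<Sum>k\<in>T. ?X i k)"
      if i: "i \<in> ?N" for i
    proof -
      have "eps d a \<phi> (insert i T) x = a i * sg i T * \<phi> T x
          + (\<Sum>k\<in>T. a k * sg k (insert i T) * \<phi> (insert i (T - {k})) x)"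
        unfolding eps_def using i fT T
        by (auto simp: sg_insert_nless insert_Diff_if intro!: sum.cong)
      then show ?thesis by (simp add: distrib_left sum_distrib_left sg_square mult_ac)
    qed
    then show ?thesis by (simp add: iota_def sum.distrib)
  qed
  have 2: "eps d a (iota d u \<phi>) T x = (\<Sum>k\<in>T. u k * a k * \<phi> T x) + (\<Sum>k\<in>T. \<Sum>i\<in>?N. ?Y i k)"
  proof -
    have "a k * sg k T * iota d u \<phi> (T - {k}) x = u k * a k * \<phi> T x + (\<Sum>i\<in>?N. ?Y i k)"
      if k: "k \<in> T" for k
    proof -
      have N: "{..<d} - (T - {k}) = insert k ?N" using k T by auto
      have "iota d u \<phi> (T - {k}) x = u k * sg k T * \<phi> T x
          + (\<Sum>i\<in>?N. u i * sg i (T - {k}) * \<phi> (insert i (T - {k})) x)"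
        unfolding iota_def N using k by (simp add: sg_remove_nless insert_absorb)
      then show ?thesis by (simp add: distrib_left sum_distrib_left sg_square mult_ac)
    qed
    then show ?thesis using T by (simp add: eps_def sum.distrib)
  qed
  have 3: "?X i k = - ?Y i k" if "i \<in> ?N" "k \<in> T" for i k
  proof -
    have "i \<noteq> k" using that by auto
    then consider "i < k" | "k < i" by linarith
    then show ?thesis using that fT
      by cases (simp_all add: sg_insert_less sg_insert_nless sg_remove_less sg_remove_nless mult_ac)
  qed
  have "(\<Sum>i\<in>?N. \<Sum>k\<in>T. ?X i k) = (\<Sum>i\<in>?N. \<Sum>k\<in>T. - ?Y i k)"
    by (intro sum.cong refl 3)
  also have "\<dots> = - (\<Sum>k\<in>T. \<Sum>i\<in>?N. ?Y i k)" by (simp only: sum_negf) (subst sum.swap, rule refl)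
  finally have 4: "(\<Sum>i\<in>?N. \<Sum>k\<in>T. ?X i k) = - (\<Sum>k\<in>T. \<Sum>i\<in>?N. ?Y i k)" .
  have "{..<d} = ?N \<union> T" using T by auto
  then have "(\<Sum>i<d. u i * a i) = (\<Sum>i\<in>?N. u i * a i) + (\<Sum>i\<in>T. u i * a i)"
    using fT sum.union_disjoint[of ?N T "\<lambda>i. u i * a i"] by auto
  then show ?thesis unfolding 1 2 4 by (simp add: distrib_right sum_distrib_right)
qed

text \<open>With \<theta>_i the sum over v of \<theta> v i times x_v, the Koszul differential, the
  sum of \<theta>_i times contraction by e_i, equals the sum over v of x_v times contraction by
  \<theta> v. In coefficients, multiplication by x_v evaluates at the quotient index:
  \<open>s v x\<close> is x divided by x_v, or \<open>None\<close> if x_v does not divide x.\<close>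

definition kos :: "nat \<Rightarrow> 'v set \<Rightarrow> ('v \<Rightarrow> 'x \<Rightarrow> 'x option) \<Rightarrow> ('v \<Rightarrow> nat \<Rightarrow> 'k) \<Rightarrow>
    (nat set \<Rightarrow> 'x \<Rightarrow> 'k::field) \<Rightarrow> nat set \<Rightarrow> 'x \<Rightarrow> 'k" where
  "kos d V s \<theta> \<phi> T x = (\<Sum>v\<in>V. case s v x of None \<Rightarrow> 0 | Some y \<Rightarrow> iota d (\<theta> v) \<phi> T y)"

lemma iota_kos:
  "iota d u (kos d V s \<theta> \<phi>) T x
    = (\<Sum>v\<in>V. case s v x of None \<Rightarrow> 0 | Some y \<Rightarrow> iota d u (iota d (\<theta> v) \<phi>) T y)"
proof -
  have "iota d u (kos d V s \<theta> \<phi>) T x = (\<Sum>v\<in>V. \<Sum>i\<in>{..<d} - T. u i * sg i T *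
      (case s v x of None \<Rightarrow> 0 | Some y \<Rightarrow> iota d (\<theta> v) \<phi> (insert i T) y))"
    unfolding iota_def[of d u] kos_def sum_distrib_left by (rule sum.swap)
  also have "\<dots> = (\<Sum>v\<in>V. case s v x of None \<Rightarrow> 0 | Some y \<Rightarrow> iota d u (iota d (\<theta> v) \<phi>) T y)"
    by (rule sum.cong) (auto simp: iota_def[of d u] split: option.split)
  finally show ?thesis .
qed

text \<open>Contractions anticommute while the partial divisions commute, so the double sum is
  alternating.\<close>

lemma kos_kos:
  assumes V: "finite V" and T: "T \<subseteq> {..<d}"
    and c: "\<And>v w x. v \<in> V \<Longrightarrow> w \<in> V \<Longrightarrow> Option.bind (s v x) (s w) = Option.bind (s w x) (s v)"
  shows "kos d V s \<theta> (kos d V s \<theta> \<phi>) T x = 0"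
proof -
  let ?a = "\<lambda>v w. case Option.bind (s v x) (s w) of None \<Rightarrow> 0
      | Some y \<Rightarrow> iota d (\<theta> v) (iota d (\<theta> w) \<phi>) T y"
  have "kos d V s \<theta> (kos d V s \<theta> \<phi>) T x = (\<Sum>v\<in>V. \<Sum>w\<in>V. ?a v w)"
    unfolding kos_def[of d V s \<theta> "kos d V s \<theta> \<phi>"] iota_kos
    by (rule sum.cong) (auto split: option.split)
  also have "\<dots> = 0"
  proof (rule alternating_sum_0[OF V])
    fix v show "?a v v = 0" by (auto simp: iota_iota(2)[OF T] split: option.split)
  next
    fix v w assume "v \<in> V" "w \<in> V"
    then have "Option.bind (s v x) (s w) = Option.bind (s w x) (s v)" by (rule c)
    then show "?a v w = - ?a w v"
      by (auto simp: iota_iota(1)[OF T, of "\<theta> v" "\<theta> w"] split: option.split)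
  qed
  finally show ?thesis .
qed

lemma iota_diff: "iota d u (\<phi> - \<psi>) T x = iota d u \<phi> T x - iota d u \<psi> T x"
  by (simp add: iota_def right_diff_distrib sum_subtractf)

lemma iota_add: "iota d u (\<phi> + \<psi>) T x = iota d u \<phi> T x + iota d u \<psi> T x"
  by (simp add: iota_def distrib_left sum.distrib)

lemma kos_add: "kos d V s \<theta> (\<phi> + \<psi>) = kos d V s \<theta> \<phi> + kos d V s \<theta> \<psi>"
  by (intro ext) (auto simp: kos_def iota_add simp flip: sum.distrib intro!: sum.cong split: option.split)

lemma kos_diff: "kos d V s \<theta> (\<phi> - \<psi>) = kos d V s \<theta> \<phi> - kos d V s \<theta> \<psi>"
  by (intro ext) (auto simp: kos_def iota_diff simp flip: sum_subtractf intro!: sum.cong split: option.split)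

text \<open>If \<open>a\<close> is dual to \<open>\<theta>\<close>, each of the contractions \<open>iota (\<theta> v)\<close> is split by wedging with \<open>a v\<close>,
  so that a common kernel lives in exterior degree at most \<open>d - card V\<close>.\<close>

lemma eps_support:
  assumes "\<And>T x. g T x \<noteq> 0 \<Longrightarrow> T \<subseteq> {..<d} \<and> card T = j" and nz: "eps d a g T x \<noteq> 0"
  shows "T \<subseteq> {..<d} \<and> card T = Suc j"
proof -
  have T: "T \<subseteq> {..<d}" using nz by (auto simp: eps_def split: if_splits)
  then obtain k where k: "k \<in> T" "a k * sg k T * g (T - {k}) x \<noteq> 0"
    using nz unfolding eps_def by (metis (no_types, lifting) sum.neutral)
  then have "card (T - {k}) = j" using assms(1)[of "T - {k}" x] by auto
  moreover have "finite T" using T finite_subset by blast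
  ultimately show ?thesis using k(1) T by (metis card.remove)
qed

lemma contraction_kernel_zero:
  assumes "finite V"
    and "\<And>v w. v \<in> V \<Longrightarrow> w \<in> V \<Longrightarrow> (\<Sum>i<d. \<theta> v i * a w i) = (if v = w then 1 else 0)"
    and "\<And>T x. g T x \<noteq> 0 \<Longrightarrow> T \<subseteq> {..<d} \<and> card T = j"
    and "\<And>v T x. v \<in> V \<Longrightarrow> T \<subseteq> {..<d} \<Longrightarrow> iota d (\<theta> v) g T x = 0"
    and "d < j + card V"
  shows "g T x = (0 :: 'k::field)"
  using assms
proof (induction V arbitrary: g j T x rule: finite_induct)
  case empty
  show ?case
  proof (rule ccontr)
    assume "g T x \<noteq> 0"
    with empty.prems(2) have "T \<subseteq> {..<d}" "card T = j" by blast+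
    then show False using card_mono[of "{..<d}" T] empty.prems(4) by simp
  qed
next
  case (insert v V)
  \<comment> \<open>Wedging with \<open>a v\<close> raises the exterior degree by one and stays in
    the kernels for the remaining vertices, so \<open>j + card V\<close> is preserved when v is
    dropped. Once \<open>?g\<close> vanishes, the Clifford relation returns g = 0.\<close>
  let ?g = "eps d (a v) g"
  have e0: "eps d (a v) (iota d (\<theta> w) g) T x = 0" if w: "w \<in> insert v V" for w T x
  proof -
    have "iota d (\<theta> w) g (T - {k}) x = 0" if "T \<subseteq> {..<d}" for k
      by (rule insert.prems(3)[OF w]) (use that in auto)
    then show ?thesis by (simp add: eps_def)
  qed
  have z: "?g T x = 0" for T x
  proof (rule insert.IH[of _ "Suc j"])
    fix w T x assume w: "w \<in> V" and T: "T \<subseteq> {..<d}"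
    have "iota d (\<theta> w) ?g T x + eps d (a v) (iota d (\<theta> w) g) T x = 0"
      unfolding iota_eps[OF T] using insert.prems(1)[of w v] w insert.hyps by auto
    moreover have "eps d (a v) (iota d (\<theta> w) g) T x = 0"
      using w by (intro e0) simp
    ultimately show "iota d (\<theta> w) ?g T x = 0" by simp
  next
    fix T x assume nz: "?g T x \<noteq> 0"
    show "T \<subseteq> {..<d} \<and> card T = Suc j" by (rule eps_support[OF _ nz]) (rule insert.prems(2))
  next
    fix v' w assume "v' \<in> V" "w \<in> V"
    then show "(\<Sum>i<d. \<theta> v' i * a w i) = (if v' = w then 1 else 0)" by (intro insert.prems(1)) auto
  next
    show "d < Suc j + card V" using insert.prems(4) insert.hyps by simp
  qed
  show ?case
  proof (cases "T \<subseteq> {..<d}")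
    case True
    have "iota d (\<theta> v) ?g T x + eps d (a v) (iota d (\<theta> v) g) T x = g T x"
      unfolding iota_eps[OF True] using insert.prems(1)[of v v] by simp
    moreover have "iota d (\<theta> v) ?g T x = 0" by (simp add: iota_def z)
    moreover have "eps d (a v) (iota d (\<theta> v) g) T x = 0"
      by (intro e0) simp
    ultimately show ?thesis by simp
  qed (use insert.prems(2) in blast)
qed

section \<open>Koszul complexes of polynomial rings\<close>

abbreviation esingle :: "'v \<Rightarrow> 'v \<Rightarrow>\<^sub>0 nat" where "esingle v \<equiv> Poly_Mapping.single v (Suc 0)"

definition mdeg :: "('v \<Rightarrow>\<^sub>0 nat) \<Rightarrow> nat" where
  "mdeg m = (\<Sum>v\<in>Poly_Mapping.keys m. Poly_Mapping.lookup m v)"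

lemma mdeg_superset:
  assumes "finite A" "Poly_Mapping.keys m \<subseteq> A"
  shows "mdeg m = (\<Sum>v\<in>A. Poly_Mapping.lookup m v)"
  unfolding mdeg_def using assms by (intro sum.mono_neutral_left) (auto simp: in_keys_iff)

lemma mdeg_plus: "mdeg (m + m') = mdeg m + mdeg m'"
proof -
  let ?A = "Poly_Mapping.keys m \<union> Poly_Mapping.keys m'"
  have "Poly_Mapping.keys (m + m') \<subseteq> ?A" by (rule Poly_Mapping.keys_add)
  then show ?thesis by (simp add: mdeg_superset[of ?A] lookup_add sum.distrib)
qed

lemma mdeg_single: "mdeg (Poly_Mapping.single v n) = n"
  by (cases "n = 0") (auto simp: mdeg_def)

lemma mdeg_eq_0: "mdeg m = 0 \<longleftrightarrow> m = 0"
  by (auto simp: mdeg_def in_keys_iff intro!: poly_mapping_eqI)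

lemma keys_plus_nat:
  "Poly_Mapping.keys (m + m' :: 'v \<Rightarrow>\<^sub>0 nat) = Poly_Mapping.keys m \<union> Poly_Mapping.keys m'"
  by (auto simp: in_keys_iff lookup_add)

lemma minus_esingle_plus: "v \<in> Poly_Mapping.keys m \<Longrightarrow> (m - esingle v) + esingle v = m"
  by (rule poly_mapping_eqI) (auto simp: lookup_add lookup_minus lookup_single in_keys_iff when_def)

lemma mdeg_minus_esingle: "v \<in> Poly_Mapping.keys m \<Longrightarrow> Suc (mdeg (m - esingle v)) = mdeg m"
  using mdeg_plus[of "m - esingle v" "esingle v"] by (simp add: minus_esingle_plus mdeg_single)

lemma keys_minus_esingle: "Poly_Mapping.keys (m - esingle v) \<subseteq> Poly_Mapping.keys m"
  by (auto simp: in_keys_iff lookup_minus)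

definition mdiv :: "'v \<Rightarrow> ('v \<Rightarrow>\<^sub>0 nat) \<Rightarrow> ('v \<Rightarrow>\<^sub>0 nat) option" where
  "mdiv v m = (if v \<in> Poly_Mapping.keys m then Some (m - esingle v) else None)"

text \<open>With \<open>D\<close> the divided difference in \<open>x\<^sub>v\<close>, the operator \<open>eps (a v) \<circ> D\<close> is a homotopy from the
  identity of the Koszul complex to a chain map whose image does not involve \<open>x\<^sub>v\<close>.\<close>

lemma poly_koszul_homotopy:
  fixes \<chi> :: "nat set \<Rightarrow> ('v \<Rightarrow>\<^sub>0 nat) \<Rightarrow> 'k::field"
  assumes V: "finite V" and v: "v \<in> V" and T: "T \<subseteq> {..<d}"
    and dual: "\<And>w. w \<in> V \<Longrightarrow> (\<Sum>i<d. \<theta> w i * a i) = (if w = v then 1 else 0)"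
  defines "\<sigma> \<equiv> \<lambda>\<phi> T m. eps d a \<phi> T (m + esingle v)"
  shows "kos d V mdiv \<theta> (\<sigma> \<chi>) T m + \<sigma> (kos d V mdiv \<theta> \<chi>) T m =
    \<chi> T m - (if v \<in> Poly_Mapping.keys m then 0 else iota d (\<theta> v) (eps d a \<chi>) T m)"
proof -
  have ek: "eps d a (kos d V mdiv \<theta> \<chi>) T y
      = (\<Sum>w\<in>V. case mdiv w y of None \<Rightarrow> 0 | Some y' \<Rightarrow> eps d a (iota d (\<theta> w) \<chi>) T y')" for y
  proof -
    have "eps d a (kos d V mdiv \<theta> \<chi>) T y = (\<Sum>w\<in>V. \<Sum>k\<in>T. a k * sg k T *
        (case mdiv w y of None \<Rightarrow> 0 | Some y' \<Rightarrow> iota d (\<theta> w) \<chi> (T - {k}) y'))"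
      using T unfolding eps_def kos_def sum_distrib_left by simp (rule sum.swap)
    also have "\<dots> = (\<Sum>w\<in>V. case mdiv w y of None \<Rightarrow> 0 | Some y' \<Rightarrow> eps d a (iota d (\<theta> w) \<chi>) T y')"
      using T by (intro sum.cong) (auto simp: eps_def split: option.split)
    finally show ?thesis .
  qed
  have ios: "iota d u (\<sigma> \<chi>) T y = iota d u (eps d a \<chi>) T (y + esingle v)" for u y
    by (simp add: \<sigma>_def iota_def)
  let ?t = "\<lambda>w. (case mdiv w m of None \<Rightarrow> 0 | Some y \<Rightarrow> iota d (\<theta> w) (\<sigma> \<chi>) T y) +
    (case mdiv w (m + esingle v) of None \<Rightarrow> 0 | Some y \<Rightarrow> eps d a (iota d (\<theta> w) \<chi>) T y)"
  \<comment> \<open>For w other than v, duality makes contraction by \<theta> w anticommute with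
    wedging by a, and dividing by x_w commutes with the shift by x_v.\<close>
  have t0: "?t w = 0" if w: "w \<in> V" "w \<noteq> v" for w
  proof -
    have k: "w \<in> Poly_Mapping.keys (m + esingle v) \<longleftrightarrow> w \<in> Poly_Mapping.keys m"
      using w by (auto simp: keys_plus_nat)
    have "m + esingle v - esingle w = m - esingle w + esingle v" if "w \<in> Poly_Mapping.keys m"
      using w by (intro poly_mapping_eqI)
        (auto simp: lookup_add lookup_minus lookup_single when_def)
    then show ?thesis
      using iota_eps[OF T, of "\<theta> w" a \<chi> "m - esingle w + esingle v"] dual[of w] w
      by (auto simp: mdiv_def k ios)
  qed
  have "kos d V mdiv \<theta> (\<sigma> \<chi>) T m + \<sigma> (kos d V mdiv \<theta> \<chi>) T m = (\<Sum>w\<in>V. ?t w)"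
  proof -
    have "\<sigma> (kos d V mdiv \<theta> \<chi>) T m = eps d a (kos d V mdiv \<theta> \<chi>) T (m + esingle v)"
      by (simp add: \<sigma>_def)
    then show ?thesis unfolding ek by (simp add: kos_def sum.distrib)
  qed
  also have "\<dots> = ?t v" using V v t0 by (subst sum.remove[of _ v]) (auto intro!: sum.neutral)
  also have "\<dots> = \<chi> T m - (if v \<in> Poly_Mapping.keys m then 0 else iota d (\<theta> v) (eps d a \<chi>) T m)"
  proof -
    have vm: "mdiv v (m + esingle v) = Some m" by (simp add: mdiv_def keys_plus_nat)
    show ?thesis
    proof (cases "v \<in> Poly_Mapping.keys m")
      case True
      have "?t v = iota d (\<theta> v) (eps d a \<chi>) T m + eps d a (iota d (\<theta> v) \<chi>) T m"
        using True minus_esingle_plus[OF True] unfolding vm by (simp add: mdiv_def ios)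
      then show ?thesis using True iota_eps[OF T, of "\<theta> v" a \<chi> m] dual[OF v] by simp
    next
      case False
      have "?t v = eps d a (iota d (\<theta> v) \<chi>) T m"
        using False unfolding vm by (simp add: mdiv_def)
      then show ?thesis using False iota_eps[OF T, of "\<theta> v" a \<chi> m] dual[OF v]
        by (simp add: algebra_simps)
    qed
  qed
  finally show ?thesis .
qed

lemma mdiv_commute: "Option.bind (mdiv v x) (mdiv w) = Option.bind (mdiv w x) (mdiv v)"
proof (cases "v = w")
  case False
  have "x - esingle v - esingle w = x - esingle w - esingle v"
    by (rule poly_mapping_eqI) (simp add: lookup_minus)
  moreover have "v \<in> Poly_Mapping.keys (x - esingle w) \<longleftrightarrow> v \<in> Poly_Mapping.keys x"
    "w \<in> Poly_Mapping.keys (x - esingle v) \<longleftrightarrow> w \<in> Poly_Mapping.keys x"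
    using False by (auto simp: in_keys_iff lookup_minus lookup_single)
  ultimately show ?thesis by (simp add: mdiv_def)
qed simp

lemma kos_support:
  assumes "kos d V s \<theta> \<psi> T x \<noteq> 0"
  obtains v i y where "v \<in> V" "s v x = Some y" "i \<in> {..<d} - T" "\<psi> (insert i T) y \<noteq> 0"
proof -
  obtain v where v: "v \<in> V" "(case s v x of None \<Rightarrow> 0 | Some y \<Rightarrow> iota d (\<theta> v) \<psi> T y) \<noteq> 0"
    using assms unfolding kos_def by (metis (no_types, lifting) sum.neutral)
  then obtain y where y: "s v x = Some y" "iota d (\<theta> v) \<psi> T y \<noteq> 0" by (cases "s v x") auto
  then obtain i where "i \<in> {..<d} - T" "\<psi> (insert i T) y \<noteq> 0"
    unfolding iota_def by (metis (no_types, lifting) mult_zero_right sum.neutral)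
  with v y that show ?thesis by blast
qed

lemma kos_mdiv_support:
  assumes s: "\<And>T m. \<psi> T m \<noteq> 0 \<Longrightarrow>
      T \<subseteq> {..<d} \<and> card T = Suc p \<and> Poly_Mapping.keys m \<subseteq> V \<and> mdeg m = e"
    and nz: "kos d V mdiv \<theta> \<psi> T m \<noteq> 0"
  shows "T \<subseteq> {..<d} \<and> card T = p \<and> Poly_Mapping.keys m \<subseteq> V \<and> mdeg m = Suc e"
proof -
  obtain v i y where *: "v \<in> V" "mdiv v m = Some y" "i \<in> {..<d} - T" "\<psi> (insert i T) y \<noteq> 0"
    by (rule kos_support[OF nz])
  then have vm: "v \<in> Poly_Mapping.keys m" "y = m - esingle v" by (auto simp: mdiv_def split: if_splits)
  have **: "insert i T \<subseteq> {..<d}" "card (insert i T) = Suc p" "Poly_Mapping.keys y \<subseteq> V" "mdeg y = e"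
    using s[OF *(4)] by auto
  have "finite T" using **(1) by (meson finite_lessThan finite_subset insert_subset)
  moreover have "Poly_Mapping.keys m = Poly_Mapping.keys y \<union> {v}"
    using keys_plus_nat[of y "esingle v"] minus_esingle_plus[OF vm(1)] vm(2) by simp
  ultimately show ?thesis using * ** mdeg_minus_esingle[OF vm(1)] vm(2) by auto
qed

text \<open>The homotopy is applied for one variable after another. Each time the cycle changes by a
  boundary and loses all monomials that involve the variable; after the last variable nothing is
  left, since a monomial of positive degree in \<open>V\<close> involves some variable.\<close>

lemma poly_koszul_exact:
  fixes \<phi> :: "nat set \<Rightarrow> ('v \<Rightarrow>\<^sub>0 nat) \<Rightarrow> 'k::field"
  assumes V: "finite V"
    and dual: "\<And>v w. v \<in> V \<Longrightarrow> w \<in> V \<Longrightarrow> (\<Sum>i<d. \<theta> v i * a w i) = (if v = w then 1 else 0)"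
    and supp: "\<And>T m. \<phi> T m \<noteq> 0 \<Longrightarrow>
      T \<subseteq> {..<d} \<and> card T = p \<and> Poly_Mapping.keys m \<subseteq> V \<and> mdeg m = Suc e"
    and cyc: "\<And>T m. T \<subseteq> {..<d} \<Longrightarrow> kos d V mdiv \<theta> \<phi> T m = 0"
  shows "\<exists>\<psi>. (\<forall>T m. \<psi> T m \<noteq> 0 \<longrightarrow>
      T \<subseteq> {..<d} \<and> card T = Suc p \<and> Poly_Mapping.keys m \<subseteq> V \<and> mdeg m = e) \<and>
      (\<forall>T m. T \<subseteq> {..<d} \<longrightarrow> \<phi> T m = kos d V mdiv \<theta> \<psi> T m)"
proof -
  let ?S = "\<lambda>p e (\<psi> :: nat set \<Rightarrow> ('v \<Rightarrow>\<^sub>0 nat) \<Rightarrow> 'k). \<forall>T m. \<psi> T m \<noteq> 0 \<longrightarrow>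
      T \<subseteq> {..<d} \<and> card T = p \<and> Poly_Mapping.keys m \<subseteq> V \<and> mdeg m = e"
  have kk: "kos d V mdiv \<theta> (kos d V mdiv \<theta> \<psi>) T m = 0" if "T \<subseteq> {..<d}"
    for T m and \<psi> :: "nat set \<Rightarrow> ('v \<Rightarrow>\<^sub>0 nat) \<Rightarrow> 'k"
    by (rule kos_kos[OF V that]) (rule mdiv_commute)
  \<comment> \<open>U is the set of variables already eliminated from the representative of the
    cycle.\<close>
  have step: "\<exists>\<psi>. ?S (Suc p) e \<psi> \<and> ?S p (Suc e) (\<phi> - kos d V mdiv \<theta> \<psi>) \<and>
      (\<forall>T m. Poly_Mapping.keys m \<inter> U \<noteq> {} \<longrightarrow> T \<subseteq> {..<d} \<longrightarrow> (\<phi> - kos d V mdiv \<theta> \<psi>) T m = 0)"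
    if "U \<subseteq> V" for U
  proof -
    have "finite U" using that V finite_subset by blast
    then show ?thesis using that
    proof (induction U rule: finite_induct)
      case empty
      show ?case
      proof -
        have "kos d V mdiv \<theta> (\<lambda>_ _. 0) = (\<lambda>_ _. 0)"
          by (intro ext) (auto simp: kos_def iota_def intro!: sum.neutral split: option.split)
        with supp show ?thesis by (intro exI[of _ "\<lambda>_ _. 0"]) (simp add: fun_diff_def)
      qed
    next
      case (insert v U)
      then obtain \<psi> where \<psi>: "?S (Suc p) e \<psi>" "?S p (Suc e) (\<phi> - kos d V mdiv \<theta> \<psi>)"
        "\<And>T m. Poly_Mapping.keys m \<inter> U \<noteq> {} \<Longrightarrow> T \<subseteq> {..<d} \<Longrightarrow> (\<phi> - kos d V mdiv \<theta> \<psi>) T m = 0"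
        by auto
      have v: "v \<in> V" using insert by simp
      define \<chi> where "\<chi> = \<phi> - kos d V mdiv \<theta> \<psi>"
      define \<sigma> where "\<sigma> = (\<lambda>(\<phi> :: nat set \<Rightarrow> ('v \<Rightarrow>\<^sub>0 nat) \<Rightarrow> 'k) T m. eps d (a v) \<phi> T (m + esingle v))"
      have cyc\<chi>: "kos d V mdiv \<theta> \<chi> T m = 0" if "T \<subseteq> {..<d}" for T m
        unfolding \<chi>_def kos_diff using cyc[OF that] kk[OF that] by (simp add: fun_diff_def)
      have hom: "kos d V mdiv \<theta> (\<sigma> \<chi>) T m = \<chi> T m
          - (if v \<in> Poly_Mapping.keys m then 0 else iota d (\<theta> v) (eps d (a v) \<chi>) T m)"
        if T: "T \<subseteq> {..<d}" for T m
      proof -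
        have "\<sigma> (kos d V mdiv \<theta> \<chi>) T m = 0"
          unfolding \<sigma>_def eps_def using T by (auto intro!: sum.neutral cyc\<chi>)
        then show ?thesis
          using poly_koszul_homotopy[OF V v T, of \<theta> "a v" \<chi> m] dual[OF _ v] by (simp add: \<sigma>_def)
      qed
      have s1: "?S (Suc p) e (\<sigma> \<chi>)"
      proof (intro allI impI)
        fix T m assume nz: "\<sigma> \<chi> T m \<noteq> 0"
        then have nz': "eps d (a v) \<chi> T (m + esingle v) \<noteq> 0" by (simp add: \<sigma>_def)
        have "T \<subseteq> {..<d} \<and> card T = Suc p"
          by (rule eps_support[OF _ nz']) (use \<psi>(2) in \<open>simp add: \<chi>_def\<close>)
        moreover obtain k where "\<chi> (T - {k}) (m + esingle v) \<noteq> 0"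
          using nz' unfolding eps_def by (metis (no_types, lifting) mult_zero_right sum.neutral)
        then have "Poly_Mapping.keys (m + esingle v) \<subseteq> V \<and> mdeg (m + esingle v) = Suc e"
          using \<psi>(2) unfolding \<chi>_def by blast
        ultimately show "T \<subseteq> {..<d} \<and> card T = Suc p \<and> Poly_Mapping.keys m \<subseteq> V \<and> mdeg m = e"
          by (auto simp: keys_plus_nat mdeg_plus mdeg_single)
      qed
      have eq: "(\<phi> - kos d V mdiv \<theta> (\<psi> + \<sigma> \<chi>)) T m =
          (if v \<in> Poly_Mapping.keys m then 0 else iota d (\<theta> v) (eps d (a v) \<chi>) T m)"
        if "T \<subseteq> {..<d}" for T m
        using hom[OF that, of m] unfolding kos_add by (simp add: \<chi>_def fun_diff_def)
      show ?case
      proof (intro exI conjI)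
        show "?S (Suc p) e (\<psi> + \<sigma> \<chi>)" using \<psi>(1) s1 by (metis add_0 plus_fun_apply)
      next
        \<comment> \<open>The remaining term acts on the exterior part only and leaves m fixed, so
          it cannot bring back a variable of U.\<close>
        have "iota d (\<theta> v) (eps d (a v) \<chi>) T m = 0" 
          if "Poly_Mapping.keys m \<inter> U \<noteq> {}" "T \<subseteq> {..<d}" for T m
        proof -
          have "\<chi> T' m = 0" for T' using \<psi>(3)[OF that(1), of T'] \<psi>(2) unfolding \<chi>_def by blast
          then have "eps d (a v) \<chi> T' m = 0" for T' unfolding eps_def by (simp only: mult_zero_right sum.neutral_const if_cancel)
          then show ?thesis unfolding iota_def by (simp only: mult_zero_right sum.neutral_const)
        qed
        then show "\<forall>T m. Poly_Mapping.keys m \<inter> insert v U \<noteq> {} \<longrightarrow> T \<subseteq> {..<d} \<longrightarrow>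
            (\<phi> - kos d V mdiv \<theta> (\<psi> + \<sigma> \<chi>)) T m = 0"
          by (intro allI impI) (subst eq, auto)
      next
        show "?S p (Suc e) (\<phi> - kos d V mdiv \<theta> (\<psi> + \<sigma> \<chi>))"
        proof (intro allI impI)
          fix T m assume nz: "(\<phi> - kos d V mdiv \<theta> (\<psi> + \<sigma> \<chi>)) T m \<noteq> 0"
          have s: "?S (Suc p) e (\<psi> + \<sigma> \<chi>)" using \<psi>(1) s1 by (metis add_0 plus_fun_apply)
          consider "\<phi> T m \<noteq> 0" | "kos d V mdiv \<theta> (\<psi> + \<sigma> \<chi>) T m \<noteq> 0"
            using nz by (cases "\<phi> T m = 0") (simp_all add: fun_diff_def)
          then show "T \<subseteq> {..<d} \<and> card T = p \<and> Poly_Mapping.keys m \<subseteq> V \<and> mdeg m = Suc e"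
          proof cases
            case 2
            show ?thesis by (rule kos_mdiv_support[OF _ 2]) (use s in blast)
          qed (use supp in blast)
        qed
      qed
    qed
  qed
  obtain \<psi> where \<psi>: "?S (Suc p) e \<psi>" "?S p (Suc e) (\<phi> - kos d V mdiv \<theta> \<psi>)"
    "\<And>T m. Poly_Mapping.keys m \<inter> V \<noteq> {} \<Longrightarrow> T \<subseteq> {..<d} \<Longrightarrow> (\<phi> - kos d V mdiv \<theta> \<psi>) T m = 0"
    using step[OF order_refl] by blast
  have "(\<phi> - kos d V mdiv \<theta> \<psi>) T m = 0" if T: "T \<subseteq> {..<d}" for T m
  proof (rule ccontr)
    assume nz: "\<not> ?thesis"
    then have m: "Poly_Mapping.keys m \<subseteq> V" "mdeg m = Suc e" using \<psi>(2) by blast+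
    then have "Poly_Mapping.keys m \<noteq> {}" by (auto simp: mdeg_def)
    then have "Poly_Mapping.keys m \<inter> V \<noteq> {}" using m(1) by (simp only: Int_absorb2 not_False_eq_True)
    with nz T \<psi>(3) show False by blast
  qed
  then show ?thesis using \<psi>(1) by (intro exI[of _ \<psi>]) (auto simp: fun_diff_def)
qed

section \<open>Vertices of faces\<close>

locale sposet =
  fixes P :: "'a::order set"
  assumes simplicial: "simplicial_poset P"
begin

abbreviation z :: 'a where "z \<equiv> zero_hat P"

definition V :: "'a \<Rightarrow> 'a set" where "V t = {v \<in> atoms P. v \<le> t}"

lemma finite_P: "finite P"
  using simplicial by (simp add: simplicial_poset_def)

lemma z_minimal: "minimal_in P z"
  using simplicial unfolding simplicial_poset_def zero_hat_def by (metis theI')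

lemma z_P: "z \<in> P"
  using z_minimal by (simp add: minimal_in_def)

lemma z_le:
  assumes "x \<in> P" shows "z \<le> x"
proof -
  have "finite {y \<in> P. y \<le> x}" using finite_P by simp
  moreover have "{y \<in> P. y \<le> x} \<noteq> {}" using assms by blast
  ultimately obtain y where y: "y \<in> P" "y \<le> x" "\<And>w. w \<in> P \<Longrightarrow> w \<le> x \<Longrightarrow> w \<le> y \<Longrightarrow> w = y"
    using finite_has_minimal[of "{y \<in> P. y \<le> x}"] by auto
  then have "minimal_in P y" by (meson minimal_in_def order_trans)
  then have "y = z" using z_minimal simplicial unfolding simplicial_poset_def by blast
  with y show ?thesis by simp
qed

lemma atoms_iff: "v \<in> atoms P \<longleftrightarrow> v \<in> P \<and> v \<noteq> z \<and> (\<forall>y\<in>P. y \<le> v \<longrightarrow> y = z \<or> y = v)"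
  by (auto simp: atoms_def minimal_in_def)

lemma finite_atoms: "finite (atoms P)"
  by (rule finite_subset[OF _ finite_P]) (auto simp: atoms_iff)

lemma V_subset_atoms: "V t \<subseteq> atoms P" by (auto simp: V_def)

lemma finite_V: "finite (V t)"
  using finite_subset[OF V_subset_atoms finite_atoms] .

lemma V_mono: "x \<le> y \<Longrightarrow> V x \<subseteq> V y"
  by (auto simp: V_def)

text \<open>Under the abstract isomorphism f the atoms below t are exactly the preimages of
  singletons. Hence f x and V x determine each other, and the interval below t becomes the lattice
  of subsets of V t without any choice of f.\<close>

lemma interval_iso:
  assumes t: "t \<in> P"
  shows "\<And>x y. x \<in> P \<Longrightarrow> y \<in> P \<Longrightarrow> x \<le> t \<Longrightarrow> y \<le> t \<Longrightarrow> V x \<subseteq> V y \<Longrightarrow> x \<le> y"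
    and "\<And>W. W \<subseteq> V t \<Longrightarrow> \<exists>x\<in>P. x \<le> t \<and> V x = W"
proof -
  define I where "I = {x \<in> P. x \<le> t}"
  have I: "I = {x \<in> P. z \<le> x \<and> x \<le> t}" using z_le by (auto simp: I_def)
  have "boolean_interval P z t" using simplicial t by (simp add: simplicial_poset_def)
  then obtain X :: "nat set" and f where X: "finite X" and f: "bij_betw f I (Pow X)"
    and ord: "\<And>x y. x \<in> I \<Longrightarrow> y \<in> I \<Longrightarrow> x \<le> y \<longleftrightarrow> f x \<subseteq> f y"
    unfolding boolean_interval_def I by blast
  have zI: "z \<in> I" using z_P z_le[OF t] by (simp add: I_def)
  have inj: "x = y" if "x \<in> I" "y \<in> I" "f x = f y" for x y
    using f that by (auto simp: bij_betw_def inj_on_def)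
  have surj: "\<exists>x\<in>I. f x = Y" if "Y \<subseteq> X" for Y
    using f that unfolding bij_betw_def by (metis PowI imageE)
  have fX: "f x \<subseteq> X" if "x \<in> I" for x using f that by (auto simp: bij_betw_def)
  have fz: "f z = {}"
  proof -
    obtain x where "x \<in> I" "f x = {}" using surj[of "{}"] by auto
    then show ?thesis using ord[OF zI \<open>x \<in> I\<close>] z_le by (auto simp: I_def)
  qed
  have down: "y \<in> I" if "x \<in> I" "y \<in> P" "y \<le> x" for x y using that by (auto simp: I_def)
  have atomI: "v \<in> atoms P" if v: "v \<in> I" "f v = {a}" for v a
  proof -
    have "v \<noteq> z" using v fz by auto
    moreover have "y = z \<or> y = v" if "y \<in> P" "y \<le> v" for y
    proof -
      have y: "y \<in> I" using down v that by blast
      then have "f y \<subseteq> {a}" using ord[OF y v(1)] that v by auto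
      then have "f y = {} \<or> f y = {a}" by auto
      then show ?thesis using inj y zI v fz by metis
    qed
    ultimately show ?thesis using v by (auto simp: atoms_iff I_def)
  qed
  have atomD: "\<exists>a. f v = {a}" if v: "v \<in> I" "v \<in> atoms P" for v
  proof -
    have "f v \<noteq> {}" using inj[OF v(1) zI] fz v(2) by (auto simp: atoms_iff)
    then obtain a where a: "a \<in> f v" by auto
    then obtain y where y: "y \<in> I" "f y = {a}" using surj[of "{a}"] fX[OF v(1)] by auto
    then have "y \<le> v" using ord a v by auto
    then have "y = z \<or> y = v" using v(2) y by (auto simp: atoms_iff I_def)
    then show ?thesis using y fz by auto
  qed
  have Vf: "a \<in> f x \<longleftrightarrow> (\<exists>v\<in>V x. f v = {a})" if x: "x \<in> I" for x a
  proof
    assume a: "a \<in> f x"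
    then obtain y where y: "y \<in> I" "f y = {a}" using surj[of "{a}"] fX[OF x] by auto
    then have "y \<le> x" using ord x a by auto
    then show "\<exists>v\<in>V x. f v = {a}" using y atomI by (auto simp: V_def)
  next
    assume "\<exists>v\<in>V x. f v = {a}"
    then obtain v where v: "v \<in> atoms P" "v \<le> x" "f v = {a}" by (auto simp: V_def)
    then have "v \<in> I" using down[OF x] by (auto simp: atoms_iff)
    then show "a \<in> f x" using ord[OF _ x] v by auto
  qed
  show "x \<le> y" if "x \<in> P" "y \<in> P" "x \<le> t" "y \<le> t" "V x \<subseteq> V y" for x y
  proof -
    have xy: "x \<in> I" "y \<in> I" using that by (auto simp: I_def)
    then have "f x \<subseteq> f y" using Vf that(5) by blast
    then show ?thesis using ord xy by simp
  qed
  show "\<exists>x\<in>P. x \<le> t \<and> V x = W" if W: "W \<subseteq> V t" for W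
  proof -
    have tI: "t \<in> I" using t by (simp add: I_def)
    have WI: "w \<in> I" if "w \<in> W" for w using that W t by (auto simp: I_def V_def atoms_iff)
    have "(\<Union>w\<in>W. f w) \<subseteq> X" using WI fX by blast
    then obtain x where x: "x \<in> I" "f x = (\<Union>w\<in>W. f w)" using surj by metis
    have "V x = W"
    proof
      show "W \<subseteq> V x"
      proof
        fix w assume w: "w \<in> W"
        then have "w \<le> x" using ord[OF WI[OF w] x(1)] x(2) by auto
        then show "w \<in> V x" using w W by (auto simp: V_def)
      qed
      show "V x \<subseteq> W"
      proof
        fix v assume v: "v \<in> V x"
        then have vI: "v \<in> I" "v \<in> atoms P" using x(1) by (auto simp: I_def V_def atoms_iff)
        then obtain a where a: "f v = {a}" using atomD by blast
        then have "a \<in> f x" using Vf[OF x(1)] v by blast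
        then obtain w where w: "w \<in> W" "a \<in> f w" using x(2) by auto
        obtain b where "f w = {b}" using atomD[OF WI[OF w(1)]] w W by (auto simp: V_def)
        then have "f w = f v" using w a by auto
        then show "v \<in> W" using inj[OF WI[OF w(1)] vI(1)] w by auto
      qed
    qed
    then show ?thesis using x by (auto simp: I_def)
  qed
qed

text \<open>The face of t spanned by W. The ambient t is needed because distinct elements of a
  simplicial poset can have the same vertices.\<close>

definition fc :: "'a \<Rightarrow> 'a set \<Rightarrow> 'a" where
  "fc t W = (THE x. x \<in> P \<and> x \<le> t \<and> V x = W)"

lemma V_inj_below:
  assumes "t \<in> P" "x \<in> P" "y \<in> P" "x \<le> t" "y \<le> t" "V x = V y"
  shows "x = y"
  using interval_iso(1)[OF assms(1), of x y] interval_iso(1)[OF assms(1), of y x] assms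
  by (auto intro: order_antisym)

lemma fc:
  assumes "t \<in> P" "W \<subseteq> V t"
  shows "fc t W \<in> P" "fc t W \<le> t" "V (fc t W) = W"
proof -
  have "\<exists>!x. x \<in> P \<and> x \<le> t \<and> V x = W"
    using interval_iso(2)[OF assms] V_inj_below[OF assms(1)] by blast
  then have "fc t W \<in> P \<and> fc t W \<le> t \<and> V (fc t W) = W" unfolding fc_def by (rule theI')
  then show "fc t W \<in> P" "fc t W \<le> t" "V (fc t W) = W" by auto
qed

lemma fc_unique:
  assumes "t \<in> P" "x \<in> P" "x \<le> t" shows "fc t (V x) = x"
  using V_inj_below[OF assms(1) fc(1) assms(2) fc(2) assms(3) fc(3)] assms V_mono by blast

lemma fc_fc:
  assumes "t \<in> P" "W \<subseteq> V t" "W' \<subseteq> W" shows "fc (fc t W) W' = fc t W'"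
proof -
  have a: "fc t W \<in> P" "fc t W \<le> t" "V (fc t W) = W" using fc assms by blast+
  then have b: "fc (fc t W) W' \<in> P" "fc (fc t W) W' \<le> fc t W" "V (fc (fc t W) W') = W'"
    using fc[of "fc t W" W'] assms(3) by auto
  show ?thesis using fc_unique[OF assms(1) b(1)] a b by auto
qed

lemma V_z: "V z = {}"
  using z_le by (auto simp: V_def atoms_iff intro: order_antisym)

lemma V_empty_iff: "x \<in> P \<Longrightarrow> V x = {} \<longleftrightarrow> x = z"
  using V_inj_below[of x x z] z_P z_le V_z by auto

lemma V_atom: "v \<in> atoms P \<Longrightarrow> V v = {v}"
  by (auto simp: V_def atoms_iff)

lemma V_less:
  assumes "y \<in> P" "x \<in> P" "x < y" shows "V x \<subset> V y"
  using V_mono[of x y] V_inj_below[of y x y] assms by (auto simp: less_le)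

text \<open>Along a chain the vertex sets grow strictly, which bounds its length; deleting the
  vertices of t one at a time gives a chain that attains the bound. The count is of elements
  strictly below t, so the last one, \<open>z\<close>, compensates for the absence of t
  itself.\<close>

lemma rk_eq_card_V:
  assumes t: "t \<in> P" shows "rk P t = card (V t)"
proof -
  define S where "S = {card C | C. C \<subseteq> {x \<in> P. x < t} \<and> Complete_Partial_Order.chain (\<le>) C}"
  have le: "n \<le> card (V t)" if n: "n \<in> S" for n
  proof -
    obtain C where C: "n = card C" "C \<subseteq> {x \<in> P. x < t}" "Complete_Partial_Order.chain (\<le>) C"
      using n by (auto simp: S_def)
    have "inj_on (card \<circ> V) C"
    proof (rule inj_onI, rule ccontr)
      fix x y assume xy: "x \<in> C" "y \<in> C" "(card \<circ> V) x = (card \<circ> V) y" "x \<noteq> y"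
      then have "x < y \<or> y < x" using C(3) by (auto simp: chain_def less_le)
      then have "V x \<subset> V y \<or> V y \<subset> V x" using V_less[of x y] V_less[of y x] C(2) xy(1,2) by auto
      then have "card (V x) < card (V y) \<or> card (V y) < card (V x)"
        using psubset_card_mono[OF finite_V] by blast
      then show False using xy(3) by simp
    qed
    moreover have "(card \<circ> V) ` C \<subseteq> {..<card (V t)}"
      using C(2) V_less[OF t] psubset_card_mono[OF finite_V] by auto
    ultimately show ?thesis using card_inj_on_le[of "card \<circ> V" C "{..<card (V t)}"] C(1) by simp
  qed
  have "card (V t) \<in> S" using t unfolding S_def
  proof (induction "card (V t)" arbitrary: t)
    case 0
    then show ?case by (auto intro!: exI[of _ "{}"] simp: chain_def)
  next
    case (Suc n)
    then obtain v where v: "v \<in> V t" by fastforce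
    let ?t = "fc t (V t - {v})"
    have t: "?t \<in> P" "?t \<le> t" "V ?t = V t - {v}" using fc[OF Suc.prems, of "V t - {v}"] by auto
    have "v \<notin> V ?t" using t(3) by simp
    with v have "?t \<noteq> t" by metis
    with t(2) have lt: "?t < t" by simp
    have n: "n = card (V ?t)" using t(3) v Suc(2) finite_V by simp
    obtain C where C: "n = card C" "C \<subseteq> {x \<in> P. x < ?t}" "Complete_Partial_Order.chain (\<le>) C"
      using Suc(1)[OF n t(1)] n by auto
    have "finite C" using C(2) finite_P finite_subset[of C P] by auto
    moreover have "?t \<notin> C" using C(2) by auto
    ultimately have "card (insert ?t C) = card (V t)" using C(1) Suc(2) by simp
    moreover have "insert ?t C \<subseteq> {x \<in> P. x < t}" using C(2) t lt by auto
    moreover have "Complete_Partial_Order.chain (\<le>) (insert ?t C)"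
      using C(2,3) by (auto simp: chain_def less_le)
    ultimately show ?case by (metis (mono_tags, lifting) mem_Collect_eq)
  qed
  moreover have "finite S" using le by (meson finite_nat_set_iff_bounded_le)
  ultimately show ?thesis unfolding rk_def S_def[symmetric] using le by (intro Max_eqI) auto
qed

lemma rk_le: "t \<in> P \<Longrightarrow> rk P t \<le> poset_rank P"
  unfolding poset_rank_def using finite_P by simp

lemma card_V_le: "t \<in> P \<Longrightarrow> card (V t) \<le> poset_rank P"
  using rk_le rk_eq_card_V by simp

end

section \<open>Chains and the kernels of contractions\<close>

definition fscale :: "'k::field \<Rightarrow> ('x \<Rightarrow> 'k) \<Rightarrow> 'x \<Rightarrow> 'k" where
  "fscale a f = (\<lambda>x. a * f x)"

interpretation fs: vector_space fscale
  by unfold_locales (auto simp: fscale_def algebra_simps)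

interpretation fsp: vector_space_pair fscale fscale ..

lemma fs_linearI:
  assumes "\<And>f g. L (f + g) = L f + L g" "\<And>a f. L (fscale a f) = fscale a (L f)"
  shows "Vector_Spaces.linear fscale fscale L"
  by unfold_locales (use assms in auto)

lemma sum_fun_apply: "(\<Sum>i\<in>I. f i) x = (\<Sum>i\<in>I. f i x)"
  by (induction I rule: infinite_finite_induct) auto

lemma finite_chain_least:
  fixes c :: "'a::order set"
  assumes "finite c" "c \<noteq> {}" "Complete_Partial_Order.chain (\<le>) c"
  shows "\<exists>b\<in>c. \<forall>\<tau>\<in>c. b \<le> \<tau>"
  using assms
proof (induction c rule: finite_ne_induct)
  case (insert x F)
  have "Complete_Partial_Order.chain (\<le>) F" using insert.prems by (auto simp: chain_def)
  then obtain b where b: "b \<in> F" "\<forall>\<tau>\<in>F. b \<le> \<tau>" using insert.IH by blast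
  have "x \<le> b \<or> b \<le> x" using insert.prems b by (auto simp: chain_def)
  then show ?case using b by (auto intro: order_trans)
qed auto

definition bottom :: "'a::order set \<Rightarrow> 'a" where "bottom c = (THE b. b \<in> c \<and> (\<forall>\<tau>\<in>c. b \<le> \<tau>))"

lemma bot_eqI: "b \<in> c \<Longrightarrow> (\<And>\<tau>. \<tau> \<in> c \<Longrightarrow> b \<le> \<tau>) \<Longrightarrow> bottom c = b"
  unfolding bottom_def by (rule the_equality) (auto intro: order_antisym)

lemma sg_least: "(\<And>\<tau>. \<tau> \<in> c \<Longrightarrow> b \<le> \<tau>) \<Longrightarrow> sg b c = 1"
proof -
  assume "\<And>\<tau>. \<tau> \<in> c \<Longrightarrow> b \<le> \<tau>"
  then have e: "{u \<in> c. u < b} = {}" by (fastforce simp: less_le_not_le)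
  show ?thesis unfolding sg_def e by simp
qed

text \<open>The augmented simplicial coboundary: on a one-element chain it takes the value of y at
  the empty chain.\<close>

definition cobd :: "('a::order set \<Rightarrow> 'k::field) \<Rightarrow> 'a set \<Rightarrow> 'k" where
  "cobd y c = (\<Sum>\<tau>\<in>c. sg \<tau> c * y (c - {\<tau>}))"

text \<open>Only vertices with property Q are removed, the others are frozen. With Q a bound on the
  rank this allows cochains of a link to be studied one rank at a time.\<close>

definition pcobd :: "('a::order \<Rightarrow> bool) \<Rightarrow> ('a set \<Rightarrow> 'k::field) \<Rightarrow> 'a set \<Rightarrow> 'k" where
  "pcobd Q y c = (\<Sum>\<tau>\<in>{\<tau> \<in> c. Q \<tau>}. sg \<tau> c * y (c - {\<tau>}))"

lemma pcobd_pcobd: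
  assumes c: "finite c" "Complete_Partial_Order.chain (\<le>) c"
  shows "pcobd Q (pcobd Q y) c = (0 :: 'k::field)"
proof -
  let ?c = "{\<tau> \<in> c. Q \<tau>}"
  have fc: "finite ?c" using c(1) by simp
  let ?a = "\<lambda>\<tau> \<sigma>. if \<tau> = \<sigma> then 0 else sg \<tau> c * (sg \<sigma> (c - {\<tau>}) * y (c - {\<tau>} - {\<sigma>}))"
  have "pcobd Q (pcobd Q y) c = (\<Sum>\<tau>\<in>?c. \<Sum>\<sigma>\<in>?c. ?a \<tau> \<sigma>)"
    unfolding pcobd_def
  proof (rule sum.cong[OF refl])
    fix \<tau> assume \<tau>: "\<tau> \<in> ?c"
    have e: "{\<sigma> \<in> c - {\<tau>}. Q \<sigma>} = ?c - {\<tau>}" by auto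
    have "(\<Sum>\<sigma>\<in>?c. ?a \<tau> \<sigma>) = (\<Sum>\<sigma>\<in>?c - {\<tau>}. ?a \<tau> \<sigma>)"
      using \<tau> fc by (simp add: sum.remove[of _ \<tau>])
    also have "\<dots> = sg \<tau> c * (\<Sum>\<sigma>\<in>?c - {\<tau>}. sg \<sigma> (c - {\<tau>}) * y (c - {\<tau>} - {\<sigma>}))"
      unfolding sum_distrib_left by (rule sum.cong) auto
    finally show "sg \<tau> c * (\<Sum>\<sigma>\<in>{\<sigma> \<in> c - {\<tau>}. Q \<sigma>}. sg \<sigma> (c - {\<tau>}) * y (c - {\<tau>} - {\<sigma>})) = (\<Sum>\<sigma>\<in>?c. ?a \<tau> \<sigma>)"
      unfolding e ..
  qed
  also have "\<dots> = 0"
  proof (rule alternating_sum_0[OF fc])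
    fix \<tau> \<sigma> assume ts: "\<tau> \<in> ?c" "\<sigma> \<in> ?c"
    have less: "?a \<tau> \<sigma> = - ?a \<sigma> \<tau>" if "\<tau> \<in> c" "\<sigma> \<in> c" "\<tau> < \<sigma>" for \<tau> \<sigma>
    proof -
      have "sg \<sigma> (c - {\<tau>}) = (- sg \<sigma> c :: 'k)" using that c(1) by (intro sg_remove_less)
      moreover have "sg \<tau> (c - {\<sigma>}) = (sg \<tau> c :: 'k)" using that by (intro sg_remove_nless) auto
      moreover have "c - {\<tau>} - {\<sigma>} = c - {\<sigma>} - {\<tau>}" by blast
      ultimately show ?thesis using that by simp
    qed
    have "\<tau> = \<sigma> \<or> \<tau> < \<sigma> \<or> \<sigma> < \<tau>" using c(2) ts by (auto simp: chain_def less_le)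
    then show "?a \<tau> \<sigma> = - ?a \<sigma> \<tau>" using less[of \<tau> \<sigma>] less[of \<sigma> \<tau>] ts by auto
  qed auto
  finally show ?thesis .
qed

lemma pcobd_True: "pcobd (\<lambda>_. True) = cobd"
  by (intro ext) (simp add: pcobd_def cobd_def)

lemma cobd_cobd:
  "finite c \<Longrightarrow> Complete_Partial_Order.chain (\<le>) c \<Longrightarrow> cobd (cobd y) c = (0 :: 'k::field)"
  unfolding pcobd_True[symmetric] by (rule pcobd_pcobd)

text \<open>Removing the least element has sign +1, and its presence flips the sign of every other
  removal. This is the cone formula behind both the exactness of the rows and the restriction of
  cochains to links.\<close>

lemma cobd_insert_least:
  assumes "finite c" "b \<notin> c" "\<And>\<tau>. \<tau> \<in> c \<Longrightarrow> b \<le> \<tau>"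
  shows "cobd y (insert b c) = y c - cobd (\<lambda>c'. y (insert b c')) c"
proof -
  have "cobd y (insert b c) = y c + (\<Sum>\<tau>\<in>c. sg \<tau> (insert b c) * y (insert b c - {\<tau>}))"
    unfolding cobd_def using assms sg_least[of "insert b c" b] by auto
  also have "(\<Sum>\<tau>\<in>c. sg \<tau> (insert b c) * y (insert b c - {\<tau>})) = (\<Sum>\<tau>\<in>c. - (sg \<tau> c * y (insert b (c - {\<tau>}))))"
  proof (rule sum.cong[OF refl])
    fix \<tau> assume t: "\<tau> \<in> c"
    then have "b < \<tau>" using assms by (auto simp: less_le)
    then show "sg \<tau> (insert b c) * y (insert b c - {\<tau>}) = - (sg \<tau> c * y (insert b (c - {\<tau>})))"
      using assms(1,2) t by (auto simp: sg_insert_less insert_Diff_if)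
  qed
  also have "\<dots> = - cobd (\<lambda>c'. y (insert b c')) c" by (simp add: cobd_def sum_negf)
  finally show ?thesis by simp
qed

lemma cobd_diff: "cobd (f - g) c = cobd f c - cobd g c"
  by (simp add: cobd_def right_diff_distrib sum_subtractf)

lemma cobd_add: "cobd (f + g) c = cobd f c + cobd g c"
  by (simp add: cobd_def distrib_left sum.distrib)

lemma cobd_cong: "(\<And>\<tau>. \<tau> \<in> c \<Longrightarrow> f (c - {\<tau>}) = g (c - {\<tau>})) \<Longrightarrow> cobd f c = cobd g c"
  unfolding cobd_def by (rule sum.cong) auto

section \<open>Chains above a face\<close>

context sposet
begin

text \<open>\<open>Ch z\<close> is the order complex. For any other r the chains at or above r form
  a cone with apex r.\<close>

definition Ch :: "'a \<Rightarrow> 'a set set" where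
  "Ch r = {c. c \<subseteq> P - {z} \<and> Complete_Partial_Order.chain (\<le>) c \<and> (\<forall>\<tau>\<in>c. r \<le> \<tau>)}"

text \<open>The upper part of the link of t: the order complex of the elements strictly above t,
  with the empty chain.\<close>

definition Lk :: "'a \<Rightarrow> 'a set set" where
  "Lk t = {c. c \<subseteq> {x \<in> P. t < x} \<and> Complete_Partial_Order.chain (\<le>) c}"

lemma Ch_finite: "c \<in> Ch r \<Longrightarrow> finite c"
  using finite_P by (auto simp: Ch_def intro: finite_subset)

lemma Ch_subset: "c \<in> Ch r \<Longrightarrow> c' \<subseteq> c \<Longrightarrow> c' \<in> Ch r"
  unfolding Ch_def chain_def by blast

lemma Ch_antimono: "c \<in> Ch r \<Longrightarrow> r' \<le> r \<Longrightarrow> c \<in> Ch r'"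
  by (auto simp: Ch_def)

lemma Ch_z: "c \<in> Ch r \<Longrightarrow> c \<in> Ch z"
  using z_le by (auto simp: Ch_def)

lemma Lk_finite: "c \<in> Lk t \<Longrightarrow> finite c"
  using finite_P by (auto simp: Lk_def intro: finite_subset)

lemma Lk_subset: "c \<in> Lk t \<Longrightarrow> c' \<subseteq> c \<Longrightarrow> c' \<in> Lk t"
  unfolding Lk_def chain_def by blast

lemma Lk_insert: "c \<in> Lk t \<Longrightarrow> t \<in> P \<Longrightarrow> t \<noteq> z \<Longrightarrow> insert t c \<in> Ch z \<and> t \<notin> c \<and> bottom (insert t c) = t"
  using z_le by (auto simp: Lk_def Ch_def chain_def less_le intro!: bot_eqI dest: order_antisym)

lemma bottom:
  assumes "c \<in> Ch r" "c \<noteq> {}"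
  shows "bottom c \<in> c" "\<And>\<tau>. \<tau> \<in> c \<Longrightarrow> bottom c \<le> \<tau>" "bottom c \<in> P" "bottom c \<noteq> z" "r \<le> bottom c"
    "c \<in> Ch (bottom c)"
proof -
  obtain b where b: "b \<in> c" "\<forall>\<tau>\<in>c. b \<le> \<tau>"
    using finite_chain_least[OF Ch_finite[OF assms(1)] assms(2)] assms(1) by (auto simp: Ch_def)
  then have "bottom c = b" by (intro bot_eqI) auto
  with b assms show "bottom c \<in> c" "\<And>\<tau>. \<tau> \<in> c \<Longrightarrow> bottom c \<le> \<tau>" "bottom c \<in> P" "bottom c \<noteq> z" "r \<le> bottom c"
    "c \<in> Ch (bottom c)" by (auto simp: Ch_def)
qed

lemma Lk_minus_bot:
  assumes "c \<in> Ch r" "c \<noteq> {}" shows "c - {bottom c} \<in> Lk (bottom c)"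
  using bottom[OF assms] assms by (auto simp: Lk_def Ch_def chain_def less_le)

lemma bot_mono:
  assumes "c \<in> Ch r" "c' \<subseteq> c" "c' \<noteq> {}" shows "bottom c \<le> bottom c'"
  using bottom(1)[OF Ch_subset[OF assms(1,2)] assms(3)] bottom(2)[OF assms(1)] assms(2,3) by blast

end

text \<open>\<open>\<theta> v i\<close> is the coefficient of x_v in the i-th parameter, and
  \<open>a t\<close> is a dual family for the vertices of t. In the application d is the rank of P,
  so chains above t have at most d - card (V t) elements and \<open>link_exact\<close> says that
  their augmented cohomology vanishes below the top.\<close>

locale local_acyclic = sposet P for P :: "'a::order set" +
  fixes d :: nat and \<theta> :: "'a \<Rightarrow> nat \<Rightarrow> 'k::field" and a :: "'a \<Rightarrow> 'a \<Rightarrow> nat \<Rightarrow> 'k"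
  assumes dual: "\<And>t v w. t \<in> P \<Longrightarrow> v \<in> V t \<Longrightarrow> w \<in> V t \<Longrightarrow>
      (\<Sum>i<d. \<theta> v i * a t w i) = (if v = w then 1 else 0)"
    and link_exact: "\<And>t q (y :: 'a set \<Rightarrow> 'k). t \<in> P \<Longrightarrow> t \<noteq> z \<Longrightarrow> q + card (V t) < d \<Longrightarrow>
      (\<And>c. c \<in> Lk t \<Longrightarrow> card c = Suc q \<Longrightarrow> cobd y c = 0) \<Longrightarrow>
      \<exists>x. \<forall>c\<in>Lk t. card c = q \<longrightarrow> y c = cobd x c"
begin

definition K :: "nat \<Rightarrow> nat \<Rightarrow> (nat set \<Rightarrow> 'a set \<Rightarrow> 'k) \<Rightarrow> bool" where
  "K J q y \<longleftrightarrow> (\<forall>T c. y T c \<noteq> 0 \<longrightarrow> T \<subseteq> {..<d} \<and> card T = J \<and> c \<in> Ch z \<and> card c = q)"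

text \<open>Over a chain with least element t the values lie in the degree zero homology of the
  column, the exterior forms annihilated by the contractions at all vertices of t. The empty chain
  carries no condition.\<close>

definition ker :: "(nat set \<Rightarrow> 'a set \<Rightarrow> 'k) \<Rightarrow> bool" where
  "ker y \<longleftrightarrow> (\<forall>T c v. T \<subseteq> {..<d} \<longrightarrow> c \<in> Ch z \<longrightarrow> c \<noteq> {} \<longrightarrow> v \<in> V (bottom c) \<longrightarrow> iota d (\<theta> v) y T c = 0)"

text \<open>The common kernel is an exterior power of a space of dimension d - card (V t), so it
  vanishes in larger exterior degree. The unit type stands in for the spectator index.\<close>

lemma ker_eq_0:
  assumes "K J q y" "ker y" "c \<in> Ch z" "c \<noteq> {}" "d < J + card (V (bottom c))"
  shows "y T c = 0"
proof -
  let ?g = "\<lambda>T (_::unit). y T c"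
  have "?g T () = 0"
  proof (rule contraction_kernel_zero[of "V (bottom c)" \<theta> "a (bottom c)" d ?g J])
    fix v T and x :: unit assume "v \<in> V (bottom c)" "T \<subseteq> {..<d}"
    then have "iota d (\<theta> v) y T c = 0" using assms by (simp add: ker_def)
    then show "iota d (\<theta> v) ?g T x = 0" by (simp add: iota_def)
  next
    show "?g T x \<noteq> 0 \<Longrightarrow> T \<subseteq> {..<d} \<and> card T = J" for T x using assms(1) by (auto simp: K_def)
  qed (use assms dual finite_V bottom(3)[OF assms(3,4)] in auto)
  then show ?thesis .
qed

text \<open>The argument of g is cut down to the q-element chains above t, so that g depends
  linearly on precisely the values which are to be integrated.\<close>

definition primitive :: "'a \<Rightarrow> nat \<Rightarrow> (('a set \<Rightarrow> 'k) \<Rightarrow> 'a set \<Rightarrow> 'k) \<Rightarrow> bool" where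
  "primitive t q g \<longleftrightarrow> Vector_Spaces.linear fscale fscale g \<and>
    (\<forall>y::'a set \<Rightarrow> 'k. (\<forall>c\<in>Lk t. card c = Suc q \<longrightarrow> cobd y c = 0) \<longrightarrow>
       (\<forall>c\<in>Lk t. card c = q \<longrightarrow> cobd (g (\<lambda>c. if c \<in> Lk t \<and> card c = q then y c else 0)) c = y c))"

text \<open>The linear right inverse keeps the primitives inside the kernels of the contractions.\<close>

lemma link_primitive:
  assumes t: "t \<in> P" "t \<noteq> z" and q: "q + card (V t) < d"
  shows "\<exists>g. primitive t q g"
proof -
  define f where "f = (\<lambda>(x::'a set \<Rightarrow> 'k) c. if c \<in> Lk t \<and> card c = q then cobd x c else 0)"
  have lf: "Vector_Spaces.linear fscale fscale f"
    by (rule fs_linearI) (auto simp: f_def fscale_def cobd_def fun_eq_iff distrib_left sum.distrib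
        sum_distrib_left mult_ac)
  obtain g where g: "Vector_Spaces.linear fscale fscale g" "\<And>v. v \<in> range f \<Longrightarrow> f (g v) = v"
    using fsp.linear_exists_right_inverse_on[OF lf fs.subspace_UNIV] by blast
  have "cobd (g (\<lambda>c. if c \<in> Lk t \<and> card c = q then y c else 0)) c = y c"
    if y: "\<forall>c\<in>Lk t. card c = Suc q \<longrightarrow> cobd y c = 0" and c: "c \<in> Lk t" "card c = q" for y c
  proof -
    let ?y = "\<lambda>c. if c \<in> Lk t \<and> card c = q then y c else 0"
    obtain x where x: "\<forall>c\<in>Lk t. card c = q \<longrightarrow> y c = cobd x c"
      using link_exact[OF t q, of y] y by blast
    have "f x = ?y" unfolding f_def by (intro ext) (use x in simp)
    then have "f (g ?y) = ?y" using g(2) by (metis rangeI)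
    then have "f (g ?y) c = ?y c" by simp
    then show ?thesis using c by (simp add: f_def)
  qed
  then show ?thesis using g(1) unfolding primitive_def by blast
qed

lemma K_diff:
  assumes "K J q y" "K J q x" shows "K J q (\<lambda>T c. y T c - x T c)"
  unfolding K_def
proof (intro allI impI)
  fix T c assume "y T c - x T c \<noteq> 0"
  then have "y T c \<noteq> 0 \<or> x T c \<noteq> 0" by auto
  then show "T \<subseteq> {..<d} \<and> card T = J \<and> c \<in> Ch z \<and> card c = q" using assms unfolding K_def by blast
qed

lemma K_cobd:
  assumes "K J q x"
  shows "K J (Suc q) (\<lambda>T c. if c \<in> Ch z then cobd (x T) c else 0)"
  unfolding K_def
proof (intro allI impI)
  fix T c assume nz: "(if c \<in> Ch z then cobd (x T) c else 0) \<noteq> 0"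
  then have c: "c \<in> Ch z" "cobd (x T) c \<noteq> 0" by (auto split: if_splits)
  then obtain \<tau> where t: "\<tau> \<in> c" "x T (c - {\<tau>}) \<noteq> 0"
    unfolding cobd_def by (metis (no_types, lifting) mult_zero_right sum.neutral)
  then have "T \<subseteq> {..<d} \<and> card T = J \<and> card (c - {\<tau>}) = q" using assms unfolding K_def by blast
  then show "T \<subseteq> {..<d} \<and> card T = J \<and> c \<in> Ch z \<and> card c = Suc q"
    using c(1) t(1) Ch_finite[OF c(1)] by (metis card.remove)
qed

lemma iota_cobd: "iota d u (\<lambda>T c. cobd (x T) c) T c = cobd (iota d u x T) c"
  unfolding iota_def cobd_def sum_distrib_left by (subst sum.swap) (simp add: mult_ac)

text \<open>A subchain has a larger least element, hence satisfies more contraction conditions than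
  are needed. The exception is the empty chain, which satisfies none and reaches all one-element
  chains; so x has to vanish there.\<close>

lemma ker_cobd:
  assumes "ker x" "\<And>T. x T {} = 0"
  shows "ker (\<lambda>T c. if c \<in> Ch z then cobd (x T) c else 0)"
  unfolding ker_def
proof (intro allI impI)
  fix T c v assume T: "T \<subseteq> {..<d}" and c: "c \<in> Ch z" "c \<noteq> {}" and v: "v \<in> V (bottom c)"
  have "iota d (\<theta> v) (\<lambda>T c. if c \<in> Ch z then cobd (x T) c else 0) T c = iota d (\<theta> v) (\<lambda>T c. cobd (x T) c) T c"
    using c(1) by (simp add: iota_def)
  also have "\<dots> = cobd (iota d (\<theta> v) x T) c" by (rule iota_cobd)
  also have "\<dots> = 0" unfolding cobd_def
  proof (rule sum.neutral, rule ballI)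
    fix \<tau> assume "\<tau> \<in> c"
    have "iota d (\<theta> v) x T (c - {\<tau>}) = 0"
    proof (cases "c - {\<tau>} = {}")
      case True
      show ?thesis unfolding True iota_def assms(2) by simp
    next
      case False
      have "V (bottom c) \<subseteq> V (bottom (c - {\<tau>}))" using bot_mono[OF c(1) _ False] by (intro V_mono) auto
      then show ?thesis using assms(1) T v False Ch_subset[OF c(1), of "c - {\<tau>}"] unfolding ker_def by blast
    qed
    then show "sg \<tau> c * iota d (\<theta> v) x T (c - {\<tau>}) = 0" by simp
  qed
  finally show "iota d (\<theta> v) (\<lambda>T c. if c \<in> Ch z then cobd (x T) c else 0) T c = 0" .
qed

text \<open>Induction on the largest rank N of the least element of a chain in the support. In the
  highest layer y restricts to a cocycle on each upper link and is integrated there; subtracting the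
  coboundary lowers N. If J exceeds d minus that rank, the kernel is zero and nothing has to be
  integrated; otherwise q < J puts q into the range where links are acyclic.\<close>

lemma kernel_exact_aux:
  assumes "K J (Suc q) y" "ker y" "q < J"
    and "\<And>T c. c \<in> Ch z \<Longrightarrow> cobd (y T) c = 0"
    and "\<And>T c. y T c \<noteq> 0 \<Longrightarrow> card (V (bottom c)) \<le> N"
  shows "\<exists>x. K J q x \<and> ker x \<and> (\<forall>T. x T {} = 0) \<and> (\<forall>T. \<forall>c\<in>Ch z. y T c = cobd (x T) c)"
  using assms
proof (induction N arbitrary: y)
  case 0
  have y0: "y T c = 0" for T c
  proof (rule ccontr)
    assume nz: "y T c \<noteq> 0"
    then have c: "c \<in> Ch z" "c \<noteq> {}" using 0(1) unfolding K_def by fastforce+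
    have "V (bottom c) = {}" using 0(5)[OF nz] finite_V by simp
    then show False using bottom[OF c] V_empty_iff by blast
  qed
  then show ?case by (intro exI[of _ "\<lambda>_ _. 0"]) (auto simp: K_def ker_def iota_def cobd_def)
next
  case (Suc N)
  define g where "g = (\<lambda>t. SOME g. primitive t q g)"
  \<comment> \<open>The elements of the layer to be removed, those over which the kernel can be
    nonzero.\<close>
  define R where "R = (\<lambda>t. t \<in> P \<and> t \<noteq> z \<and> card (V t) = Suc N \<and> J + Suc N \<le> d)"
  define yt where "yt = (\<lambda>t T c. if c \<in> Lk t \<and> card c = q then y T (insert t c) else 0)"
  have g: "Vector_Spaces.linear fscale fscale (g t)"
      "\<And>y c. (\<And>c. c \<in> Lk t \<Longrightarrow> card c = Suc q \<Longrightarrow> cobd y c = 0) \<Longrightarrow> c \<in> Lk t \<Longrightarrow> card c = q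
        \<Longrightarrow> cobd (g t (\<lambda>c. if c \<in> Lk t \<and> card c = q then y c else 0)) c = y c" if "R t" for t
  proof -
    have "q + card (V t) < d" using that Suc.prems(3) by (simp add: R_def)
    then have "primitive t q (g t)"
      unfolding g_def using that by (intro someI_ex[of "primitive t q"] link_primitive) (auto simp: R_def)
    then have *: "Vector_Spaces.linear fscale fscale (g t)"
      "\<And>y c. \<forall>c\<in>Lk t. card c = Suc q \<longrightarrow> cobd y c = 0 \<Longrightarrow> c \<in> Lk t \<Longrightarrow> card c = q \<Longrightarrow>
         cobd (g t (\<lambda>c. if c \<in> Lk t \<and> card c = q then y c else 0)) c = y c"
      unfolding primitive_def by blast+
    show "Vector_Spaces.linear fscale fscale (g t)" by (rule *(1))
    show "cobd (g t (\<lambda>c. if c \<in> Lk t \<and> card c = q then y c else 0)) c = y c"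
      if "\<And>c. c \<in> Lk t \<Longrightarrow> card c = Suc q \<Longrightarrow> cobd y c = 0" "c \<in> Lk t" "card c = q" for y c
      by (rule *(2)) (use that in auto)
  qed
  have big0: "y T c = 0" if "c \<in> Ch z" "c \<noteq> {}" "Suc N < card (V (bottom c))" for T c
    using Suc.prems(5)[of T c] that by force
  have gyt: "cobd (g t (yt t T)) c = y T (insert t c)" if t: "R t" and c: "c \<in> Lk t" "card c = q" for t T c
  proof -
    have "cobd (g t (\<lambda>c. if c \<in> Lk t \<and> card c = q then y T (insert t c) else 0)) c = y T (insert t c)"
    proof (rule g(2)[OF t _ c])
      \<comment> \<open>The restriction to the link is closed: in the coboundary of y at
        \<open>insert t c\<close> the term without t vanishes, because all of c lies above t and y
        is zero on chains starting beyond the layer.\<close>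
      fix c assume c: "c \<in> Lk t" "card c = Suc q"
      have ins: "insert t c \<in> Ch z" "t \<notin> c" "\<And>\<tau>. \<tau> \<in> c \<Longrightarrow> t < \<tau>"
        using Lk_insert[OF c(1)] c(1) t unfolding R_def Lk_def by blast+
      have cz: "c \<in> Ch z" "c \<noteq> {}" using Ch_subset[OF ins(1)] c(2) by auto
      have "t < bottom c" using bottom(1)[OF cz] ins(3) by blast
      then have "card (V t) < card (V (bottom c))"
        using V_less[OF bottom(3)[OF cz]] t by (intro psubset_card_mono finite_V) (auto simp: R_def)
      then have "y T c = 0" using big0[OF cz] t by (simp add: R_def)
      moreover have "cobd (y T) (insert t c) = y T c - cobd (\<lambda>c'. y T (insert t c')) c"
        using ins Lk_finite[OF c(1)] by (intro cobd_insert_least) (auto simp: less_le)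
      ultimately show "cobd (\<lambda>c. y T (insert t c)) c = 0" using Suc.prems(4)[OF ins(1), of T] by simp
    qed
    then show ?thesis by (simp add: yt_def)
  qed
  \<comment> \<open>The minus sign cancels the one in \<open>cobd_insert_least\<close>.\<close>
  define x where "x = (\<lambda>T c. if T \<subseteq> {..<d} \<and> card T = J \<and> c \<in> Ch z \<and> card c = q \<and> c \<noteq> {} \<and> R (bottom c)
     then - g (bottom c) (yt (bottom c) T) (c - {bottom c}) else 0)"
  have Kx: "K J q x" by (auto simp: K_def x_def)
  \<comment> \<open>The primitive is chosen by a linear operator that does not depend on T, so
    contractions pass through it and reach y, where they vanish.\<close>
  have kerx: "ker x" unfolding ker_def
  proof (intro allI impI)
    fix T c v assume T: "T \<subseteq> {..<d}" and c: "c \<in> Ch z" "c \<noteq> {}" and v: "v \<in> V (bottom c)"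
    show "iota d (\<theta> v) x T c = 0"
    proof (cases "card c = q \<and> R (bottom c) \<and> Suc (card T) = J")
      case False
      have "x (insert i T) c = 0" if "i \<in> {..<d} - T" for i
        using False that T finite_subset[OF T] by (auto simp: x_def)
      then show ?thesis by (simp add: iota_def)
    next
      case True
      let ?t = "bottom c" and ?c = "c - {bottom c}"
      interpret gl: Vector_Spaces.linear fscale fscale "g ?t" using g(1) True by blast
      have "iota d (\<theta> v) x T c = (\<Sum>i\<in>{..<d} - T. \<theta> v i * sg i T * - g ?t (yt ?t (insert i T)) ?c)"
        unfolding iota_def using True T finite_subset[OF T] c by (intro sum.cong refl) (auto simp: x_def)
      also have "\<dots> = - (\<Sum>i\<in>{..<d} - T. fscale (\<theta> v i * sg i T) (g ?t (yt ?t (insert i T)))) ?c"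
        by (simp add: fscale_def sum_negf sum_fun_apply)
      also have "(\<Sum>i\<in>{..<d} - T. fscale (\<theta> v i * sg i T) (g ?t (yt ?t (insert i T)))) =
          g ?t (\<Sum>i\<in>{..<d} - T. fscale (\<theta> v i * sg i T) (yt ?t (insert i T)))"
        by (simp add: gl.sum gl.scale)
      also have "(\<Sum>i\<in>{..<d} - T. fscale (\<theta> v i * sg i T) (yt ?t (insert i T))) = 0"
      proof (rule ext)
        fix c'
        show "(\<Sum>i\<in>{..<d} - T. fscale (\<theta> v i * sg i T) (yt ?t (insert i T))) c' = 0 c'"
        proof (cases "c' \<in> Lk ?t \<and> card c' = q")
          case True': True
          then have "insert ?t c' \<in> Ch z" "bottom (insert ?t c') = ?t" using Lk_insert True by (auto simp: R_def)
          then have "iota d (\<theta> v) y T (insert ?t c') = 0"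
            using Suc.prems(2) T v by (simp add: ker_def)
          then show ?thesis using True' by (simp add: sum_fun_apply fscale_def yt_def iota_def)
        qed (auto simp: sum_fun_apply fscale_def yt_def)
      qed
      finally show ?thesis using fun_cong[OF gl.zero, of "c - {bottom c}"] by (simp add: zero_fun_def)
    qed
  qed
  let ?y = "\<lambda>T c. if c \<in> Ch z then y T c - cobd (x T) c else 0"
  have x0: "x T c = 0" if "\<not> (c \<in> Ch z \<and> c \<noteq> {} \<and> R (bottom c))" for T c using that by (auto simp: x_def)
  let ?dx = "\<lambda>T c. if c \<in> Ch z then cobd (x T) c else 0"
  have y_diff: "?y T c = y T c - ?dx T c" for T c using Suc.prems(1) by (auto simp: K_def)
  have Ky: "K J (Suc q) ?y"
    unfolding y_diff by (rule K_diff[OF Suc.prems(1) K_cobd[OF Kx]])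
  have kery: "ker ?y"
  proof -
    have "ker (y - ?dx)" using Suc.prems(2) ker_cobd[OF kerx] x0 unfolding ker_def by (simp add: iota_diff)
    moreover have "y - ?dx = ?y" using y_diff by (intro ext) simp
    ultimately show ?thesis by simp
  qed
  have y4: "cobd (?y T) c = 0" if c: "c \<in> Ch z" for T c
  proof -
    have "cobd (?y T) c = cobd (y T - cobd (x T)) c"
      using Ch_subset[OF c] by (intro cobd_cong) auto
    also have "\<dots> = 0" using Suc.prems(4)[OF c] cobd_cobd[OF Ch_finite[OF c], of "x T"] c
      unfolding cobd_diff by (simp add: Ch_def)
    finally show ?thesis .
  qed
  have y5: "card (V (bottom c)) \<le> N" if nz: "?y T c \<noteq> 0" for T c
  proof (rule ccontr)
    assume *: "\<not> card (V (bottom c)) \<le> N"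
    have cK: "T \<subseteq> {..<d} \<and> card T = J \<and> c \<in> Ch z \<and> card c = Suc q"
      using nz Ky unfolding K_def by blast
    then have c: "c \<in> Ch z" "c \<noteq> {}" "T \<subseteq> {..<d}" "card T = J" "card c = Suc q" by auto
    let ?b = "bottom c" and ?c = "c - {bottom c}"
    \<comment> \<open>x lives on chains starting in the layer itself. A subchain that has lost its
      least element starts at a larger rank.\<close>
    have sub0: "x T c' = 0" if "c' \<subseteq> c" "Suc N < card (V (bottom c)) \<or> ?b \<notin> c'" for c'
    proof (rule ccontr)
      assume nz: "x T c' \<noteq> 0"
      then have c': "c' \<in> Ch z" "c' \<noteq> {}" "R (bottom c')" using x0 by blast+
      have le: "?b \<le> bottom c'" using bot_mono[OF c(1) that(1) c'(2)] .
      have "card (V ?b) \<le> card (V (bottom c'))" by (intro card_mono finite_V V_mono le)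
      moreover have "?b \<notin> c' \<Longrightarrow> card (V ?b) < card (V (bottom c'))"
        using bottom(1)[OF c'(1,2)] le bottom(3)[OF c(1,2)] bottom(3)[OF c'(1,2)]
        by (intro psubset_card_mono finite_V V_less) (auto simp: less_le)
      ultimately show False using c'(3) that(2) * by (auto simp: R_def)
    qed
    have "y T c = cobd (x T) c"
    proof (cases "Suc N < card (V ?b)")
      case True
      have "cobd (x T) c = 0" unfolding cobd_def using sub0 True by (intro sum.neutral) auto
      then show ?thesis using big0[OF c(1,2) True] by simp
    next
      case False
      with * have N: "card (V ?b) = Suc N" by simp
      show ?thesis
      proof (cases "J + Suc N \<le> d")
        case False
        then have "y T c = 0" using ker_eq_0[OF Suc.prems(1,2) c(1,2)] N by simp
        moreover have "x T c' = 0" for c' using x0 False by (auto simp: R_def)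
        ultimately show ?thesis by (simp add: cobd_def)
      next
        case True
        then have Rb: "R ?b" using N bottom[OF c(1,2)] by (simp add: R_def)
        have cc: "?c \<in> Lk ?b" "card ?c = q" "insert ?b ?c = c"
          using Lk_minus_bot[OF c(1,2)] bottom(1)[OF c(1,2)] c(5) Ch_finite[OF c(1)] by auto
        have "cobd (x T) (insert ?b ?c) = x T ?c - cobd (\<lambda>c'. x T (insert ?b c')) ?c"
          using bottom(2)[OF c(1,2)] Ch_finite[OF c(1)] by (intro cobd_insert_least) auto
        also have "x T ?c = 0" by (rule sub0) auto
        also have "cobd (\<lambda>c'. x T (insert ?b c')) ?c = - cobd (g ?b (yt ?b T)) ?c"
          unfolding cobd_def sum_negf[symmetric]
        proof (rule sum.cong[OF refl])
          fix \<tau> assume t: "\<tau> \<in> ?c"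
          have L: "?c - {\<tau>} \<in> Lk ?b" by (rule Lk_subset[OF cc(1) Diff_subset])
          have I: "insert ?b (?c - {\<tau>}) \<in> Ch z \<and> ?b \<notin> ?c - {\<tau>} \<and> bottom (insert ?b (?c - {\<tau>})) = ?b"
            by (rule Lk_insert[OF L bottom(3,4)[OF c(1,2)]])
          have "card (insert ?b (?c - {\<tau>})) = q"
            using t cc(2) Ch_finite[OF c(1)] I by (metis card.remove card_insert_disjoint finite_Diff)
          then have "x T (insert ?b (?c - {\<tau>})) = - g ?b (yt ?b T) (?c - {\<tau>})"
            unfolding x_def using I c(3,4) Rb by (simp add: insert_Diff_if)
          then show "sg \<tau> ?c * x T (insert ?b (?c - {\<tau>})) = - (sg \<tau> ?c * g ?b (yt ?b T) (?c - {\<tau>}))"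
            by simp
        qed
        also have "cobd (g ?b (yt ?b T)) ?c = y T (insert ?b ?c)" by (rule gyt[OF Rb cc(1,2)])
        finally show ?thesis unfolding cc(3) by simp
      qed
    qed
    then show False using nz c(1) by simp
  qed
  obtain x' where x': "K J q x'" "ker x'" "\<forall>T. x' T {} = 0" "\<forall>T. \<forall>c\<in>Ch z. ?y T c = cobd (x' T) c"
  proof -
    have "\<exists>x'. K J q x' \<and> ker x' \<and> (\<forall>T. x' T {} = 0) \<and> (\<forall>T. \<forall>c\<in>Ch z. ?y T c = cobd (x' T) c)"
      by (rule Suc.IH[OF Ky kery Suc.prems(3)]) (fact y4, fact y5)
    then show thesis using that by blast
  qed
  show ?case
  proof (intro exI conjI)
    show "K J q (x + x')" using Kx x'(1) unfolding K_def by (metis add_0 plus_fun_apply)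
    show "ker (x + x')" using kerx x'(2) unfolding ker_def by (simp add: iota_add)
    show "\<forall>T. (x + x') T {} = 0" using x'(3) x0 by simp
    show "\<forall>T. \<forall>c\<in>Ch z. y T c = cobd ((x + x') T) c"
    proof (intro allI ballI)
      fix T c assume c: "c \<in> Ch z"
      have "?y T c = cobd (x' T) c" using x'(4) c by blast
      then show "y T c = cobd ((x + x') T) c" using c by (simp add: cobd_add diff_eq_eq add.commute)
    qed
  qed
qed

lemma kernel_exact:
  assumes "K J (Suc q) y" "ker y" "q < J" "\<And>T c. c \<in> Ch z \<Longrightarrow> cobd (y T) c = 0"
  shows "\<exists>x. K J q x \<and> ker x \<and> (\<forall>T. x T {} = 0) \<and> (\<forall>T. \<forall>c\<in>Ch z. y T c = cobd (x T) c)"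
proof (rule kernel_exact_aux[OF assms(1-3)])
  show "cobd (y T) c = 0" if "c \<in> Ch z" for T c using assms(4) that .
  show "card (V (bottom c)) \<le> card (atoms P)" for c by (rule card_mono[OF finite_atoms V_subset_atoms])
qed

end

section \<open>The double complex\<close>

type_synonym 'a idx = "'a set \<times> 'a \<times> ('a \<Rightarrow>\<^sub>0 nat)"

abbreviation mkeys :: "('a \<Rightarrow>\<^sub>0 nat) \<Rightarrow> 'a set" where "mkeys \<equiv> Poly_Mapping.keys"

context sposet
begin

text \<open>The pairs \<open>(r, m)\<close> with \<open>mon r m\<close> index the monomial basis of the face ring: \<open>m\<close> is a monomial
  in the vertices of \<open>r\<close> that involves each of them. \<open>sv v\<close> divides by \<open>x\<^sub>v\<close>.\<close>

definition mon :: "'a \<Rightarrow> ('a \<Rightarrow>\<^sub>0 nat) \<Rightarrow> bool" where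
  "mon r m \<longleftrightarrow> r \<in> P \<and> mkeys m = V r"

definition sv :: "'a \<Rightarrow> 'a idx \<Rightarrow> 'a idx option" where
  "sv v = (\<lambda>(c, r, m). if c \<in> Ch r \<and> mon r m \<and> v \<in> mkeys m
     then Some (c, fc r (mkeys (m - esingle v)), m - esingle v) else None)"

lemma mon_fc: 
  assumes "r \<in> P" "mkeys m \<subseteq> V r" shows "mon (fc r (mkeys m)) m" "fc r (mkeys m) \<le> r"
  using fc[OF assms] by (auto simp: mon_def)

lemma mon_div:
  assumes "mon r m"
  shows "mon (fc r (mkeys (m - esingle v))) (m - esingle v)" "fc r (mkeys (m - esingle v)) \<le> r"
  using mon_fc[of r "m - esingle v"] keys_minus_esingle[of m v] assms by (auto simp: mon_def)

lemma mon_eq_fc: "mon r m \<Longrightarrow> r \<le> b \<Longrightarrow> b \<in> P \<Longrightarrow> fc b (mkeys m) = r"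
  using fc_unique by (auto simp: mon_def)

lemma mon_z: "mon r m \<Longrightarrow> m = 0 \<longleftrightarrow> r = z"
  using V_empty_iff[of r] V_z by (auto simp: mon_def)

lemma sv_Some:
  assumes "sv v (c, r, m) = Some y"
  shows "c \<in> Ch r" "mon r m" "v \<in> mkeys m" "y = (c, fc r (mkeys (m - esingle v)), m - esingle v)"
    "c \<in> Ch (fc r (mkeys (m - esingle v)))"
proof -
  show *: "c \<in> Ch r" "mon r m" "v \<in> mkeys m" "y = (c, fc r (mkeys (m - esingle v)), m - esingle v)"
    using assms by (auto simp: sv_def split: if_splits)
  show "c \<in> Ch (fc r (mkeys (m - esingle v)))" using Ch_antimono[OF *(1)] mon_div[OF *(2)] by blast
qed

text \<open>Both orders lead to the face of r spanned by the variables left after both divisions,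
  since a face of a face of r is a face of r.\<close>

lemma sv_commute: "Option.bind (sv v x) (sv w) = Option.bind (sv w x) (sv v)"
proof (cases "v = w")
  case False
  obtain c r m where x: "x = (c, r, m)" by (cases x) auto
  have k: "v \<in> mkeys (m - esingle w) \<longleftrightarrow> v \<in> mkeys m" "w \<in> mkeys (m - esingle v) \<longleftrightarrow> w \<in> mkeys m"
    using False by (auto simp: in_keys_iff lookup_minus lookup_single)
  have e: "m - esingle v - esingle w = m - esingle w - esingle v"
    by (rule poly_mapping_eqI) (simp add: lookup_minus)
  show ?thesis
  proof (cases "c \<in> Ch r \<and> mon r m \<and> v \<in> mkeys m \<and> w \<in> mkeys m")
    case True
    have f: "fc (fc r (mkeys (m - esingle u))) (mkeys (m - esingle u - esingle u')) = fc r (mkeys (m - esingle u - esingle u'))" for u u'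
      using True keys_minus_esingle[of m u] keys_minus_esingle[of "m - esingle u" u']
      by (intro fc_fc) (auto simp: mon_def)
    have c: "c \<in> Ch (fc r (mkeys (m - esingle u)))" for u
      using True Ch_antimono mon_div by blast
    have mo: "mon (fc r (mkeys (m - esingle u))) (m - esingle u)" for u using True mon_div by blast
    show ?thesis using True c mo f[of v w] f[of w v] unfolding e by (simp add: x sv_def k e)
  next
    case F: False
    have N: "Option.bind (sv a x) (sv b) = None"
      if ab: "b \<in> mkeys (m - esingle a) \<longleftrightarrow> b \<in> mkeys m" "\<not> (c \<in> Ch r \<and> mon r m \<and> a \<in> mkeys m \<and> b \<in> mkeys m)" for a b
    proof (cases "sv a x")
      case (Some y)
      note s = sv_Some[OF Some[unfolded x]]
      have "b \<notin> mkeys (m - esingle a)" using ab s(1-3) by simp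
      then show ?thesis using Some s(4) by (simp add: sv_def)
    qed simp
    have "Option.bind (sv v x) (sv w) = None" "Option.bind (sv w x) (sv v) = None"
      by (rule N; use F k in blast)+
    then show ?thesis by simp
  qed
qed simp

end

context local_acyclic
begin

text \<open>\<open>E J p q\<close> is the part of total degree \<open>J\<close> of the double complex with differentials \<open>bd\<close> and \<open>del\<close>:
  \<open>p\<close> is the Koszul degree, and the cochains live on the \<open>q\<close>-element chains at or above \<open>r\<close>.\<close>

definition E :: "nat \<Rightarrow> nat \<Rightarrow> nat \<Rightarrow> (nat set \<Rightarrow> 'a idx \<Rightarrow> 'k) \<Rightarrow> bool" where
  "E J p q \<phi> \<longleftrightarrow> (\<forall>T c r m. \<phi> T (c, r, m) \<noteq> 0 \<longrightarrow>
     T \<subseteq> {..<d} \<and> card T = p \<and> c \<in> Ch r \<and> card c = q \<and> mon r m \<and> mdeg m + p = J)"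

definition bd :: "(nat set \<Rightarrow> 'a idx \<Rightarrow> 'k) \<Rightarrow> nat set \<Rightarrow> 'a idx \<Rightarrow> 'k" where
  "bd = kos d (atoms P) sv \<theta>"

text \<open>No sign depending on the Koszul degree is built in, so \<open>bd\<close> and
  \<open>del\<close> commute and zigzags are linked by equalities without signs.\<close>

definition del :: "(nat set \<Rightarrow> 'a idx \<Rightarrow> 'k) \<Rightarrow> nat set \<Rightarrow> 'a idx \<Rightarrow> 'k" where
  "del \<phi> T = (\<lambda>(c, r, m). if c \<in> Ch r then cobd (\<lambda>c. \<phi> T (c, r, m)) c else 0)"

text \<open>The contracting homotopy of the cone with apex r.\<close>

definition cone :: "(nat set \<Rightarrow> 'a idx \<Rightarrow> 'k) \<Rightarrow> nat set \<Rightarrow> 'a idx \<Rightarrow> 'k" where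
  "cone \<phi> T = (\<lambda>(c, r, m). if r \<notin> c \<and> insert r c \<in> Ch r then \<phi> T (insert r c, r, m) else 0)"

definition mul :: "'a \<Rightarrow> (nat set \<Rightarrow> 'a idx \<Rightarrow> 'k) \<Rightarrow> nat set \<Rightarrow> 'a idx \<Rightarrow> 'k" where
  "mul v \<phi> T x = (case sv v x of None \<Rightarrow> 0 | Some y \<Rightarrow> \<phi> T y)"

lemma E_D:
  assumes "E J p q \<phi>" "\<phi> T (c, r, m) \<noteq> 0"
  shows "T \<subseteq> {..<d}" "card T = p" "c \<in> Ch r" "card c = q" "mon r m" "mdeg m + p = J" "finite T"
  using assms finite_subset[of T "{..<d}"] unfolding E_def by blast+

lemma E_add: "E J p q \<phi> \<Longrightarrow> E J p q \<psi> \<Longrightarrow> E J p q (\<phi> + \<psi>)"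
  unfolding E_def by (metis add_0 plus_fun_apply)

lemma E_diff: "E J p q \<phi> \<Longrightarrow> E J p q \<psi> \<Longrightarrow> E J p q (\<phi> - \<psi>)"
  unfolding E_def fun_diff_def by (metis (no_types, lifting) diff_zero)

lemma bd_add: "bd (\<phi> + \<psi>) = bd \<phi> + bd \<psi>" by (simp add: bd_def kos_add)
lemma bd_diff: "bd (\<phi> - \<psi>) = bd \<phi> - bd \<psi>" by (simp add: bd_def kos_diff)

lemma del_add: "del (\<phi> + \<psi>) = del \<phi> + del \<psi>"
  by (intro ext) (auto simp: del_def cobd_def distrib_left sum.distrib)
lemma del_diff: "del (\<phi> - \<psi>) = del \<phi> - del \<psi>"
  by (intro ext) (auto simp: del_def cobd_def fun_diff_def right_diff_distrib sum_subtractf)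

lemma E_bd:
  assumes "E J (Suc p) q \<phi>" shows "E J p q (bd \<phi>)"
  unfolding E_def
proof (intro allI impI)
  fix T c r m assume "bd \<phi> T (c, r, m) \<noteq> 0"
  then obtain v i y where *: "v \<in> atoms P" "sv v (c, r, m) = Some y" "i \<in> {..<d} - T" "\<phi> (insert i T) y \<noteq> 0"
    unfolding bd_def by (rule kos_support)
  note s = sv_Some[OF *(2)]
  note e = E_D[OF assms *(4)[unfolded s(4)]]
  have "Suc (mdeg (m - esingle v)) = mdeg m" using mdeg_minus_esingle s(3) .
  with e s * show "T \<subseteq> {..<d} \<and> card T = p \<and> c \<in> Ch r \<and> card c = q \<and> mon r m \<and> mdeg m + p = J" by auto
qed

lemma bd_E_0:
  assumes "E J 0 q \<phi>" shows "bd \<phi> = 0"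
proof (rule ccontr)
  assume "bd \<phi> \<noteq> 0"
  then obtain T c r m where "bd \<phi> T (c, r, m) \<noteq> 0" by (force simp: fun_eq_iff)
  then obtain v i y where *: "sv v (c, r, m) = Some y" "i \<in> {..<d} - T" "\<phi> (insert i T) y \<noteq> 0"
    unfolding bd_def by (rule kos_support)
  show False using E_D[OF assms *(3)[unfolded sv_Some(4)[OF *(1)]]] by auto
qed

lemma E_del:
  assumes "E J p q \<phi>" shows "E J p (Suc q) (del \<phi>)"
  unfolding E_def
proof (intro allI impI)
  fix T c r m assume "del \<phi> T (c, r, m) \<noteq> 0"
  then have c: "c \<in> Ch r" "cobd (\<lambda>c. \<phi> T (c, r, m)) c \<noteq> 0" by (auto simp: del_def split: if_splits)
  then obtain \<tau> where t: "\<tau> \<in> c" "\<phi> T (c - {\<tau>}, r, m) \<noteq> 0"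
    unfolding cobd_def by (metis (no_types, lifting) mult_zero_right sum.neutral)
  then show "T \<subseteq> {..<d} \<and> card T = p \<and> c \<in> Ch r \<and> card c = Suc q \<and> mon r m \<and> mdeg m + p = J"
    using E_D[OF assms t(2)] c(1) Ch_finite[OF c(1)] by (metis card.remove)
qed

lemma E_cone:
  assumes "E J p (Suc q) \<phi>" shows "E J p q (cone \<phi>)"
  unfolding E_def
proof (intro allI impI)
  fix T c r m assume nz: "cone \<phi> T (c, r, m) \<noteq> 0"
  then have c: "insert r c \<in> Ch r" "r \<notin> c" "\<phi> T (insert r c, r, m) \<noteq> 0" by (auto simp: cone_def split: if_splits)
  then have "c \<in> Ch r" "finite c" using Ch_subset[OF c(1), of c] Ch_finite by auto
  then show "T \<subseteq> {..<d} \<and> card T = p \<and> c \<in> Ch r \<and> card c = q \<and> mon r m \<and> mdeg m + p = J"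
    using E_D[OF assms c(3)] c by auto
qed

lemma E_mul:
  assumes "E J p q \<phi>" shows "E (Suc J) p q (mul v \<phi>)"
  unfolding E_def
proof (intro allI impI)
  fix T c r m assume "mul v \<phi> T (c, r, m) \<noteq> 0"
  then obtain y where y: "sv v (c, r, m) = Some y" "\<phi> T y \<noteq> 0" by (auto simp: mul_def split: option.splits)
  note s = sv_Some[OF y(1)]
  have "Suc (mdeg (m - esingle v)) = mdeg m" using mdeg_minus_esingle s(3) .
  then show "T \<subseteq> {..<d} \<and> card T = p \<and> c \<in> Ch r \<and> card c = q \<and> mon r m \<and> mdeg m + p = Suc J"
    using E_D[OF assms y(2)[unfolded s(4)]] s by auto
qed

lemma bd_bd: assumes "E J p q \<phi>" shows "bd (bd \<phi>) = 0"
proof (intro ext)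
  fix T x
  show "bd (bd \<phi>) T x = 0 T x"
  proof (cases "T \<subseteq> {..<d}")
    case True
    have "bd (bd \<phi>) T x = 0" unfolding bd_def by (rule kos_kos[OF finite_atoms True]) (rule sv_commute)
    then show ?thesis by simp
  next
    case False
    have "bd (bd \<phi>) T x = 0"
    proof (cases p)
      case 0 
      then show ?thesis using bd_E_0[of J q \<phi>] bd_E_0[of J q 0] assms by (simp add: E_def)
    next
      case (Suc p')
      then have E1: "E J p' q (bd \<phi>)" using assms E_bd by blast
      show ?thesis
      proof (cases p')
        case 0 then show ?thesis using bd_E_0 E1 by simp
      next
        case (Suc p'') then show ?thesis using E_bd[of J p'' q "bd \<phi>"] E1 E_D(1) False by (cases x) blast
      qed
    qed
    then show ?thesis by simp
  qed
qed

lemma del_del: "del (del \<phi>) = 0"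
proof (intro ext)
  fix T and x :: "'a idx"
  obtain c r m where x: "x = (c, r, m)" by (cases x) auto
  show "del (del \<phi>) T x = 0 T x"
  proof (cases "c \<in> Ch r")
    case True
    have "del (del \<phi>) T x = cobd (cobd (\<lambda>c. \<phi> T (c, r, m))) c"
      unfolding x del_def using True Ch_subset[OF True] by (auto intro!: cobd_cong)
    then show ?thesis using cobd_cobd[OF Ch_finite[OF True]] True by (simp add: Ch_def)
  qed (simp add: x del_def)
qed

lemma bd_del: "bd (del \<phi>) = del (bd \<phi>)"
proof (intro ext)
  fix T and x :: "'a idx"
  obtain c r m where x: "x = (c, r, m)" by (cases x) auto
  have "bd (del \<phi>) T x = (\<Sum>v\<in>atoms P. case sv v x of None \<Rightarrow> 0 | Some y \<Rightarrow> iota d (\<theta> v) (del \<phi>) T y)"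
    by (simp add: bd_def kos_def)
  show "bd (del \<phi>) T x = del (bd \<phi>) T x"
  proof (cases "c \<in> Ch r")
    case False
    then show ?thesis by (simp add: x bd_def kos_def sv_def del_def)
  next
    case True
    have "del (bd \<phi>) T x = (\<Sum>v\<in>atoms P. \<Sum>\<tau>\<in>c. sg \<tau> c * (case sv v (c - {\<tau>}, r, m) of None \<Rightarrow> 0 | Some y \<Rightarrow> iota d (\<theta> v) \<phi> T y))"
      using True unfolding x del_def cobd_def bd_def kos_def sum_distrib_left by simp (rule sum.swap)
    also have "\<dots> = bd (del \<phi>) T x" unfolding bd_def kos_def
    proof (rule sum.cong[OF refl])
      fix v
      show "(\<Sum>\<tau>\<in>c. sg \<tau> c * (case sv v (c - {\<tau>}, r, m) of None \<Rightarrow> 0 | Some y \<Rightarrow> iota d (\<theta> v) \<phi> T y)) =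
        (case sv v x of None \<Rightarrow> 0 | Some y \<Rightarrow> iota d (\<theta> v) (del \<phi>) T y)"
      proof (cases "mon r m \<and> v \<in> mkeys m")
        case False
        then show ?thesis by (auto simp: x sv_def)
      next
        case mv: True
        let ?r = "fc r (mkeys (m - esingle v))" and ?m = "m - esingle v"
        have c: "c \<in> Ch ?r" using Ch_antimono[OF True] mon_div mv by blast
        have "sv v (c - {\<tau>}, r, m) = Some (c - {\<tau>}, ?r, ?m)" for \<tau>
          using mv Ch_subset[OF True, of "c - {\<tau>}"] by (auto simp: sv_def)
        moreover have "sv v x = Some (c, ?r, ?m)" using mv True by (simp add: x sv_def)
        moreover have "iota d (\<theta> v) (del \<phi>) T (c, ?r, ?m) = (\<Sum>\<tau>\<in>c. sg \<tau> c * iota d (\<theta> v) \<phi> T (c - {\<tau>}, ?r, ?m))"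
          using c unfolding iota_def del_def cobd_def sum_distrib_left
          by (simp add: sum_distrib_left) (subst sum.swap, simp add: mult_ac)
        ultimately show ?thesis by simp
      qed
    qed
    finally show ?thesis ..
  qed
qed

lemma mul_del: "mul v (del \<phi>) = del (mul v \<phi>)"
proof (intro ext)
  fix T and x :: "'a idx"
  obtain c r m where x: "x = (c, r, m)" by (cases x) auto
  show "mul v (del \<phi>) T x = del (mul v \<phi>) T x"
  proof (cases "c \<in> Ch r \<and> mon r m \<and> v \<in> mkeys m")
    case False
    have "mul v \<phi> T (c - {\<tau>}, r, m) = 0" if "c \<in> Ch r" for \<tau> using False that by (auto simp: mul_def sv_def)
    then show ?thesis using False by (auto simp: x mul_def sv_def del_def cobd_def)
  next
    case True
    let ?r = "fc r (mkeys (m - esingle v))" and ?m = "m - esingle v"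
    have "c \<in> Ch ?r" using Ch_antimono True mon_div by blast
    moreover have "sv v (c - {\<tau>}, r, m) = Some (c - {\<tau>}, ?r, ?m)" for \<tau>
      using True Ch_subset[of c r "c - {\<tau>}"] by (auto simp: sv_def)
    ultimately show ?thesis using True by (simp add: x mul_def sv_def del_def cobd_def)
  qed
qed

lemma mul_bd: "mul v (bd \<phi>) = bd (mul v \<phi>)"
proof (intro ext)
  fix T and x :: "'a idx"
  have "mul v (bd \<phi>) T x = (\<Sum>w\<in>atoms P. case Option.bind (sv v x) (sv w) of None \<Rightarrow> 0 | Some y \<Rightarrow> iota d (\<theta> w) \<phi> T y)"
    by (auto simp: mul_def bd_def kos_def split: option.split)
  also have "\<dots> = (\<Sum>w\<in>atoms P. case Option.bind (sv w x) (sv v) of None \<Rightarrow> 0 | Some y \<Rightarrow> iota d (\<theta> w) \<phi> T y)"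
    by (simp only: sv_commute)
  also have "\<dots> = bd (mul v \<phi>) T x" unfolding bd_def kos_def
    by (rule sum.cong) (auto simp: iota_def mul_def split: option.split)
  finally show "mul v (bd \<phi>) T x = bd (mul v \<phi>) T x" .
qed

text \<open>For fixed \<open>(r, m)\<close> with \<open>m \<noteq> 0\<close>, the rows are the augmented cochains of a cone with apex \<open>r\<close>.\<close>

lemma row_exact:
  assumes E: "E J p (Suc q) \<phi>" and pJ: "p < J" and d0: "del \<phi> = 0"
  shows "E J p q (cone \<phi>)" "del (cone \<phi>) = \<phi>"
proof -
  show E1: "E J p q (cone \<phi>)" using E_cone[OF E] .
  show "del (cone \<phi>) = \<phi>"
  proof (intro ext)
    fix T and x :: "'a idx"
    obtain c r m where x: "x = (c, r, m)" by (cases x) auto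
    show "del (cone \<phi>) T x = \<phi> T x"
    proof (cases "c \<in> Ch r \<and> mon r m \<and> mdeg m + p = J")
      case False
      have "del (cone \<phi>) T x = 0" using E_del[OF E1] False unfolding x E_def by blast
      moreover have "\<phi> T x = 0" using E False unfolding x E_def by blast
      ultimately show ?thesis by simp
    next
      case True
      then have "m \<noteq> 0" using pJ by (auto simp: mdeg_def)
      then have rz: "r \<in> P" "r \<noteq> z" using True mon_z by (auto simp: mon_def)
      have c: "finite c" "\<And>\<tau>. \<tau> \<in> c \<Longrightarrow> r \<le> \<tau>" using True Ch_finite by (auto simp: Ch_def)
      have ins: "insert r c' \<in> Ch r" if "c' \<subseteq> c" for c'
      proof -
        have "c' \<in> Ch r" using Ch_subset True that by blast
        then show ?thesis using rz by (auto simp: Ch_def chain_def)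
      qed
      have dx: "del (cone \<phi>) T x = cobd (\<lambda>c. cone \<phi> T (c, r, m)) c" using True by (simp add: del_def x)
      show ?thesis
      proof (cases "r \<in> c")
        case r: True
        have "cobd (\<lambda>c. cone \<phi> T (c, r, m)) c = (\<Sum>\<tau>\<in>c. if \<tau> = r then \<phi> T (c, r, m) else 0)"
          unfolding cobd_def
        proof (rule sum.cong[OF refl])
          fix \<tau> assume "\<tau> \<in> c"
          show "sg \<tau> c * cone \<phi> T (c - {\<tau>}, r, m) = (if \<tau> = r then \<phi> T (c, r, m) else 0)"
            using r True sg_least[of c r] c(2) by (auto simp: cone_def insert_absorb)
        qed
        then show ?thesis using r c(1) dx by (simp add: x)
      next
        case r: False
        have "del \<phi> T (insert r c, r, m) = 0" using d0 by simp
        then have "cobd (\<lambda>c. \<phi> T (c, r, m)) (insert r c) = 0" using ins[of c] by (simp add: del_def)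
        then have "\<phi> T (c, r, m) = cobd (\<lambda>c'. \<phi> T (insert r c', r, m)) c"
          using cobd_insert_least[OF c(1) r c(2), of "\<lambda>c. \<phi> T (c, r, m)"] by simp
        also have "\<dots> = cobd (\<lambda>c. cone \<phi> T (c, r, m)) c"
          using r ins by (intro cobd_cong) (auto simp: cone_def)
        finally show ?thesis unfolding dx by (simp add: x)
      qed
    qed
  qed
qed

text \<open>The start of the row is injective: the value at the empty chain reappears as the
  coboundary at the chain consisting of r alone, which is available because r differs from
  \<open>z\<close>.\<close>

lemma row_exact_0:
  assumes E: "E J p 0 \<phi>" and pJ: "p < J" and d0: "del \<phi> = 0"
  shows "\<phi> = 0"
proof (rule ccontr)
  assume "\<phi> \<noteq> 0"
  then obtain T c r m where nz: "\<phi> T (c, r, m) \<noteq> 0" by (force simp: fun_eq_iff)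
  note e = E_D[OF E nz]
  have c: "c = {}" using e(3,4) Ch_finite by auto
  have "m \<noteq> 0" using pJ e(6) by (auto simp: mdeg_def)
  then have "{r} \<in> Ch r" using e(5) mon_z by (auto simp: mon_def Ch_def chain_def)
  moreover have "del \<phi> T ({r}, r, m) = 0" using d0 by simp
  ultimately have "\<phi> T ({}, r, m) = 0" by (simp add: del_def cobd_def sg_def)
  then show False using nz c by simp
qed

text \<open>Over a nonempty chain with least element b the pairs (r, m) with r \<le> b correspond to
  the monomials in V b, since r is the face of b spanned by the support of m. So the column is a
  polynomial Koszul complex, and p < J is positivity of the polynomial degree. A preimage is chosen
  for each chain independently.\<close>

lemma col_exact:
  assumes E: "E J p (Suc q) \<phi>" and pJ: "p < J" and b0: "bd \<phi> = 0"
  shows "\<exists>\<psi>. E J (Suc p) (Suc q) \<psi> \<and> bd \<psi> = \<phi>"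
proof -
  obtain e where e: "J = p + Suc e" using pJ less_imp_Suc_add by auto
  have "\<exists>\<psi>. (\<forall>T m. \<psi> T m \<noteq> 0 \<longrightarrow> T \<subseteq> {..<d} \<and> card T = Suc p \<and> mkeys m \<subseteq> V (bottom c) \<and> mdeg m = e) \<and>
      (\<forall>T r m. T \<subseteq> {..<d} \<longrightarrow> c \<in> Ch r \<longrightarrow> mon r m \<longrightarrow> \<phi> T (c, r, m) = kos d (V (bottom c)) mdiv \<theta> \<psi> T m)"
    if c: "c \<in> Ch z" "c \<noteq> {}" for c
  proof -
    let ?b = "bottom c"
    note b = bottom[OF c]
    \<comment> \<open>The column over c as a chain of the polynomial Koszul complex: the missing
      face r is recovered from the support of m.\<close>
    define f where "f = (\<lambda>T m. if mkeys m \<subseteq> V ?b then \<phi> T (c, fc ?b (mkeys m), m) else 0)"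
    have fr: "\<phi> T (c, r, m) = f T m" if r: "c \<in> Ch r" "mon r m" for T r m
    proof -
      have "r \<le> ?b" using bottom(5)[OF r(1) c(2)] .
      moreover have "mkeys m \<subseteq> V ?b" using r(2) V_mono[OF \<open>r \<le> ?b\<close>] by (simp add: mon_def)
      ultimately show ?thesis using mon_eq_fc[OF r(2)] b(3) by (simp add: f_def)
    qed
    have "\<exists>\<psi>. (\<forall>T m. \<psi> T m \<noteq> 0 \<longrightarrow> T \<subseteq> {..<d} \<and> card T = Suc p \<and> mkeys m \<subseteq> V ?b \<and> mdeg m = e) \<and>
      (\<forall>T m. T \<subseteq> {..<d} \<longrightarrow> f T m = kos d (V ?b) mdiv \<theta> \<psi> T m)"
    proof (rule poly_koszul_exact[where a = "a ?b"])
      show "finite (V ?b)" by (rule finite_V)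
      show "(\<Sum>i<d. \<theta> v i * a ?b w i) = (if v = w then 1 else 0)" if "v \<in> V ?b" "w \<in> V ?b" for v w
        using dual b(3) that by blast
      show "T \<subseteq> {..<d} \<and> card T = p \<and> mkeys m \<subseteq> V ?b \<and> mdeg m = Suc e" if nz: "f T m \<noteq> 0" for T m
      proof -
        have m: "mkeys m \<subseteq> V ?b" "\<phi> T (c, fc ?b (mkeys m), m) \<noteq> 0" using nz by (auto simp: f_def split: if_splits)
        show ?thesis using E_D[OF E m(2)] m(1) e by auto
      qed
      show "kos d (V ?b) mdiv \<theta> f T m = 0" if T: "T \<subseteq> {..<d}" for T m
      proof (cases "mkeys m \<subseteq> V ?b")
        case False
        have "(case mdiv v m of None \<Rightarrow> 0 | Some y \<Rightarrow> iota d (\<theta> v) f T y) = 0" if v: "v \<in> V ?b" for v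
        proof (cases "v \<in> mkeys m")
          case True
          have "\<not> mkeys (m - esingle v) \<subseteq> V ?b"
          proof
            assume *: "mkeys (m - esingle v) \<subseteq> V ?b"
            have "mkeys m = mkeys (m - esingle v) \<union> {v}"
              using keys_plus_nat[of "m - esingle v" "esingle v"] minus_esingle_plus[OF True] by simp
            with * v False show False by auto
          qed
          then show ?thesis by (simp add: mdiv_def f_def iota_def)
        qed (simp add: mdiv_def)
        then show ?thesis by (simp add: kos_def)
      next
        case True
        let ?r = "fc ?b (mkeys m)"
        have r: "mon ?r m" "?r \<le> ?b" using mon_fc[OF b(3) True] by auto
        have cr: "c \<in> Ch ?r" using Ch_antimono[OF b(6) r(2)] .
        have "0 = bd \<phi> T (c, ?r, m)" using b0 by simp
        also have "\<dots> = (\<Sum>v\<in>V ?b. case sv v (c, ?r, m) of None \<Rightarrow> 0 | Some y \<Rightarrow> iota d (\<theta> v) \<phi> T y)"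
          unfolding bd_def kos_def
          using True by (intro sum.mono_neutral_right finite_atoms V_subset_atoms) (auto simp: sv_def)
        also have "\<dots> = kos d (V ?b) mdiv \<theta> f T m" unfolding kos_def
        proof (rule sum.cong[OF refl])
          fix v assume "v \<in> V ?b"
          show "(case sv v (c, ?r, m) of None \<Rightarrow> 0 | Some y \<Rightarrow> iota d (\<theta> v) \<phi> T y) =
              (case mdiv v m of None \<Rightarrow> 0 | Some y \<Rightarrow> iota d (\<theta> v) f T y)"
          proof (cases "v \<in> mkeys m")
            case v: True
            let ?m = "m - esingle v"
            have "fc ?r (mkeys ?m) \<le> ?r" "mon (fc ?r (mkeys ?m)) ?m" using mon_div[OF r(1)] by auto
            then have "\<phi> T' (c, fc ?r (mkeys ?m), ?m) = f T' ?m" for T'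
              by (intro fr Ch_antimono[OF cr])
            then show ?thesis using v r(1) cr by (simp add: sv_def mdiv_def iota_def)
          qed (simp add: sv_def mdiv_def)
        qed
        finally show ?thesis by simp
      qed
    qed
    then obtain \<psi> where \<psi>: "\<forall>T m. \<psi> T m \<noteq> 0 \<longrightarrow> T \<subseteq> {..<d} \<and> card T = Suc p \<and> mkeys m \<subseteq> V ?b \<and> mdeg m = e"
      "\<And>T m. T \<subseteq> {..<d} \<Longrightarrow> f T m = kos d (V ?b) mdiv \<theta> \<psi> T m" by blast
    have "\<phi> T (c, r, m) = kos d (V ?b) mdiv \<theta> \<psi> T m" if "T \<subseteq> {..<d}" "c \<in> Ch r" "mon r m" for T r m
      using fr[OF that(2,3)] \<psi>(2)[OF that(1)] by simp
    with \<psi>(1) show ?thesis by blast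
  qed
  then obtain g where g: "\<And>c T m. c \<in> Ch z \<Longrightarrow> c \<noteq> {} \<Longrightarrow> g c T m \<noteq> 0 \<Longrightarrow>
       T \<subseteq> {..<d} \<and> card T = Suc p \<and> mkeys m \<subseteq> V (bottom c) \<and> mdeg m = e"
    "\<And>c T r m. c \<in> Ch z \<Longrightarrow> c \<noteq> {} \<Longrightarrow> T \<subseteq> {..<d} \<Longrightarrow> c \<in> Ch r \<Longrightarrow> mon r m \<Longrightarrow>
       \<phi> T (c, r, m) = kos d (V (bottom c)) mdiv \<theta> (g c) T m"
    by metis
  define \<psi> where "\<psi> = (\<lambda>T (c, r, m). if c \<in> Ch r \<and> mon r m \<and> card c = Suc q then g c T m else 0)"
  have E\<psi>: "E J (Suc p) (Suc q) \<psi>"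
    unfolding E_def
  proof (intro allI impI)
    fix T c r m assume nz: "\<psi> T (c, r, m) \<noteq> 0"
    then have *: "c \<in> Ch r" "mon r m" "card c = Suc q" "g c T m \<noteq> 0" by (auto simp: \<psi>_def split: if_splits)
    then have "c \<noteq> {}" using *(3) by auto
    then show "T \<subseteq> {..<d} \<and> card T = Suc p \<and> c \<in> Ch r \<and> card c = Suc q \<and> mon r m \<and> mdeg m + Suc p = J"
      using g(1)[OF Ch_z[OF *(1)] _ *(4)] * e by auto
  qed
  have "bd \<psi> = \<phi>"
  proof (intro ext)
    fix T and x :: "'a idx"
    obtain c r m where x: "x = (c, r, m)" by (cases x) auto
    show "bd \<psi> T x = \<phi> T x"
    proof (cases "T \<subseteq> {..<d} \<and> c \<in> Ch r \<and> mon r m \<and> card c = Suc q")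
      case False
      have "bd \<psi> T x = 0" using E_bd[OF E\<psi>] False unfolding x E_def by blast
      moreover have "\<phi> T x = 0" using E False unfolding x E_def by blast
      ultimately show ?thesis by simp
    next
      case True
      then have c: "c \<in> Ch z" "c \<noteq> {}" using Ch_z by auto
      have "mkeys m \<subseteq> V (bottom c)" using True V_mono[OF bottom(5)[of c r]] c(2) by (simp add: mon_def)
      then have "bd \<psi> T x = (\<Sum>v\<in>V (bottom c). case sv v x of None \<Rightarrow> 0 | Some y \<Rightarrow> iota d (\<theta> v) \<psi> T y)"
        unfolding bd_def kos_def x
        by (intro sum.mono_neutral_right finite_atoms V_subset_atoms) (auto simp: sv_def)
      also have "\<dots> = kos d (V (bottom c)) mdiv \<theta> (g c) T m" unfolding kos_def
      proof (rule sum.cong[OF refl])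
        fix v
        show "(case sv v x of None \<Rightarrow> 0 | Some y \<Rightarrow> iota d (\<theta> v) \<psi> T y) =
            (case mdiv v m of None \<Rightarrow> 0 | Some y \<Rightarrow> iota d (\<theta> v) (g c) T y)"
        proof (cases "v \<in> mkeys m")
          case v: True
          have "\<psi> T' (c, fc r (mkeys (m - esingle v)), m - esingle v) = g c T' (m - esingle v)" for T'
            using mon_div[of r m v] Ch_antimono[of c r] True by (auto simp: \<psi>_def)
          then show ?thesis using v True by (simp add: x sv_def mdiv_def iota_def)
        qed (simp add: x sv_def mdiv_def)
      qed
      also have "\<dots> = \<phi> T x" using g(2) c True by (simp add: x)
      finally show ?thesis .
    qed
  qed
  with E\<psi> show ?thesis by blast
qed

text \<open>In Koszul degree J the monomial is trivial. Closedness under \<open>bd\<close>, read at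
  the monomial x_v and the face v, is the contraction condition at v, so the statement is the
  exactness of the row of kernels. For q = 0 the primitive is supported at the empty chain, where it
  was arranged to vanish.\<close>

lemma top_exact:
  assumes E: "E J J (Suc q) \<phi>" and q: "q < J" and b0: "bd \<phi> = 0" and d0: "del \<phi> = 0"
  shows "\<exists>\<psi>. E J J q \<psi> \<and> bd \<psi> = 0 \<and> del \<psi> = \<phi> \<and> (q = 0 \<longrightarrow> \<psi> = 0)"
proof -
  have mz: "m = 0 \<and> r = z" if "\<phi> T (c, r, m) \<noteq> 0" for T c r m
    using E_D(5,6)[OF E that] mdeg_eq_0[of m] mon_z[of r m] by simp
  have mon_z0: "mon z 0" using z_P V_z by (simp add: mon_def)
  define y where "y = (\<lambda>T c. \<phi> T (c, z, 0))"
  have Ky: "K J (Suc q) y" unfolding K_def y_def using E_D[OF E] by blast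
  have kery: "ker y"
    unfolding ker_def
  proof (intro allI impI)
    fix T c v assume T: "T \<subseteq> {..<d}" and c: "c \<in> Ch z" "c \<noteq> {}" and v: "v \<in> V (bottom c)"
    have va: "v \<in> atoms P" "V v = {v}" "v \<in> P" "v \<le> bottom c" using v V_atom by (auto simp: V_def atoms_iff)
    have cv: "c \<in> Ch v" using Ch_antimono[OF bottom(6)[OF c] va(4)] .
    have mv: "mon v (esingle v)" using va by (simp add: mon_def)
    have fz: "fc v {} = z" using fc_unique[OF va(3) z_P z_le[OF va(3)]] V_z by simp
    \<comment> \<open>At this index only division by x_v is possible, so the Koszul differential has
      a single term.\<close>
    have sv: "sv u (c, v, esingle v) = (if u = v then Some (c, z, 0) else None)" for u
      using cv mv by (auto simp: sv_def fz)
    have "0 = bd \<phi> T (c, v, esingle v)" using b0 by simp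
    also have "\<dots> = (\<Sum>u\<in>atoms P. if u = v then iota d (\<theta> v) \<phi> T (c, z, 0) else 0)"
      unfolding bd_def kos_def sv by (intro sum.cong) auto
    also have "\<dots> = iota d (\<theta> v) y T c" using finite_atoms va(1) by (simp add: iota_def y_def)
    finally show "iota d (\<theta> v) y T c = 0" by simp
  qed
  have ycoc: "cobd (y T) c = 0" if "c \<in> Ch z" for T c
  proof -
    have "del \<phi> T (c, z, 0) = 0" using d0 by simp
    then show ?thesis using that by (simp add: del_def y_def)
  qed
  obtain x where x: "K J q x" "ker x" "\<forall>T. x T {} = 0" "\<forall>T. \<forall>c\<in>Ch z. y T c = cobd (x T) c"
    using kernel_exact[OF Ky kery q ycoc] by blast
  define \<psi> where "\<psi> = (\<lambda>T (c, r, m). if r = z \<and> m = (0 :: 'a \<Rightarrow>\<^sub>0 nat) then x T c else 0)"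
  have E\<psi>: "E J J q \<psi>"
    using x(1) mon_z0 unfolding E_def K_def \<psi>_def by (auto simp: mdeg_def split: if_splits)
  have "bd \<psi> = 0"
  proof (intro ext)
    fix T and i :: "'a idx"
    obtain c r m where i: "i = (c, r, m)" by (cases i) auto
    have "(case sv v i of None \<Rightarrow> 0 | Some y \<Rightarrow> iota d (\<theta> v) \<psi> T y) = 0" for v
    proof (cases "sv v i")
      case (Some y)
      note s = sv_Some[OF Some[unfolded i]]
      have "iota d (\<theta> v) \<psi> T y = 0"
      proof (cases "fc r (mkeys (m - esingle v)) = z \<and> m - esingle v = 0 \<and> T \<subseteq> {..<d} \<and> c \<noteq> {}")
        case True
        have "m = esingle v" using minus_esingle_plus[OF s(3)] True by simp
        then have "v \<in> V r" using s(2) by (auto simp: mon_def)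
        then have "v \<in> V (bottom c)" using V_mono[OF bottom(5)[OF s(1)]] True by blast
        then have "iota d (\<theta> v) x T c = 0" using x(2) Ch_z[OF s(1)] True unfolding ker_def by blast
        moreover have "y = (c, z, 0)" using s(4) True by metis
        ultimately show ?thesis by (simp add: iota_def \<psi>_def)
      next
        case False
        have "\<psi> (insert k T) y = 0" if "k \<in> {..<d} - T" for k
        proof (rule ccontr)
          assume nz: "\<psi> (insert k T) y \<noteq> 0"
          have "insert k T \<subseteq> {..<d}" using E_D(1)[OF E\<psi>] nz s(4) by blast
          then show False using False nz s(4) x(3) by (auto simp: \<psi>_def split: if_splits)
        qed
        then show ?thesis by (simp add: iota_def)
      qed
      then show ?thesis using Some by simp
    qed simp
    then show "bd \<psi> T i = 0 T i" by (simp add: bd_def kos_def)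
  qed
  moreover have "del \<psi> = \<phi>"
  proof (intro ext)
    fix T and i :: "'a idx"
    obtain c r m where i: "i = (c, r, m)" by (cases i) auto
    show "del \<psi> T i = \<phi> T i"
    proof (cases "c \<in> Ch r \<and> r = z \<and> m = 0")
      case True
      then have *: "c \<in> Ch z" "r = z" "m = 0" by auto
      have "del \<psi> T i = cobd (x T) c" unfolding i *(2,3) using *(1) by (simp add: del_def \<psi>_def)
      also have "\<dots> = y T c" using x(4) True by auto
      finally show ?thesis using True by (simp add: y_def i)
    next
      case False
      have "\<phi> T i = 0" using mz E_D(3)[OF E] False unfolding i by blast
      moreover have "del \<psi> T i = 0" using False Ch_z[of c r] by (auto simp: i del_def \<psi>_def cobd_def)
      ultimately show ?thesis by simp
    qed
  qed
  moreover have "\<psi> = 0" if "q = 0"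
  proof (intro ext)
    fix T and i :: "'a idx"
    obtain c r m where i: "i = (c, r, m)" by (cases i) auto
    show "\<psi> T i = 0 T i"
    proof (rule ccontr)
      assume nz: "\<psi> T i \<noteq> 0 T i"
      then have nz': "\<psi> T (c, r, m) \<noteq> 0" by (simp add: i)
      have "c = {}" using E_D(3,4)[OF E\<psi> nz'] Ch_finite that by auto
      then show False using nz' x(3) by (auto simp: \<psi>_def split: if_splits)
    qed
  qed
  ultimately show ?thesis using E\<psi> by blast
qed

text \<open>The start \<open>\<zeta> 0\<close> lives on the empty chain, that is, in the Koszul
  complex of the face ring in degree p. If p + q = J, the end \<open>\<zeta> q\<close> lives in the
  row of the trivial monomial and is a cochain of the order complex with exterior
  coefficients.\<close>

definition zigzag :: "nat \<Rightarrow> nat \<Rightarrow> nat \<Rightarrow> (nat \<Rightarrow> nat set \<Rightarrow> 'a idx \<Rightarrow> 'k) \<Rightarrow> bool" where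
  "zigzag J p q \<zeta> \<longleftrightarrow> (\<forall>k\<le>q. E J (p + k) k (\<zeta> k)) \<and> (\<forall>k<q. del (\<zeta> k) = bd (\<zeta> (Suc k)))"

lemma del_0: "del 0 = 0" by (intro ext) (auto simp: del_def cobd_def)
lemma bd_0: "bd 0 = 0" using bd_diff[of 0 0] by simp
lemma E_0: "E J p q 0" by (simp add: E_def)

text \<open>An end that is a coboundary is pushed back along the rows until the start becomes a
  Koszul boundary. The rows passed have Koszul degree p + k with k < q, below J by assumption, hence
  are exact.\<close>

lemma zigzag_boundary:
  assumes zz: "zigzag J p q \<zeta>" and J: "p + q \<le> J"
    and top: "q = 0 \<and> \<zeta> 0 = 0 \<or> (\<exists>q' w. q = Suc q' \<and> E J (p + q) q' w \<and> \<zeta> q = del w)"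
  shows "\<exists>u. E J (Suc p) 0 u \<and> \<zeta> 0 = bd u"
proof (cases q)
  case 0
  then show ?thesis using top E_0 bd_0 by (intro exI[of _ 0]) auto
next
  case (Suc q')
  \<comment> \<open>Descending induction from the end: every entry is a row coboundary plus a Koszul
    boundary. The row part, moved one step down, accounts for the differential of the previous
    entry.\<close>
  have claim: "\<exists>w u. E J (p + Suc k) k w \<and> E J (Suc p + Suc k) (Suc k) u \<and> \<zeta> (Suc k) = del w + bd u" if "k \<le> q'" for k
    using that
  proof (induction rule: inc_induct)
    case base
    then obtain w where "E J (p + q) q' w" "\<zeta> q = del w" using top Suc by auto
    then have "E J (p + Suc q') q' w" "\<zeta> (Suc q') = del w + bd 0" using Suc bd_0 by (simp_all add: bd_0)
    then show ?case using E_0[of J "Suc p + Suc q'" "Suc q'"] by blast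
  next
    case (step k)
    then obtain w u where wu: "E J (p + Suc (Suc k)) (Suc k) w" "E J (Suc p + Suc (Suc k)) (Suc (Suc k)) u"
      "\<zeta> (Suc (Suc k)) = del w + bd u" by blast
    have k: "Suc k < q" using step Suc by simp
    have Ek: "E J (p + Suc k) (Suc k) (\<zeta> (Suc k))" using zz k unfolding zigzag_def by (blast intro: less_imp_le)
    have Ew: "E J (p + Suc k) (Suc k) (bd w)" using wu(1) E_bd[of J "p + Suc k"] by simp
    have "del (\<zeta> (Suc k)) = bd (\<zeta> (Suc (Suc k)))" using zz k by (simp add: zigzag_def)
    also have "\<dots> = del (bd w)" unfolding wu(3) bd_add bd_bd[OF wu(2)] bd_del by simp
    finally have "del (\<zeta> (Suc k) - bd w) = 0" by (simp add: del_diff)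
    then have "E J (p + Suc k) k (cone (\<zeta> (Suc k) - bd w))" "del (cone (\<zeta> (Suc k) - bd w)) = \<zeta> (Suc k) - bd w"
      using row_exact[OF E_diff[OF Ek Ew]] k J by auto
    then show ?case using wu(1) by (intro exI[of _ "cone (\<zeta> (Suc k) - bd w)"] exI[of _ w]) auto
  qed
  obtain w u where wu: "E J (p + Suc 0) 0 w" "E J (Suc p + Suc 0) (Suc 0) u" "\<zeta> (Suc 0) = del w + bd u"
    using claim[of 0] by auto
  have E0: "E J p 0 (\<zeta> 0)" using zz by (auto simp: zigzag_def)
  have Ew: "E J p 0 (bd w)" using wu(1) E_bd by simp
  have "del (\<zeta> 0) = bd (\<zeta> (Suc 0))" using zz Suc by (simp add: zigzag_def)
  also have "\<dots> = del (bd w)" unfolding wu(3) bd_add bd_bd[OF wu(2)] bd_del by simp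
  finally have "del (\<zeta> 0 - bd w) = 0" by (simp add: del_diff)
  then have "\<zeta> 0 - bd w = 0" using row_exact_0[OF E_diff[OF E0 Ew]] J Suc by simp
  then show ?thesis using wu(1) by (intro exI[of _ w]) auto
qed

text \<open>The opposite direction to \<open>zigzag_boundary\<close>: a start that is a Koszul
  boundary is pushed up through the exact columns. In the last step the positive polynomial degree
  is used up, and the exactness of the kernels replaces that of the columns.\<close>

lemma zigzag_top:
  assumes zz: "zigzag J p (Suc q) \<zeta>" and J: "p + Suc q = J" and d0: "del (\<zeta> (Suc q)) = 0"
    and u: "E J (Suc p) 0 u" "\<zeta> 0 = bd u"
  shows "\<exists>w. E J J q w \<and> \<zeta> (Suc q) = del w"
proof -
  have claim: "\<exists>u. E J (Suc p + k) k u \<and> del (\<zeta> k) = del (bd u)" if "k \<le> q" for k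
    using that
  proof (induction k)
    case 0
    then show ?case using u by (intro exI[of _ u]) simp
  next
    case (Suc k)
    then obtain u where u: "E J (Suc p + k) k u" "del (\<zeta> k) = del (bd u)" by auto
    have k: "Suc k \<le> Suc q" "k < Suc q" using Suc by auto
    have "E J (p + Suc k) (Suc k) (\<zeta> (Suc k))" using zz k unfolding zigzag_def by blast
    then have Ek: "E J (Suc p + k) (Suc k) (\<zeta> (Suc k) - del u)"
      using E_del[OF u(1)] by (intro E_diff) simp_all
    have "bd (\<zeta> (Suc k)) = bd (del u)" using zz k u(2) by (auto simp: zigzag_def bd_del)
    then have "bd (\<zeta> (Suc k) - del u) = 0" by (simp add: bd_diff)
    moreover have "Suc p + k < J" using Suc J by simp
    ultimately obtain u' where "E J (Suc (Suc p + k)) (Suc k) u'" "bd u' = \<zeta> (Suc k) - del u"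
      using col_exact[OF Ek] by blast
    moreover from this have "\<zeta> (Suc k) = bd u' + del u" by simp
    moreover have "del (\<zeta> (Suc k)) = del (bd u')"
      unfolding \<open>\<zeta> (Suc k) = bd u' + del u\<close> del_add del_del by (rule add_0_right)
    moreover have "Suc p + Suc k = Suc (Suc p + k)" by simp
    ultimately show ?case by metis
  qed
  obtain u where u: "E J (Suc p + q) q u" "del (\<zeta> q) = del (bd u)" using claim by blast
  have EJ: "E J J (Suc q) (\<zeta> (Suc q) - del u)"
    using zz E_del[OF u(1)] J by (intro E_diff) (auto simp: zigzag_def)
  have "bd (\<zeta> (Suc q)) = bd (del u)" using zz u(2) by (auto simp: zigzag_def bd_del)
  then have "bd (\<zeta> (Suc q) - del u) = 0" "del (\<zeta> (Suc q) - del u) = 0"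
    using d0 by (simp_all add: bd_diff del_diff del_del)
  then obtain w where "E J J q w" "del w = \<zeta> (Suc q) - del u" using top_exact[OF EJ] J by auto
  then show ?thesis using u(1) J by (intro exI[of _ "w + u"]) (auto simp: del_add intro!: E_add)
qed

text \<open>The columns extend the zigzag up to Koszul degree J. There the coboundary of the last
  entry lies in the kernels and is removed by a correction in the kernels, available because p > 0
  means q < J. For q = 0 the correction is zero, so the start remains \<phi>.\<close>

lemma zigzag_lift:
  assumes E0: "E J p 0 \<phi>" and b0: "bd \<phi> = 0" and p: "0 < p" "p + q = J"
  shows "\<exists>\<zeta>. zigzag J p q \<zeta> \<and> \<zeta> 0 = \<phi> \<and> del (\<zeta> q) = 0"
proof -
  have claim: "\<exists>\<zeta>. zigzag J p k \<zeta> \<and> \<zeta> 0 = \<phi> \<and> bd (del (\<zeta> k)) = 0" if "k \<le> q" for k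
    using that
  proof (induction k)
    case 0
    then show ?case using E0 b0 by (intro exI[of _ "\<lambda>_. \<phi>"]) (auto simp: zigzag_def bd_del del_0)
  next
    case (Suc k)
    then obtain \<zeta> where z: "zigzag J p k \<zeta>" "\<zeta> 0 = \<phi>" "bd (del (\<zeta> k)) = 0"
      using Suc_leD by blast
    have "E J (p + k) (Suc k) (del (\<zeta> k))" using z(1) by (auto simp: zigzag_def intro!: E_del)
    then obtain w where w: "E J (Suc (p + k)) (Suc k) w" "bd w = del (\<zeta> k)"
      using col_exact[OF _ _ z(3)] Suc p by fastforce
    have "zigzag J p (Suc k) (\<zeta>(Suc k := w))"
      using z(1) w unfolding zigzag_def by (auto simp: le_Suc_eq less_Suc_eq)
    moreover have "bd (del ((\<zeta>(Suc k := w)) (Suc k))) = 0"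
      unfolding fun_upd_same bd_del w(2) by (rule del_del)
    moreover have "(\<zeta>(Suc k := w)) 0 = \<phi>" using z(2) by simp
    ultimately show ?case by blast
  qed
  obtain \<zeta> where z: "zigzag J p q \<zeta>" "\<zeta> 0 = \<phi>" "bd (del (\<zeta> q)) = 0" using claim by blast
  have "E J J (Suc q) (del (\<zeta> q))" using z(1) p(2) E_del by (auto simp: zigzag_def)
  then obtain \<psi> where g: "E J J q \<psi>" "bd \<psi> = 0" "del \<psi> = del (\<zeta> q)" "q = 0 \<longrightarrow> \<psi> = 0"
  proof -
    have "q < J" using p by simp
    then show thesis using top_exact[OF \<open>E J J (Suc q) (del (\<zeta> q))\<close> _ z(3) del_del] that by blast
  qed
  let ?\<zeta> = "\<zeta>(q := \<zeta> q - \<psi>)"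
  have "E J J q (\<zeta> q - \<psi>)" using z(1) g(1) p(2) E_diff by (auto simp: zigzag_def)
  then have "zigzag J p q ?\<zeta>"
    using z(1) g(2) p(2) unfolding zigzag_def by (auto simp: bd_diff)
  moreover have "?\<zeta> 0 = \<phi>" using z(2) g(4) by auto
  ultimately show ?thesis using g(3) by (intro exI[of _ ?\<zeta>]) (simp add: del_diff)
qed

text \<open>The zigzag is built from its end, alternating the Koszul differential with the homotopy
  of the rows.\<close>

lemma zigzag_exists:
  assumes x: "E J J q x" and d0: "del x = 0" and p: "p + q = J"
  shows "\<exists>\<zeta>. zigzag J p q \<zeta> \<and> \<zeta> q = x"
proof -
  \<comment> \<open>The index k counts steps down from the end, so \<open>\<eta> k\<close> has
    Koszul degree J - k and lives on chains with q - k elements.\<close>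
  define \<eta> where "\<eta> = (\<lambda>k. ((\<lambda>\<phi>. cone (bd \<phi>)) ^^ k) x)"
  have \<eta>: "k \<le> q \<Longrightarrow> E J (J - k) (q - k) (\<eta> k) \<and> bd (del (\<eta> k)) = 0 \<and> (k < q \<longrightarrow> del (\<eta> (Suc k)) = bd (\<eta> k))" for k
  proof (induction k)
    have step: "E J (J - Suc k) (q - Suc k) (\<eta> (Suc k)) \<and> del (\<eta> (Suc k)) = bd (\<eta> k)"
      if k: "k < q" and E: "E J (J - k) (q - k) (\<eta> k)" and z: "bd (del (\<eta> k)) = 0" for k
    proof -
      have "E J (J - Suc k) (q - k) (bd (\<eta> k))" using E_bd[of J "J - Suc k"] E k p by (simp add: Suc_diff_Suc)
      then have "E J (J - Suc k) (Suc (q - Suc k)) (bd (\<eta> k))" using k by (simp add: Suc_diff_Suc)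
      moreover have "del (bd (\<eta> k)) = 0" using z by (simp add: bd_del)
      ultimately show ?thesis using row_exact[of J "J - Suc k" "q - Suc k" "bd (\<eta> k)"] k p by (simp add: \<eta>_def)
    qed
    {
      case 0
      have "E J (J - 0) (q - 0) (\<eta> 0)" "bd (del (\<eta> 0)) = 0" using x d0 bd_0 by (simp_all add: \<eta>_def)
      then show ?case using step[of 0] by auto
    next
      case (Suc k)
      then have IH: "E J (J - k) (q - k) (\<eta> k)" "bd (del (\<eta> k)) = 0" "del (\<eta> (Suc k)) = bd (\<eta> k)"
        by (meson Suc_leD Suc_le_lessD)+
      have E1: "E J (J - Suc k) (q - Suc k) (\<eta> (Suc k))" using step[of k] Suc.prems IH by auto
      have "bd (del (\<eta> (Suc k))) = 0" unfolding IH(3) by (rule bd_bd[OF IH(1)])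
      then show ?case using E1 step[of "Suc k"] by auto
    }
  qed
  have "zigzag J p q (\<lambda>k. \<eta> (q - k))"
    unfolding zigzag_def
  proof (intro conjI allI impI)
    fix k assume "k \<le> q"
    then show "E J (p + k) k (\<eta> (q - k))" using \<eta>[of "q - k"] p by (auto simp: algebra_simps)
  next
    fix k assume k: "k < q"
    then have "Suc (q - Suc k) = q - k" by simp
    then show "del (\<eta> (q - k)) = bd (\<eta> (q - Suc k))" using \<eta>[of "q - Suc k"] k by auto
  qed
  then show ?thesis by (intro exI[of _ "\<lambda>k. \<eta> (q - k)"]) (simp add: \<eta>_def)
qed

text \<open>Multiplied by \<open>x\<^sub>v\<close>, a zigzag moves up one degree, where also its top row is exact.\<close>

lemma zigzag_mul:
  assumes zz: "zigzag J 0 J \<zeta>" and d0: "del (\<zeta> J) = 0"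
  shows "\<exists>u. E (Suc J) (Suc 0) 0 u \<and> mul v (\<zeta> 0) = bd u"
proof (rule zigzag_boundary)
  show "zigzag (Suc J) 0 J (\<lambda>k. mul v (\<zeta> k))"
    using zz by (auto simp: zigzag_def mul_bd simp flip: mul_del intro!: E_mul)
  have E: "E (Suc J) J J (mul v (\<zeta> J))" using zz by (auto simp: zigzag_def intro!: E_mul)
  have "mul v 0 = 0" by (intro ext) (auto simp: mul_def split: option.split)
  then have d: "del (mul v (\<zeta> J)) = 0" using d0 mul_del by metis
  show "J = 0 \<and> mul v (\<zeta> 0) = 0 \<or> (\<exists>q' w. J = Suc q' \<and> E (Suc J) (0 + J) q' w \<and> mul v (\<zeta> J) = del w)"
  proof (cases J)
    case 0
    then show ?thesis using row_exact_0[of "Suc J" J "mul v (\<zeta> J)"] E d by simp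
  next
    case (Suc q)
    then show ?thesis using row_exact[of "Suc J" J q "mul v (\<zeta> J)"] E d by auto
  qed
qed simp

end

section \<open>Cocycles and Betti numbers\<close>

interpretation fieldvs: vector_space "(*) :: 'k::field \<Rightarrow> 'k \<Rightarrow> 'k"
  by unfold_locales (auto simp: algebra_simps)

declare fieldvs.scale_scale [simp del]

lemma lookup_chain_scale: "Poly_Mapping.lookup (chain_scale a c) F = a * Poly_Mapping.lookup c F"
  by (simp add: chain_scale_def Poly_Mapping.map.rep_eq when_def)

interpretation cs: vector_space chain_scale
  by unfold_locales
    (rule poly_mapping_eqI, simp add: lookup_chain_scale lookup_add distrib_left distrib_right mult.assoc)+

interpretation cs_f: vector_space_pair chain_scale "(*) :: 'k::field \<Rightarrow> 'k \<Rightarrow> 'k" ..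

declare fieldvs.scale_scale [simp del]

interpretation cs_cs: vector_space_pair chain_scale chain_scale ..

text \<open>The pairing of a cochain with a chain.\<close>

definition pr :: "('b \<Rightarrow> 'k::field) \<Rightarrow> ('b \<Rightarrow>\<^sub>0 'k) \<Rightarrow> 'k" where
  "pr y c = (\<Sum>F\<in>Poly_Mapping.keys c. y F * Poly_Mapping.lookup c F)"

lemma pr_superset:
  assumes "finite A" "Poly_Mapping.keys c \<subseteq> A"
  shows "pr y c = (\<Sum>F\<in>A. y F * Poly_Mapping.lookup c F)"
  unfolding pr_def using assms by (intro sum.mono_neutral_left) (auto simp: in_keys_iff)

lemma pr_linear: 
  fixes y :: "'b \<Rightarrow> 'k::field"
  shows "Vector_Spaces.linear chain_scale (*) (pr y)"
proof unfold_locales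
  fix b1 b2 :: "'b \<Rightarrow>\<^sub>0 'k"
  let ?A = "Poly_Mapping.keys b1 \<union> Poly_Mapping.keys b2"
  have "Poly_Mapping.keys (b1 + b2) \<subseteq> ?A" by (rule Poly_Mapping.keys_add)
  then show "pr y (b1 + b2) = pr y b1 + pr y b2"
    by (simp add: pr_superset[of ?A] lookup_add distrib_left sum.distrib)
next
  fix r and b :: "'b \<Rightarrow>\<^sub>0 'k"
  have "Poly_Mapping.keys (chain_scale r b) \<subseteq> Poly_Mapping.keys b"
    by (auto simp: in_keys_iff lookup_chain_scale)
  then show "pr y (chain_scale r b) = r * pr y b"
    by (simp add: pr_superset[of "Poly_Mapping.keys b"] lookup_chain_scale sum_distrib_left mult_ac)
qed

lemma pr_single: "pr y (Poly_Mapping.single F a) = y F * a"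
  by (cases "a = 0") (auto simp: pr_def)

lemma pr_diff: "pr (y - y') c = pr y c - pr y' c"
  by (simp add: pr_def left_diff_distrib sum_subtractf)

lemma pr_cong: "(\<And>F. F \<in> Poly_Mapping.keys c \<Longrightarrow> y F = y' F) \<Longrightarrow> pr y c = pr y' c"
  by (simp add: pr_def)

lemma chain_as_sum:
  "c = (\<Sum>F\<in>Poly_Mapping.keys c. chain_scale (Poly_Mapping.lookup c F) (Poly_Mapping.single F 1))"
  by (rule poly_mapping_eqI) (auto simp: lookup_sum lookup_chain_scale lookup_single when_def in_keys_iff if_distrib sum.If_cases cong: if_cong)

lemma linear_eq_pr:
  assumes "Vector_Spaces.linear chain_scale (*) g"
  shows "g c = pr (\<lambda>F. g (Poly_Mapping.single F 1)) c"
proof -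
  interpret g: Vector_Spaces.linear chain_scale "(*)" g by fact
  have "g c = g (\<Sum>F\<in>Poly_Mapping.keys c. chain_scale (Poly_Mapping.lookup c F) (Poly_Mapping.single F 1))"
    using chain_as_sum[of c] by simp
  also have "\<dots> = pr (\<lambda>F. g (Poly_Mapping.single F 1)) c"
    by (simp add: g.sum g.scale pr_def mult.commute)
  finally show ?thesis .
qed

text \<open>The signs of \<open>cobd\<close> are those of \<open>boundary_map\<close>, so the two
  are adjoint under the pairing. This is the bridge from homological Betti numbers to
  cocycles.\<close>

lemma pr_boundary: "pr y (boundary_map c) = pr (cobd y) c"
proof -
  interpret g: Vector_Spaces.linear chain_scale "(*)" "pr y" by (rule pr_linear)
  show ?thesis
    unfolding boundary_map_def g.sum pr_single pr_def[of "cobd y"] cobd_def sum_distrib_right sg_def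
    by (intro sum.cong) (auto simp: mult_ac)
qed

lemma lookup_eq_pr: "Poly_Mapping.lookup c G = pr (\<lambda>F. if F = G then 1 else 0) c"
proof -
  have "pr (\<lambda>F. if F = G then 1 else 0) c
      = (\<Sum>F\<in>Poly_Mapping.keys c. if F = G then Poly_Mapping.lookup c G else 0)"
    unfolding pr_def by (rule sum.cong) auto
  then show ?thesis by (simp add: in_keys_iff)
qed

text \<open>The defining sum runs over the support of its argument, which is not additive; each
  coordinate of the result, however, is a pairing with a fixed cochain and hence linear.\<close>

lemma boundary_linear:
  "Vector_Spaces.linear chain_scale chain_scale (boundary_map :: ('a::order set \<Rightarrow>\<^sub>0 'b::field) \<Rightarrow> _)"
proof unfold_locales
  fix b1 b2 :: "'a set \<Rightarrow>\<^sub>0 'b"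
  show "boundary_map (b1 + b2) = boundary_map b1 + boundary_map b2"
  proof (rule poly_mapping_eqI)
    fix G
    show "Poly_Mapping.lookup (boundary_map (b1 + b2)) G = Poly_Mapping.lookup (boundary_map b1 + boundary_map b2) G"
      unfolding lookup_add lookup_eq_pr[of "boundary_map _"] pr_boundary by (rule cs_f.linear_add[OF pr_linear])
  qed
next
  fix r and b :: "'a set \<Rightarrow>\<^sub>0 'b"
  show "boundary_map (chain_scale r b) = chain_scale r (boundary_map b)"
  proof (rule poly_mapping_eqI)
    fix G
    show "Poly_Mapping.lookup (boundary_map (chain_scale r b)) G = Poly_Mapping.lookup (chain_scale r (boundary_map b)) G"
      unfolding lookup_chain_scale lookup_eq_pr[of "boundary_map _"] pr_boundary by (rule cs_f.linear_scale[OF pr_linear])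
  qed
qed

text \<open>Cohomology classes are produced as the functionals dual to a basis of the cycles modulo the
  boundaries, since the Betti numbers are defined by homology.\<close>

lemma betti_cocycles:
  fixes K :: "'a::order set set" and q :: nat
  assumes finK: "finite K" and finF: "\<And>F. F \<in> K \<Longrightarrow> finite F"
    and down: "\<And>F G. F \<in> K \<Longrightarrow> G \<subseteq> F \<Longrightarrow> G \<in> K"
    and ch: "\<And>F. F \<in> K \<Longrightarrow> Complete_Partial_Order.chain (\<le>) F"
  defines "N \<equiv> betti TYPE('k::field) K (int q - 1)"
  shows "\<exists>x :: nat \<Rightarrow> 'a set \<Rightarrow> 'k. 
    (\<forall>l c. x l c \<noteq> 0 \<longrightarrow> c \<in> K \<and> card c = q) \<and>
    (\<forall>l<N. \<forall>c\<in>K. cobd (x l) c = 0) \<and>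
    (\<forall>f w. (\<forall>c\<in>K. card c = q \<longrightarrow> (\<Sum>l<N. f l * x l c) = cobd w c) \<longrightarrow> (\<forall>l<N. f l = 0)) \<and>
    (\<forall>y. (\<forall>c\<in>K. card c = Suc q \<longrightarrow> cobd y c = 0) \<longrightarrow>
       (\<exists>f w. \<forall>c\<in>K. card c = q \<longrightarrow> y c = (\<Sum>l<N. f l * x l c) + cobd w c))"
proof -
  let ?sg = "\<lambda>F :: 'a set. Poly_Mapping.single F (1 :: 'k)"
  define C where "C = (\<lambda>q. chain_space TYPE('k) K (int q - 1))"
  have C_iff: "c \<in> C n \<longleftrightarrow> (\<forall>F\<in>Poly_Mapping.keys c. F \<in> K \<and> card F = n)" for c n
    by (auto simp: C_def chain_space_def)
  define Z where "Z = cycle_space TYPE('k) K (int q - 1)"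
  define B where "B = boundary_space TYPE('k) K (int q - 1)"
  have Z_iff: "c \<in> Z \<longleftrightarrow> c \<in> C q \<and> boundary_map c = 0" for c by (simp add: Z_def cycle_space_def C_def)
  have B_eq: "B = boundary_map ` C (Suc q)" by (simp add: B_def boundary_space_def C_def)
  interpret bl: Vector_Spaces.linear chain_scale chain_scale "boundary_map :: ('a set \<Rightarrow>\<^sub>0 'k) \<Rightarrow> _"
    by (rule boundary_linear)
  have subC: "cs.subspace (C n)" for n
  proof (rule cs.subspaceI)
    show "0 \<in> C n" by (simp add: C_iff)
    show "x + y \<in> C n" if "x \<in> C n" "y \<in> C n" for x y
      using that Poly_Mapping.keys_add[of x y] unfolding C_iff by blast
    show "chain_scale c x \<in> C n" if "x \<in> C n" for c x
      using that unfolding C_iff by (auto simp: in_keys_iff lookup_chain_scale)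
  qed
  have singC: "?sg F \<in> C n" if "F \<in> K" "card F = n" for F n using that by (simp add: C_iff)
  have subZ: "cs.subspace Z"
    by (rule cs.subspaceI) (auto simp only: Z_iff add_0_left cs.scale_zero_right bl.zero bl.add bl.scale cs.subspace_0[OF subC]
        intro: cs.subspace_add[OF subC] cs.subspace_scale[OF subC])
  have subB: "cs.subspace B" unfolding B_eq using bl.subspace_image[OF subC] .
  have bC: "boundary_map c \<in> C n" if "c \<in> C (Suc n)" for c n
  proof -
    have "F - {v} \<in> K \<and> card (F - {v}) = n" if "F \<in> Poly_Mapping.keys c" "v \<in> F" for F v
      using \<open>c \<in> C (Suc n)\<close> that down finF unfolding C_iff by auto
    then have "Poly_Mapping.single (F - {v}) a \<in> C n" if "F \<in> Poly_Mapping.keys c" "v \<in> F" for F v a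
      using that unfolding C_iff by simp
    then show ?thesis unfolding boundary_map_def
      by (intro cs.subspace_sum[OF subC])
  qed
  have bb: "boundary_map (boundary_map c) = 0" if "c \<in> C n" for c n
  proof (rule poly_mapping_eqI)
    fix G
    have "pr (cobd (cobd y)) c = 0" for y
      unfolding pr_def using that cobd_cobd[OF finF ch] by (intro sum.neutral) (auto simp: C_iff)
    then show "Poly_Mapping.lookup (boundary_map (boundary_map c)) G = Poly_Mapping.lookup 0 G"
      by (simp only: lookup_eq_pr[of "boundary_map _"] pr_boundary lookup_zero)
  qed
  have BZ: "B \<subseteq> Z" unfolding B_eq using bC bb by (auto simp: Z_iff)
  let ?S = "?sg ` {F \<in> K. card F = q}"
  have finS: "finite ?S" using finK by simp
  have CS: "C q \<subseteq> cs.span ?S"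
  proof
    fix c assume c: "c \<in> C q"
    have "(\<Sum>F\<in>Poly_Mapping.keys c. chain_scale (Poly_Mapping.lookup c F) (?sg F)) \<in> cs.span ?S"
      using c by (intro cs.span_sum cs.span_scale cs.span_base) (auto simp: C_iff)
    then show "c \<in> cs.span ?S" using chain_as_sum[of c] by simp
  qed
  obtain bB where bB: "bB \<subseteq> B" "cs.independent bB" "B \<subseteq> cs.span bB" "card bB = cs.dim B"
    by (rule cs.basis_exists)
  obtain bZ where bZ: "bB \<subseteq> bZ" "bZ \<subseteq> Z" "cs.independent bZ" "Z \<subseteq> cs.span bZ"
    using cs.maximal_independent_subset_extend[OF order_trans[OF bB(1) BZ] bB(2)] by metis
  have ZC: "Z \<subseteq> C q" by (auto simp: Z_iff)
  have finZ: "finite bZ"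
    using cs.independent_span_bound[OF finS bZ(3)] bZ(2) ZC CS by blast
  have "cs.dim Z = card bZ" "cs.dim B = card bB"
    using cs.basis_card_eq_dim[OF bZ(2,4,3)] bB(4) by simp_all
  \<comment> \<open>A basis of the boundaries is extended to one of the cycles; the added vectors
    represent a basis of homology.\<close>
  then have N: "N = card (bZ - bB)"
    unfolding N_def betti_def Z_def[symmetric] B_def[symmetric]
    using card_Diff_subset[of bB bZ] finite_subset[OF bZ(1) finZ] bZ(1) by simp
  obtain e where e: "bij_betw e {..<N} (bZ - bB)"
    using ex_bij_betw_nat_finite[of "bZ - bB"] finZ N by (auto simp: atLeast0LessThan)
  have eZ: "e l \<in> bZ" "e l \<notin> bB" if "l < N" for l using e that by (auto simp: bij_betw_def)
  have einj: "e l = e k \<longleftrightarrow> l = k" if "l < N" "k < N" for l k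
    using e that by (auto simp: bij_betw_def inj_on_def)
  have "\<exists>g. Vector_Spaces.linear chain_scale (*) g \<and> (\<forall>b\<in>bZ. g b = (if b = e l then 1 else (0::'k)))" for l
    by (rule cs_f.linear_independent_extend[OF bZ(3)])
  then obtain g where g: "\<And>l. Vector_Spaces.linear chain_scale (*) (g l)"
    "\<And>l b. b \<in> bZ \<Longrightarrow> g l b = (if b = e l then 1 else (0::'k))" by metis
  define x where "x = (\<lambda>l F. if F \<in> K \<and> card F = q then g l (?sg F) else 0)"
  have xg: "pr (x l) c = g l c" if "c \<in> C q" for l c
    unfolding linear_eq_pr[OF g(1), of l c] using that by (intro pr_cong) (auto simp: C_iff x_def)
  \<comment> \<open>The dual functionals vanish on boundaries, which by adjointness makes the
    cochains \<open>x l\<close> closed.\<close>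
  have gB: "g l b = 0" if "b \<in> B" "l < N" for b l
  proof -
    have "b \<in> cs.span bB" using that bB(3) by blast
    moreover have "g l b' = 0" if "b' \<in> bB" for b' using g(2)[of b' l] that bZ(1) eZ[OF \<open>l < N\<close>] by auto
    ultimately show ?thesis by (rule cs_f.linear_eq_0_on_span[OF g(1), rotated])
  qed
  have cob_pr: "cobd y F = pr y (boundary_map (?sg F))" for y :: "'a set \<Rightarrow> 'k" and F
    by (simp add: pr_boundary pr_single)
  have 1: "x l c \<noteq> 0 \<longrightarrow> c \<in> K \<and> card c = q" for l c by (auto simp: x_def)
  have 2: "cobd (x l) c = 0" if l: "l < N" and c: "c \<in> K" for l c
  proof (cases "card c = Suc q")
    case True
    have s: "?sg c \<in> C (Suc q)" using singC c True by blast
    then have "boundary_map (?sg c) \<in> B" by (simp add: B_eq)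
    then show ?thesis unfolding cob_pr using gB l xg[OF bC[OF s]] by simp
  next
    case False
    have "x l (c - {\<tau>}) = 0" if "\<tau> \<in> c" for \<tau>
    proof -
      have "Suc (card (c - {\<tau>})) = card c" using that finF[OF c] by (metis card.remove)
      then show ?thesis using False by (auto simp: x_def)
    qed
    then show ?thesis by (simp add: cobd_def)
  qed
  have prsum: "pr (\<lambda>c. \<Sum>l<N. f l * x l c) c = (\<Sum>l<N. f l * pr (x l) c)" for f c
    unfolding pr_def sum_distrib_left sum_distrib_right
    by (subst sum.swap) (simp add: mult_ac)
  have eC: "e k \<in> C q" "boundary_map (e k) = 0" if "k < N" for k
    using eZ[OF that] bZ(2) by (auto simp: Z_iff)
  have 3: "f k = 0" if k: "k < N" and eq: "\<forall>c\<in>K. card c = q \<longrightarrow> (\<Sum>l<N. f l * x l c) = cobd w c" for f w k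
  proof -
    have "pr (\<lambda>c. \<Sum>l<N. f l * x l c) (e k) = pr (cobd w) (e k)"
      using eC(1)[OF k] eq by (intro pr_cong) (auto simp: C_iff)
    also have "\<dots> = 0" unfolding pr_boundary[symmetric] eC(2)[OF k] by (simp add: pr_def)
    finally have "(\<Sum>l<N. f l * g l (e k)) = 0" unfolding prsum using xg[OF eC(1)[OF k]] by simp
    moreover have "f l * g l (e k) = (if l = k then f k else 0)" if "l < N" for l
      using g(2)[OF eZ(1)[OF k], of l] einj[OF that k] by auto
    ultimately show ?thesis using k by simp
  qed
  have 4: "\<exists>f w. \<forall>c\<in>K. card c = q \<longrightarrow> y c = (\<Sum>l<N. f l * x l c) + cobd w c"
    if y: "\<forall>c\<in>K. card c = Suc q \<longrightarrow> cobd y c = 0" for y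
  proof -
    define f where "f = (\<lambda>l. pr y (e l))"
    \<comment> \<open>The coefficients f are the values of y on the homology basis, so the
      difference vanishes on all cycles.\<close>
    define y' where "y' = y - (\<lambda>c. \<Sum>l<N. f l * x l c)"
    have y'pr: "pr y' c = pr y c - (\<Sum>l<N. f l * g l c)" if "c \<in> C q" for c
      unfolding y'_def pr_diff prsum using xg[OF that] by simp
    have y'0: "pr y' c = 0" if "c \<in> Z" for c
    proof -
      have "pr y' b = 0" if b: "b \<in> bZ" for b
      proof (cases "b \<in> bB")
        case True
        then obtain c' where c': "c' \<in> C (Suc q)" "b = boundary_map c'" using bB(1) B_eq by auto
        have "pr (cobd y) c' = 0" unfolding pr_def using c'(1) y by (intro sum.neutral) (auto simp: C_iff)
        then have "pr y b = 0" by (simp add: c'(2) pr_boundary)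
        moreover have "g l b = 0" if "l < N" for l using gB that True bB(1) by blast
        ultimately show ?thesis using y'pr[of b] b bZ(2) ZC by auto
      next
        case False
        then obtain k where k: "k < N" "b = e k" using e b by (auto simp: bij_betw_def)
        have "f l * g l b = (if l = k then f k else 0)" if "l < N" for l
          using g(2)[OF b, of l] einj[OF that k(1)] k(2) by auto
        then have "(\<Sum>l<N. f l * g l b) = f k" using k(1) by simp
        then show ?thesis using y'pr[of b] b bZ(2) ZC k(2) by (auto simp: f_def)
      qed
      then show ?thesis using cs_f.linear_eq_0_on_span[OF pr_linear] that bZ(4) by blast
    qed
    \<comment> \<open>A functional that vanishes on cycles factors through the boundary map.
      Composing it with a linear section of that map gives the primitive w.\<close>
    obtain g0 where g0: "range g0 \<subseteq> C q" "Vector_Spaces.linear chain_scale chain_scale g0"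
      "\<And>v. v \<in> boundary_map ` C q \<Longrightarrow> boundary_map (g0 v) = v"
      using cs_cs.linear_exists_right_inverse_on[OF boundary_linear subC[of q]] by blast
    have hl: "Vector_Spaces.linear chain_scale (*) (\<lambda>c. pr y' (g0 c))"
    proof unfold_locales
      fix b1 b2 show "pr y' (g0 (b1 + b2)) = pr y' (g0 b1) + pr y' (g0 b2)"
        by (simp add: cs_cs.linear_add[OF g0(2)] cs_f.linear_add[OF pr_linear])
    next
      fix r b show "pr y' (g0 (chain_scale r b)) = r * pr y' (g0 b)"
        by (simp add: cs_cs.linear_scale[OF g0(2)] cs_f.linear_scale[OF pr_linear])
    qed
    define w where "w = (\<lambda>G. pr y' (g0 (?sg G)))"
    have "y c = (\<Sum>l<N. f l * x l c) + cobd w c" if c: "c \<in> K" "card c = q" for c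
    proof -
      let ?s = "?sg c" and ?t = "g0 (boundary_map (?sg c))"
      have sC: "?s \<in> C q" using singC c by blast
      have tC: "?t \<in> C q" using g0(1) by auto
      have "boundary_map ?t = boundary_map ?s" using g0(3) sC by blast
      then have "?s - ?t \<in> Z" using cs.subspace_diff[OF subC sC tC] by (simp add: Z_iff bl.diff)
      then have "pr y' ?s = pr y' ?t" using y'0 cs_f.linear_diff[OF pr_linear, of y' ?s ?t] by simp
      also have "\<dots> = pr w (boundary_map ?s)" unfolding w_def using linear_eq_pr[OF hl] .
      also have "\<dots> = cobd w c" by (simp add: cob_pr)
      finally have "y' c = cobd w c" by (simp add: pr_single)
      then show ?thesis by (simp add: y'_def fun_diff_def diff_eq_eq add.commute)
    qed
    then show ?thesis by blast
  qed
  show ?thesis using 1 2 3 4 by (intro exI[of _ x]) blast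
qed

section \<open>The h-vector and monomial counts\<close>

definition face_count :: "'v set \<Rightarrow> nat \<Rightarrow> nat" where
  "face_count A t = card {m :: 'v \<Rightarrow>\<^sub>0 nat. mkeys m = A \<and> mdeg m = t}"

lemma finite_monomials:
  assumes "finite A" shows "finite {m :: 'v \<Rightarrow>\<^sub>0 nat. mkeys m \<subseteq> A \<and> mdeg m = t}"
proof -
  let ?M = "{m :: 'v \<Rightarrow>\<^sub>0 nat. mkeys m \<subseteq> A \<and> mdeg m = t}"
  have "Poly_Mapping.lookup ` ?M \<subseteq> {f. \<forall>x. (x \<in> A \<longrightarrow> f x \<in> {..t}) \<and> (x \<notin> A \<longrightarrow> f x = 0)}"
  proof
    fix f assume "f \<in> Poly_Mapping.lookup ` ?M"
    then obtain m where m: "m \<in> ?M" "f = Poly_Mapping.lookup m" by auto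
    have "f x \<le> t" if "x \<in> A" for x
      using m member_le_sum[OF that, of "Poly_Mapping.lookup m"] assms mdeg_superset[OF assms, of m] by auto
    moreover have "f x = 0" if "x \<notin> A" for x using m that by (auto simp: in_keys_iff)
    ultimately show "f \<in> {f. \<forall>x. (x \<in> A \<longrightarrow> f x \<in> {..t}) \<and> (x \<notin> A \<longrightarrow> f x = 0)}" by auto
  qed
  then have "finite (Poly_Mapping.lookup ` ?M)"
    by (rule finite_subset) (rule finite_set_of_finite_funs, use assms in auto)
  moreover have "inj_on Poly_Mapping.lookup ?M" by (auto simp: inj_on_def intro: poly_mapping_eqI)
  ultimately show ?thesis by (rule finite_imageD)
qed

lemma face_count_empty: "face_count {} t = (if t = 0 then 1 else 0)"
proof -
  have "{m :: 'a \<Rightarrow>\<^sub>0 nat. mkeys m = {} \<and> mdeg m = t} = (if t = 0 then {0} else {})"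
    by (auto simp: mdeg_def)
  then show ?thesis by (simp add: face_count_def)
qed

lemma face_count_insert_0: "face_count (insert v A) 0 = 0"
proof -
  have "{m :: 'a \<Rightarrow>\<^sub>0 nat. mkeys m = insert v A \<and> mdeg m = 0} = {}" by (auto simp: mdeg_eq_0)
  then show ?thesis by (simp only: face_count_def card.empty)
qed

text \<open>Division by x_v either keeps v in the support or removes it.\<close>

lemma face_count_insert_Suc:
  assumes A: "finite A" "v \<notin> A"
  shows "face_count (insert v A) (Suc t) = face_count (insert v A) t + face_count A t"
proof -
  let ?M = "\<lambda>A t. {m :: 'a \<Rightarrow>\<^sub>0 nat. mkeys m = A \<and> mdeg m = t}"
  have fin: "finite (?M B s)" if "finite B" for B s
    by (rule finite_subset[OF _ finite_monomials[OF that, of s]]) auto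
  let ?f = "\<lambda>m. m + esingle v"
  have inj: "inj_on ?f X" for X by (simp add: inj_on_def)
  have "?M (insert v A) (Suc t) = ?f ` ?M (insert v A) t \<union> ?f ` ?M A t"
  proof
    show "?f ` ?M (insert v A) t \<union> ?f ` ?M A t \<subseteq> ?M (insert v A) (Suc t)"
    proof
      fix m' assume "m' \<in> ?f ` ?M (insert v A) t \<union> ?f ` ?M A t"
      then show "m' \<in> ?M (insert v A) (Suc t)"
        by (elim UnE imageE) (simp_all add: keys_plus_nat mdeg_plus mdeg_single)
    qed
    show "?M (insert v A) (Suc t) \<subseteq> ?f ` ?M (insert v A) t \<union> ?f ` ?M A t"
    proof
      fix m assume m: "m \<in> ?M (insert v A) (Suc t)"
      then have v: "v \<in> mkeys m" by auto
      have e: "m = ?f (m - esingle v)" using minus_esingle_plus[OF v] by simp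
      have dg: "mdeg (m - esingle v) = t" using mdeg_minus_esingle[OF v] m by simp
      have "mkeys m = mkeys (m - esingle v) \<union> {v}" using keys_plus_nat[of "m - esingle v" "esingle v"] e by simp
      then have k: "mkeys (m - esingle v) \<union> {v} = insert v A" using m by simp
      have "mkeys (m - esingle v) = insert v A \<or> mkeys (m - esingle v) = A"
        using A(2) k[THEN equalityD1] k[THEN equalityD2] by (cases "v \<in> mkeys (m - esingle v)") blast+
      then have mem: "m - esingle v \<in> ?M (insert v A) t \<union> ?M A t" using dg by simp
      have "?f (m - esingle v) \<in> ?f ` (?M (insert v A) t \<union> ?M A t)" by (rule imageI[OF mem])
      then show "m \<in> ?f ` ?M (insert v A) t \<union> ?f ` ?M A t" unfolding image_Un minus_esingle_plus[OF v] .
    qed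
  qed
  moreover have "?f ` ?M (insert v A) t \<inter> ?f ` ?M A t = {}"
  proof -
    have "insert v A \<noteq> A" using A(2) by blast
    have "?M (insert v A) t \<inter> ?M A t = {}"
    proof (rule equals0I)
      fix m assume "m \<in> ?M (insert v A) t \<inter> ?M A t"
      then have "mkeys m = insert v A" "mkeys m = A" by blast+
      then have "insert v A = A" by (rule trans[OF sym])
      with \<open>insert v A \<noteq> A\<close> show False by contradiction
    qed
    then show ?thesis unfolding image_Int[OF inj[of UNIV], symmetric] by simp
  qed
  ultimately show ?thesis unfolding face_count_def
    using A(1) fin by (simp add: card_Un_disjoint card_image[OF inj])
qed

text \<open>The generating function of monomials with full support is a product of card A geometric
  series X/(1 - X), here with denominators cleared.\<close>

lemma face_count_fps:
  assumes "finite A"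
  shows "(1 - fps_X) ^ card A * Abs_fps (\<lambda>t. int (face_count A t)) = fps_X ^ card A"
  using assms
proof (induction A rule: finite_induct)
  case empty
  have "Abs_fps (\<lambda>t. int (face_count {} t)) = 1" by (rule fps_ext) (simp add: face_count_empty)
  then show ?case by simp
next
  case (insert v A)
  have "(1 - fps_X) * Abs_fps (\<lambda>t. int (face_count (insert v A) t)) = fps_X * Abs_fps (\<lambda>t. int (face_count A t))"
  proof (rule fps_ext)
    fix n show "fps_nth ((1 - fps_X) * Abs_fps (\<lambda>t. int (face_count (insert v A) t))) n = fps_nth (fps_X * Abs_fps (\<lambda>t. int (face_count A t))) n"
      by (cases n) (simp_all add: left_diff_distrib face_count_insert_0 face_count_insert_Suc insert.hyps)
  qed
  then have "(1 - fps_X) ^ Suc (card A) * Abs_fps (\<lambda>t. int (face_count (insert v A) t))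
      = fps_X * ((1 - fps_X) ^ card A * Abs_fps (\<lambda>t. int (face_count A t)))"
    by (simp only: power_Suc2 mult.assoc mult.left_commute)
  then show ?case using insert by simp
qed

lemma fps_one_minus_X_power: "fps_nth ((1 - fps_X) ^ n :: int fps) k = (- 1) ^ k * int (n choose k)"
proof (induction n arbitrary: k)
  case 0
  then show ?case by (cases k) auto
next
  case (Suc n)
  have "fps_nth ((1 - fps_X) ^ Suc n :: int fps) k = fps_nth ((1 - fps_X) ^ n - fps_X * (1 - fps_X) ^ n) k"
    by (simp add: left_diff_distrib)
  then show ?case by (cases k) (simp_all add: Suc algebra_simps)
qed

lemma poly_X_minus_1_power: "Polynomial.coeff ([:- 1, 1:] ^ n :: int poly) k = (if k \<le> n then (- 1) ^ (n - k) * int (n choose k) else 0)"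
proof (induction n arbitrary: k)
  case 0
  then show ?case by (cases k) auto
next
  case (Suc n)
  have "([:- 1, 1:] ^ Suc n :: int poly) = pCons 0 ([:- 1, 1:] ^ n) - [:- 1, 1:] ^ n"
    by simp
  then have "Polynomial.coeff ([:- 1, 1:] ^ Suc n :: int poly) k
      = Polynomial.coeff (pCons 0 ([:- 1, 1:] ^ n)) k - Polynomial.coeff ([:- 1, 1:] ^ n :: int poly) k"
    by (simp only: coeff_diff)
  also have "\<dots> = (if k \<le> Suc n then (- 1) ^ (Suc n - k) * int (Suc n choose k) else 0)"
  proof (cases k)
    case 0
    then show ?thesis by (simp add: Suc)
  next
    case (Suc k')
    consider "k' < n" | "k' = n" | "n < k'" by linarith
    then show ?thesis
    proof cases
      case 1
      then have "n - k' = Suc (n - Suc k')" by simp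
      then show ?thesis using 1 by (simp add: Suc Suc.IH algebra_simps)
    qed (simp_all add: Suc Suc.IH)
  qed
  finally show ?case .
qed

context sposet
begin

text \<open>The Hilbert function of the face ring, through its monomial basis.\<close>

definition hilb :: "nat \<Rightarrow> nat" where "hilb t = card {(r, m). mon r m \<and> mdeg m = t}"

lemma finite_mon: "finite {(r, m). mon r m \<and> mdeg m = t}"
proof (rule finite_subset)
  show "{(r, m). mon r m \<and> mdeg m = t} \<subseteq> P \<times> {m. mkeys m \<subseteq> atoms P \<and> mdeg m = t}"
    using V_subset_atoms by (auto simp: mon_def)
  show "finite (P \<times> {m. mkeys m \<subseteq> atoms P \<and> mdeg m = t})"
    using finite_P finite_monomials[OF finite_atoms] by simp
qed

lemma hilb_eq: "hilb t = (\<Sum>r\<in>P. face_count (V r) t)"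
proof -
  have "{(r, m). mon r m \<and> mdeg m = t} = (SIGMA r:P. {m. mkeys m = V r \<and> mdeg m = t})"
    by (auto simp: mon_def)
  moreover have "finite {m. mkeys m = V r \<and> mdeg m = t}" for r
    by (rule finite_subset[OF _ finite_monomials[OF finite_V, of r t]]) auto
  ultimately show ?thesis using finite_P by (simp add: hilb_def face_count_def card_SigmaI)
qed

lemma sum_by_rank:
  fixes g :: "nat \<Rightarrow> 'b::comm_ring_1"
  shows "(\<Sum>r\<in>P. g (card (V r))) = (\<Sum>i\<le>poset_rank P. of_nat (fnum P (int i - 1)) * g i)"
proof -
  have "(\<Sum>r\<in>P. g (card (V r))) = (\<Sum>i\<le>poset_rank P. \<Sum>r\<in>{r \<in> P. card (V r) = i}. g (card (V r)))"
    using finite_P card_V_le by (intro sum.group[symmetric]) auto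
  also have "\<dots> = (\<Sum>i\<le>poset_rank P. of_nat (fnum P (int i - 1)) * g i)"
  proof (rule sum.cong[OF refl])
    fix i
    have "{t \<in> P. int (rk P t) = int i - 1 + 1} = {r \<in> P. card (V r) = i}" using rk_eq_card_V by auto
    then show "(\<Sum>r\<in>{r \<in> P. card (V r) = i}. g (card (V r))) = of_nat (fnum P (int i - 1)) * g i"
      by (simp add: fnum_def)
  qed
  finally show ?thesis .
qed

text \<open>Multiplying the Hilbert series by (1 - X)^d gives the sum of f_(i-1) X^i (1 - X)^(d-i),
  the generating polynomial of the h-numbers. Its coefficient at J is also the Euler characteristic
  of the degree J strand of the Koszul complex, with chain spaces of dimension (d choose p) * hilb
  (J - p).\<close>

lemma hnum_eq_euler:
  assumes J: "J \<le> poset_rank P"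
  shows "hnum P J = (\<Sum>p\<le>J. (- 1) ^ p * int ((poset_rank P choose p) * hilb (J - p)))"
proof -
  let ?d = "poset_rank P"
  let ?H = "Abs_fps (\<lambda>t. int (hilb t))"
  have H: "?H = (\<Sum>r\<in>P. Abs_fps (\<lambda>t. int (face_count (V r) t)))"
    by (rule fps_ext) (simp add: hilb_eq fps_sum_nth)
  have "(1 - fps_X) ^ ?d * ?H = (\<Sum>r\<in>P. (1 - fps_X) ^ (?d - card (V r)) * fps_X ^ card (V r))"
    unfolding H sum_distrib_left
  proof (rule sum.cong[OF refl])
    fix r assume "r \<in> P"
    then have "(1 - fps_X :: int fps) ^ ?d = (1 - fps_X) ^ (?d - card (V r)) * (1 - fps_X) ^ card (V r)"
      using card_V_le by (simp flip: power_add)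
    then show "(1 - fps_X) ^ ?d * Abs_fps (\<lambda>t. int (face_count (V r) t)) = (1 - fps_X) ^ (?d - card (V r)) * fps_X ^ card (V r)"
      using face_count_fps[OF finite_V, of r] by (simp add: mult.assoc)
  qed
  also have "\<dots> = (\<Sum>i\<le>?d. of_nat (fnum P (int i - 1)) * ((1 - fps_X) ^ (?d - i) * fps_X ^ i))"
    by (rule sum_by_rank)
  finally have eq: "(1 - fps_X) ^ ?d * ?H = (\<Sum>i\<le>?d. of_nat (fnum P (int i - 1)) * ((1 - fps_X) ^ (?d - i) * fps_X ^ i))" .
  have "fps_nth ((1 - fps_X) ^ ?d * ?H) J = (\<Sum>p\<le>J. (- 1) ^ p * int ((?d choose p) * hilb (J - p)))"
    by (simp add: fps_mult_nth fps_one_minus_X_power atLeast0AtMost mult.assoc)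
  moreover have "fps_nth (\<Sum>i\<le>?d. of_nat (fnum P (int i - 1)) * ((1 - fps_X) ^ (?d - i) * fps_X ^ i) :: int fps) J = hnum P J"
  proof -
    have t: "fps_nth (of_nat (fnum P (int i - 1)) * ((1 - fps_X) ^ (?d - i) * fps_X ^ i) :: int fps) J
        = Polynomial.coeff (Polynomial.smult (int (fnum P (int i - 1))) ([:- 1, 1:] ^ (?d - i))) (?d - J)" if i: "i \<le> ?d" for i
    proof -
      have "fps_nth (of_nat (fnum P (int i - 1)) * ((1 - fps_X) ^ (?d - i) * fps_X ^ i) :: int fps) J
          = int (fnum P (int i - 1)) * (if J < i then 0 else (- 1) ^ (J - i) * int ((?d - i) choose (J - i)))"
        by (simp add: fps_of_nat[symmetric] fps_X_power_mult_right_nth fps_one_minus_X_power)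
      moreover have "?d - J \<le> ?d - i \<longleftrightarrow> i \<le> J" using i J by linarith
      \<comment> \<open>The polynomial defining \<open>hnum\<close> has its coefficients in reverse
        order, which is matched by the symmetry of the binomial coefficients.\<close>
      moreover have "?d - i - (?d - J) = J - i" "(?d - i) choose (?d - J) = ((?d - i) choose (J - i))" if "i \<le> J"
        using that J binomial_symmetric[of "J - i" "?d - i"] by auto
      ultimately show ?thesis by (auto simp: poly_X_minus_1_power not_less)
    qed
    show ?thesis unfolding hnum_def Let_def fps_sum_nth coeff_sum
      by (rule sum.cong[OF refl]) (simp only: atMost_iff t)
  qed
  ultimately show ?thesis using eq by simp
qed

end

section \<open>Koszul homology of the face ring\<close>

lemma fs_independent_extend:
  fixes x :: "'i \<Rightarrow> 'x \<Rightarrow> 'k::field"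
  assumes W: "fs.subspace W" and bW: "bW \<subseteq> W" "fs.independent bW" "W \<subseteq> fs.span bW" "finite bW"
    and I: "finite I"
    and ind: "\<And>c. (\<Sum>i\<in>I. fscale (c i) (x i)) \<in> W \<Longrightarrow> \<forall>i\<in>I. c i = 0"
  shows "fs.independent (bW \<union> x ` I)" "card (bW \<union> x ` I) = card bW + card I"
proof -
  have inj: "inj_on x I"
  proof (rule inj_onI, rule ccontr)
    fix i j assume ij: "i \<in> I" "j \<in> I" "x i = x j" "i \<noteq> j"
    let ?c = "\<lambda>k. if k = i then 1 else if k = j then - 1 else (0::'k)"
    have "(\<Sum>k\<in>I. fscale (?c k) (x k)) = fscale (?c i) (x i) + (fscale (?c j) (x j) + (\<Sum>k\<in>I - {i} - {j}. fscale (?c k) (x k)))"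
      using ij I by (simp add: sum.remove[of I i] sum.remove[of "I - {i}" j])
    also have "(\<Sum>k\<in>I - {i} - {j}. fscale (?c k) (x k)) = 0" by (intro sum.neutral) auto
    finally have "(\<Sum>k\<in>I. fscale (?c k) (x k)) = 0" using ij(3,4) by (simp add: zero_fun_def)
    then have "(\<Sum>k\<in>I. fscale (?c k) (x k)) \<in> W" using fs.subspace_0[OF W] by metis
    then have "?c i = 0" using ind[of ?c] ij(1) by blast
    then show False by simp
  qed
  have disj: "bW \<inter> x ` I = {}"
  proof (rule ccontr)
    assume "bW \<inter> x ` I \<noteq> {}"
    then obtain i where i: "i \<in> I" "x i \<in> W" using bW(1) by auto
    let ?c = "\<lambda>k. if k = i then 1 else (0::'k)"
    have "(\<Sum>k\<in>I. fscale (?c k) (x k)) = fscale (?c i) (x i) + (\<Sum>k\<in>I - {i}. fscale (?c k) (x k))"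
      using i(1) I by (rule sum.remove[rotated])
    also have "(\<Sum>k\<in>I - {i}. fscale (?c k) (x k)) = 0" by (intro sum.neutral) auto
    finally have "(\<Sum>k\<in>I. fscale (?c k) (x k)) \<in> W" using i(2) by simp
    then have "?c i = 0" using ind[of ?c] i(1) by blast
    then show False by simp
  qed
  show "card (bW \<union> x ` I) = card bW + card I"
    using disj bW(4) I inj by (simp add: card_Un_disjoint card_image)
  show "fs.independent (bW \<union> x ` I)"
  proof (rule fs.independent_if_scalars_zero)
    show "finite (bW \<union> x ` I)" using bW(4) I by simp
    fix f y assume s: "(\<Sum>y\<in>bW \<union> x ` I. fscale (f y) y) = 0" and y: "y \<in> bW \<union> x ` I"
    have split: "(\<Sum>y\<in>bW. fscale (f y) y) + (\<Sum>i\<in>I. fscale (f (x i)) (x i)) = 0"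
      using s disj bW(4) I by (simp add: sum.union_disjoint sum.reindex[OF inj])
    have w: "(\<Sum>y\<in>bW. fscale (f y) y) \<in> W"
      using bW(1) by (intro fs.subspace_sum[OF W] fs.subspace_scale[OF W]) auto
    have "(\<Sum>i\<in>I. fscale (f (x i)) (x i)) = - (\<Sum>y\<in>bW. fscale (f y) y)"
      using split by (simp add: add_eq_0_iff)
    then have "(\<Sum>i\<in>I. fscale (f (x i)) (x i)) \<in> W" using fs.subspace_neg[OF W w] by simp
    then have z: "f (x i) = 0" if "i \<in> I" for i using ind[of "\<lambda>i. f (x i)"] that by blast
    then have "(\<Sum>i\<in>I. fscale (f (x i)) (x i)) = 0" by (intro sum.neutral) auto
    then have "(\<Sum>y\<in>bW. fscale (f y) y) = 0" using split by simp
    then have "f y = 0" if "y \<in> bW" using fs.independentD[OF bW(2,4) order_refl _ that] by blast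
    then show "f y = 0" using y z by auto
  qed
qed

text \<open>Applied with W the Koszul boundaries and x the constructed classes: inside all chains
  this bounds the dimension, inside the cycles in positive Koszul degree it computes it. The ambient
  function space is infinite-dimensional, hence the finite spanning sets.\<close>

lemma fs_dim_extend:
  fixes x :: "'i \<Rightarrow> 'x \<Rightarrow> 'k::field"
  assumes W: "fs.subspace W" "W \<subseteq> fs.span A" "finite A" and S: "fs.subspace S" "W \<subseteq> S" "x ` I \<subseteq> S"
    and I: "finite I"
    and ind: "\<And>c. (\<Sum>i\<in>I. fscale (c i) (x i)) \<in> W \<Longrightarrow> \<forall>i\<in>I. c i = 0"
  shows "S \<subseteq> fs.span A' \<Longrightarrow> finite A' \<Longrightarrow> fs.dim W + card I \<le> fs.dim S"
    and "(\<And>s. s \<in> S \<Longrightarrow> \<exists>c. s - (\<Sum>i\<in>I. fscale (c i) (x i)) \<in> W) \<Longrightarrow> fs.dim S = fs.dim W + card I"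
proof -
  obtain bW where bW: "bW \<subseteq> W" "fs.independent bW" "W \<subseteq> fs.span bW" "card bW = fs.dim W"
    by (rule fs.basis_exists)
  have fbW: "finite bW" using fs.independent_span_bound[OF W(3) bW(2)] bW(1) W(2) by blast
  let ?B = "bW \<union> x ` I"
  have B: "fs.independent ?B" "card ?B = fs.dim W + card I"
    using fs_independent_extend[OF W(1) bW(1-3) fbW I ind] bW(4) by auto
  have BS: "?B \<subseteq> S" using bW(1) S by auto
  show "fs.dim W + card I \<le> fs.dim S" if A': "S \<subseteq> fs.span A'" "finite A'"
  proof -
    obtain bS where bS: "bS \<subseteq> S" "fs.independent bS" "S \<subseteq> fs.span bS" "card bS = fs.dim S"
      by (rule fs.basis_exists)
    have "finite bS" using fs.independent_span_bound[OF A'(2) bS(2)] bS(1) A'(1) by blast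
    then have "card ?B \<le> card bS" using fs.independent_span_bound[of bS ?B] B(1) BS bS(3) by blast
    then show ?thesis using B(2) bS(4) by simp
  qed
  show "fs.dim S = fs.dim W + card I" if sp: "\<And>s. s \<in> S \<Longrightarrow> \<exists>c. s - (\<Sum>i\<in>I. fscale (c i) (x i)) \<in> W"
  proof -
    have "S \<subseteq> fs.span ?B"
    proof
      fix s assume "s \<in> S"
      then obtain c where c: "s - (\<Sum>i\<in>I. fscale (c i) (x i)) \<in> W" using sp by blast
      have "s - (\<Sum>i\<in>I. fscale (c i) (x i)) \<in> fs.span ?B"
        using c bW(3) fs.span_mono[of bW ?B] by blast
      moreover have "(\<Sum>i\<in>I. fscale (c i) (x i)) \<in> fs.span ?B"
        by (intro fs.span_sum fs.span_scale fs.span_base) auto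
      ultimately have "s - (\<Sum>i\<in>I. fscale (c i) (x i)) + (\<Sum>i\<in>I. fscale (c i) (x i)) \<in> fs.span ?B"
        by (rule fs.span_add)
      then show "s \<in> fs.span ?B" by simp
    qed
    then show ?thesis using fs.basis_card_eq_dim[OF BS _ B(1)] B(2) by simp
  qed
qed

lemma fs_rank_nullity:
  fixes f :: "('x \<Rightarrow> 'k::field) \<Rightarrow> ('y \<Rightarrow> 'k)"
  assumes f: "Vector_Spaces.linear fscale fscale f" and S: "fs.subspace S" "S \<subseteq> fs.span A" "finite A"
  shows "fs.dim S = fs.dim {s \<in> S. f s = 0} + fs.dim (f ` S)"
proof -
  interpret fl: Vector_Spaces.linear fscale fscale f by fact
  let ?W = "{s \<in> S. f s = 0}"
  have W: "fs.subspace ?W"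
    by (rule fs.subspaceI) (auto simp only: mem_Collect_eq fl.zero fl.add fl.scale add_0_left fs.scale_zero_right
        intro: fs.subspace_0[OF S(1)] fs.subspace_add[OF S(1)] fs.subspace_scale[OF S(1)])
  obtain b where b: "b \<subseteq> f ` S" "fs.independent b" "f ` S \<subseteq> fs.span b" "card b = fs.dim (f ` S)"
    by (rule fs.basis_exists)
  have "b \<subseteq> fs.span (f ` A)" using b(1) S(2) fl.span_image[of A] by blast
  then have fb: "finite b" using fs.independent_span_bound[OF _ b(2)] S(3) by blast
  have "\<forall>y\<in>b. \<exists>s\<in>S. f s = y" using b(1) by blast
  then obtain g where g: "\<And>y. y \<in> b \<Longrightarrow> g y \<in> S" "\<And>y. y \<in> b \<Longrightarrow> f (g y) = y" by metis
  have fg: "f (\<Sum>y\<in>b. fscale (c y) (g y)) = (\<Sum>y\<in>b. fscale (c y) y)" for c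
    unfolding fl.sum fl.scale by (intro sum.cong refl) (simp only: g(2))
  have "fs.dim S = fs.dim ?W + card b"
  proof (rule fs_dim_extend(2)[OF W _ S(3) S(1)])
    show "?W \<subseteq> fs.span A" using S(2) by blast
    show "?W \<subseteq> S" by blast
    show "g ` b \<subseteq> S" using g(1) by blast
    show "finite b" by (rule fb)
    show "\<forall>i\<in>b. c i = 0" if "(\<Sum>i\<in>b. fscale (c i) (g i)) \<in> ?W" for c
    proof -
      have "(\<Sum>y\<in>b. fscale (c y) y) = 0" using that fg by simp
      then show ?thesis using fs.independentD[OF b(2) fb order_refl] by blast
    qed
    show "\<exists>c. s - (\<Sum>i\<in>b. fscale (c i) (g i)) \<in> ?W" if s: "s \<in> S" for s
    proof -
      have "f s \<in> fs.span b" using b(3) s by blast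
      then obtain c where c: "f s = (\<Sum>y\<in>b. fscale (c y) y)" using fs.span_finite[OF fb] by auto
      have "(\<Sum>i\<in>b. fscale (c i) (g i)) \<in> S"
        by (intro fs.subspace_sum[OF S(1)] fs.subspace_scale[OF S(1)] g(1))
      then have "s - (\<Sum>i\<in>b. fscale (c i) (g i)) \<in> S" using fs.subspace_diff[OF S(1) s] by blast
      moreover have "f (s - (\<Sum>i\<in>b. fscale (c i) (g i))) = 0" unfolding fl.diff fg c by simp
      ultimately show ?thesis by blast
    qed
  qed
  then show ?thesis using b(4) by simp
qed

lemma fs_dim_supported:
  assumes "finite U"
  shows "fs.dim {f :: 'x \<Rightarrow> 'k::field. \<forall>x. f x \<noteq> 0 \<longrightarrow> x \<in> U} = card U"
    and "{f :: 'x \<Rightarrow> 'k. \<forall>x. f x \<noteq> 0 \<longrightarrow> x \<in> U} \<subseteq> fs.span ((\<lambda>u x. if x = u then 1 else 0) ` U)"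
    and "fs.subspace {f :: 'x \<Rightarrow> 'k. \<forall>x. f x \<noteq> 0 \<longrightarrow> x \<in> U}"
proof -
  let ?S = "{f :: 'x \<Rightarrow> 'k. \<forall>x. f x \<noteq> 0 \<longrightarrow> x \<in> U}"
  let ?e = "\<lambda>u x. if x = u then 1 else (0 :: 'k)"
  have ev: "(\<Sum>u\<in>U. fscale (c u) (?e u)) x = (if x \<in> U then c x else 0)" for c x
  proof -
    have "(\<Sum>u\<in>U. fscale (c u) (?e u)) x = (\<Sum>u\<in>U. if u = x then c x else 0)"
      unfolding sum_fun_apply by (rule sum.cong) (auto simp: fscale_def)
    then show ?thesis using assms by simp
  qed
  have rep: "f = (\<Sum>u\<in>U. fscale (f u) (?e u))" if "f \<in> ?S" for f
    using that by (intro ext) (auto simp: ev)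
  show sub: "fs.subspace ?S" by (rule fs.subspaceI) (auto simp: fscale_def, metis add.right_neutral)
  have "fs.dim ?S = fs.dim {0 :: 'x \<Rightarrow> 'k} + card U"
  proof (rule fs_dim_extend(2)[where A = "{}" and x = ?e])
    show "\<exists>c. s - (\<Sum>i\<in>U. fscale (c i) (?e i)) \<in> {0}" if "s \<in> ?S" for s
      using rep[OF that] by (intro exI[of _ s]) (metis right_minus_eq singletonI)
    show "\<forall>i\<in>U. c i = 0" if "(\<Sum>i\<in>U. fscale (c i) (?e i)) \<in> {0}" for c
    proof
      fix i assume i: "i \<in> U"
      have "(\<Sum>i\<in>U. fscale (c i) (?e i)) i = 0" using that by simp
      then show "c i = 0" using ev[of c i] i by simp
    qed
    show "{0} \<subseteq> ?S" by simp
  qed (use sub assms in \<open>auto simp: fs.subspace_single_0 fs.span_empty split: if_splits\<close>)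
  moreover have "fs.dim {0 :: 'x \<Rightarrow> 'k} = 0" using fs.dim_span[of "{} :: ('x \<Rightarrow> 'k) set"]
      fs.dim_eq_card_independent[OF fs.independent_empty, where 'b='x and 'a='k] by simp
  ultimately show "fs.dim ?S = card U" by simp
  show "?S \<subseteq> fs.span (?e ` U)"
  proof
    fix f assume "f \<in> ?S"
    have "(\<Sum>u\<in>U. fscale (f u) (?e u)) \<in> fs.span (?e ` U)"
      by (intro fs.span_sum fs.span_scale fs.span_base) auto
    then show "f \<in> fs.span (?e ` U)" using rep[OF \<open>f \<in> ?S\<close>] by simp
  qed
qed

section \<open>Koszul classes from cocycles of the order complex\<close>

context local_acyclic
begin

definition lc :: "'i set \<Rightarrow> ('i \<Rightarrow> 'k) \<Rightarrow> ('i \<Rightarrow> nat set \<Rightarrow> 'a idx \<Rightarrow> 'k) \<Rightarrow> nat set \<Rightarrow> 'a idx \<Rightarrow> 'k" where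
  "lc I c \<phi> = (\<lambda>T x. \<Sum>i\<in>I. c i * \<phi> i T x)"

lemma bd_lc: "bd (lc I c \<phi>) = lc I c (\<lambda>i. bd (\<phi> i))"
proof (intro ext)
  fix T x
  have *: "iota d u (lc I c \<phi>) T y = (\<Sum>i\<in>I. c i * iota d u (\<phi> i) T y)" for u y
    unfolding iota_def lc_def sum_distrib_left by (subst sum.swap) (simp add: mult_ac)
  have "bd (lc I c \<phi>) T x = (\<Sum>v\<in>atoms P. \<Sum>i\<in>I. c i * (case sv v x of None \<Rightarrow> 0 | Some y \<Rightarrow> iota d (\<theta> v) (\<phi> i) T y))"
    unfolding bd_def kos_def by (rule sum.cong) (auto simp: * split: option.split)
  also have "\<dots> = lc I c (\<lambda>i. bd (\<phi> i)) T x"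
    unfolding lc_def bd_def kos_def sum_distrib_left by (rule sum.swap)
  finally show "bd (lc I c \<phi>) T x = lc I c (\<lambda>i. bd (\<phi> i)) T x" .
qed

lemma del_lc: "del (lc I c \<phi>) = lc I c (\<lambda>i. del (\<phi> i))"
proof (intro ext)
  fix T and x :: "'a idx"
  obtain k r m where x: "x = (k, r, m)" by (cases x) auto
  show "del (lc I c \<phi>) T x = lc I c (\<lambda>i. del (\<phi> i)) T x"
    unfolding lc_def x del_def cobd_def
    by (simp add: sum_distrib_left) (intro impI, subst sum.swap, simp add: mult_ac)
qed

lemma E_lc:
  assumes "\<And>i. i \<in> I \<Longrightarrow> E J p q (\<phi> i)" shows "E J p q (lc I c \<phi>)"
  unfolding E_def
proof (intro allI impI)
  fix T k r m assume "lc I c \<phi> T (k, r, m) \<noteq> 0"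
  then obtain i where i: "i \<in> I" "c i * \<phi> i T (k, r, m) \<noteq> 0"
    unfolding lc_def by (meson sum.neutral)
  then have "\<phi> i T (k, r, m) \<noteq> 0" by auto
  then show "T \<subseteq> {..<d} \<and> card T = p \<and> k \<in> Ch r \<and> card k = q \<and> mon r m \<and> mdeg m + p = J"
    using assms[OF i(1)] unfolding E_def by blast
qed

lemma zigzag_lc:
  assumes "\<And>i. i \<in> I \<Longrightarrow> zigzag J p q (\<zeta> i)"
  shows "zigzag J p q (\<lambda>k. lc I c (\<lambda>i. \<zeta> i k))"
  unfolding zigzag_def
proof (intro conjI allI impI)
  show "E J (p + k) k (lc I c (\<lambda>i. \<zeta> i k))" if "k \<le> q" for k
    using assms that by (intro E_lc) (auto simp: zigzag_def)
  show "del (lc I c (\<lambda>i. \<zeta> i k)) = bd (lc I c (\<lambda>i. \<zeta> i (Suc k)))" if "k < q" for k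
  proof -
    have "del (\<zeta> i k) = bd (\<zeta> i (Suc k))" if "i \<in> I" for i
      using assms[OF that] \<open>k < q\<close> unfolding zigzag_def by blast
    then show ?thesis unfolding del_lc bd_lc by (intro ext) (simp add: lc_def)
  qed
qed

lemma zigzag_diff:
  assumes "zigzag J p q \<zeta>" "zigzag J p q \<xi>" shows "zigzag J p q (\<lambda>k. \<zeta> k - \<xi> k)"
  unfolding zigzag_def
proof (intro conjI allI impI)
  show "E J (p + k) k (\<zeta> k - \<xi> k)" if "k \<le> q" for k
    using assms that unfolding zigzag_def by (blast intro: E_diff)
  show "del (\<zeta> k - \<xi> k) = bd (\<zeta> (Suc k) - \<xi> (Suc k))" if "k < q" for k
    using assms that unfolding zigzag_def bd_diff del_diff by metis
qed

definition betti_nr :: "nat \<Rightarrow> nat" where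
  "betti_nr q = betti TYPE('k) (order_complex_bar P) (int q - 1)"

lemma order_complex_eq: "order_complex_bar P = Ch z"
  using z_le Ch_finite by (auto simp: order_complex_bar_def Ch_def)

text \<open>Indexes a basis of the J-th exterior power of k^d tensored with the cohomology of the
  order complex on chains of q elements.\<close>

definition class_index :: "nat \<Rightarrow> nat \<Rightarrow> (nat set \<times> nat) set" where
  "class_index J q = {T. T \<subseteq> {..<d} \<and> card T = J} \<times> {..<betti_nr q}"

lemma class_index: "finite (class_index J q)" "card (class_index J q) = (d choose J) * betti_nr q"
  using n_subsets[of "{..<d}" J] by (auto simp: class_index_def card_cartesian_product)

definition boundaries :: "nat \<Rightarrow> nat \<Rightarrow> (nat set \<Rightarrow> 'a idx \<Rightarrow> 'k) set" where
  "boundaries J p = {bd u | u. E J (Suc p) 0 u}"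

text \<open>The classes are the starts of zigzags that end in the tensor basis. A combination
  bounding at the start gives a coboundary at the end, hence has zero coefficients. For p > 0 a
  cycle is lifted to a zigzag, its end is expanded in the cocycle basis up to a coboundary, and the
  difference of zigzags shows that the starts agree up to a boundary.\<close>

lemma koszul_classes:
  assumes J: "p + q = J"
  shows "\<exists>g. (\<forall>i\<in>class_index J q. \<exists>\<zeta>. zigzag J p q \<zeta> \<and> \<zeta> 0 = g i \<and> del (\<zeta> q) = 0) \<and>
    (\<forall>c. lc (class_index J q) c g \<in> boundaries J p \<longrightarrow> (\<forall>i\<in>class_index J q. c i = 0)) \<and>
    (0 < p \<longrightarrow> (\<forall>y. E J p 0 y \<and> bd y = 0 \<longrightarrow> (\<exists>c. y - lc (class_index J q) c g \<in> boundaries J p)))"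
proof -
  let ?I = "class_index J q" and ?N = "betti_nr q"
  have fin: "finite (Ch z)" by (rule finite_subset[of _ "Pow P"]) (use finite_P in \<open>auto simp: Ch_def\<close>)
  have ch: "Complete_Partial_Order.chain (\<le>) F" if "F \<in> Ch z" for F using that by (simp add: Ch_def)
  have "\<exists>x :: nat \<Rightarrow> 'a set \<Rightarrow> 'k.
    (\<forall>l c. x l c \<noteq> 0 \<longrightarrow> c \<in> Ch z \<and> card c = q) \<and>
    (\<forall>l<?N. \<forall>c\<in>Ch z. cobd (x l) c = 0) \<and>
    (\<forall>f w. (\<forall>c\<in>Ch z. card c = q \<longrightarrow> (\<Sum>l<?N. f l * x l c) = cobd w c) \<longrightarrow> (\<forall>l<?N. f l = 0)) \<and>
    (\<forall>y. (\<forall>c\<in>Ch z. card c = Suc q \<longrightarrow> cobd y c = 0) \<longrightarrow>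
       (\<exists>f w. \<forall>c\<in>Ch z. card c = q \<longrightarrow> y c = (\<Sum>l<?N. f l * x l c) + cobd w c))"
    unfolding betti_nr_def order_complex_eq
    by (rule betti_cocycles[OF fin]) (fact Ch_finite, fact Ch_subset, fact ch)
  then obtain x :: "nat \<Rightarrow> 'a set \<Rightarrow> 'k" where x':
    "\<forall>l c. x l c \<noteq> 0 \<longrightarrow> c \<in> Ch z \<and> card c = q"
    "\<forall>l<?N. \<forall>c\<in>Ch z. cobd (x l) c = 0"
    "\<forall>f w. (\<forall>c\<in>Ch z. card c = q \<longrightarrow> (\<Sum>l<?N. f l * x l c) = cobd w c) \<longrightarrow> (\<forall>l<?N. f l = 0)"
    "\<forall>y. (\<forall>c\<in>Ch z. card c = Suc q \<longrightarrow> cobd y c = 0) \<longrightarrow>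
       (\<exists>f w. \<forall>c\<in>Ch z. card c = q \<longrightarrow> y c = (\<Sum>l<?N. f l * x l c) + cobd w c)"
    by (elim exE conjE)
  have x: "\<And>l c. x l c \<noteq> 0 \<Longrightarrow> c \<in> Ch z \<and> card c = q"
    "\<And>l c. l < ?N \<Longrightarrow> c \<in> Ch z \<Longrightarrow> cobd (x l) c = 0"
    "\<And>f w l. \<forall>c\<in>Ch z. card c = q \<longrightarrow> (\<Sum>l<?N. f l * x l c) = cobd w c \<Longrightarrow> l < ?N \<Longrightarrow> f l = 0"
    "\<And>y. \<forall>c\<in>Ch z. card c = Suc q \<longrightarrow> cobd y c = 0 \<Longrightarrow>
       \<exists>f w. \<forall>c\<in>Ch z. card c = q \<longrightarrow> y c = (\<Sum>l<?N. f l * x l c) + cobd w c"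
    subgoal using x'(1) by blast
    subgoal using x'(2) by blast
    subgoal for f w l using x'(3)[THEN spec, of f, THEN spec, of w] by blast
    subgoal for y using x'(4)[THEN spec, of y] by blast
    done
  have mon_z0: "mon z 0" using z_P V_z by (simp add: mon_def)
  \<comment> \<open>The tensor of e_T' with the cocycle \<open>x l\<close>, placed at the trivial
    monomial.\<close>
  define X where "X = (\<lambda>(T' :: nat set, l) T (c, r, m). if T = T' \<and> r = z \<and> m = (0 :: 'a \<Rightarrow>\<^sub>0 nat) then x l c else 0)"
  have X_eq: "X i T (c, r, m) = (if T = fst i \<and> r = z \<and> m = 0 then x (snd i) c else 0)" for i T c r m
    by (simp add: X_def case_prod_beta)
  have EX: "E J J q (X i)" if "i \<in> ?I" for i
    unfolding E_def
  proof (intro allI impI)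
    fix T c r m assume "X i T (c, r, m) \<noteq> 0"
    then have "T = fst i" "r = z" "m = 0" "x (snd i) c \<noteq> 0" by (auto simp: X_eq split: if_splits)
    then show "T \<subseteq> {..<d} \<and> card T = J \<and> c \<in> Ch r \<and> card c = q \<and> mon r m \<and> mdeg m + J = J"
      using x(1) mon_z0 that by (auto simp: class_index_def mdeg_def)
  qed
  have dX: "del (X i) = 0" if "i \<in> ?I" for i
  proof (intro ext)
    fix T and n :: "'a idx"
    obtain c r m where n: "n = (c, r, m)" by (cases n) auto
    have "cobd (\<lambda>c. X i T (c, r, m)) c = (if T = fst i \<and> r = z \<and> m = 0 then cobd (x (snd i)) c else 0)"
    proof (cases "T = fst i \<and> r = z \<and> m = 0")
      case False
      show ?thesis unfolding X_eq if_not_P[OF False] by (simp add: cobd_def)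
    qed (simp add: X_eq)
    then show "del (X i) T n = 0 T n" using x(2)[of "snd i"] that Ch_z[of c r] by (auto simp: n del_def class_index_def)
  qed
  have "\<forall>i\<in>?I. \<exists>\<zeta>. zigzag J p q \<zeta> \<and> \<zeta> q = X i" using zigzag_exists[OF EX dX J] by blast
  then obtain Z where Z: "\<And>i. i \<in> ?I \<Longrightarrow> zigzag J p q (Z i)" "\<And>i. i \<in> ?I \<Longrightarrow> Z i q = X i" by metis
  define g where "g = (\<lambda>i. Z i 0)"
  have ZL: "zigzag J p q (\<lambda>k. lc ?I c (\<lambda>i. Z i k))" for c by (rule zigzag_lc[OF Z(1)])
  have ZLq: "lc ?I c (\<lambda>i. Z i q) = lc ?I c X" for c using Z(2) by (intro ext) (simp add: lc_def)
  have dL: "del (lc ?I c X) = 0" for c using dX unfolding del_lc by (intro ext) (simp add: lc_def)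
  have LX: "lc ?I c X T (k, z, 0) = (\<Sum>l<?N. c (T, l) * x l k)" if "T \<subseteq> {..<d}" "card T = J" for c T k
  proof -
    have "lc ?I c X T (k, z, 0) = (\<Sum>T'\<in>{T. T \<subseteq> {..<d} \<and> card T = J}. \<Sum>l<?N. c (T', l) * (if T = T' then x l k else 0))"
      unfolding lc_def class_index_def by (simp add: sum.cartesian_product case_prod_beta X_eq)
    also have "\<dots> = (\<Sum>T'\<in>{T. T \<subseteq> {..<d} \<and> card T = J}. if T = T' then \<Sum>l<?N. c (T, l) * x l k else 0)"
      by (rule sum.cong) auto
    also have "\<dots> = (\<Sum>l<?N. c (T, l) * x l k)" using that by (simp add: sum.delta')
    finally show ?thesis .
  qed
  have ind: "c i = 0" if b: "lc ?I c g \<in> boundaries J p" and i: "i \<in> ?I" for c i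
  proof -
    obtain u where u: "E J (Suc p) 0 u" "lc ?I c g = bd u" using b by (auto simp: boundaries_def)
    obtain T l where Tl: "i = (T, l)" "T \<subseteq> {..<d}" "card T = J" "l < ?N" using i by (auto simp: class_index_def)
    have "\<exists>w. \<forall>k\<in>Ch z. lc ?I c X T (k, z, 0) = cobd w k"
    proof (cases q)
      case 0
      \<comment> \<open>Koszul degree J + 1 would require polynomial degree -1, so u is
        zero.\<close>
      then have "Suc p = Suc J" using J by simp
      then have "u = 0" using u(1) by (intro ext) (auto simp: E_def)
      then have z0: "lc ?I c X = 0" using u(2) bd_0 ZLq[of c] 0 by (simp add: g_def)
      show ?thesis unfolding z0 by (intro exI[of _ "\<lambda>_. 0"]) (simp add: cobd_def)
    next
      case (Suc q')
      have "del (lc ?I c (\<lambda>i. Z i (Suc q'))) = 0" using dL ZLq Suc by simp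
      then obtain w where w: "E J J q' w" "lc ?I c (\<lambda>i. Z i (Suc q')) = del w"
        using zigzag_top[OF ZL[of c, unfolded Suc] _ _ u(1)] u(2) J Suc unfolding g_def by blast
      have "lc ?I c X T (k, z, 0) = cobd (\<lambda>k. w T (k, z, 0)) k" if "k \<in> Ch z" for k
      proof -
        have "lc ?I c X = del w" using w(2) ZLq[of c] Suc by simp
        then show ?thesis using that by (simp add: del_def)
      qed
      then show ?thesis by blast
    qed
    then obtain w where "\<forall>k\<in>Ch z. (\<Sum>l<?N. c (T, l) * x l k) = cobd w k" using LX Tl by auto
    then show ?thesis using x(3)[of "\<lambda>l. c (T, l)" w l] Tl by auto
  qed
  have span: "\<exists>c. y - lc ?I c g \<in> boundaries J p" if p: "0 < p" and y: "E J p 0 y" "bd y = 0" for y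
  proof -
    obtain \<zeta> where z: "zigzag J p q \<zeta>" "\<zeta> 0 = y" "del (\<zeta> q) = 0" using zigzag_lift[OF y p J] by blast
    have Eq: "E J J q (\<zeta> q)" using z(1) J by (auto simp: zigzag_def)
    have "\<exists>f w. \<forall>k\<in>Ch z. card k = q \<longrightarrow> \<zeta> q T (k, z, 0) = (\<Sum>l<?N. f l * x l k) + cobd w k" for T
    proof (rule x(4), intro ballI impI)
      fix k assume "k \<in> Ch z"
      have "del (\<zeta> q) T (k, z, 0) = 0" using z(3) by simp
      then show "cobd (\<lambda>k. \<zeta> q T (k, z, 0)) k = 0" using \<open>k \<in> Ch z\<close> by (simp add: del_def)
    qed
    then obtain f w where fw: "\<And>T k. k \<in> Ch z \<Longrightarrow> card k = q \<Longrightarrow>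
        \<zeta> q T (k, z, 0) = (\<Sum>l<?N. f T l * x l k) + cobd (w T) k" by metis
    define c where "c = (\<lambda>(T, l). f T l)"
    \<comment> \<open>The primitives w are arbitrary functions; W cuts them down to the support
      required by \<open>E\<close>. For q = 0 nothing remains, since no chain has -1
      elements.\<close>
    define W where "W = (\<lambda>T (k, r, m). if T \<subseteq> {..<d} \<and> card T = J \<and> k \<in> Ch z \<and> Suc (card k) = q \<and> r = z \<and> m = (0 :: 'a \<Rightarrow>\<^sub>0 nat)
        then w T k else 0)"
    have EW: "E J J q' W" if "q = Suc q'" for q'
      using mon_z0 that unfolding E_def W_def by (auto simp: mdeg_def split: if_splits)
    have Eqd: "E J J q (\<zeta> q - lc ?I c X)" by (intro E_diff Eq E_lc EX)
    have top: "\<zeta> q - lc ?I c X = del W"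
    proof (intro ext)
      fix T and n :: "'a idx"
      obtain k r m where n: "n = (k, r, m)" by (cases n) auto
      show "(\<zeta> q - lc ?I c X) T n = del W T n"
      proof (cases "T \<subseteq> {..<d} \<and> card T = J \<and> k \<in> Ch z \<and> card k = q \<and> r = z \<and> m = 0")
        case True
        have "W T (k - {\<tau>}, z, 0) = w T (k - {\<tau>})" if "\<tau> \<in> k" for \<tau>
        proof -
          have "Suc (card (k - {\<tau>})) = q" using True that Ch_finite by (metis card.remove)
          then show ?thesis using True Ch_subset[of k z "k - {\<tau>}"] by (simp add: W_def)
        qed
        then have "cobd (\<lambda>k. W T (k, z, 0)) k = cobd (w T) k" by (intro cobd_cong)
        then show ?thesis using fw[of k T] LX[of T c k] True by (simp add: n del_def c_def)
      next
        case False
        have "(\<zeta> q - lc ?I c X) T n = 0"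
        proof (rule ccontr)
          assume nz: "(\<zeta> q - lc ?I c X) T n \<noteq> 0"
          note e = E_D[OF Eqd nz[unfolded n]]
          have "m = 0" using e(6) mdeg_eq_0 by auto
          then show False using False e mon_z Ch_z by blast
        qed
        moreover have "del W T n = 0"
        proof (rule ccontr)
          assume nz: "del W T n \<noteq> 0"
          then have k: "k \<in> Ch r" "cobd (\<lambda>k. W T (k, r, m)) k \<noteq> 0" by (auto simp: n del_def split: if_splits)
          then obtain \<tau> where t: "\<tau> \<in> k" "W T (k - {\<tau>}, r, m) \<noteq> 0"
            unfolding cobd_def by (metis (no_types, lifting) mult_zero_right sum.neutral)
          then have "T \<subseteq> {..<d} \<and> card T = J \<and> Suc (card (k - {\<tau>})) = q \<and> r = z \<and> m = 0"
            by (auto simp: W_def split: if_splits)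
          moreover have "Suc (card (k - {\<tau>})) = card k" using t(1) Ch_finite[OF k(1)] by (metis card.remove)
          ultimately show False using False k(1) by auto
        qed
        ultimately show ?thesis by simp
      qed
    qed
    let ?\<zeta> = "\<lambda>k. \<zeta> k - lc ?I c (\<lambda>i. Z i k)"
    have "\<exists>u. E J (Suc p) 0 u \<and> ?\<zeta> 0 = bd u"
    proof (rule zigzag_boundary)
      show "zigzag J p q ?\<zeta>" by (rule zigzag_diff[OF z(1) ZL])
      show "p + q \<le> J" using J by simp
      show "q = 0 \<and> ?\<zeta> 0 = 0 \<or> (\<exists>q' w. q = Suc q' \<and> E J (p + q) q' w \<and> ?\<zeta> q = del w)"
      proof (cases q)
        case 0
        have "W = 0" by (intro ext) (auto simp: W_def 0)
        then show ?thesis using top ZLq[of c] del_0 0 by metis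
      next
        case (Suc q')
        then show ?thesis using top ZLq[of c] EW[OF Suc] J by auto
      qed
    qed
    then show ?thesis using z(2) unfolding boundaries_def g_def by auto
  qed
  have "\<exists>\<zeta>. zigzag J p q \<zeta> \<and> \<zeta> 0 = g i \<and> del (\<zeta> q) = 0" if "i \<in> ?I" for i
    using Z[OF that] dX[OF that] by (intro exI[of _ "Z i"]) (simp add: g_def)
  with ind span show ?thesis by (intro exI[of _ g]) blast
qed

text \<open>The Koszul differential of the start has zero coboundary, because moving it to the next
  entry applies \<open>bd\<close> twice, and the row is injective at its start.\<close>

lemma zigzag_cycle:
  assumes zz: "zigzag J (Suc p) q \<zeta>" and d0: "del (\<zeta> q) = 0" and J: "Suc p + q = J"
  shows "bd (\<zeta> 0) = 0"
proof (rule row_exact_0)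
  have E: "E J (Suc p) 0 (\<zeta> 0)" using zz by (auto simp: zigzag_def)
  then show "E J p 0 (bd (\<zeta> 0))" by (rule E_bd)
  show "p < J" using J by simp
  show "del (bd (\<zeta> 0)) = 0"
  proof (cases q)
    case 0
    then have "del (\<zeta> 0) = 0" using d0 by simp
    then have "bd (del (\<zeta> 0)) = 0" using bd_0 by metis
    then show ?thesis by (simp add: bd_del)
  next
    case (Suc q')
    then have E1: "E J (Suc p + 1) 1 (\<zeta> 1)" "del (\<zeta> 0) = bd (\<zeta> 1)" using zz by (auto simp: zigzag_def)
    show ?thesis unfolding bd_del[symmetric] E1(2) by (rule bd_bd[OF E1(1)])
  qed
qed

end

section \<open>The lower bound for the h-vector\<close>

context local_acyclic
begin

definition koszul_index :: "nat \<Rightarrow> nat \<Rightarrow> (nat set \<times> 'a idx) set" where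
  "koszul_index J p = {(T, c, r, m). T \<subseteq> {..<d} \<and> card T = p \<and> c = {} \<and> mon r m \<and> mdeg m + p = J}"

lemma koszul_index_card:
  "finite (koszul_index J p)" "p \<le> J \<Longrightarrow> card (koszul_index J p) = (d choose p) * hilb (J - p)"
  "J < p \<Longrightarrow> koszul_index J p = {}"
proof -
  let ?f = "\<lambda>(T :: nat set, r :: 'a, m :: 'a \<Rightarrow>\<^sub>0 nat). (T, {} :: 'a set, r, m)"
  let ?T = "{T. T \<subseteq> {..<d} \<and> card T = p}"
  have eq: "koszul_index J p = ?f ` (?T \<times> {(r, m). mon r m \<and> mdeg m = J - p})" if "p \<le> J"
    using that by (auto simp: koszul_index_def image_iff)
  show e: "koszul_index J p = {}" if "J < p" for J p using that by (auto simp: koszul_index_def)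
  have fT: "finite ?T" by simp
  show "finite (koszul_index J p)"
  proof (cases "p \<le> J")
    case True
    show ?thesis unfolding eq[OF True] by (intro finite_imageI finite_cartesian_product fT finite_mon)
  qed (use e in auto)
  have inj: "inj_on ?f A" for A by (auto simp: inj_on_def)
  show "card (koszul_index J p) = (d choose p) * hilb (J - p)" if "p \<le> J"
    unfolding eq[OF that] card_image[OF inj] card_cartesian_product hilb_def
    using n_subsets[of "{..<d}" p] by simp
qed

text \<open>The same spaces as \<open>E J p 0\<close>, with the two arguments combined into one so
  that the linear algebra of functions applies.\<close>

definition F :: "nat \<Rightarrow> nat \<Rightarrow> (nat set \<times> 'a idx \<Rightarrow> 'k) set" where
  "F J p = {f. \<forall>x. f x \<noteq> 0 \<longrightarrow> x \<in> koszul_index J p}"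

lemma F_iff: "f \<in> F J p \<longleftrightarrow> E J p 0 (curry f)"
proof
  assume "f \<in> F J p"
  then have *: "(T, c, r, m) \<in> koszul_index J p" if "f (T, c, r, m) \<noteq> 0" for T c r m
    using that by (simp add: F_def)
  have e: "{} \<in> Ch r" for r by (simp add: Ch_def chain_def)
  show "E J p 0 (curry f)" unfolding E_def
  proof (intro allI impI)
    fix T c r m assume "curry f T (c, r, m) \<noteq> 0"
    then have "(T, c, r, m) \<in> koszul_index J p" using * by simp
    then have "T \<subseteq> {..<d}" "card T = p" "c = {}" "mon r m" "mdeg m + p = J" by (auto simp: koszul_index_def)
    then show "T \<subseteq> {..<d} \<and> card T = p \<and> c \<in> Ch r \<and> card c = 0 \<and> mon r m \<and> mdeg m + p = J"
      using e by simp
  qed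
next
  assume E: "E J p 0 (curry f)"
  have "x \<in> koszul_index J p" if nz: "f x \<noteq> 0" for x
  proof -
    obtain T c r m where x: "x = (T, c, r, m)" by (cases x) auto
    have "curry f T (c, r, m) \<noteq> 0" using nz x by simp
    note e = E_D[OF E this]
    have "c = {}" using e(3,4) Ch_finite by auto
    then show ?thesis using e by (simp add: x koszul_index_def)
  qed
  then show "f \<in> F J p" by (simp add: F_def)
qed

definition bdu :: "(nat set \<times> 'a idx \<Rightarrow> 'k) \<Rightarrow> nat set \<times> 'a idx \<Rightarrow> 'k" where
  "bdu f = (\<lambda>(T, x). bd (curry f) T x)"

lemma curry_bdu: "curry (bdu f) = bd (curry f)"
  by (intro ext) (simp add: bdu_def)

lemma curry_sum: "curry (\<Sum>i\<in>I. fscale (c i) (g i)) = lc I c (\<lambda>i. curry (g i))"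
  by (intro ext) (simp add: lc_def sum_fun_apply fscale_def)

lemma bdu_linear: "Vector_Spaces.linear fscale fscale bdu"
proof (rule fs_linearI)
  fix f g :: "nat set \<times> 'a idx \<Rightarrow> 'k" and a :: 'k
  have "curry (f + g) = curry f + curry g" by (intro ext) simp
  then show "bdu (f + g) = bdu f + bdu g" by (intro ext) (auto simp: bdu_def bd_add)
  have "curry (fscale a f) = lc {()} (\<lambda>_. a) (\<lambda>_. curry f)" by (intro ext) (simp add: lc_def fscale_def)
  then show "bdu (fscale a f) = fscale a (bdu f)" by (intro ext) (auto simp: bdu_def bd_lc, simp add: lc_def fscale_def bdu_def)
qed

lemma F_props: "fs.subspace (F J p)" "\<exists>A. finite A \<and> F J p \<subseteq> fs.span A" "fs.dim (F J p) = card (koszul_index J p)"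
  using fs_dim_supported[OF koszul_index_card(1)[of J p], where 'k='k] koszul_index_card(1)[of J p]
  unfolding F_def by blast+

lemma boundaries_iff: "f \<in> bdu ` F J (Suc p) \<longleftrightarrow> curry f \<in> boundaries J p"
proof
  assume "f \<in> bdu ` F J (Suc p)"
  then show "curry f \<in> boundaries J p" unfolding boundaries_def using curry_bdu F_iff by blast
next
  assume "curry f \<in> boundaries J p"
  then obtain u where u: "E J (Suc p) 0 u" "curry f = bd u" by (auto simp: boundaries_def)
  have "curry (case_prod u) = u" by simp
  then have "curry (bdu (case_prod u)) = curry f" using u(2) curry_bdu by metis
  then have "bdu (case_prod u) = f" by (metis case_prod_curry)
  moreover have "case_prod u \<in> F J (Suc p)" using u(1) by (simp add: F_iff)
  ultimately show "f \<in> bdu ` F J (Suc p)" by blast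
qed

text \<open>Boundaries together with the classes are independent in every Koszul degree; in positive
  Koszul degree the classes are cycles and span modulo boundaries.\<close>

lemma dim_cycles:
  assumes J: "p + q = J"
  shows "fs.dim (bdu ` F J (Suc p)) + (d choose J) * betti_nr q \<le> fs.dim (F J p)"
    and "0 < p \<Longrightarrow> fs.dim {f \<in> F J p. bdu f = 0} = fs.dim (bdu ` F J (Suc p)) + (d choose J) * betti_nr q"
proof -
  let ?I = "class_index J q" and ?B = "bdu ` F J (Suc p)"
  interpret bl: Vector_Spaces.linear fscale fscale bdu by (rule bdu_linear)
  obtain g where g: "\<forall>i\<in>?I. \<exists>\<zeta>. zigzag J p q \<zeta> \<and> \<zeta> 0 = g i \<and> del (\<zeta> q) = 0"
    "\<And>c. lc ?I c g \<in> boundaries J p \<Longrightarrow> \<forall>i\<in>?I. c i = 0"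
    "\<And>y. 0 < p \<Longrightarrow> E J p 0 y \<Longrightarrow> bd y = 0 \<Longrightarrow> \<exists>c. y - lc ?I c g \<in> boundaries J p"
    using koszul_classes[OF J] by blast
  have Eg: "E J p 0 (g i)" if "i \<in> ?I" for i using g(1) that unfolding zigzag_def by force
  let ?g = "\<lambda>i. case_prod (g i)"
  have cg: "curry (\<Sum>i\<in>?I. fscale (c i) (?g i)) = lc ?I c g" for c unfolding curry_sum by simp
  have BW: "fs.subspace ?B" using bl.subspace_image F_props(1) by blast
  obtain A where A: "finite A" "F J p \<subseteq> fs.span A" using F_props(2) by blast
  have BF: "?B \<subseteq> F J p" using E_bd by (auto simp: F_iff curry_bdu)
  have gF: "?g ` ?I \<subseteq> F J p" using Eg by (auto simp: F_iff)
  have ind: "\<forall>i\<in>?I. c i = 0" if "(\<Sum>i\<in>?I. fscale (c i) (?g i)) \<in> ?B" for c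
    using that g(2) unfolding boundaries_iff cg by blast
  show "fs.dim ?B + (d choose J) * betti_nr q \<le> fs.dim (F J p)"
    using fs_dim_extend(1)[OF BW _ A(1) F_props(1) BF gF class_index(1) ind A(2) A(1)] A(2) BF class_index(2)
    by fastforce
  show "fs.dim {f \<in> F J p. bdu f = 0} = fs.dim ?B + (d choose J) * betti_nr q" if p: "0 < p"
  proof -
    let ?Z = "{f \<in> F J p. bdu f = 0}"
    have ZW: "fs.subspace ?Z"
      by (rule fs.subspaceI) (auto simp only: mem_Collect_eq bl.zero bl.add bl.scale add_0_left fs.scale_zero_right
        intro: fs.subspace_0[OF F_props(1)] fs.subspace_add[OF F_props(1)] fs.subspace_scale[OF F_props(1)])
    have bdu0: "bdu f = 0 \<longleftrightarrow> bd (curry f) = 0" for f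
      by (auto simp: bdu_def fun_eq_iff)
    have BZ: "?B \<subseteq> ?Z"
    proof
      fix f assume f: "f \<in> ?B"
      then obtain u where u: "E J (Suc p) 0 u" "curry f = bd u" unfolding boundaries_iff boundaries_def by blast
      have "bd (curry f) = 0" unfolding u(2) by (rule bd_bd[OF u(1)])
      then show "f \<in> ?Z" using f BF bdu0 by blast
    qed
    have gZ: "?g ` ?I \<subseteq> ?Z"
    proof
      fix f assume "f \<in> ?g ` ?I"
      then obtain i where i: "i \<in> ?I" "f = ?g i" by blast
      then obtain \<zeta> where z: "zigzag J p q \<zeta>" "\<zeta> 0 = g i" "del (\<zeta> q) = 0" using g(1) by blast
      obtain p' where p': "p = Suc p'" using p by (cases p) auto
      have "bd (\<zeta> 0) = 0" using zigzag_cycle[of J p' q \<zeta>] z(1,3) J p' by simp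
      then have "bd (curry f) = 0" using z(2) i(2) by simp
      then show "f \<in> ?Z" using bdu0 gF i by blast
    qed
    have "fs.dim ?Z = fs.dim ?B + card ?I"
    proof (rule fs_dim_extend(2)[OF BW _ A(1) ZW BZ gZ class_index(1) ind])
      show "?B \<subseteq> fs.span A" using BF A(2) by blast
      show "\<exists>c. s - (\<Sum>i\<in>?I. fscale (c i) (?g i)) \<in> ?B" if s: "s \<in> ?Z" for s
      proof -
        have "E J p 0 (curry s)" "bd (curry s) = 0" using s bdu0 F_iff by blast+
        then obtain c where c: "curry s - lc ?I c g \<in> boundaries J p" using g(3) p by blast
        have "curry (s - (\<Sum>i\<in>?I. fscale (c i) (?g i))) = curry s - lc ?I c g"
          unfolding cg[symmetric] by (intro ext) simp
        then show ?thesis unfolding boundaries_iff using c by (intro exI[of _ c]) simp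
      qed
    qed
    then show ?thesis by (simp add: class_index(2))
  qed
qed

text \<open>In the alternating sum of the dimensions the boundary spaces telescope, and only the
  homology contributions remain.\<close>

lemma h_lower_bound:
  assumes d: "d = poset_rank P" and J: "J \<le> d"
  shows "int (d choose J) * (\<Sum>i\<le>J. (- 1) ^ (J - i) * int (betti_nr i)) \<le> hnum P J"
proof -
  let ?D = "\<lambda>p. int (fs.dim (F J p))" and ?b = "\<lambda>p. int (fs.dim (bdu ` F J (Suc p)))"
    and ?M = "int (d choose J)"
  interpret bl: Vector_Spaces.linear fscale fscale bdu by (rule bdu_linear)
  have D: "?D p = int ((d choose p) * hilb (J - p))" if "p \<le> J" for p
    using F_props(3) koszul_index_card(2)[OF that] by simp
  \<comment> \<open>In Koszul degree 0 every element is a cycle and the constructed classes may miss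
    part of the homology. This is the only estimate; in the higher degrees there are
    equalities.\<close>
  have D0: "?b 0 + ?M * int (betti_nr J) \<le> ?D 0"
  proof -
    have "fs.dim (bdu ` F J (Suc 0)) + (d choose J) * betti_nr J \<le> fs.dim (F J 0)" by (rule dim_cycles(1)) simp
    then show ?thesis by (metis of_nat_add of_nat_le_iff of_nat_mult)
  qed
  have DS: "?D (Suc p) = ?b (Suc p) + ?M * int (betti_nr (J - Suc p)) + ?b p" if "Suc p \<le> J" for p
  proof -
    obtain A where "finite A" "F J (Suc p) \<subseteq> fs.span A" using F_props(2) by blast
    then have "fs.dim (F J (Suc p)) = fs.dim {f \<in> F J (Suc p). bdu f = 0} + fs.dim (bdu ` F J (Suc p))"
      using fs_rank_nullity[OF bdu_linear F_props(1)] by blast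
    also have "fs.dim {f \<in> F J (Suc p). bdu f = 0}
        = fs.dim (bdu ` F J (Suc (Suc p))) + (d choose J) * betti_nr (J - Suc p)"
      using that by (intro dim_cycles(2)) auto
    finally show ?thesis by simp
  qed
  \<comment> \<open>There is no polynomial of degree -1, so the complex stops at Koszul degree
    J.\<close>
  have bJ: "?b J = 0"
  proof -
    have "F J (Suc J) = {0}" using koszul_index_card(3)[of J "Suc J"] by (auto simp: F_def fun_eq_iff)
    then have "bdu ` F J (Suc J) = {0}" using bl.zero by simp
    moreover have "fs.dim {0 :: nat set \<times> 'a idx \<Rightarrow> 'k} = 0"
      using fs.dim_span[of "{} :: (nat set \<times> 'a idx \<Rightarrow> 'k) set"]
        fs.dim_eq_card_independent[OF fs.independent_empty, where 'b="nat set \<times> 'a idx" and 'a='k] by simp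
    ultimately show ?thesis by simp
  qed
  \<comment> \<open>The boundaries entering from Koszul degree k + 1 are the term that the next
    summand cancels; the first bracket is the nonnegative defect in Koszul degree 0.\<close>
  have claim: "(\<Sum>p\<le>k. (- 1) ^ p * ?D p) = (?D 0 - ?b 0 - ?M * int (betti_nr J))
      + ?M * (\<Sum>p\<le>k. (- 1) ^ p * int (betti_nr (J - p))) + (- 1) ^ k * ?b k" if "k \<le> J" for k
    using that
  proof (induction k)
    case (Suc k)
    then have IH: "(\<Sum>p\<le>k. (- 1) ^ p * ?D p) = (?D 0 - ?b 0 - ?M * int (betti_nr J))
      + ?M * (\<Sum>p\<le>k. (- 1) ^ p * int (betti_nr (J - p))) + (- 1) ^ k * ?b k" by simp
    show ?case unfolding sum.atMost_Suc IH DS[OF Suc.prems] by (simp add: algebra_simps)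
  qed simp
  have "hnum P J = (\<Sum>p\<le>J. (- 1) ^ p * ?D p)"
    using hnum_eq_euler[of J] J d D by simp
  also have "\<dots> \<ge> ?M * (\<Sum>p\<le>J. (- 1) ^ p * int (betti_nr (J - p)))"
    unfolding claim[OF order_refl] bJ using D0 by simp
  also have "(\<Sum>p\<le>J. (- 1) ^ p * int (betti_nr (J - p))) = (\<Sum>i\<le>J. (- 1) ^ (J - i) * int (betti_nr i))"
    by (rule sum.reindex_bij_witness[of _ "\<lambda>i. J - i" "\<lambda>i. J - i"]) auto
  finally show ?thesis .
qed

end

section \<open>Quotients of polynomial rings\<close>

lemma poly_mapping_as_sum:
  "p = (\<Sum>m\<in>Poly_Mapping.keys p. Poly_Mapping.single m (Poly_Mapping.lookup p m))"
  by (rule poly_mapping_eqI) (auto simp: lookup_sum lookup_single when_def in_keys_iff)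

lemma polys_simps [simp]:
  "mult (polys W) = (*)" "one (polys W) = 1" "zero (polys W) = 0" "add (polys W) = (+)"
  by (simp_all add: polys_def)

lemma polys_carrier: "p \<in> carrier (polys W) \<longleftrightarrow> (\<forall>m\<in>Poly_Mapping.keys p. mkeys m \<subseteq> W)"
  by (simp add: polys_def)

lemma polys_closed:
  fixes p q :: "('v, 'k::field) mpoly"
  assumes "p \<in> carrier (polys W)" "q \<in> carrier (polys W)"
  shows "p + q \<in> carrier (polys W)" "p * q \<in> carrier (polys W)" "p - q \<in> carrier (polys W)"
proof -
  show "p + q \<in> carrier (polys W)" using assms Poly_Mapping.keys_add[of p q] by (auto simp: polys_carrier)
  show "p - q \<in> carrier (polys W)"
    using assms keys_diff[of p q] by (auto simp: polys_carrier)
  show "p * q \<in> carrier (polys W)" unfolding polys_carrier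
  proof
    fix m assume "m \<in> Poly_Mapping.keys (p * q)"
    then obtain a b where "m = a + b" "a \<in> Poly_Mapping.keys p" "b \<in> Poly_Mapping.keys q"
      using keys_mult[of p q] by blast
    then show "mkeys m \<subseteq> W" using assms by (auto simp: polys_carrier keys_plus_nat)
  qed
qed

lemma polys_uminus: "p \<in> carrier (polys W) \<Longrightarrow> - p \<in> carrier (polys W)"
  by (auto simp: polys_carrier in_keys_iff)

lemma polys_01: "0 \<in> carrier (polys W)" "1 \<in> carrier (polys W)"
proof -
  show "0 \<in> carrier (polys W)" by (simp add: polys_carrier)
  show "1 \<in> carrier (polys W)" unfolding polys_carrier single_one[symmetric] by (simp del: single_one)
qed

lemma const_carrier: "const c \<in> carrier (polys W)"
  by (auto simp: const_def polys_carrier split: if_splits)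

lemma var_carrier: "v \<in> W \<Longrightarrow> var v \<in> carrier (polys W)"
  by (auto simp: var_def polys_carrier)

lemma polys_sum:
  "(\<And>i. i \<in> A \<Longrightarrow> f i \<in> carrier (polys W)) \<Longrightarrow> (\<Sum>i\<in>A. f i) \<in> carrier (polys W)"
  by (induction A rule: infinite_finite_induct) (auto intro: polys_closed polys_01)

lemma polys_prod:
  "(\<And>i. i \<in> A \<Longrightarrow> f i \<in> carrier (polys W)) \<Longrightarrow> (\<Prod>i\<in>A. f i) \<in> carrier (polys W)"
  by (induction A rule: infinite_finite_induct) (auto intro: polys_closed polys_01)

lemma polys_power: "p \<in> carrier (polys W) \<Longrightarrow> p ^ n \<in> carrier (polys W)"
  by (induction n) (auto intro: polys_closed polys_01)

lemma polys_cring: "cring (polys W :: ('v, 'k::field) mpoly ring)"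
proof (rule cringI)
  show "abelian_group (polys W :: ('v, 'k) mpoly ring)"
  proof (rule abelian_groupI)
    fix x :: "('v, 'k) mpoly" assume "x \<in> carrier (polys W)"
    then show "\<exists>y\<in>carrier (polys W). y \<oplus>\<^bsub>polys W\<^esub> x = \<zero>\<^bsub>polys W\<^esub>"
      using polys_uminus by (intro bexI[of _ "- x"]) auto
  qed (auto intro: polys_closed polys_01 simp: algebra_simps)
  show "Group.comm_monoid (polys W :: ('v, 'k) mpoly ring)"
    by (rule comm_monoidI) (auto intro: polys_closed polys_01 simp: algebra_simps)
qed (auto simp: algebra_simps)

lemma polys_a_inv: 
  assumes "q \<in> carrier (polys W)" shows "\<ominus>\<^bsub>polys W\<^esub> q = - q"
proof -
  interpret R: cring "polys W" by (rule polys_cring)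
  show ?thesis using R.minus_equality[OF _ assms polys_uminus[OF assms]] by simp
qed

lemma polys_minus: "q \<in> carrier (polys W) \<Longrightarrow> p \<ominus>\<^bsub>polys W\<^esub> q = p - q"
  by (simp add: a_minus_def polys_a_inv)

locale poly_quot =
  fixes W :: "'v set" and I :: "('v, 'k::field) mpoly set" and fs :: "('v, 'k) mpoly list"
  assumes ideal: "ideal I (polys W)" and fs: "set fs \<subseteq> carrier (polys W)"
begin

abbreviation R :: "('v, 'k) mpoly ring" where "R \<equiv> polys W"
abbreviation A where "A \<equiv> R Quot I"
abbreviation Q where "Q \<equiv> seq_quot R I fs"

text \<open>The ideal I + (fs) of the polynomial ring. It is the preimage of
  \<open>seq_ideal\<close>, so that questions about the iterated quotient become membership
  questions for polynomials.\<close>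

definition L :: "('v, 'k) mpoly set" where
  "L = {p \<in> carrier R. \<exists>g. (\<forall>i<length fs. g i \<in> carrier R) \<and> p - (\<Sum>i<length fs. g i * fs ! i) \<in> I}"

sublocale R: cring R by (rule polys_cring)
sublocale I: ideal I R by (rule ideal)
sublocale A: cring A by (rule I.quotient_is_cring) (rule polys_cring)
sublocale rh: ring_hom_ring R A "(+>\<^bsub>R\<^esub>) I" by (rule I.rcos_ring_hom_ring)

lemma I_closed:
  "p \<in> I \<Longrightarrow> q \<in> I \<Longrightarrow> p + q \<in> I" "p \<in> I \<Longrightarrow> q \<in> carrier R \<Longrightarrow> q * p \<in> I" "0 \<in> I" "p \<in> I \<Longrightarrow> p \<in> carrier R"
  "p \<in> I \<Longrightarrow> - p \<in> I" "p \<in> I \<Longrightarrow> q \<in> I \<Longrightarrow> p - q \<in> I"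
proof -
  show 1: "p \<in> I \<Longrightarrow> q \<in> I \<Longrightarrow> p + q \<in> I" for p q using I.a_closed by simp
  show "p \<in> I \<Longrightarrow> q \<in> carrier R \<Longrightarrow> q * p \<in> I" using I.I_l_closed by simp
  show "0 \<in> I" using I.zero_closed by simp
  show 2: "p \<in> I \<Longrightarrow> p \<in> carrier R" for p using I.Icarr .
  show 3: "p \<in> I \<Longrightarrow> - p \<in> I" for p using I.a_inv_closed[of p] polys_a_inv[of p W] 2[of p] by simp
  show "p \<in> I \<Longrightarrow> q \<in> I \<Longrightarrow> p - q \<in> I" using 1[OF _ 3, of p q] by simp
qed

lemma fs_nth: "i < length fs \<Longrightarrow> fs ! i \<in> carrier R"
  using fs by auto

lemma coset_eq_iff:
  assumes "p \<in> carrier R" "q \<in> carrier R"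
  shows "I +>\<^bsub>R\<^esub> p = I +>\<^bsub>R\<^esub> q \<longleftrightarrow> p - q \<in> I"
  using R.quotient_eq_iff_same_a_r_cos[OF ideal assms] polys_minus[OF assms(2), of p] by simp

lemma L_ideal: "ideal L R"
proof (rule idealI)
  show "ring R" by (rule R.ring_axioms)
  have mult: "q * p \<in> L" if "p \<in> L" "q \<in> carrier R" for p q
  proof -
    obtain g where g: "p \<in> carrier R" "\<forall>i<length fs. g i \<in> carrier R" "p - (\<Sum>i<length fs. g i * fs ! i) \<in> I"
      using \<open>p \<in> L\<close> by (auto simp: L_def)
    have "q * (p - (\<Sum>i<length fs. g i * fs ! i)) \<in> I" using I_closed(2) g(3) that(2) by blast
    then have "q * p - (\<Sum>i<length fs. (q * g i) * fs ! i) \<in> I"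
      by (simp add: right_diff_distrib sum_distrib_left mult.assoc)
    then show ?thesis unfolding L_def using g that by (auto intro!: polys_closed exI[of _ "\<lambda>i. q * g i"])
  qed
  have add: "p + q \<in> L" if pq: "p \<in> L" "q \<in> L" for p q
  proof -
    obtain g where g: "p \<in> carrier R" "\<forall>i<length fs. g i \<in> carrier R" "p - (\<Sum>i<length fs. g i * fs ! i) \<in> I"
      using pq by (auto simp: L_def)
    obtain h where h: "q \<in> carrier R" "\<forall>i<length fs. h i \<in> carrier R" "q - (\<Sum>i<length fs. h i * fs ! i) \<in> I"
      using pq by (auto simp: L_def)
    have "(p - (\<Sum>i<length fs. g i * fs ! i)) + (q - (\<Sum>i<length fs. h i * fs ! i)) \<in> I" using I_closed(1) g(3) h(3) by blast
    then have "p + q - (\<Sum>i<length fs. (g i + h i) * fs ! i) \<in> I"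
      by (simp add: distrib_right sum.distrib algebra_simps)
    then show ?thesis unfolding L_def using g h by (auto intro!: polys_closed exI[of _ "\<lambda>i. g i + h i"])
  qed
  have zero: "0 \<in> L" unfolding L_def using polys_01 I_closed(3) by (auto intro!: exI[of _ "\<lambda>_. 0"])
  have carr: "p \<in> L \<Longrightarrow> p \<in> carrier R" for p by (simp add: L_def)
  show "subgroup L (add_monoid R)"
  proof (rule R.add.subgroupI)
    show "\<ominus>\<^bsub>R\<^esub> p \<in> L" if "p \<in> L" for p
    proof -
      have "- 1 \<in> carrier R" using polys_uminus polys_01(2) by blast
      then have "- 1 * p \<in> L" using mult that by blast
      then show ?thesis using polys_a_inv[of p W] carr that by simp
    qed
  qed (use zero add carr in auto)
  show "x \<otimes>\<^bsub>R\<^esub> a \<in> L" if "a \<in> L" "x \<in> carrier R" for a x using mult that by simp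
  show "a \<otimes>\<^bsub>R\<^esub> x \<in> L" if "a \<in> L" "x \<in> carrier R" for a x using mult that by (simp add: mult.commute)
qed

lemma I_subset_L: "p \<in> I \<Longrightarrow> p \<in> L"
  unfolding L_def using I_closed(4) polys_01 by (auto intro!: exI[of _ "\<lambda>_. 0"])

lemma L_closed:
  "p \<in> L \<Longrightarrow> q \<in> L \<Longrightarrow> p + q \<in> L" "p \<in> L \<Longrightarrow> q \<in> carrier R \<Longrightarrow> q * p \<in> L" "0 \<in> L" "p \<in> L \<Longrightarrow> p \<in> carrier R"
  "p \<in> L \<Longrightarrow> q \<in> L \<Longrightarrow> p - q \<in> L"
proof -
  interpret L: ideal L R by (rule L_ideal)
  show 1: "p \<in> L \<Longrightarrow> q \<in> L \<Longrightarrow> p + q \<in> L" for p q using L.a_closed by simp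
  show 2: "p \<in> L \<Longrightarrow> q \<in> carrier R \<Longrightarrow> q * p \<in> L" for p q using L.I_l_closed by simp
  show "0 \<in> L" using L.zero_closed by simp
  show "p \<in> L \<Longrightarrow> p \<in> carrier R" for p using L.Icarr .
  have "- 1 \<in> carrier R" by (rule polys_uminus[OF polys_01(2)])
  then show "p - q \<in> L" if pq: "p \<in> L" "q \<in> L" for p q
    using 1[OF pq(1) 2[OF pq(2), of "- 1"]] by simp
qed

lemma fs_in_L: "i < length fs \<Longrightarrow> fs ! i \<in> L"
proof -
  assume i: "i < length fs"
  have "(\<Sum>j<length fs. (if j = i then 1 else 0) * fs ! j) = (\<Sum>j<length fs. if j = i then fs ! j else 0)"
    by (rule sum.cong) auto
  also have "\<dots> = fs ! i" using i by simp
  finally show ?thesis unfolding L_def using fs_nth[OF i] polys_01 I_closed(3)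
    by (auto intro!: exI[of _ "\<lambda>j. if j = i then 1 else 0"])
qed

lemma seq_ideal_eq: "seq_ideal R I fs = (\<lambda>p. I +>\<^bsub>R\<^esub> p) ` L"
proof
  let ?S = "(\<lambda>f. I +>\<^bsub>R\<^esub> f) ` set fs"
  have S: "?S \<subseteq> carrier A" using fs rh.hom_closed by blast
  have idl: "ideal ((\<lambda>p. I +>\<^bsub>R\<^esub> p) ` L) A"
  proof (rule idealI)
    show "ring A" by (rule A.ring_axioms)
    show "subgroup ((\<lambda>p. I +>\<^bsub>R\<^esub> p) ` L) (add_monoid A)"
    proof (rule A.add.subgroupI)
      show "(\<lambda>p. I +>\<^bsub>R\<^esub> p) ` L \<subseteq> carrier A" using rh.hom_closed L_closed(4) by blast
      show "(\<lambda>p. I +>\<^bsub>R\<^esub> p) ` L \<noteq> {}" using L_closed(3) by blast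
      show "\<ominus>\<^bsub>A\<^esub> a \<in> (\<lambda>p. I +>\<^bsub>R\<^esub> p) ` L" if a: "a \<in> (\<lambda>p. I +>\<^bsub>R\<^esub> p) ` L" for a
      proof -
        obtain p where p: "p \<in> L" "a = I +>\<^bsub>R\<^esub> p" using a by blast
        have "\<ominus>\<^bsub>A\<^esub> a = I +>\<^bsub>R\<^esub> (\<ominus>\<^bsub>R\<^esub> p)" using rh.hom_a_inv[of p] p L_closed(4) by simp
        moreover have "\<ominus>\<^bsub>R\<^esub> p = 0 - p" using polys_a_inv[of p W] p L_closed(4) by simp
        moreover have "0 - p \<in> L" using L_closed(5)[OF L_closed(3) p(1)] .
        ultimately show ?thesis by simp
      qed
      show "a \<oplus>\<^bsub>A\<^esub> b \<in> (\<lambda>p. I +>\<^bsub>R\<^esub> p) ` L" if ab: "a \<in> (\<lambda>p. I +>\<^bsub>R\<^esub> p) ` L" "b \<in> (\<lambda>p. I +>\<^bsub>R\<^esub> p) ` L" for a b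
      proof -
        obtain p q where p: "p \<in> L" "a = I +>\<^bsub>R\<^esub> p" "q \<in> L" "b = I +>\<^bsub>R\<^esub> q" using ab by blast
        then have "a \<oplus>\<^bsub>A\<^esub> b = I +>\<^bsub>R\<^esub> (p + q)" using rh.hom_add[of p q] L_closed(4) by simp
        then show ?thesis using L_closed(1) p by blast
      qed
    qed
    fix a x assume ax: "a \<in> (\<lambda>p. I +>\<^bsub>R\<^esub> p) ` L" "x \<in> carrier A"
    obtain p where p: "p \<in> L" "a = I +>\<^bsub>R\<^esub> p" using ax by blast
    obtain q where q: "q \<in> carrier R" "x = I +>\<^bsub>R\<^esub> q" using ax by (auto simp: FactRing_def A_RCOSETS_def')
    have e: "x \<otimes>\<^bsub>A\<^esub> a = I +>\<^bsub>R\<^esub> (q * p)" using rh.hom_mult[of q p] p q L_closed(4) by simp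
    then show "x \<otimes>\<^bsub>A\<^esub> a \<in> (\<lambda>p. I +>\<^bsub>R\<^esub> p) ` L" using L_closed(2) p q by blast
    moreover have "a \<in> carrier A" using p rh.hom_closed L_closed(4) by blast
    ultimately show "a \<otimes>\<^bsub>A\<^esub> x \<in> (\<lambda>p. I +>\<^bsub>R\<^esub> p) ` L" using A.m_comm ax(2) by simp
  qed
  have "?S \<subseteq> (\<lambda>p. I +>\<^bsub>R\<^esub> p) ` L" using fs_in_L by (auto simp: in_set_conv_nth)
  then show "seq_ideal R I fs \<subseteq> (\<lambda>p. I +>\<^bsub>R\<^esub> p) ` L"
    unfolding seq_ideal_def using A.genideal_minimal[OF idl] by blast
  show "(\<lambda>p. I +>\<^bsub>R\<^esub> p) ` L \<subseteq> seq_ideal R I fs"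
  proof
    fix y assume "y \<in> (\<lambda>p. I +>\<^bsub>R\<^esub> p) ` L"
    then obtain p g where p: "p \<in> carrier R" "y = I +>\<^bsub>R\<^esub> p" "\<forall>i<length fs. g i \<in> carrier R"
      "p - (\<Sum>i<length fs. g i * fs ! i) \<in> I" by (auto simp: L_def)
    interpret G: ideal "seq_ideal R I fs" A unfolding seq_ideal_def by (rule A.genideal_ideal[OF S])
    have gen: "I +>\<^bsub>R\<^esub> (fs ! i) \<in> seq_ideal R I fs" if "i < length fs" for i
      unfolding seq_ideal_def using A.genideal_self[OF S] that by auto
    have "I +>\<^bsub>R\<^esub> (\<Sum>i<n. g i * fs ! i) \<in> seq_ideal R I fs \<and> (\<Sum>i<n. g i * fs ! i) \<in> carrier R" if "n \<le> length fs" for n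
      using that
    proof (induction n)
      case 0
      then show ?case using G.zero_closed rh.hom_zero polys_01 by simp
    next
      case (Suc n)
      then have c: "g n \<in> carrier R" "fs ! n \<in> carrier R" "(\<Sum>i<n. g i * fs ! i) \<in> carrier R"
        using p(3) fs_nth by auto
      have "(I +>\<^bsub>R\<^esub> g n) \<otimes>\<^bsub>A\<^esub> (I +>\<^bsub>R\<^esub> (fs ! n)) \<in> seq_ideal R I fs"
        using Suc c gen rh.hom_closed by (intro G.I_l_closed) auto
      then have "I +>\<^bsub>R\<^esub> (g n * fs ! n) \<in> seq_ideal R I fs" using rh.hom_mult[OF c(1,2)] by simp
      then have "(I +>\<^bsub>R\<^esub> (\<Sum>i<n. g i * fs ! i)) \<oplus>\<^bsub>A\<^esub> (I +>\<^bsub>R\<^esub> (g n * fs ! n)) \<in> seq_ideal R I fs"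
        using G.a_closed Suc by simp
      moreover have gf: "g n * fs ! n \<in> carrier R" using polys_closed(2) c by blast
      ultimately show ?case using rh.hom_add[OF c(3) gf] polys_closed(1)[OF c(3) gf] by simp
    qed
    then have "I +>\<^bsub>R\<^esub> (\<Sum>i<length fs. g i * fs ! i) \<in> seq_ideal R I fs" "(\<Sum>i<length fs. g i * fs ! i) \<in> carrier R" by auto
    then show "y \<in> seq_ideal R I fs" using coset_eq_iff[OF p(1)] p by metis
  qed
qed

lemma seq_ideal_iff: "p \<in> carrier R \<Longrightarrow> I +>\<^bsub>R\<^esub> p \<in> seq_ideal R I fs \<longleftrightarrow> p \<in> L"
proof
  assume p: "p \<in> carrier R" "I +>\<^bsub>R\<^esub> p \<in> seq_ideal R I fs"
  then obtain q where q: "q \<in> L" "I +>\<^bsub>R\<^esub> p = I +>\<^bsub>R\<^esub> q" unfolding seq_ideal_eq by blast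
  then have "p - q \<in> L" using coset_eq_iff[OF p(1)] L_closed(4) I_subset_L by blast
  then show "p \<in> L" using L_closed(1)[OF _ q(1), of "p - q"] by simp
qed (simp add: seq_ideal_eq)

lemma seq_ideal_ideal: "ideal (seq_ideal R I fs) A"
  unfolding seq_ideal_def by (rule A.genideal_ideal) (use fs rh.hom_closed in blast)

lemma class_hom: "ring_hom_ring R Q (seq_class R I fs)"
proof -
  interpret J: ideal "seq_ideal R I fs" A by (rule seq_ideal_ideal)
  have "(\<lambda>p. seq_ideal R I fs +>\<^bsub>A\<^esub> (I +>\<^bsub>R\<^esub> p)) \<in> ring_hom R Q"
    using ring_hom_trans[OF I.rcos_ring_hom J.rcos_ring_hom] by (simp add: seq_quot_def comp_def)
  moreover have "seq_class R I fs = (\<lambda>p. seq_ideal R I fs +>\<^bsub>A\<^esub> (I +>\<^bsub>R\<^esub> p))" by (intro ext) (simp add: seq_class_def)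
  ultimately show ?thesis
    using J.quotient_is_ring R.ring_axioms by (intro ring_hom_ringI2) (simp_all add: seq_quot_def)
qed

sublocale cl: ring_hom_ring R Q "seq_class R I fs" by (rule class_hom)

lemma Q_carrier: "carrier Q = seq_class R I fs ` carrier R"
proof -
  have "carrier Q = (\<lambda>y. seq_ideal R I fs +>\<^bsub>A\<^esub> y) ` carrier A"
    by (auto simp: seq_quot_def FactRing_def A_RCOSETS_def')
  moreover have "carrier A = (\<lambda>p. I +>\<^bsub>R\<^esub> p) ` carrier R"
    by (auto simp: FactRing_def A_RCOSETS_def')
  ultimately show ?thesis by (auto simp: seq_class_def)
qed

lemma class_0_iff:
  assumes "p \<in> carrier R" shows "seq_class R I fs p = \<zero>\<^bsub>Q\<^esub> \<longleftrightarrow> p \<in> L"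
proof -
  interpret J: ideal "seq_ideal R I fs" A by (rule seq_ideal_ideal)
  have c: "I +>\<^bsub>R\<^esub> p \<in> carrier A" using rh.hom_closed assms by simp
  have "\<zero>\<^bsub>Q\<^esub> = seq_ideal R I fs" by (simp add: seq_quot_def FactRing_def)
  then have "seq_class R I fs p = \<zero>\<^bsub>Q\<^esub> \<longleftrightarrow> I +>\<^bsub>R\<^esub> p \<in> seq_ideal R I fs"
    unfolding seq_class_def using J.a_rcos_const J.a_rcos_self[OF c] by auto
  then show ?thesis using seq_ideal_iff[OF assms] by simp
qed

lemma consts_subfield: "subfield (range const) R"
proof (rule R.subfieldI)
  have cadd: "const a + const b = (const (a + b) :: ('v, 'k) mpoly)" for a b by (simp add: const_def single_add)
  have cmult: "const a * const b = (const (a * b) :: ('v, 'k) mpoly)" for a b by (simp add: const_def mult_single)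
  have cneg: "- const a = (const (- a) :: ('v, 'k) mpoly)" for a by (simp add: const_def single_uminus)
  have c1: "const 1 = (1 :: ('v, 'k) mpoly)" by (simp add: const_def)
  show "subcring (range const) R"
  proof (rule R.subcringI')
    show "subring (range const) R"
    proof (rule R.subringI)
      show "range const \<subseteq> carrier R" using const_carrier by blast
      show "\<one>\<^bsub>R\<^esub> \<in> range const" unfolding polys_simps c1[symmetric] by (rule rangeI)
      fix h assume "h \<in> range (const :: 'k \<Rightarrow> ('v, 'k) mpoly)"
      then obtain a where a: "h = const a" by blast
      show "\<ominus>\<^bsub>R\<^esub> h \<in> range const" unfolding a polys_a_inv[OF const_carrier] cneg by blast
    next
      fix h1 h2 assume "h1 \<in> range (const :: 'k \<Rightarrow> ('v, 'k) mpoly)" "h2 \<in> range (const :: 'k \<Rightarrow> ('v, 'k) mpoly)"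
      then obtain a b where ab: "h1 = const a" "h2 = const b" by blast
      show "h1 \<otimes>\<^bsub>R\<^esub> h2 \<in> range const" "h1 \<oplus>\<^bsub>R\<^esub> h2 \<in> range const" by (simp_all add: ab cadd cmult)
    qed
  qed
  show "Units (R\<lparr>carrier := range const\<rparr>) = range const - {\<zero>\<^bsub>R\<^esub>}"
  proof (intro equalityI subsetI)
    fix h assume "h \<in> range (const :: 'k \<Rightarrow> ('v, 'k) mpoly) - {\<zero>\<^bsub>R\<^esub>}"
    then obtain a where a: "h = const a" "h \<noteq> 0" by auto
    then have "a \<noteq> 0" by (auto simp: const_def)
    then have "const (inverse a) * h = 1" "h * const (inverse a) = 1" by (simp_all add: a(1) cmult c1)
    then show "h \<in> Units (R\<lparr>carrier := range const\<rparr>)"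
      using a(1) unfolding Units_def by (auto intro!: bexI[of _ "const (inverse a)"])
  qed (auto simp: Units_def)
qed

lemma scalars_eq: "scalars R I fs = seq_class R I fs ` range const"
  by (auto simp: scalars_def)

text \<open>The hypothesis excludes the zero ring, in which the image of the ground field is not a
  field.\<close>

lemma scalars_subfield: "1 \<notin> L \<Longrightarrow> subfield (scalars R I fs) Q"
  unfolding scalars_eq
  using cl.img_is_subfield(2)[OF consts_subfield] class_0_iff[OF polys_01(2)] cl.hom_one by simp

lemma class_const_0_iff: "1 \<notin> L \<Longrightarrow> seq_class R I fs (const c) = \<zero>\<^bsub>Q\<^esub> \<longleftrightarrow> c = 0"
proof -
  assume 1: "1 \<notin> L"
  have "c = 0" if "const c \<in> L"
  proof (rule ccontr)
    assume "c \<noteq> 0"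
    then have "const (inverse c) * const c = (1 :: ('v, 'k) mpoly)" by (simp add: const_def mult_single)
    then show False using L_closed(2)[OF that const_carrier, of "inverse c"] 1 by simp
  qed
  moreover have "const (0 :: 'k) = (0 :: ('v, 'k) mpoly)" by (simp add: const_def)
  ultimately show ?thesis using class_0_iff[OF const_carrier, of c] L_closed(3) by auto
qed

lemma combine_class:
  assumes "set ps \<subseteq> carrier R" "set Ks \<subseteq> scalars R I fs" "length Ks = length ps"
  shows "\<exists>cs. length cs = length ps \<and> Ks = map (\<lambda>c. seq_class R I fs (const c)) cs \<and>
    ring.combine Q Ks (map (seq_class R I fs) ps) = seq_class R I fs (\<Sum>i<length ps. const (cs ! i) * ps ! i)"
  using assms
proof (induction ps arbitrary: Ks)
  case Nil
  show ?case using Nil cl.hom_zero by simp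
next
  case (Cons p ps)
  obtain k Ks' where Ks: "Ks = k # Ks'" using Cons.prems(3) by (cases Ks) auto
  then obtain cs where cs: "length cs = length ps" "Ks' = map (\<lambda>c. seq_class R I fs (const c)) cs"
    "cl.S.combine Ks' (map (seq_class R I fs) ps) = seq_class R I fs (\<Sum>i<length ps. const (cs ! i) * ps ! i)"
    using Cons.IH[of Ks'] Cons.prems by auto
  obtain c where c: "k = seq_class R I fs (const c)" using Cons.prems(2) Ks by (auto simp: scalars_def)
  have p: "p \<in> carrier R" "(\<Sum>i<length ps. const (cs ! i) * ps ! i) \<in> carrier R" "const c * p \<in> carrier R"
    using Cons.prems(1) by (auto intro!: polys_sum polys_closed const_carrier dest: nth_mem)
  have "cl.S.combine Ks (map (seq_class R I fs) (p # ps)) =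
      seq_class R I fs (const c * p + (\<Sum>i<length ps. const (cs ! i) * ps ! i))"
    using cl.hom_add[OF p(3,2)] cl.hom_mult[OF const_carrier p(1), of c] by (simp add: Ks c cs(3))
  also have "const c * p + (\<Sum>i<length ps. const (cs ! i) * ps ! i) = (\<Sum>i<length (p # ps). const ((c # cs) ! i) * (p # ps) ! i)"
    by (simp add: sum.lessThan_Suc_shift del: sum.lessThan_Suc)
  finally show ?case using cs Ks c by (intro exI[of _ "c # cs"]) simp
qed

lemma independentI:
  assumes "1 \<notin> L" "set ps \<subseteq> carrier R"
    and ind: "\<And>cs. length cs = length ps \<Longrightarrow> (\<Sum>i<length ps. const (cs ! i) * ps ! i) \<in> L \<Longrightarrow> \<forall>i<length ps. cs ! i = 0"
  shows "ring.independent Q (scalars R I fs) (map (seq_class R I fs) ps)"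
proof -
  let ?K = "scalars R I fs" and ?Us = "map (seq_class R I fs) ps"
  have Us: "set ?Us \<subseteq> carrier Q" using assms(2) Q_carrier by auto
  have z: "\<zero>\<^bsub>Q\<^esub> \<in> ?K" using subfieldE(1)[OF scalars_subfield[OF assms(1)]] subringE(2) by blast
  show ?thesis
  proof (rule cl.S.trivial_combine_imp_independent[OF scalars_subfield[OF assms(1)] Us])
    fix Ks assume Ks: "set Ks \<subseteq> ?K" "cl.S.combine Ks ?Us = \<zero>\<^bsub>Q\<^esub>"
    have "set Ks \<subseteq> carrier Q" using Ks(1) subfieldE(3)[OF scalars_subfield[OF assms(1)]] by blast
    then obtain Ks' where Ks': "set (take (length ?Us) Ks) \<subseteq> set Ks'" "set Ks' \<subseteq> set (take (length ?Us) Ks) \<union> {\<zero>\<^bsub>Q\<^esub>}"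
      "length Ks' = length ?Us" "cl.S.combine Ks' ?Us = \<zero>\<^bsub>Q\<^esub>"
      by (rule cl.S.combine_normalize[OF _ Us Ks(2)])
    have "set Ks' \<subseteq> ?K" using Ks'(2) Ks(1) z set_take_subset[of "length ?Us" Ks] by blast
    then obtain cs where cs: "length cs = length ps" "Ks' = map (\<lambda>c. seq_class R I fs (const c)) cs"
      "cl.S.combine Ks' ?Us = seq_class R I fs (\<Sum>i<length ps. const (cs ! i) * ps ! i)"
    proof -
      have "length Ks' = length ps" using Ks'(3) by simp
      from combine_class[OF assms(2) \<open>set Ks' \<subseteq> ?K\<close> this] that show thesis by blast
    qed
    have "(\<Sum>i<length ps. const (cs ! i) * ps ! i) \<in> carrier R"
      using assms(2) by (auto intro!: polys_sum polys_closed const_carrier dest: nth_mem)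
    then have "(\<Sum>i<length ps. const (cs ! i) * ps ! i) \<in> L" using Ks'(4) cs(3) class_0_iff by simp
    then have c0: "\<forall>i<length ps. cs ! i = 0" using ind[OF cs(1)] by blast
    have z0: "seq_class R I fs (const 0) = \<zero>\<^bsub>Q\<^esub>" using class_const_0_iff[OF assms(1), of 0] by simp
    have "set Ks' \<subseteq> {\<zero>\<^bsub>Q\<^esub>}"
    proof
      fix k assume "k \<in> set Ks'"
      then obtain i where i: "i < length cs" "k = seq_class R I fs (const (cs ! i))"
        using cs(2) by (metis in_set_conv_nth length_map nth_map)
      have "cs ! i = 0" using c0 i(1) cs(1) by simp
      then show "k \<in> {\<zero>\<^bsub>Q\<^esub>}" using i(2) z0 by simp
    qed
    then show "set (take (length ?Us) Ks) \<subseteq> {\<zero>\<^bsub>Q\<^esub>}" using Ks'(1) by blast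
  qed
qed

text \<open>Finite dimension in the form used for parameters: sufficiently many polynomials satisfy
  a nontrivial linear relation modulo L.\<close>

lemma finite_dim_dependent:
  assumes "1 \<notin> L" "finite_dim_quot R I fs"
  shows "\<exists>n. \<forall>ps. set ps \<subseteq> carrier R \<longrightarrow> n < length ps \<longrightarrow>
    (\<exists>cs. length cs = length ps \<and> (\<Sum>i<length ps. const (cs ! i) * ps ! i) \<in> L \<and> (\<exists>i<length ps. cs ! i \<noteq> 0))"
proof -
  obtain n where n: "cl.S.dimension n (scalars R I fs) (carrier Q)"
    using assms(2) unfolding finite_dim_quot_def cl.S.finite_dimension_def by blast
  have "\<exists>cs. length cs = length ps \<and> (\<Sum>i<length ps. const (cs ! i) * ps ! i) \<in> L \<and> (\<exists>i<length ps. cs ! i \<noteq> 0)"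
    if ps: "set ps \<subseteq> carrier R" "n < length ps" for ps
  proof (rule ccontr)
    assume "\<not> ?thesis"
    then have "cl.S.independent (scalars R I fs) (map (seq_class R I fs) ps)"
      using independentI[OF assms(1) ps(1)] by blast
    moreover have "set (map (seq_class R I fs) ps) \<subseteq> carrier Q" using ps(1) Q_carrier by auto
    ultimately have "length (map (seq_class R I fs) ps) \<le> n"
      using cl.S.independent_length_le_dimension[OF scalars_subfield[OF assms(1)] n] by blast
    then show False using ps(2) by simp
  qed
  then show ?thesis by blast
qed

lemma finite_dim_quotI:
  assumes "1 \<notin> L" "finite B" "B \<subseteq> carrier R"
    and sp: "\<And>m. mkeys m \<subseteq> W \<Longrightarrow> Poly_Mapping.single m 1 \<in> L \<or> Poly_Mapping.single m 1 \<in> B"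
  shows "finite_dim_quot R I fs"
proof -
  let ?K = "scalars R I fs" and ?h = "seq_class R I fs"
  note K = scalars_subfield[OF assms(1)]
  obtain bs :: "('v, 'k) mpoly list" where bs: "set bs = B" using assms(2) finite_list by blast
  let ?Us = "map ?h bs"
  have Us: "set ?Us \<subseteq> carrier Q" using bs assms(3) Q_carrier by auto
  have "carrier Q \<subseteq> cl.S.Span ?K ?Us"
  proof
    fix y assume "y \<in> carrier Q"
    then obtain p where p: "p \<in> carrier R" "y = ?h p" using Q_carrier by blast
    have mono: "?h (Poly_Mapping.single m c) \<in> cl.S.Span ?K ?Us" if m: "mkeys m \<subseteq> W" for m c
    proof -
      have mc: "Poly_Mapping.single m 1 \<in> carrier R" using m by (simp add: polys_carrier)
      have "?h (Poly_Mapping.single m 1) \<in> cl.S.Span ?K ?Us"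
      proof (cases "Poly_Mapping.single m 1 \<in> L")
        case True
        then have "?h (Poly_Mapping.single m 1) = \<zero>\<^bsub>Q\<^esub>" using class_0_iff mc by blast
        then show ?thesis using cl.S.Span_subgroup_props(2)[OF K Us] by simp
      next
        case False
        then have "?h (Poly_Mapping.single m 1) \<in> set ?Us" using sp[OF m] bs by auto
        then show ?thesis using cl.S.Span_base_incl[OF K Us] by blast
      qed
      moreover have "?h (const c) \<in> ?K" by (simp add: scalars_def)
      ultimately have "?h (const c) \<otimes>\<^bsub>Q\<^esub> ?h (Poly_Mapping.single m 1) \<in> cl.S.Span ?K ?Us"
        using cl.S.Span_smult_closed[OF K Us] by blast
      moreover have "const c * Poly_Mapping.single m 1 = Poly_Mapping.single m c" by (simp add: const_def mult_single)
      ultimately show ?thesis using cl.hom_mult[OF const_carrier mc, of c] by simp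
    qed
    have sums: "?h (\<Sum>m\<in>M. Poly_Mapping.single m (Poly_Mapping.lookup p m)) \<in> cl.S.Span ?K ?Us"
      if "finite M" "M \<subseteq> Poly_Mapping.keys p" for M
      using that
    proof (induction M rule: finite_induct)
      case empty
      then show ?case using cl.S.Span_subgroup_props(2)[OF K Us] cl.hom_zero by simp
    next
      case (insert m M)
      have mW: "mkeys m \<subseteq> W" using insert.prems p(1) by (auto simp: polys_carrier)
      have c: "Poly_Mapping.single m (Poly_Mapping.lookup p m) \<in> carrier R" using mW by (simp add: polys_carrier)
      have c': "(\<Sum>m\<in>M. Poly_Mapping.single m (Poly_Mapping.lookup p m)) \<in> carrier R"
        using insert.prems p(1) by (intro polys_sum) (auto simp: polys_carrier)
      show ?case using insert cl.hom_add[OF c c'] mono[OF mW] cl.S.Span_subgroup_props(3)[OF K Us] by simp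
    qed
    have "(\<Sum>m\<in>Poly_Mapping.keys p. Poly_Mapping.single m (Poly_Mapping.lookup p m)) = p"
      by (rule poly_mapping_as_sum[symmetric])
    then show "y \<in> cl.S.Span ?K ?Us" using p(2) sums[OF finite_keys order_refl] by simp
  qed
  then have "cl.S.Span ?K ?Us = carrier Q" using cl.S.Span_subgroup_props(1)[OF K Us] by blast
  then show ?thesis unfolding finite_dim_quot_def using cl.S.Span_finite_dimension[OF K Us] by simp
qed

end

section \<open>The monomial basis of the face ring\<close>

text \<open>Evaluation of a polynomial through a coefficient map h and a multiplicative map g on
  monomials. It serves both the restriction to a face and the evaluation along a line.\<close>

definition mev :: "('k::field \<Rightarrow> 'r::comm_ring_1) \<Rightarrow> (('v \<Rightarrow>\<^sub>0 nat) \<Rightarrow> 'r) \<Rightarrow> ('v, 'k) mpoly \<Rightarrow> 'r" where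
  "mev h g p = (\<Sum>m\<in>Poly_Mapping.keys p. h (Poly_Mapping.lookup p m) * g m)"

locale monomial_evaluation =
  fixes h :: "'k::field \<Rightarrow> 'r::comm_ring_1" and g :: "('v \<Rightarrow>\<^sub>0 nat) \<Rightarrow> 'r"
  assumes h: "h 0 = 0" "h 1 = 1" "\<And>a b. h (a + b) = h a + h b" "\<And>a b. h (a * b) = h a * h b"
    and g: "g 0 = 1" "\<And>m m'. g (m + m') = g m * g m'"
begin

lemma superset:
  assumes "finite A" "Poly_Mapping.keys p \<subseteq> A"
  shows "mev h g p = (\<Sum>m\<in>A. h (Poly_Mapping.lookup p m) * g m)"
  unfolding mev_def using assms by (intro sum.mono_neutral_left) (auto simp: in_keys_iff h)

lemma add: "mev h g (p + q) = mev h g p + mev h g q"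
proof -
  let ?A = "Poly_Mapping.keys p \<union> Poly_Mapping.keys q"
  have "Poly_Mapping.keys (p + q) \<subseteq> ?A" by (rule Poly_Mapping.keys_add)
  then show ?thesis by (simp add: superset[of ?A] lookup_add h distrib_right sum.distrib)
qed

lemma single: "mev h g (Poly_Mapping.single m a) = h a * g m"
  by (cases "a = 0") (auto simp: mev_def h)

lemma zero: "mev h g 0 = 0" by (simp add: mev_def)

lemma one: "mev h g 1 = 1"
  using single[of 0 1] by (simp add: g h)

lemma sum: "mev h g (\<Sum>i\<in>I. f i) = (\<Sum>i\<in>I. mev h g (f i))"
  by (induction I rule: infinite_finite_induct) (auto simp: zero add)

lemma mult: "mev h g (p * q) = mev h g p * mev h g q"
proof -
  have "p * q = (\<Sum>m\<in>Poly_Mapping.keys p. \<Sum>m'\<in>Poly_Mapping.keys q.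
      Poly_Mapping.single m (Poly_Mapping.lookup p m) * Poly_Mapping.single m' (Poly_Mapping.lookup q m'))"
    unfolding sum_product[symmetric] poly_mapping_as_sum[symmetric] ..
  then have "mev h g (p * q) = (\<Sum>m\<in>Poly_Mapping.keys p. \<Sum>m'\<in>Poly_Mapping.keys q.
      (h (Poly_Mapping.lookup p m) * g m) * (h (Poly_Mapping.lookup q m') * g m'))"
    by (simp add: sum mult_single single h g mult_ac)
  then show ?thesis by (simp add: mev_def sum_product)
qed

lemma uminus: "mev h g (- p) = - mev h g p"
proof -
  have "mev h g (p + - p) = 0" by (simp add: zero)
  then show ?thesis unfolding add by (simp add: add_eq_0_iff)
qed

lemma diff: "mev h g (p - q) = mev h g p - mev h g q"
  using add[of p "- q"] by (simp add: uminus)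

lemma power: "mev h g (p ^ n) = mev h g p ^ n"
  by (induction n) (auto simp: one mult)

end

definition ind :: "'v set \<Rightarrow> 'v \<Rightarrow>\<^sub>0 nat" where
  "ind A = (\<Sum>v\<in>A. esingle v)"

lemma lookup_ind: "finite A \<Longrightarrow> Poly_Mapping.lookup (ind A) v = (if v \<in> A then 1 else 0)"
  by (simp add: ind_def lookup_sum lookup_single when_def)

lemma keys_ind: "finite A \<Longrightarrow> mkeys (ind A) = A"
  by (auto simp: in_keys_iff lookup_ind split: if_splits)

lemma lookup_var_times:
  fixes p :: "('v, 'k::field) mpoly"
  shows "Poly_Mapping.lookup (Poly_Mapping.single a 1 * p) m
    = (if \<exists>b. m = a + b then Poly_Mapping.lookup p (m - a) else 0)"
proof -
  have c: "(a + x = a + b) = (x = b)" for x b by simp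
  have "Poly_Mapping.single a 1 * p = (\<Sum>x\<in>Poly_Mapping.keys p. Poly_Mapping.single (a + x) (Poly_Mapping.lookup p x))"
  proof -
    have "p = (\<Sum>m\<in>Poly_Mapping.keys p. Poly_Mapping.single m (Poly_Mapping.lookup p m))"
      by (rule poly_mapping_as_sum)
    then have "Poly_Mapping.single a 1 * p = Poly_Mapping.single a 1 * (\<Sum>m\<in>Poly_Mapping.keys p. Poly_Mapping.single m (Poly_Mapping.lookup p m))"
      by simp
    then show ?thesis by (simp add: sum_distrib_left mult_single)
  qed
  then have L: "Poly_Mapping.lookup (Poly_Mapping.single a 1 * p) m
      = (\<Sum>x\<in>Poly_Mapping.keys p. if a + x = m then Poly_Mapping.lookup p x else 0)"
    by (simp add: lookup_sum lookup_single when_def)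
  show ?thesis
  proof (cases "\<exists>b. m = a + b")
    case True
    then obtain b where b: "m = a + b" by blast
    have "(\<Sum>x\<in>Poly_Mapping.keys p. if a + x = m then Poly_Mapping.lookup p x else 0)
        = (\<Sum>x\<in>Poly_Mapping.keys p. if x = b then Poly_Mapping.lookup p b else 0)"
      unfolding b c by (rule sum.cong) auto
    then show ?thesis using L True b by (auto simp: in_keys_iff)
  next
    case False
    then have "(\<Sum>x\<in>Poly_Mapping.keys p. if a + x = m then Poly_Mapping.lookup p x else 0) = 0"
      by (intro sum.neutral) auto
    then show ?thesis using L False by simp
  qed
qed

lemma esingle_divides: "(\<exists>b. m = esingle v + b) \<longleftrightarrow> v \<in> mkeys m"
proof
  assume "v \<in> mkeys m"
  then show "\<exists>b. m = esingle v + b" using minus_esingle_plus[of v m] by (metis add.commute)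
qed (auto simp: keys_plus_nat)

lemma lookup_var_mult:
  "Poly_Mapping.lookup (var v * p) m = (if v \<in> mkeys m then Poly_Mapping.lookup p (m - esingle v) else 0)"
  using lookup_var_times[of "esingle v" p m] esingle_divides[of m v] by (simp add: var_def)

lemma lookup_const_mult: "Poly_Mapping.lookup (const c * p) m = c * Poly_Mapping.lookup p m"
proof -
  have "const c * p = (\<Sum>x\<in>Poly_Mapping.keys p. Poly_Mapping.single x (c * Poly_Mapping.lookup p x))"
  proof -
    have "p = (\<Sum>m\<in>Poly_Mapping.keys p. Poly_Mapping.single m (Poly_Mapping.lookup p m))"
      by (rule poly_mapping_as_sum)
    then have "const c * p = const c * (\<Sum>m\<in>Poly_Mapping.keys p. Poly_Mapping.single m (Poly_Mapping.lookup p m))"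
      by simp
    then show ?thesis by (simp add: sum_distrib_left mult_single const_def)
  qed
  then show ?thesis by (auto simp: lookup_sum lookup_single when_def in_keys_iff)
qed

lemma const_hom: "const 0 = 0" "const 1 = 1" "const (a + b) = const a + const b" "const (a * b) = const a * const b"
  by (simp_all add: const_def single_add mult_single)

section \<open>Coordinates on the face ring\<close>

context sposet
begin

text \<open>The exponent obtained by substituting for every x_t the product of the vertices of
  t.\<close>

definition expo :: "('a \<Rightarrow>\<^sub>0 nat) \<Rightarrow> 'a \<Rightarrow>\<^sub>0 nat" where
  "expo M = (\<Sum>t\<in>mkeys M. \<Sum>v\<in>V t. Poly_Mapping.single v (Poly_Mapping.lookup M t))"

lemma expo_superset:
  assumes "finite A" "mkeys M \<subseteq> A"
  shows "expo M = (\<Sum>t\<in>A. \<Sum>v\<in>V t. Poly_Mapping.single v (Poly_Mapping.lookup M t))"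
  unfolding expo_def using assms by (intro sum.mono_neutral_left) (auto simp: in_keys_iff)

lemma expo_plus: "expo (M + N) = expo M + expo N"
proof -
  let ?A = "mkeys M \<union> mkeys N"
  have "mkeys (M + N) \<subseteq> ?A" by (rule Poly_Mapping.keys_add)
  then show ?thesis by (simp add: expo_superset[of ?A] lookup_add single_add sum.distrib)
qed

lemma expo_0: "expo 0 = 0" by (simp add: expo_def)

lemma expo_esingle: "expo (esingle t) = ind (V t)"
  by (simp add: expo_def ind_def)

lemma expo_atoms:
  assumes "mkeys m \<subseteq> atoms P" shows "expo m = m"
proof -
  have "expo m = (\<Sum>t\<in>mkeys m. Poly_Mapping.single t (Poly_Mapping.lookup m t))"
    unfolding expo_def using assms V_atom by (intro sum.cong) auto
  also have "\<dots> = m" by (rule poly_mapping_eqI) (auto simp: lookup_sum lookup_single when_def in_keys_iff)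
  finally show ?thesis .
qed

lemma lookup_expo: "Poly_Mapping.lookup (expo M) v = (\<Sum>t\<in>mkeys M. if v \<in> V t then Poly_Mapping.lookup M t else 0)"
  unfolding expo_def lookup_sum using finite_V
  by (intro sum.cong) (auto simp: lookup_single when_def)

lemma V_subset_keys_expo: "t \<in> mkeys M \<Longrightarrow> V t \<subseteq> mkeys (expo M)"
proof
  fix v assume t: "t \<in> mkeys M" and v: "v \<in> V t"
  have "0 < (\<Sum>t\<in>mkeys M. if v \<in> V t then Poly_Mapping.lookup M t else 0)"
    using t v by (intro sum_pos2[of _ t]) (auto simp: in_keys_iff)
  then have "0 < Poly_Mapping.lookup (expo M) v" by (simp only: lookup_expo)
  then show "v \<in> mkeys (expo M)" by (simp add: in_keys_iff)
qed

lemma mdeg_expo: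
  assumes "mkeys M \<subseteq> P"
  shows "mdeg (expo M) = (\<Sum>t\<in>mkeys M. Poly_Mapping.lookup M t * rk P t)"
proof -
  have mdeg_sum: "mdeg (\<Sum>i\<in>I. f i) = (\<Sum>i\<in>I. mdeg (f i))" for I :: "'i set" and f :: "'i \<Rightarrow> 'a \<Rightarrow>\<^sub>0 nat"
    by (induction I rule: infinite_finite_induct) (auto simp: mdeg_plus mdeg_eq_0)
  have "mdeg (expo M) = (\<Sum>t\<in>mkeys M. card (V t) * Poly_Mapping.lookup M t)"
    unfolding expo_def mdeg_sum mdeg_single by simp
  also have "\<dots> = (\<Sum>t\<in>mkeys M. Poly_Mapping.lookup M t * rk P t)"
    using assms rk_eq_card_V by (intro sum.cong) auto
  finally show ?thesis .
qed

text \<open>\<open>phi r\<close> restricts an element of the face ring to the polynomial ring on the vertices of \<open>r\<close>.\<close>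

definition phi_mono :: "'a \<Rightarrow> ('a \<Rightarrow>\<^sub>0 nat) \<Rightarrow> ('a, 'k::field) mpoly" where
  "phi_mono r M = (if mkeys M \<subseteq> {t. t \<le> r} then Poly_Mapping.single (expo M) 1 else 0)"

definition phi :: "'a \<Rightarrow> ('a, 'k::field) mpoly \<Rightarrow> ('a, 'k) mpoly" where
  "phi r = mev const (phi_mono r)"

lemma phi_evaluation: "monomial_evaluation const (phi_mono r)"
  by unfold_locales (auto simp: const_hom phi_mono_def expo_0 expo_plus keys_plus_nat mult_single)

lemmas phi_add = monomial_evaluation.add[OF phi_evaluation, folded phi_def]
lemmas phi_diff = monomial_evaluation.diff[OF phi_evaluation, folded phi_def]
lemmas phi_mult = monomial_evaluation.mult[OF phi_evaluation, folded phi_def]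
lemmas phi_sum = monomial_evaluation.sum[OF phi_evaluation, folded phi_def]
lemmas phi_zero = monomial_evaluation.zero[OF phi_evaluation, folded phi_def]
lemmas phi_one = monomial_evaluation.one[OF phi_evaluation, folded phi_def]
lemmas phi_single = monomial_evaluation.single[OF phi_evaluation, folded phi_def]
lemmas phi_uminus = monomial_evaluation.uminus[OF phi_evaluation, folded phi_def]

lemma phi_var: "phi r (var t) = (if t \<le> r then Poly_Mapping.single (ind (V t)) 1 else 0)"
  unfolding var_def phi_single One_nat_def by (simp add: phi_mono_def const_hom expo_esingle)

lemma phi_const: "phi r (const c) = const c"
  unfolding const_def[of c] phi_single by (simp add: phi_mono_def expo_0 const_def)

lemma lookup_phi: "Poly_Mapping.lookup (phi r p) m
    = (\<Sum>M\<in>Poly_Mapping.keys p. if mkeys M \<subseteq> {t. t \<le> r} \<and> expo M = m then Poly_Mapping.lookup p M else 0)"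
  unfolding phi_def mev_def lookup_sum lookup_const_mult phi_mono_def
  by (intro sum.cong) (auto simp: lookup_single when_def)

text \<open>If a monomial contributes to m, each face in its support has all its vertices in the
  support of m. Below r it therefore lies below the face spanned by m, and the larger r makes no
  difference.\<close>

lemma phi_local:
  assumes p: "p \<in> carrier (polys P)" and r: "r \<in> P" "mkeys m \<subseteq> V r"
  shows "Poly_Mapping.lookup (phi r p) m = Poly_Mapping.lookup (phi (fc r (mkeys m)) p) m"
  unfolding lookup_phi
proof (rule sum.cong[OF refl])
  fix M assume M: "M \<in> Poly_Mapping.keys p"
  note f = fc[OF r]
  have "mkeys M \<subseteq> {t. t \<le> r} \<longleftrightarrow> mkeys M \<subseteq> {t. t \<le> fc r (mkeys m)}" if e: "expo M = m"
  proof
    assume le: "mkeys M \<subseteq> {t. t \<le> r}"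
    show "mkeys M \<subseteq> {t. t \<le> fc r (mkeys m)}"
    proof
      fix t assume t: "t \<in> mkeys M"
      have "t \<in> P" using p M t by (auto simp: polys_carrier)
      moreover have "V t \<subseteq> V (fc r (mkeys m))" using V_subset_keys_expo[OF t] e f(3) by simp
      ultimately show "t \<in> {t. t \<le> fc r (mkeys m)}"
        using interval_iso(1)[OF r(1), of t "fc r (mkeys m)"] f le t by auto
    qed
  qed (use f(2) in \<open>auto intro: order_trans\<close>)
  then show "(if mkeys M \<subseteq> {t. t \<le> r} \<and> expo M = m then Poly_Mapping.lookup p M else 0)
      = (if mkeys M \<subseteq> {t. t \<le> fc r (mkeys m)} \<and> expo M = m then Poly_Mapping.lookup p M else 0)" by auto
qed

text \<open>The coordinate at the basis element (r, m): the coefficient of m after restriction to r,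
  read only where m involves every vertex of r.\<close>

definition Psi :: "('a, 'k::field) mpoly \<Rightarrow> 'a \<Rightarrow> ('a \<Rightarrow>\<^sub>0 nat) \<Rightarrow> 'k" where
  "Psi p r m = (if mon r m then Poly_Mapping.lookup (phi r p) m else 0)"

lemma Psi_diff: "Psi (p - q) r m = Psi p r m - Psi q r m"
  by (simp add: Psi_def phi_diff lookup_minus)
lemma Psi_sum: "Psi (\<Sum>i\<in>I. f i) r m = (\<Sum>i\<in>I. Psi (f i) r m)"
  by (simp add: Psi_def phi_sum lookup_sum)
lemma Psi_const_mult: "Psi (const c * p) r m = c * Psi p r m"
  by (simp add: Psi_def phi_mult phi_const lookup_const_mult)

text \<open>In coordinates, multiplication by a vertex is the partial division that drives the
  double complex.\<close>

lemma Psi_var_mult: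
  fixes p :: "('a, 'k::field) mpoly"
  assumes p: "p \<in> carrier (polys P)" and v: "v \<in> atoms P"
  shows "Psi (var v * p) r m = (if mon r m \<and> v \<in> mkeys m
     then Psi p (fc r (mkeys (m - esingle v))) (m - esingle v) else 0)"
proof (cases "mon r m")
  case True
  have Vv: "ind (V v) = esingle v" using V_atom[OF v] by (simp add: ind_def)
  have "phi r (var v :: ('a, 'k) mpoly) = (if v \<le> r then var v else 0)" unfolding phi_var Vv by (simp add: var_def)
  moreover have vr: "v \<le> r" if "v \<in> mkeys m" using True that by (auto simp: mon_def V_def)
  ultimately have "Poly_Mapping.lookup (phi r (var v * p)) m = (if v \<in> mkeys m then Poly_Mapping.lookup (phi r p) (m - esingle v) else 0)"
    unfolding phi_mult by (cases "v \<in> mkeys m"; cases "v \<le> r") (simp_all add: lookup_var_mult)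
  moreover have "Poly_Mapping.lookup (phi r p) (m - esingle v) = Psi p (fc r (mkeys (m - esingle v))) (m - esingle v)"
    using phi_local[OF p, of r "m - esingle v"] mon_div[OF True, of v] keys_minus_esingle[of m v] True
    by (auto simp: Psi_def mon_def)
  ultimately show ?thesis using True by (simp add: Psi_def)
qed (simp add: Psi_def)

lemma Psi_homogeneous:
  assumes p: "p \<in> carrier (polys P)" "homogeneous (rk P) j p" and nz: "Psi p r m \<noteq> 0"
  shows "mdeg m = j"
proof -
  have "Poly_Mapping.lookup (phi r p) m \<noteq> 0" using nz by (auto simp: Psi_def split: if_splits)
  then obtain M where "M \<in> Poly_Mapping.keys p"
    "(if mkeys M \<subseteq> {t. t \<le> r} \<and> expo M = m then Poly_Mapping.lookup p M else 0) \<noteq> 0"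
    unfolding lookup_phi by (rule sum.not_neutral_contains_not_neutral)
  then have M: "M \<in> Poly_Mapping.keys p" "expo M = m" by (auto split: if_splits)
  have "mkeys M \<subseteq> P" using p M by (auto simp: polys_carrier)
  then show ?thesis using p(2) M mdeg_expo[of M] by (auto simp: homogeneous_def)
qed

text \<open>The squarefree part of a basis monomial is carried by the variable of its support.\<close>

definition bmon :: "'a \<Rightarrow> ('a \<Rightarrow>\<^sub>0 nat) \<Rightarrow> 'a \<Rightarrow>\<^sub>0 nat" where
  "bmon r m = esingle r + (m - ind (V r))"

lemma mon_decompose: 
  assumes "mon r m" shows "ind (V r) + (m - ind (V r)) = m"
proof (rule poly_mapping_eqI)
  fix k
  have "k \<in> V r \<longleftrightarrow> Poly_Mapping.lookup m k \<noteq> 0" using assms unfolding mon_def using in_keys_iff[of k m] by auto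
  then show "Poly_Mapping.lookup (ind (V r) + (m - ind (V r))) k = Poly_Mapping.lookup m k"
    by (simp add: lookup_add lookup_minus lookup_ind[OF finite_V])
qed

lemma keys_minus_subset: "mkeys (m - n) \<subseteq> mkeys m" for m n :: "'a \<Rightarrow>\<^sub>0 nat"
  by (auto simp: in_keys_iff lookup_minus)

lemma bmon_props:
  assumes "mon r m"
  shows "mkeys (bmon r m) \<subseteq> P" "expo (bmon r m) = m" "mkeys (bmon r m) \<subseteq> {t. t \<le> s} \<longleftrightarrow> r \<le> s"
proof -
  have k: "mkeys (m - ind (V r)) \<subseteq> V r" using keys_minus_subset[of m "ind (V r)"] assms by (auto simp: mon_def)
  have at: "mkeys (m - ind (V r)) \<subseteq> atoms P" using k V_subset_atoms by blast
  show "mkeys (bmon r m) \<subseteq> P" using assms at by (auto simp: bmon_def keys_plus_nat mon_def atoms_iff)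
  show "expo (bmon r m) = m"
    using expo_esingle[of r] by (simp add: bmon_def expo_plus expo_atoms[OF at] mon_decompose[OF assms])
  show "mkeys (bmon r m) \<subseteq> {t. t \<le> s} \<longleftrightarrow> r \<le> s"
    using k by (auto simp: bmon_def keys_plus_nat V_def intro: order_trans)
qed

text \<open>The coordinates are dual to the basis monomials: the monomial of (r, m) restricts to
  zero unless r \<le> s, and then equality of supports forces s = r.\<close>

lemma Psi_bmon:
  assumes m: "mon r m"
  shows "Psi (Poly_Mapping.single (bmon r m) c) s n = (if s = r \<and> n = m then c else 0)"
proof (cases "mon s n")
  case True
  have e: "phi s (Poly_Mapping.single (bmon r m) c) = (if r \<le> s then Poly_Mapping.single m c else 0)"
    unfolding phi_single phi_mono_def bmon_props(2,3)[OF m] by (simp add: const_def mult_single)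
  have "r \<le> s \<and> n = m \<longleftrightarrow> s = r \<and> n = m"
  proof
    assume *: "r \<le> s \<and> n = m"
    then have "V r = V s" using m True by (simp add: mon_def)
    then have "r = s" using V_inj_below[of s r s] * m True by (auto simp: mon_def)
    then show "s = r \<and> n = m" using * by simp
  qed auto
  then show ?thesis using True unfolding Psi_def e by (auto simp: lookup_single when_def)
next
  case False
  then show ?thesis using m by (auto simp: Psi_def)
qed

lemma Psi_surj:
  assumes fin: "finite {(r, m). f r m \<noteq> 0}" and f: "\<And>r m. f r m \<noteq> 0 \<Longrightarrow> mon r m \<and> mdeg m = j"
  shows "\<exists>p \<in> carrier (polys P). homogeneous (rk P) j p \<and> Psi p = f"
proof -
  let ?S = "{(r, m). f r m \<noteq> 0}"
  define p where "p = (\<Sum>(r, m)\<in>?S. Poly_Mapping.single (bmon r m) (f r m))"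
  have keys: "\<exists>r m. M = bmon r m \<and> mon r m \<and> mdeg m = j" if "M \<in> Poly_Mapping.keys p" for M
  proof -
    have "Poly_Mapping.lookup p M \<noteq> 0" using that by (simp add: in_keys_iff)
    then have "\<exists>x\<in>?S. Poly_Mapping.lookup (case x of (r, m) \<Rightarrow> Poly_Mapping.single (bmon r m) (f r m)) M \<noteq> 0"
      unfolding p_def lookup_sum by (meson sum.neutral)
    then obtain r m where "f r m \<noteq> 0" "Poly_Mapping.lookup (Poly_Mapping.single (bmon r m) (f r m)) M \<noteq> 0" by auto
    then have "M = bmon r m" "mon r m \<and> mdeg m = j" using f[of r m] by (auto simp: lookup_single when_def split: if_splits)
    then show ?thesis by blast
  qed
  have "p \<in> carrier (polys P)" unfolding polys_carrier using keys bmon_props(1) by blast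
  moreover have "homogeneous (rk P) j p" unfolding homogeneous_def
  proof
    fix M assume "M \<in> Poly_Mapping.keys p"
    then obtain r m where "M = bmon r m" "mon r m" "mdeg m = j" using keys by blast
    then show "(\<Sum>v\<in>mkeys M. Poly_Mapping.lookup M v * rk P v) = j"
      using mdeg_expo[of M] bmon_props(1,2)[of r m] by simp
  qed
  moreover have "Psi p = f"
  proof (intro ext)
    fix s n
    have "Psi p s n = (\<Sum>x\<in>?S. if x = (s, n) then f s n else 0)"
      unfolding p_def Psi_sum
    proof (rule sum.cong[OF refl])
      fix x assume "x \<in> ?S"
      then obtain r m where x: "x = (r, m)" "f r m \<noteq> 0" by auto
      have "mon r m" using f x(2) by blast
      then show "Psi (case x of (r, m) \<Rightarrow> Poly_Mapping.single (bmon r m) (f r m)) s n = (if x = (s, n) then f s n else 0)"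
        unfolding x by (simp add: Psi_bmon)
    qed
    also have "\<dots> = f s n" using fin by simp
    finally show "Psi p s n = f s n" .
  qed
  ultimately show ?thesis by blast
qed

end

section \<open>The face ideal and straightening\<close>

context sposet
begin

lemma V_subset_P: "V t \<subseteq> P"
  by (auto simp: V_def atoms_iff)

definition mub :: "'a \<Rightarrow> 'a \<Rightarrow> 'a set" where
  "mub t s = {r. minimal_in (upper_bounds P t s) r}"

lemma upper_bounds_join:
  assumes "t \<in> P" "s \<in> P" "u \<in> upper_bounds P t s"
  shows "fc u (V t \<union> V s) \<in> mub t s" "fc u (V t \<union> V s) \<le> u" "V (fc u (V t \<union> V s)) = V t \<union> V s"
    and "\<And>r. r \<in> mub t s \<Longrightarrow> r \<le> u \<Longrightarrow> r = fc u (V t \<union> V s)"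
proof -
  let ?j = "fc u (V t \<union> V s)"
  have u: "u \<in> P" "t \<le> u" "s \<le> u" using assms(3) by (auto simp: upper_bounds_def)
  have sub: "V t \<union> V s \<subseteq> V u" using V_mono u by auto
  note j = fc[OF u(1) sub]
  have le: "?j \<le> r" if r: "r \<in> upper_bounds P t s" "r \<le> u" for r
  proof -
    have "V t \<union> V s \<subseteq> V r" using r V_mono by (auto simp: upper_bounds_def)
    then show ?thesis using interval_iso(1)[OF u(1) j(1) _ j(2) r(2)] r(1) j(3) by (simp add: upper_bounds_def)
  qed
  have jub: "?j \<in> upper_bounds P t s"
    using interval_iso(1)[OF u(1) assms(1) j(1) u(2) j(2)] interval_iso(1)[OF u(1) assms(2) j(1) u(3) j(2)] j
    by (auto simp: upper_bounds_def)
  have "y = ?j" if y: "y \<in> upper_bounds P t s" "y \<le> ?j" for y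
  proof -
    have "y \<le> u" using y(2) j(2) by (rule order_trans)
    then show ?thesis using le[OF y(1)] y(2) by (intro order_antisym)
  qed
  then show "?j \<in> mub t s" using jub by (simp add: mub_def minimal_in_def)
  show "?j \<le> u" "V ?j = V t \<union> V s" by (rule j)+
  show "r = ?j" if r: "r \<in> mub t s" "r \<le> u" for r
  proof -
    have "r \<in> upper_bounds P t s" using r by (simp add: mub_def minimal_in_def)
    then have "?j \<le> r" using le r(2) by blast
    then show ?thesis using r(1) jub by (auto simp: mub_def minimal_in_def)
  qed
qed

lemma mub_D: "r \<in> mub t s \<Longrightarrow> r \<in> upper_bounds P t s"
  by (simp add: mub_def minimal_in_def)

lemma finite_mub: "finite (mub t s)"
  by (rule finite_subset[OF _ finite_P]) (auto simp: mub_def minimal_in_def upper_bounds_def)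

lemma meet_eq:
  assumes "t \<in> P" "s \<in> P" "u \<in> upper_bounds P t s"
  shows "meet P t s = fc u (V t \<inter> V s)"
proof -
  let ?m = "fc u (V t \<inter> V s)"
  have u: "u \<in> P" "t \<le> u" "s \<le> u" using assms(3) by (auto simp: upper_bounds_def)
  have sub: "V t \<inter> V s \<subseteq> V u" using V_mono u by auto
  note m = fc[OF u(1) sub]
  have ms: "?m \<le> t" "?m \<le> s"
    using interval_iso(1)[OF u(1) m(1) assms(1) m(2) u(2)] interval_iso(1)[OF u(1) m(1) assms(2) m(2) u(3)] m by auto
  have gr: "x \<le> ?m" if x: "x \<in> P" "x \<le> t" "x \<le> s" for x
  proof -
    have "V x \<subseteq> V ?m" using V_mono x m(3) by auto
    then show ?thesis using interval_iso(1)[OF u(1) x(1) m(1) order_trans[OF x(2) u(2)] m(2)] by simp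
  qed
  show ?thesis unfolding meet_def
    by (rule the_equality) (use m ms gr in \<open>auto intro: order_antisym\<close>)
qed

definition face_gens :: "('a, 'k::field) mpoly set" where
  "face_gens = {var t * var s | t s. t \<in> P \<and> s \<in> P \<and> upper_bounds P t s = {}} \<union>
      {var t * var s - var (meet P t s) * (\<Sum>r | minimal_in (upper_bounds P t s) r. var r) | t s.
         t \<in> P \<and> s \<in> P \<and> \<not> t \<le> s \<and> \<not> s \<le> t \<and> upper_bounds P t s \<noteq> {}} \<union>
      {var (zero_hat P) - 1}"

lemma face_ideal_eq: "face_ideal P = Idl\<^bsub>polys P\<^esub> (face_gens :: ('a, 'k::field) mpoly set)"
  by (simp add: face_ideal_def face_gens_def)

lemma gen2_carrier:
  assumes "t \<in> P" "s \<in> P" "upper_bounds P t s \<noteq> {}"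
  shows "(var t * var s - var (meet P t s) * (\<Sum>r\<in>mub t s. var r) :: ('a, 'k::field) mpoly) \<in> carrier (polys P)"
proof -
  obtain u where u: "u \<in> upper_bounds P t s" using assms(3) by blast
  have "meet P t s \<in> P" unfolding meet_eq[OF assms(1,2) u]
    using u V_mono by (intro fc(1)) (auto simp: upper_bounds_def)
  moreover have "\<And>r. r \<in> mub t s \<Longrightarrow> r \<in> P" using mub_D by (auto simp: upper_bounds_def)
  ultimately show ?thesis using assms(1,2) by (intro polys_closed polys_sum var_carrier) auto
qed

lemma face_gens_carrier: "(face_gens :: ('a, 'k::field) mpoly set) \<subseteq> carrier (polys P)"
proof
  fix x :: "('a, 'k) mpoly" assume "x \<in> face_gens"
  then consider t s where "x = var t * var s" "t \<in> P" "s \<in> P"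
    | t s where "x = var t * var s - var (meet P t s) * (\<Sum>r\<in>mub t s. var r)" "t \<in> P" "s \<in> P" "upper_bounds P t s \<noteq> {}"
    | "x = var z - 1" unfolding face_gens_def mub_def by blast
  then show "x \<in> carrier (polys P)"
  proof cases
    case 1 then show ?thesis by (auto intro: polys_closed var_carrier)
  next
    case 2 then show ?thesis using gen2_carrier by blast
  next
    case 3 then show ?thesis by (auto intro: polys_closed var_carrier polys_01 z_P)
  qed
qed

lemma face_ideal_ideal: "ideal (face_ideal P :: ('a, 'k::field) mpoly set) (polys P)"
proof -
  interpret R: cring "polys P :: ('a, 'k) mpoly ring" by (rule polys_cring)
  show ?thesis unfolding face_ideal_eq by (rule R.genideal_ideal[OF face_gens_carrier])
qed

lemma face_gens_subset: "(face_gens :: ('a, 'k::field) mpoly set) \<subseteq> face_ideal P"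
proof -
  interpret R: cring "polys P :: ('a, 'k) mpoly ring" by (rule polys_cring)
  show ?thesis unfolding face_ideal_eq by (rule R.genideal_self[OF face_gens_carrier])
qed

lemma ind_union_inter:
  "finite A \<Longrightarrow> finite B \<Longrightarrow> ind (A \<inter> B) + ind (A \<union> B) = ind A + ind B"
  by (rule poly_mapping_eqI) (auto simp: lookup_add lookup_ind)

text \<open>Restriction to r kills all minimal upper bounds except the one below r, and the relation
  left is the identity between the products of the vertices over intersection and union and over the
  two faces separately.\<close>

lemma phi_face_gens:
  assumes r: "r \<in> P" and x: "x \<in> (face_gens :: ('a, 'k::field) mpoly set)"
  shows "phi r x = 0"
proof -
  consider t s where "x = var t * var s" "t \<in> P" "s \<in> P" "upper_bounds P t s = {}"
    | t s where "x = var t * var s - var (meet P t s) * (\<Sum>r\<in>mub t s. var r)" "t \<in> P" "s \<in> P" "upper_bounds P t s \<noteq> {}"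
    | "x = var z - 1" using x unfolding face_gens_def mub_def by blast
  then show ?thesis
  proof cases
    case 1
    then have "\<not> (t \<le> r \<and> s \<le> r)" using r by (auto simp: upper_bounds_def)
    then show ?thesis unfolding 1(1) phi_mult phi_var by auto
  next
    case 2
    show ?thesis
    proof (cases "t \<le> r \<and> s \<le> r")
      case True
      then have rub: "r \<in> upper_bounds P t s" using r by (simp add: upper_bounds_def)
      let ?j = "fc r (V t \<union> V s)"
      note j = upper_bounds_join[OF 2(2,3) rub]
      have m: "meet P t s = fc r (V t \<inter> V s)" by (rule meet_eq[OF 2(2,3) rub])
      have vm: "V (meet P t s) = V t \<inter> V s" "meet P t s \<le> r"
        unfolding m using fc(2,3)[OF r, of "V t \<inter> V s"] V_mono[of t r] True by auto
      have "phi r (\<Sum>r\<in>mub t s. var r :: ('a, 'k) mpoly) = (\<Sum>k\<in>mub t s. if k = ?j then Poly_Mapping.single (ind (V t \<union> V s)) 1 else 0)"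
        unfolding phi_sum
      proof (rule sum.cong[OF refl])
        fix k assume k: "k \<in> mub t s"
        have "k \<le> r \<longleftrightarrow> k = ?j" using j(4)[OF k] j(2) by auto
        then show "phi r (var k :: ('a, 'k) mpoly) = (if k = ?j then Poly_Mapping.single (ind (V t \<union> V s)) 1 else 0)"
          unfolding phi_var using j(3) by auto
      qed
      also have "\<dots> = Poly_Mapping.single (ind (V t \<union> V s)) 1" using finite_mub j(1) by simp
      finally have s: "phi r (\<Sum>r\<in>mub t s. var r :: ('a, 'k) mpoly) = Poly_Mapping.single (ind (V t \<union> V s)) 1" .
      have "phi r (var t * var s :: ('a, 'k) mpoly) = Poly_Mapping.single (ind (V t) + ind (V s)) 1"
        using True unfolding phi_mult phi_var by (simp add: mult_single)
      moreover have "phi r (var (meet P t s) * (\<Sum>r\<in>mub t s. var r) :: ('a, 'k) mpoly) = Poly_Mapping.single (ind (V t \<inter> V s) + ind (V t \<union> V s)) 1"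
        unfolding phi_mult s unfolding phi_var using vm by (simp add: mult_single)
      ultimately show ?thesis unfolding 2(1) phi_diff by (simp add: ind_union_inter[OF finite_V finite_V])
    next
      case False
      have "phi r (var k :: ('a, 'k) mpoly) = 0" if "k \<in> mub t s" for k
      proof -
        have "\<not> k \<le> r" using mub_D[OF that] False by (auto simp: upper_bounds_def intro: order_trans)
        then show ?thesis by (simp add: phi_var)
      qed
      then have "phi r (\<Sum>r\<in>mub t s. var r :: ('a, 'k) mpoly) = 0" unfolding phi_sum by simp
      moreover have "phi r (var t * var s :: ('a, 'k) mpoly) = 0" unfolding phi_mult phi_var using False by auto
      ultimately show ?thesis unfolding 2(1) phi_diff phi_mult by simp
    qed
  next
    case 3
    then show ?thesis unfolding 3 phi_diff phi_var phi_one using z_le[OF r] V_z by (simp add: ind_def)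
  qed
qed

lemma phi_face_ideal:
  assumes r: "r \<in> P" and p: "p \<in> (face_ideal P :: ('a, 'k::field) mpoly set)"
  shows "phi r p = 0"
proof -
  interpret R: cring "polys P :: ('a, 'k) mpoly ring" by (rule polys_cring)
  let ?K = "{p \<in> carrier (polys P :: ('a, 'k) mpoly ring). phi r p = 0}"
  have "ideal ?K (polys P)"
  proof (rule idealI)
    show "ring (polys P :: ('a, 'k) mpoly ring)" by (rule R.ring_axioms)
    show "subgroup ?K (add_monoid (polys P))"
    proof (rule R.add.subgroupI)
      have "0 \<in> ?K" by (simp add: polys_01 phi_zero)
      then show "?K \<noteq> {}" by blast
      show "\<ominus>\<^bsub>polys P\<^esub> a \<in> ?K" if "a \<in> ?K" for a
        using that polys_uminus[of a P] by (simp add: phi_uminus polys_a_inv)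
      show "a \<oplus>\<^bsub>polys P\<^esub> b \<in> ?K" if "a \<in> ?K" "b \<in> ?K" for a b
        using that polys_closed(1)[of a P b] by (simp add: phi_add)
    qed blast
    show "x \<otimes>\<^bsub>polys P\<^esub> a \<in> ?K" "a \<otimes>\<^bsub>polys P\<^esub> x \<in> ?K" if "a \<in> ?K" "x \<in> carrier (polys P)" for a x
      using that polys_closed(2)[of a P x] polys_closed(2)[of x P a] by (simp_all add: phi_mult)
  qed
  moreover have "face_gens \<subseteq> ?K" using face_gens_carrier phi_face_gens[OF r] by blast
  ultimately have "face_ideal P \<subseteq> ?K" unfolding face_ideal_eq by (rule R.genideal_minimal)
  then show ?thesis using p by blast
qed

lemma Psi_face_ideal: "p \<in> face_ideal P \<Longrightarrow> Psi p r m = 0"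
  by (simp add: Psi_def mon_def phi_face_ideal)

end

locale face_ring = sposet P for P :: "'a::order set" +
  fixes fs :: "('a, 'k::field) mpoly list"
  assumes fs_carrier: "set fs \<subseteq> carrier (polys P)"
begin

sublocale pq: poly_quot P "face_ideal P" fs
  by (rule poly_quot.intro[OF face_ideal_ideal fs_carrier])

abbreviation Id :: "('a, 'k) mpoly set" where "Id \<equiv> face_ideal P"
abbreviation RP :: "('a, 'k) mpoly set" where "RP \<equiv> carrier (polys P)"

lemma cong_trans: "p - q \<in> Id \<Longrightarrow> q - r \<in> Id \<Longrightarrow> p - r \<in> Id"
  using pq.I_closed(1)[of "p - q" "q - r"] by simp

lemma cong_mult: "p - q \<in> Id \<Longrightarrow> s \<in> RP \<Longrightarrow> p * s - q * s \<in> Id"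
  using pq.I_closed(2)[of "p - q" s] by (simp add: algebra_simps)

lemma Id_sum: "(\<And>i. i \<in> A \<Longrightarrow> f i \<in> Id) \<Longrightarrow> (\<Sum>i\<in>A. f i) \<in> Id"
  by (induction A rule: infinite_finite_induct) (auto intro: pq.I_closed(1,3))

lemma rel_no_ub: "t \<in> P \<Longrightarrow> s \<in> P \<Longrightarrow> upper_bounds P t s = {} \<Longrightarrow> var t * var s \<in> Id"
  using face_gens_subset by (force simp: face_gens_def)

lemma rel_z: "var z - 1 \<in> Id"
  using face_gens_subset by (force simp: face_gens_def)

lemma rel_straighten:
  assumes "t \<in> P" "s \<in> P" "\<not> t \<le> s" "\<not> s \<le> t" "upper_bounds P t s \<noteq> {}"
  shows "var t * var s - var (meet P t s) * (\<Sum>r\<in>mub t s. var r) \<in> Id"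
proof -
  have "var t * var s - var (meet P t s) * (\<Sum>r\<in>mub t s. var r) \<in> (face_gens :: ('a, 'k) mpoly set)"
    unfolding face_gens_def mub_def using assms by blast
  then show ?thesis using face_gens_subset by blast
qed

text \<open>Below \<open>\<mu>\<close> only one of the minimal upper bounds survives multiplication by \<open>x\<^sub>\<mu>\<close>.\<close>

lemma vertex_face_mult:
  assumes \<mu>: "\<mu> \<in> P" and W: "insert v W \<subseteq> V \<mu>" "v \<notin> W"
  shows "var v * var (fc \<mu> W) * var \<mu> - var (fc \<mu> (insert v W)) * var \<mu> \<in> Id"
proof -
  let ?s = "fc \<mu> W" and ?j = "fc \<mu> (insert v W)"
  have v: "v \<in> P" "V v = {v}" "v \<le> \<mu>" "v \<noteq> z" using W V_atom[of v] by (auto simp: V_def atoms_iff)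
  have s: "?s \<in> P" "?s \<le> \<mu>" "V ?s = W" using fc[OF \<mu>, of W] W by auto
  have vv: "fc \<mu> {v} = v" using fc_unique[OF \<mu> v(1,3)] v(2) by simp
  have car: "var \<mu> \<in> RP" "var v \<in> RP" by (rule var_carrier[OF \<mu>], rule var_carrier[OF v(1)])
  show ?thesis
  proof (cases "W = {}")
    case True
    have "?s = z" using s True V_empty_iff by auto
    have "(var z - 1) * (var v * var \<mu>) \<in> Id" using pq.I_closed(2)[OF rel_z polys_closed(2)[OF car(2,1)]]
      by (simp add: mult.commute)
    then show ?thesis using True \<open>?s = z\<close> vv by (simp add: algebra_simps)
  next
    case False
    have inc: "\<not> v \<le> ?s" "\<not> ?s \<le> v"
      using V_mono[of v ?s] V_mono[of ?s v] s(3) v(2) W(2) False by auto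
    have ub: "\<mu> \<in> upper_bounds P v ?s" using \<mu> v s by (simp add: upper_bounds_def)
    have un: "V v \<union> V ?s = insert v W" using v s by auto
    note j = upper_bounds_join[OF v(1) s(1) ub, unfolded un]
    have "V v \<inter> V ?s = {}" using v s W(2) by auto
    then have m: "meet P v ?s = z" using meet_eq[OF v(1) s(1) ub] fc_unique[OF \<mu> z_P z_le[OF \<mu>]] V_z by simp
    have mubP: "r \<in> mub v ?s \<Longrightarrow> r \<in> P" for r using mub_D[of r v ?s] by (auto simp: upper_bounds_def)
    have cs: "(\<Sum>r\<in>mub v ?s. var r) \<in> RP" using mubP by (intro polys_sum var_carrier)
    have 1: "var v * var ?s * var \<mu> - var z * (\<Sum>r\<in>mub v ?s. var r) * var \<mu> \<in> Id"
      using cong_mult[OF rel_straighten[OF v(1) s(1) inc] car(1)] ub m by auto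
    have "(var z - 1) * ((\<Sum>r\<in>mub v ?s. var r) * var \<mu>) \<in> Id"
      using pq.I_closed(2)[OF rel_z polys_closed(2)[OF cs car(1)]] by (simp add: mult.commute)
    then have 2: "var z * (\<Sum>r\<in>mub v ?s. var r) * var \<mu> - (\<Sum>r\<in>mub v ?s. var r) * var \<mu> \<in> Id"
      by (simp add: algebra_simps)
    have "var r * var \<mu> \<in> Id" if r: "r \<in> mub v ?s - {?j}" for r
    proof (rule rel_no_ub)
      show "r \<in> P" "\<mu> \<in> P" using mubP r \<mu> by auto
      show "upper_bounds P r \<mu> = {}"
      proof (rule ccontr)
        assume "upper_bounds P r \<mu> \<noteq> {}"
        then obtain u where u: "u \<in> P" "r \<le> u" "\<mu> \<le> u" by (auto simp: upper_bounds_def)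
        then have ub': "u \<in> upper_bounds P v ?s" using ub by (auto simp: upper_bounds_def intro: order_trans)
        have "?j \<in> mub v ?s" "?j \<le> u" using j(1,2) u(3) by (auto intro: order_trans)
        then have "?j = fc u (V v \<union> V ?s)" using upper_bounds_join(4)[OF v(1) s(1) ub'] by blast
        moreover have "r = fc u (V v \<union> V ?s)" using upper_bounds_join(4)[OF v(1) s(1) ub', of r] r u(2) by blast
        ultimately show False using r by simp
      qed
    qed
    then have "(\<Sum>r\<in>mub v ?s - {?j}. var r * var \<mu>) \<in> Id"
      by (rule Id_sum)
    moreover have "(\<Sum>r\<in>mub v ?s. var r :: ('a, 'k) mpoly) * var \<mu> - var ?j * var \<mu> = (\<Sum>r\<in>mub v ?s - {?j}. var r * var \<mu>)"
      using finite_mub j(1) by (simp add: sum.remove[of _ ?j] distrib_right sum_distrib_right)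
    ultimately have 3: "(\<Sum>r\<in>mub v ?s. var r) * var \<mu> - var ?j * var \<mu> \<in> Id" by simp
    show ?thesis using cong_trans[OF cong_trans[OF 1 2] 3] .
  qed
qed

text \<open>In the presence of x_\<mu> the variable of a face of \<mu> may be replaced by the
  product of its vertices; the vertices are added one at a time.\<close>

lemma face_mult:
  assumes \<mu>: "\<mu> \<in> P" and s: "s \<in> P" "s \<le> \<mu>"
  shows "var s * var \<mu> - Poly_Mapping.single (ind (V s)) 1 * var \<mu> \<in> Id"
proof -
  have "var (fc \<mu> W) * var \<mu> - Poly_Mapping.single (ind W) 1 * var \<mu> \<in> Id" if "W \<subseteq> V \<mu>" for W
  proof -
    have "finite W" using that finite_V finite_subset by blast
    then show ?thesis using that
    proof (induction W rule: finite_induct)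
      case empty
      have "fc \<mu> {} = z" using fc_unique[OF \<mu> z_P z_le[OF \<mu>]] V_z by simp
      moreover have "(var z - 1) * var \<mu> \<in> Id" using pq.I_closed(2)[OF rel_z var_carrier[OF \<mu>]] by (simp add: mult.commute)
      ultimately show ?case by (simp add: ind_def algebra_simps)
    next
      case (insert v W)
      have vP: "v \<in> P" using insert.prems by (auto simp: V_def atoms_iff)
      have e: "Poly_Mapping.single (ind (insert v W)) 1 = var v * Poly_Mapping.single (ind W) (1 :: 'k)"
        using insert.hyps by (simp add: ind_def var_def mult_single)
      have 1: "var v * var (fc \<mu> W) * var \<mu> - var (fc \<mu> (insert v W)) * var \<mu> \<in> Id"
        using vertex_face_mult[OF \<mu> insert.prems insert.hyps(2)] .
      have 2: "(var (fc \<mu> W) * var \<mu> - Poly_Mapping.single (ind W) 1 * var \<mu>) * var v \<in> Id"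
        using pq.I_closed(2)[OF insert.IH var_carrier[OF vP]] insert.prems by (simp add: mult.commute)
      have "(var (fc \<mu> W) * var \<mu> - Poly_Mapping.single (ind W) 1 * var \<mu>) * var v
          - (var v * var (fc \<mu> W) * var \<mu> - var (fc \<mu> (insert v W)) * var \<mu>) \<in> Id"
        by (rule pq.I_closed(6)[OF 2 1])
      then show ?case unfolding e by (simp add: algebra_simps)
    qed
  qed
  then show ?thesis using fc_unique[OF \<mu> s] V_mono[OF s(2)] by metis
qed

text \<open>Congruence modulo the face ideal to a combination of basis monomials.\<close>

definition Sp :: "('a, 'k) mpoly \<Rightarrow> bool" where
  "Sp p \<longleftrightarrow> p \<in> RP \<and> (\<exists>q. (\<forall>M\<in>Poly_Mapping.keys q. \<exists>r m. mon r m \<and> M = bmon r m) \<and> p - q \<in> Id)"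

lemma Sp_0: "Sp 0"
  unfolding Sp_def using polys_01(1) pq.I_closed(3) by (auto intro!: exI[of _ 0])

lemma Sp_add: "Sp p \<Longrightarrow> Sp q \<Longrightarrow> Sp (p + q)"
proof -
  assume "Sp p" "Sp q"
  then obtain p' q' where *: "p \<in> RP" "q \<in> RP" "\<forall>M\<in>Poly_Mapping.keys p'. \<exists>r m. mon r m \<and> M = bmon r m" "p - p' \<in> Id"
    "\<forall>M\<in>Poly_Mapping.keys q'. \<exists>r m. mon r m \<and> M = bmon r m" "q - q' \<in> Id" by (auto simp: Sp_def)
  have "p + q - (p' + q') \<in> Id" using pq.I_closed(1)[OF *(4,6)] by (simp add: algebra_simps)
  moreover have "\<forall>M\<in>Poly_Mapping.keys (p' + q'). \<exists>r m. mon r m \<and> M = bmon r m"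
    using Poly_Mapping.keys_add[of p' q'] *(3,5) by blast
  ultimately show ?thesis unfolding Sp_def using polys_closed(1)[OF *(1,2)] by blast
qed

lemma Sp_sum: "(\<And>i. i \<in> A \<Longrightarrow> Sp (f i)) \<Longrightarrow> Sp (\<Sum>i\<in>A. f i)"
  by (induction A rule: infinite_finite_induct) (auto intro: Sp_0 Sp_add)

lemma Sp_const: "Sp p \<Longrightarrow> Sp (const c * p)"
proof -
  assume "Sp p"
  then obtain p' where *: "p \<in> RP" "\<forall>M\<in>Poly_Mapping.keys p'. \<exists>r m. mon r m \<and> M = bmon r m" "p - p' \<in> Id"
    by (auto simp: Sp_def)
  have "const c * p - const c * p' \<in> Id"
    using pq.I_closed(2)[OF *(3) const_carrier, of c] by (simp add: right_diff_distrib)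
  moreover have "\<forall>M\<in>Poly_Mapping.keys (const c * p'). \<exists>r m. mon r m \<and> M = bmon r m"
    using *(2) by (auto simp: in_keys_iff lookup_const_mult)
  ultimately show ?thesis unfolding Sp_def using polys_closed(2)[OF const_carrier *(1)] by blast
qed

lemma Sp_cong: "p \<in> RP \<Longrightarrow> p - p' \<in> Id \<Longrightarrow> Sp p' \<Longrightarrow> Sp p"
  unfolding Sp_def using cong_trans by blast

lemma bmon_carrier: "mon r m \<Longrightarrow> Poly_Mapping.single (bmon r m) 1 \<in> RP"
  using bmon_props(1)[of r m] by (auto simp: polys_carrier)

lemma Sp_bmon:
  assumes m: "mon r m" shows "Sp (Poly_Mapping.single (bmon r m) 1)"
proof -
  have "\<forall>M\<in>Poly_Mapping.keys (Poly_Mapping.single (bmon r m) (1 :: 'k)). \<exists>r m. mon r m \<and> M = bmon r m"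
    using m by (simp, blast)
  moreover have "Poly_Mapping.single (bmon r m) 1 - Poly_Mapping.single (bmon r m) 1 \<in> Id"
    using pq.I_closed(3) by simp
  ultimately show ?thesis unfolding Sp_def using bmon_carrier[OF m] by blast
qed

text \<open>The smaller face is expanded into its vertices, which join the monomial factor supported
  on \<mu>.\<close>

lemma Sp_face_times:
  assumes \<mu>: "\<mu> \<in> P" and s: "s \<in> P" "s \<le> \<mu>" and N: "mkeys N \<subseteq> V \<mu>"
  shows "Sp (var s * var \<mu> * Poly_Mapping.single N 1)"
proof -
  let ?m = "ind (V \<mu>) + (ind (V s) + N)" and ?y = "Poly_Mapping.single N (1 :: 'k)"
  have y: "?y \<in> RP" using N V_subset_P by (auto simp: polys_carrier)
  have m: "mon \<mu> ?m" using \<mu> N V_mono[OF s(2)] by (auto simp: mon_def keys_plus_nat keys_ind[OF finite_V])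
  have "Poly_Mapping.single (ind (V s)) 1 * var \<mu> * ?y = Poly_Mapping.single (bmon \<mu> ?m) 1"
    unfolding bmon_def add_diff_cancel_left' by (simp add: var_def mult_single add_ac)
  then have "var s * var \<mu> * ?y - Poly_Mapping.single (bmon \<mu> ?m) 1 \<in> Id"
    using cong_mult[OF face_mult[OF \<mu> s] y] by simp
  moreover have "var s * var \<mu> * ?y \<in> RP" by (intro polys_closed(2) var_carrier \<mu> s y)
  ultimately show ?thesis using Sp_cong Sp_bmon[OF m] by blast
qed

text \<open>One straightening step. Comparable variables are absorbed by the larger one;
  incomparable ones without an upper bound give zero; otherwise the meet appears together with
  minimal upper bounds above it, which is again the comparable case.\<close>

lemma Sp_var_bmon:
  assumes t: "t \<in> P" and m: "mon r m"
  shows "Sp (var t * Poly_Mapping.single (bmon r m) 1)"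
proof -
  let ?N = "m - ind (V r)"
  let ?y = "Poly_Mapping.single ?N (1 :: 'k)"
  have r: "r \<in> P" using m by (simp add: mon_def)
  have N: "mkeys ?N \<subseteq> V r" using keys_minus_subset[of m "ind (V r)"] m by (auto simp: mon_def)
  have y: "?y \<in> RP" using N V_subset_P by (auto simp: polys_carrier)
  have b: "Poly_Mapping.single (bmon r m) 1 = var r * ?y" by (simp add: bmon_def var_def mult_single)
  have car: "var t * var r * ?y \<in> RP" by (intro polys_closed(2) var_carrier t r y)
  consider "t \<le> r" | "r \<le> t" | "\<not> t \<le> r" "\<not> r \<le> t" "upper_bounds P t r = {}"
    | "\<not> t \<le> r" "\<not> r \<le> t" "upper_bounds P t r \<noteq> {}" by blast
  then have "Sp (var t * var r * ?y)"
  proof cases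
    case 1
    then show ?thesis using Sp_face_times[OF r t _ N] by simp
  next
    case 2
    have "Sp (var r * var t * ?y)" using Sp_face_times[OF t r 2] N V_mono[OF 2] by blast
    then show ?thesis by (simp add: mult.commute)
  next
    case 3
    have "var t * var r * ?y - 0 \<in> Id" using pq.I_closed(2)[OF rel_no_ub[OF t r 3(3)] y] by (simp add: mult.commute)
    then show ?thesis using Sp_cong[OF car _ Sp_0] by blast
  next
    case 4
    have "var t * var r * ?y - var (meet P t r) * (\<Sum>k\<in>mub t r. var k) * ?y \<in> Id"
      using cong_mult[OF rel_straighten[OF t r 4] y] .
    moreover have "var (meet P t r) * (\<Sum>k\<in>mub t r. var k) * ?y = (\<Sum>k\<in>mub t r. var (meet P t r) * var k * ?y)"
      by (simp add: sum_distrib_left sum_distrib_right)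
    moreover have "Sp (var (meet P t r) * var k * ?y)" if k: "k \<in> mub t r" for k
    proof (rule Sp_face_times)
      have ub: "k \<in> upper_bounds P t r" using mub_D[OF k] .
      then show kP: "k \<in> P" by (simp add: upper_bounds_def)
      have "V t \<inter> V r \<subseteq> V k" using ub V_mono by (auto simp: upper_bounds_def)
      then show "meet P t r \<in> P" "meet P t r \<le> k" unfolding meet_eq[OF t r ub] using fc(1,2)[OF kP] by blast+
      show "mkeys ?N \<subseteq> V k" using N V_mono[of r k] ub by (auto simp: upper_bounds_def)
    qed
    then have "Sp (\<Sum>k\<in>mub t r. var (meet P t r) * var k * ?y)" by (rule Sp_sum)
    ultimately show ?thesis using Sp_cong[OF car] by simp
  qed
  then show ?thesis unfolding b by (simp add: mult.assoc)
qed

lemma Sp_var_mult: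
  assumes t: "t \<in> P" and p: "Sp p" shows "Sp (var t * p)"
proof -
  obtain q where q: "p \<in> RP" "\<forall>M\<in>Poly_Mapping.keys q. \<exists>r m. mon r m \<and> M = bmon r m" "p - q \<in> Id"
    using p by (auto simp: Sp_def)
  have "q = (\<Sum>M\<in>Poly_Mapping.keys q. const (Poly_Mapping.lookup q M) * Poly_Mapping.single M 1)"
    by (rule poly_mapping_eqI) (auto simp: const_def mult_single lookup_sum lookup_single when_def in_keys_iff)
  then have "var t * q = var t * (\<Sum>M\<in>Poly_Mapping.keys q. const (Poly_Mapping.lookup q M) * Poly_Mapping.single M 1)"
    by (rule arg_cong)
  then have e: "var t * q = (\<Sum>M\<in>Poly_Mapping.keys q. const (Poly_Mapping.lookup q M) * (var t * Poly_Mapping.single M 1))"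
    unfolding sum_distrib_left mult.left_commute[of "var t"] .
  have "Sp (var t * Poly_Mapping.single M 1)" if M: "M \<in> Poly_Mapping.keys q" for M
  proof -
    obtain r m where "mon r m" "M = bmon r m" using q(2) M by blast
    then show ?thesis using Sp_var_bmon[OF t] by simp
  qed
  then have S: "Sp (var t * q)" unfolding e by (intro Sp_sum Sp_const)
  have "var t * p - var t * q \<in> Id" using pq.I_closed(2)[OF q(3) var_carrier[OF t]] by (simp add: right_diff_distrib)
  then show ?thesis using Sp_cong[OF polys_closed(2)[OF var_carrier[OF t] q(1)] _ S] by blast
qed

text \<open>Variables are multiplied on one at a time. The monomial 1 is a basis monomial only
  through its congruence with x_z.\<close>

lemma Sp_single: "mkeys M \<subseteq> P \<Longrightarrow> Sp (Poly_Mapping.single M 1)"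
proof (induction "mdeg M" arbitrary: M)
  case 0
  then have M: "M = 0" using mdeg_eq_0 by metis
  have mz: "mon z 0" using z_P V_z by (simp add: mon_def)
  have "bmon z 0 = esingle z" using V_z by (simp add: bmon_def ind_def)
  then have "Sp (var z)" using Sp_bmon[OF mz] by (simp add: var_def)
  moreover have "1 - var z \<in> Id" using pq.I_closed(5)[OF rel_z] by simp
  ultimately have "Sp 1" using Sp_cong polys_01(2) by blast
  then show ?case by (simp add: M)
next
  case (Suc n)
  then obtain t where t: "t \<in> mkeys M" by (fastforce simp: mdeg_def)
  have "n = mdeg (M - esingle t)" using mdeg_minus_esingle[OF t] Suc(2) by simp
  moreover have "mkeys (M - esingle t) \<subseteq> P" using keys_minus_esingle[of M t] Suc.prems by blast
  ultimately have "Sp (Poly_Mapping.single (M - esingle t) 1)" using Suc(1) by blast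
  then have "Sp (var t * Poly_Mapping.single (M - esingle t) 1)" using Sp_var_mult t Suc.prems by blast
  moreover have "var t * Poly_Mapping.single (M - esingle t) 1 = Poly_Mapping.single M (1 :: 'k)"
    using minus_esingle_plus[OF t] by (simp add: var_def mult_single add.commute)
  ultimately show ?case by simp
qed

lemma Sp_all: "p \<in> RP \<Longrightarrow> Sp p"
proof -
  assume p: "p \<in> RP"
  have "p = (\<Sum>M\<in>Poly_Mapping.keys p. const (Poly_Mapping.lookup p M) * Poly_Mapping.single M 1)"
    by (rule poly_mapping_eqI) (auto simp: const_def mult_single lookup_sum lookup_single when_def in_keys_iff)
  moreover have "Sp (\<Sum>M\<in>Poly_Mapping.keys p. const (Poly_Mapping.lookup p M) * Poly_Mapping.single M 1)"
    using p by (intro Sp_sum Sp_const Sp_single) (auto simp: polys_carrier)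
  ultimately show ?thesis by simp
qed

text \<open>Basis monomials span modulo the ideal and the coordinates are dual to them, so a
  combination with vanishing coordinates is zero. This identifies the ideal as the common kernel of
  the coordinates.\<close>

lemma Id_iff_Psi:
  assumes p: "p \<in> RP"
  shows "p \<in> Id \<longleftrightarrow> (\<forall>r m. Psi p r m = 0)"
proof
  assume "p \<in> Id"
  then show "\<forall>r m. Psi p r m = 0" using Psi_face_ideal by blast
next
  assume z: "\<forall>r m. Psi p r m = 0"
  obtain q where q: "\<forall>M\<in>Poly_Mapping.keys q. \<exists>r m. mon r m \<and> M = bmon r m" "p - q \<in> Id"
    using Sp_all[OF p] by (auto simp: Sp_def)
  have Pq: "Psi q r m = 0" for r m
    using Psi_face_ideal[OF q(2), of r m] z by (simp add: Psi_diff)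
  have "q = 0"
  proof (rule ccontr)
    assume "q \<noteq> 0"
    then obtain K where K: "K \<in> Poly_Mapping.keys q" by (metis equals0I keys_eq_empty)
    then obtain r m where rm: "mon r m" "K = bmon r m" using q(1) by blast
    have qs: "q = (\<Sum>M\<in>Poly_Mapping.keys q. Poly_Mapping.single M (Poly_Mapping.lookup q M))"
      by (rule poly_mapping_as_sum)
    have "Psi q r m = (\<Sum>M\<in>Poly_Mapping.keys q. Psi (Poly_Mapping.single M (Poly_Mapping.lookup q M)) r m)"
      using Psi_sum[of "\<lambda>M. Poly_Mapping.single M (Poly_Mapping.lookup q M)" "Poly_Mapping.keys q" r m] qs by simp
    also have "\<dots> = (\<Sum>M\<in>Poly_Mapping.keys q. if M = K then Poly_Mapping.lookup q K else 0)"
    proof (rule sum.cong[OF refl])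
      fix M assume "M \<in> Poly_Mapping.keys q"
      then obtain s n where sn: "mon s n" "M = bmon s n" using q(1) by blast
      have "M = K \<longleftrightarrow> r = s \<and> m = n"
      proof
        assume "M = K"
        then have "expo (bmon s n) = expo (bmon r m)" "\<And>u. s \<le> u \<longleftrightarrow> r \<le> u"
          using sn rm bmon_props(3)[OF sn(1)] bmon_props(3)[OF rm(1)] by auto
        then show "r = s \<and> m = n" using bmon_props(2)[OF sn(1)] bmon_props(2)[OF rm(1)] by (metis order_antisym order_refl)
      qed (use sn rm in auto)
      then show "Psi (Poly_Mapping.single M (Poly_Mapping.lookup q M)) r m = (if M = K then Poly_Mapping.lookup q K else 0)"
        unfolding sn(2) Psi_bmon[OF sn(1)] using sn(2) by auto
    qed
    also have "\<dots> = Poly_Mapping.lookup q K" using K by simp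
    finally show False using Pq K by (simp add: in_keys_iff)
  qed
  then show "p \<in> Id" using q(2) by simp
qed

end

section \<open>Colours on links\<close>

context sposet
begin

text \<open>Ranks above t, numbered from 0. A chain above t uses every colour at most once.\<close>

definition colour :: "'a \<Rightarrow> 'a \<Rightarrow> nat" where "colour t w = card (V w) - Suc (card (V t))"

lemma card_V_less: "x \<in> P \<Longrightarrow> y \<in> P \<Longrightarrow> x < y \<Longrightarrow> card (V x) < card (V y)"
  using V_less by (intro psubset_card_mono finite_V)

lemma Lk_less:
  assumes c: "c \<in> Lk t" and w: "u \<in> c" "w \<in> c"
  shows "u < w \<longleftrightarrow> card (V u) < card (V w)"
proof -
  have P: "u \<in> P" "w \<in> P" using c w by (auto simp: Lk_def)
  have "u \<le> w \<or> w \<le> u" using c w by (auto simp: Lk_def chain_def)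
  then consider "u < w" | "w < u" | "u = w" by (auto simp: less_le)
  then show ?thesis
  proof cases
    case 2
    then show ?thesis using card_V_less[OF P(2,1) 2] by auto
  qed (use card_V_less[OF P] in auto)
qed

lemma Lk_card_V: "t \<in> P \<Longrightarrow> c \<in> Lk t \<Longrightarrow> w \<in> c \<Longrightarrow> card (V w) = Suc (card (V t) + colour t w)"
  using card_V_less[of t w] by (auto simp: Lk_def colour_def)

lemma Lk_colour_less: "t \<in> P \<Longrightarrow> c \<in> Lk t \<Longrightarrow> u \<in> c \<Longrightarrow> w \<in> c \<Longrightarrow> u < w \<longleftrightarrow> colour t u < colour t w"
  using Lk_less Lk_card_V by simp

lemma Lk_colour_inj: "t \<in> P \<Longrightarrow> c \<in> Lk t \<Longrightarrow> inj_on (colour t) c"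
proof (rule inj_onI)
  fix u w assume *: "t \<in> P" "c \<in> Lk t" "u \<in> c" "w \<in> c" "colour t u = colour t w"
  have "u \<le> w \<or> w \<le> u" using * by (auto simp: Lk_def chain_def)
  then show "u = w" using Lk_colour_less[OF *(1-4)] Lk_colour_less[OF *(1,2,4,3)] *(5) by (auto simp: less_le)
qed

lemma Lk_colour_bound: "t \<in> P \<Longrightarrow> c \<in> Lk t \<Longrightarrow> w \<in> c \<Longrightarrow> colour t w + card (V t) < poset_rank P"
  using card_V_le[of w] Lk_card_V[of t c w] by (auto simp: Lk_def)

text \<open>If all smaller colours occur, the number of elements below w is the colour of w. Signs
  then depend on colours only, which is how signed coboundaries are compared with sign-free products
  of polynomials.\<close>

lemma sg_colour:
  assumes t: "t \<in> P" and c: "c \<in> Lk t" and w: "w \<in> c" and full: "{..<colour t w} \<subseteq> colour t ` c"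
  shows "sg w c = (- 1) ^ colour t w"
proof -
  have "colour t ` {u \<in> c. u < w} = {..<colour t w}"
  proof
    show "colour t ` {u \<in> c. u < w} \<subseteq> {..<colour t w}" using Lk_colour_less[OF t c _ w] by auto
    show "{..<colour t w} \<subseteq> colour t ` {u \<in> c. u < w}"
    proof
      fix k assume k: "k \<in> {..<colour t w}"
      then obtain u where u: "u \<in> c" "colour t u = k" using full by blast
      then show "k \<in> colour t ` {u \<in> c. u < w}" using Lk_colour_less[OF t c u(1) w] k by auto
    qed
  qed
  moreover have "inj_on (colour t) {u \<in> c. u < w}" by (rule inj_on_subset[OF Lk_colour_inj[OF t c]]) auto
  ultimately have "card {u \<in> c. u < w} = colour t w" by (metis card_image card_lessThan)
  then show ?thesis by (simp add: sg_def)
qed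

lemma colour_remove:
  assumes "t \<in> P" "c \<in> Lk t" "w \<in> c"
  shows "colour t ` (c - {w}) = colour t ` c - {colour t w}"
  using inj_on_image_set_diff[OF Lk_colour_inj[OF assms(1,2)], of c "{w}"] assms(3) by auto

text \<open>The regularity condition on the colour classes \<open>f\<^sub>k\<close>, read off in squarefree degrees:
  \<open>f\<^sub>n y \<in> (f\<^sub>k : k < n)\<close> implies \<open>y \<in> (f\<^sub>k : k < n)\<close>.\<close>

definition colour_regular :: "'k::field itself \<Rightarrow> 'a \<Rightarrow> nat \<Rightarrow> bool" where
  "colour_regular _ t n \<longleftrightarrow> (\<forall>(y :: 'a set \<Rightarrow> 'k) \<alpha>.
     (\<forall>c\<in>Lk t. {..n} \<subseteq> colour t ` c \<longrightarrow>
        (\<Sum>w | w \<in> c \<and> colour t w = n. y (c - {w})) = (\<Sum>w | w \<in> c \<and> colour t w < n. \<alpha> (colour t w) (c - {w}))) \<longrightarrow>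
     (\<exists>g. \<forall>c\<in>Lk t. n \<notin> colour t ` c \<longrightarrow> {..<n} \<subseteq> colour t ` c \<longrightarrow>
        y c = (\<Sum>w | w \<in> c \<and> colour t w < n. g (colour t w) (c - {w}))))"

abbreviation (input) low :: "'a \<Rightarrow> nat \<Rightarrow> 'a \<Rightarrow> bool" where "low t n \<equiv> \<lambda>w. colour t w < n"

text \<open>Elements of colour at least n are frozen, and \<open>full\<close> says that \<phi> has
  no component in the top degree of the remaining colours. To add colour n, the part avoiding it is
  split into a piece containing all lower colours, integrated by regularity, and a rest covered by
  induction; what remains contains colour n and is again covered by induction.\<close>

lemma colour_exact:
  fixes \<phi> :: "'a set \<Rightarrow> 'k::field"
  assumes t: "t \<in> P"
    and reg: "\<And>k. k < n \<Longrightarrow> colour_regular TYPE('k) t k"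
    and cyc: "\<And>c. c \<in> Lk t \<Longrightarrow> pcobd (low t n) \<phi> c = 0"
    and full: "\<And>c. c \<in> Lk t \<Longrightarrow> {..<n} \<subseteq> colour t ` c \<Longrightarrow> \<phi> c = 0"
  shows "\<exists>\<psi>. \<forall>c\<in>Lk t. \<phi> c = pcobd (low t n) \<psi> c"
  using reg cyc full
proof (induction n arbitrary: \<phi>)
  case 0
  then show ?case by (intro exI[of _ "\<lambda>_. 0"]) (simp add: pcobd_def)
next
  case (Suc n)
  let ?C = "\<lambda>c. colour t ` c"
  note fin = Lk_finite
  have sub: "c - {w} \<in> Lk t" if "c \<in> Lk t" for c w using Lk_subset[OF that] by blast
  have rem: "?C (c - {w}) = ?C c - {colour t w}" if "c \<in> Lk t" "w \<in> c" for c w using colour_remove[OF t that] .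
  have split0: "pcobd (low t (Suc n)) f c = pcobd (low t n) f c" if "n \<notin> ?C c" for f :: "'a set \<Rightarrow> 'k" and c
  proof -
    have "{w \<in> c. colour t w < Suc n} = {w \<in> c. colour t w < n}" using that by (auto simp: less_Suc_eq)
    then show ?thesis by (simp add: pcobd_def)
  qed
  have split1: "\<exists>w. w \<in> c \<and> colour t w = n \<and> {u \<in> c. colour t u = n} = {w} \<and>
      (\<forall>f :: 'a set \<Rightarrow> 'k. pcobd (low t (Suc n)) f c = sg w c * f (c - {w}) + pcobd (low t n) f c)"
    if c: "c \<in> Lk t" "n \<in> ?C c" for c
  proof -
    obtain w where w: "w \<in> c" "colour t w = n" using c(2) by blast
    have u: "{u \<in> c. colour t u = n} = {w}" using Lk_colour_inj[OF t c(1)] w by (auto simp: inj_on_def)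
    then have "{u \<in> c. colour t u < Suc n} = insert w {u \<in> c. colour t u < n}" by (auto simp: less_Suc_eq)
    moreover have "w \<notin> {u \<in> c. colour t u < n}" using w by simp
    ultimately have "pcobd (low t (Suc n)) f c = sg w c * f (c - {w}) + pcobd (low t n) f c" for f :: "'a set \<Rightarrow> 'k"
      unfolding pcobd_def using fin[OF c(1)] by simp
    with w u show ?thesis by blast
  qed
  have pc_diff: "pcobd Q (f - g) c = pcobd Q f c - pcobd Q g c" for Q and f g :: "'a set \<Rightarrow> 'k" and c
    by (simp add: pcobd_def right_diff_distrib sum_subtractf)
  have pc_add: "pcobd Q (f + g) c = pcobd Q f c + pcobd Q g c" for Q and f g :: "'a set \<Rightarrow> 'k" and c
    by (simp add: pcobd_def distrib_left sum.distrib)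
  have pc0: "pcobd Q f c = 0" if "\<And>w. w \<in> c \<Longrightarrow> Q w \<Longrightarrow> f (c - {w}) = 0" for Q and f :: "'a set \<Rightarrow> 'k" and c
    unfolding pcobd_def using that by (intro sum.neutral) auto
  have pc_cong: "pcobd Q f c = pcobd Q g c" if "\<And>w. w \<in> c \<Longrightarrow> Q w \<Longrightarrow> f (c - {w}) = g (c - {w})"
    for Q and f g :: "'a set \<Rightarrow> 'k" and c
    unfolding pcobd_def using that by (intro sum.cong) auto
  \<comment> \<open>The part of \<phi> on chains avoiding colour n.\<close>
  define \<beta> where "\<beta> = (\<lambda>c. if n \<notin> ?C c then \<phi> c else 0)"
  \<comment> \<open>The top component of \<beta>, where the induction hypothesis does not
    apply.\<close>
  define y where "y = (\<lambda>c. if n \<notin> ?C c \<and> {..<n} \<subseteq> ?C c then \<phi> c else 0)"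
  have reg: "colour_regular TYPE('k) t n" using Suc.prems(1) by simp
  have d\<beta>: "pcobd (low t n) \<beta> c = 0" if c: "c \<in> Lk t" for c
  proof (cases "n \<in> ?C c")
    case True
    show ?thesis by (rule pc0) (use rem[OF c] True in \<open>auto simp: \<beta>_def\<close>)
  next
    case False
    have "pcobd (low t n) \<beta> c = pcobd (low t n) \<phi> c" by (rule pc_cong) (use rem[OF c] False in \<open>auto simp: \<beta>_def\<close>)
    then show ?thesis using Suc.prems(2)[OF c] split0[OF False] by simp
  qed
  have dy: "pcobd (low t n) y c = 0" if c: "c \<in> Lk t" for c
    by (rule pc0) (use rem[OF c] in \<open>auto simp: y_def\<close>)
  have "\<exists>g. \<forall>c\<in>Lk t. n \<notin> ?C c \<longrightarrow> {..<n} \<subseteq> ?C c \<longrightarrow>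
      y c = (\<Sum>w | w \<in> c \<and> colour t w < n. g (colour t w) (c - {w}))"
  proof -
    \<comment> \<open>Closedness of \<phi> at a chain with all colours up to n, solved for the
      removal of colour n. The signs (-1)^n and (-1)^k are those of the coboundary.\<close>
    let ?\<alpha> = "\<lambda>k c. - ((- 1) ^ (n + k)) * \<phi> c"
    have "(\<Sum>w | w \<in> c \<and> colour t w = n. y (c - {w})) = (\<Sum>w | w \<in> c \<and> colour t w < n. ?\<alpha> (colour t w) (c - {w}))"
      if c: "c \<in> Lk t" and fu: "{..n} \<subseteq> ?C c" for c
    proof -
      have "n \<in> ?C c" using fu by auto
      then obtain w where w: "w \<in> c" "colour t w = n" "{u \<in> c. colour t u = n} = {w}"
        "\<And>f :: 'a set \<Rightarrow> 'k. pcobd (low t (Suc n)) f c = sg w c * f (c - {w}) + pcobd (low t n) f c"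
        using split1[OF c] by blast
      have sgw: "sg u c = ((- 1) ^ colour t u :: 'k)" if "u \<in> c" "colour t u \<le> n" for u
      proof (rule sg_colour[OF t c that(1)])
        have "{..<colour t u} \<subseteq> {..n}" using that(2) by auto
        then show "{..<colour t u} \<subseteq> ?C c" using fu by blast
      qed
      have yw: "y (c - {w}) = \<phi> (c - {w})" using rem[OF c w(1)] w(2) fu by (auto simp: y_def)
      have "0 = (- 1) ^ n * \<phi> (c - {w}) + pcobd (low t n) \<phi> c"
        using Suc.prems(2)[OF c] w(4)[of \<phi>] sgw[OF w(1)] w(2) by simp
      then have A: "(- 1) ^ n * \<phi> (c - {w}) = - pcobd (low t n) \<phi> c"
        by (simp add: eq_neg_iff_add_eq_0)
      have "\<phi> (c - {w}) = (- 1) ^ n * ((- 1) ^ n * \<phi> (c - {w}))"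
        by (simp flip: mult.assoc power_add add: mult_2[symmetric])
      also have "\<dots> = - ((- 1) ^ n * pcobd (low t n) \<phi> c)" unfolding A by simp
      also have "\<dots> = (\<Sum>u | u \<in> c \<and> colour t u < n. ?\<alpha> (colour t u) (c - {u}))"
        unfolding pcobd_def sum_distrib_left sum_negf[symmetric]
        by (rule sum.cong) (auto simp: sgw power_add mult_ac)
      finally show ?thesis unfolding w(3) by (simp add: yw)
    qed
    then have "\<forall>c\<in>Lk t. {..n} \<subseteq> ?C c \<longrightarrow> (\<Sum>w | w \<in> c \<and> colour t w = n. y (c - {w})) =
        (\<Sum>w | w \<in> c \<and> colour t w < n. ?\<alpha> (colour t w) (c - {w}))" by blast
    then show ?thesis by (rule mp[OF spec[OF spec[OF reg[unfolded colour_regular_def], of y], of ?\<alpha>]])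
  qed
  then obtain g where g: "\<And>c. c \<in> Lk t \<Longrightarrow> n \<notin> ?C c \<Longrightarrow> {..<n} \<subseteq> ?C c \<Longrightarrow>
      y c = (\<Sum>w | w \<in> c \<and> colour t w < n. g (colour t w) (c - {w}))" by blast
  \<comment> \<open>On a chain missing exactly one colour k < n only the summand k is present; its
    sign cancels that of the coboundary, which then reproduces the sum given by regularity.\<close>
  define \<gamma>2 where "\<gamma>2 = (\<lambda>c. \<Sum>k<n. if k \<notin> ?C c \<and> {..<n} - {k} \<subseteq> ?C c then (- 1) ^ k * g k c else 0)"
  have \<gamma>2: "pcobd (low t n) \<gamma>2 c = y c" if c: "c \<in> Lk t" "n \<notin> ?C c" for c
  proof (cases "{..<n} \<subseteq> ?C c")
    case True
    have "pcobd (low t n) \<gamma>2 c = (\<Sum>w | w \<in> c \<and> colour t w < n. g (colour t w) (c - {w}))"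
      unfolding pcobd_def
    proof (rule sum.cong)
      fix w assume w: "w \<in> {w. w \<in> c \<and> colour t w < n}"
      then have R: "?C (c - {w}) = ?C c - {colour t w}" using rem[OF c(1)] by blast
      have "\<gamma>2 (c - {w}) = (\<Sum>k<n. if k = colour t w then (- 1) ^ k * g k (c - {w}) else 0)"
        unfolding \<gamma>2_def R by (rule sum.cong) (use True in auto)
      also have "\<dots> = (- 1) ^ colour t w * g (colour t w) (c - {w})" using w by simp
      finally have "\<gamma>2 (c - {w}) = (- 1) ^ colour t w * g (colour t w) (c - {w})" .
      moreover have "sg w c = ((- 1) ^ colour t w :: 'k)"
        using w True by (intro sg_colour[OF t c(1)]) auto
      ultimately show "sg w c * \<gamma>2 (c - {w}) = g (colour t w) (c - {w})"
        by (simp flip: mult.assoc power_add add: mult_2[symmetric])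
    qed auto
    then show ?thesis using g[OF c True] by simp
  next
    case False
    then obtain k0 where k0: "k0 < n" "k0 \<notin> ?C c" by auto
    have "\<gamma>2 (c - {w}) = 0" if w: "w \<in> c" "colour t w < n" for w
      unfolding \<gamma>2_def rem[OF c(1) w(1)]
    proof (rule sum.neutral, rule ballI)
      fix k assume "k \<in> {..<n}"
      have "colour t w \<noteq> k0" using k0(2) w(1) by auto
      have "\<not> {..<n} - {k} \<subseteq> ?C c - {colour t w}"
      proof
        assume S: "{..<n} - {k} \<subseteq> ?C c - {colour t w}"
        have "k0 = k" using S k0 by auto
        moreover have "colour t w = k" using S w(2) by auto
        ultimately show False using \<open>colour t w \<noteq> k0\<close> by simp
      qed
      then show "(if k \<notin> ?C c - {colour t w} \<and> {..<n} - {k} \<subseteq> ?C c - {colour t w} then (- 1) ^ k * g k (c - {w}) else 0) = 0"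
        by simp
    qed
    then have "pcobd (low t n) \<gamma>2 c = 0" by (intro pc0)
    then show ?thesis using False by (simp add: y_def)
  qed
  have "\<exists>\<psi>. \<forall>c\<in>Lk t. (\<beta> - y) c = pcobd (low t n) \<psi> c"
  proof (rule Suc.IH)
    show "pcobd (low t n) (\<beta> - y) c = 0" if "c \<in> Lk t" for c using d\<beta>[OF that] dy[OF that] by (simp add: pc_diff)
    show "(\<beta> - y) c = 0" if "c \<in> Lk t" "{..<n} \<subseteq> ?C c" for c using that by (simp add: \<beta>_def y_def)
  qed (use Suc.prems(1) in simp)
  then obtain \<gamma>1 where \<gamma>1: "\<And>c. c \<in> Lk t \<Longrightarrow> (\<beta> - y) c = pcobd (low t n) \<gamma>1 c" by blast
  \<comment> \<open>For chains avoiding colour n the coboundary reads only chains of this kind, so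
    the truncation loses nothing there; it also keeps the correction from disturbing the vanishing
    on full chains.\<close>
  define \<gamma> where "\<gamma> = (\<lambda>c. if n \<notin> ?C c \<and> \<not> {..<n} \<subseteq> ?C c then (\<gamma>1 + \<gamma>2) c else 0)"
  have \<gamma>: "pcobd (low t n) \<gamma> c = \<phi> c" if c: "c \<in> Lk t" "n \<notin> ?C c" for c
  proof -
    have "pcobd (low t n) \<gamma> c = pcobd (low t n) (\<gamma>1 + \<gamma>2) c"
      by (rule pc_cong) (use rem[OF c(1)] c(2) in \<open>auto simp: \<gamma>_def\<close>)
    also have "\<dots> = (\<beta> - y) c + y c" unfolding pc_add using \<gamma>1[OF c(1)] \<gamma>2[OF c] by simp
    finally show ?thesis using c(2) by (simp add: \<beta>_def)
  qed
  \<comment> \<open>Now supported on chains containing colour n. Removing the element of colour n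
    gives zero, so this is closed already for the smaller set of colours.\<close>
  define \<phi>1 where "\<phi>1 = \<phi> - pcobd (low t (Suc n)) \<gamma>"
  have \<phi>1_0: "\<phi>1 c = 0" if c: "c \<in> Lk t" "n \<notin> ?C c" for c
    using \<gamma>[OF c] split0[OF c(2), of \<gamma>] by (simp add: \<phi>1_def)
  have "\<exists>\<psi>. \<forall>c\<in>Lk t. \<phi>1 c = pcobd (low t n) \<psi> c"
  proof (rule Suc.IH)
    show "pcobd (low t n) \<phi>1 c = 0" if c: "c \<in> Lk t" for c
    proof (cases "n \<in> ?C c")
      case False
      show ?thesis by (rule pc0) (use rem[OF c] False sub[OF c] \<phi>1_0 in auto)
    next
      case True
      then obtain w where w: "w \<in> c" "colour t w = n"
        "\<And>f :: 'a set \<Rightarrow> 'k. pcobd (low t (Suc n)) f c = sg w c * f (c - {w}) + pcobd (low t n) f c"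
        using split1[OF c] by blast
      have "\<phi>1 (c - {w}) = 0" using \<phi>1_0[OF sub[OF c]] rem[OF c w(1)] w(2) by auto
      then have "pcobd (low t n) \<phi>1 c = pcobd (low t (Suc n)) \<phi>1 c" using w(3)[of \<phi>1] by simp
      also have "\<dots> = 0" unfolding \<phi>1_def pc_diff
        using Suc.prems(2)[OF c] pcobd_pcobd[OF fin[OF c], of "low t (Suc n)" \<gamma>] c by (simp add: Lk_def)
      finally show ?thesis .
    qed
    show "\<phi>1 c = 0" if c: "c \<in> Lk t" "{..<n} \<subseteq> ?C c" for c
    proof (cases "n \<in> ?C c")
      case True
      then obtain w where w: "w \<in> c" "colour t w = n"
        "\<And>f :: 'a set \<Rightarrow> 'k. pcobd (low t (Suc n)) f c = sg w c * f (c - {w}) + pcobd (low t n) f c"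
        using split1[OF c(1)] by blast
      have "\<gamma> (c - {w}) = 0" using rem[OF c(1) w(1)] w(2) c(2) by (auto simp: \<gamma>_def)
      moreover have "pcobd (low t n) \<gamma> c = 0" by (rule pc0) (use rem[OF c(1)] True in \<open>auto simp: \<gamma>_def\<close>)
      moreover have "\<phi> c = 0" using Suc.prems(3)[OF c(1)] c(2) True by (auto simp: lessThan_Suc)
      ultimately show ?thesis using w(3)[of \<gamma>] by (simp add: \<phi>1_def)
    qed (use \<phi>1_0 c in blast)
  qed (use Suc.prems(1) in simp)
  then obtain \<psi>1 where \<psi>1: "\<And>c. c \<in> Lk t \<Longrightarrow> \<phi>1 c = pcobd (low t n) \<psi>1 c" by blast
  \<comment> \<open>The restriction to chains containing colour n makes the new removal contribute
    nothing.\<close>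
  define \<psi>2 where "\<psi>2 = (\<lambda>c. if n \<in> ?C c then \<psi>1 c else 0)"
  have "pcobd (low t (Suc n)) \<psi>2 c = \<phi>1 c" if c: "c \<in> Lk t" for c
  proof (cases "n \<in> ?C c")
    case True
    then obtain w where w: "w \<in> c" "colour t w = n"
      "\<And>f :: 'a set \<Rightarrow> 'k. pcobd (low t (Suc n)) f c = sg w c * f (c - {w}) + pcobd (low t n) f c"
      using split1[OF c] by blast
    have "\<psi>2 (c - {w}) = 0" using rem[OF c w(1)] w(2) by (simp add: \<psi>2_def)
    moreover have "pcobd (low t n) \<psi>2 c = pcobd (low t n) \<psi>1 c"
      by (rule pc_cong) (use rem[OF c] True in \<open>auto simp: \<psi>2_def\<close>)
    ultimately show ?thesis using w(3)[of \<psi>2] \<psi>1[OF c] by simp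
  next
    case False
    have "pcobd (low t (Suc n)) \<psi>2 c = 0" by (rule pc0) (use rem[OF c] False in \<open>auto simp: \<psi>2_def\<close>)
    then show ?thesis using \<phi>1_0[OF c False] by simp
  qed
  then have "\<phi> c = pcobd (low t (Suc n)) (\<gamma> + \<psi>2) c" if "c \<in> Lk t" for c
    using that unfolding pc_add by (simp add: \<phi>1_def)
  then show ?case by blast
qed

lemma link_exact_of_regular:
  fixes y :: "'a set \<Rightarrow> 'k::field"
  assumes t: "t \<in> P" and q: "q + card (V t) < poset_rank P"
    and reg: "\<And>n. n + card (V t) < poset_rank P \<Longrightarrow> colour_regular TYPE('k) t n"
    and cyc: "\<And>c. c \<in> Lk t \<Longrightarrow> card c = Suc q \<Longrightarrow> cobd y c = 0"
  shows "\<exists>x. \<forall>c\<in>Lk t. card c = q \<longrightarrow> y c = cobd x c"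
proof -
  define e where "e = poset_rank P - card (V t)"
  define \<phi> where "\<phi> = (\<lambda>c. if card c = q then y c else 0)"
  have pc: "pcobd (low t e) f c = cobd f c" if c: "c \<in> Lk t" for f :: "'a set \<Rightarrow> 'k" and c
  proof -
    have "{w \<in> c. colour t w < e} = c" using Lk_colour_bound[OF t c] by (fastforce simp: e_def)
    then show ?thesis by (simp add: pcobd_def cobd_def)
  qed
  have "\<exists>\<psi>. \<forall>c\<in>Lk t. \<phi> c = pcobd (low t e) \<psi> c"
  proof (rule colour_exact[OF t])
    show "colour_regular TYPE('k) t k" if "k < e" for k using reg that by (simp add: e_def)
    show "pcobd (low t e) \<phi> c = 0" if c: "c \<in> Lk t" for c
    proof (cases "card c = Suc q")
      case True
      have "cobd \<phi> c = cobd y c" using True Lk_finite[OF c] by (intro cobd_cong) (simp add: \<phi>_def)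
      then show ?thesis using cyc[OF c True] pc[OF c] by simp
    next
      case False
      have "\<phi> (c - {\<tau>}) = 0" if "\<tau> \<in> c" for \<tau>
      proof -
        have "Suc (card (c - {\<tau>})) = card c" using that Lk_finite[OF c] by (metis card.remove)
        then show ?thesis using False by (auto simp: \<phi>_def)
      qed
      then show ?thesis unfolding pc[OF c] by (simp add: cobd_def)
    qed
    show "\<phi> c = 0" if c: "c \<in> Lk t" "{..<e} \<subseteq> colour t ` c" for c
    proof -
      have "e \<le> card (colour t ` c)" using card_mono[OF _ c(2)] Lk_finite[OF c(1)] by simp
      also have "\<dots> \<le> card c" using card_image_le Lk_finite[OF c(1)] by blast
      finally show ?thesis using q by (simp add: \<phi>_def e_def)
    qed
  qed
  then obtain \<psi> where \<psi>: "\<forall>c\<in>Lk t. \<phi> c = pcobd (low t e) \<psi> c" by blast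
  have "y c = cobd \<psi> c" if "c \<in> Lk t" "card c = q" for c
    using bspec[OF \<psi> that(1)] pc[OF that(1), of \<psi>] that(2) by (simp add: \<phi>_def)
  then show ?thesis by blast
qed

end

section \<open>Stanley-Reisner ideals and the Buchsbaum property\<close>

lemma var_prod: "(\<Prod>v\<in>F. var v) = Poly_Mapping.single (ind F) 1"
  by (induction F rule: infinite_finite_induct) (auto simp: ind_def var_def mult_single)

lemma single_carrier: "mkeys m \<subseteq> W \<Longrightarrow> Poly_Mapping.single m c \<in> carrier (polys W)"
  by (simp add: polys_carrier)

lemma genideal_carrier: 
  assumes "S \<subseteq> carrier (polys W)"
  shows "ideal (Idl\<^bsub>polys W\<^esub> S) (polys W)" "S \<subseteq> Idl\<^bsub>polys W\<^esub> S"
    "\<And>J. ideal J (polys W) \<Longrightarrow> S \<subseteq> J \<Longrightarrow> Idl\<^bsub>polys W\<^esub> S \<subseteq> J"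
proof -
  interpret R: cring "polys W" by (rule polys_cring)
  show "ideal (Idl\<^bsub>polys W\<^esub> S) (polys W)" "S \<subseteq> Idl\<^bsub>polys W\<^esub> S"
    "\<And>J. ideal J (polys W) \<Longrightarrow> S \<subseteq> J \<Longrightarrow> Idl\<^bsub>polys W\<^esub> S \<subseteq> J"
    using R.genideal_ideal[OF assms] R.genideal_self[OF assms] R.genideal_minimal[of _ S] by auto
qed

lemma polys_idealI:
  fixes J :: "('v, 'k::field) mpoly set"
  assumes "J \<subseteq> carrier (polys W)" "0 \<in> J" "\<And>p q. p \<in> J \<Longrightarrow> q \<in> J \<Longrightarrow> p + q \<in> J"
    and mult: "\<And>p q. p \<in> J \<Longrightarrow> q \<in> carrier (polys W) \<Longrightarrow> q * p \<in> J"
  shows "ideal J (polys W)"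
proof -
  interpret R: cring "polys W :: ('v, 'k) mpoly ring" by (rule polys_cring)
  have neg: "- p \<in> J" if "p \<in> J" for p
    using mult[OF that polys_uminus[OF polys_01(2)]] by simp
  show ?thesis
  proof (rule idealI)
    show "subgroup J (add_monoid (polys W))"
    proof (rule R.add.subgroupI)
      fix a assume a: "a \<in> J"
      then show "\<ominus>\<^bsub>polys W\<^esub> a \<in> J" using polys_a_inv[of a W] assms(1) neg[OF a] by auto
    qed (use assms in auto)
  qed (use assms R.ring_axioms in \<open>auto simp: mult.commute\<close>)
qed

lemma sr_ideal:
  fixes K :: "'v set set"
  shows "ideal (stanley_reisner_ideal K :: ('v, 'k::field) mpoly set) (polys (\<Union>K))"
  unfolding stanley_reisner_ideal_def
  by (rule genideal_carrier(1)) (auto intro!: polys_prod var_carrier)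

text \<open>The ideal is generated by monomials: the monomials with nonface support span an ideal
  because faces are closed under subsets, and each of them is divisible by the product of its
  support.\<close>

lemma sr_ideal_iff:
  fixes p :: "('v, 'k::field) mpoly"
  assumes down: "\<And>F G. F \<in> K \<Longrightarrow> G \<subseteq> F \<Longrightarrow> G \<in> K"
  shows "p \<in> stanley_reisner_ideal K \<longleftrightarrow> p \<in> carrier (polys (\<Union>K)) \<and> (\<forall>m\<in>Poly_Mapping.keys p. mkeys m \<notin> K)"
proof -
  let ?R = "polys (\<Union>K) :: ('v, 'k) mpoly ring"
  define G :: "('v, 'k) mpoly set" where "G = {\<Prod>v\<in>F. var v | F. F \<subseteq> \<Union>K \<and> finite F \<and> F \<notin> K}"
  define J where "J = {p \<in> carrier ?R. \<forall>m\<in>Poly_Mapping.keys p. mkeys m \<notin> K}"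
  have I: "stanley_reisner_ideal K = Idl\<^bsub>?R\<^esub> G" by (simp add: stanley_reisner_ideal_def G_def)
  have G: "G \<subseteq> carrier ?R" unfolding G_def by (auto intro!: polys_prod var_carrier)
  have "ideal J ?R"
  proof (rule polys_idealI)
    fix p q assume p: "p \<in> J" and q: "q \<in> J"
    have "mkeys m \<notin> K" if m: "m \<in> Poly_Mapping.keys (p + q)" for m
    proof -
      have "m \<in> Poly_Mapping.keys p \<or> m \<in> Poly_Mapping.keys q" using m Poly_Mapping.keys_add[of p q] by blast
      then show ?thesis using p q by (auto simp: J_def)
    qed
    then show "p + q \<in> J" using p q polys_closed(1)[of p "\<Union>K" q] by (simp add: J_def)
  next
    fix p q assume p: "p \<in> J" and q: "q \<in> carrier ?R"
    have "mkeys m \<notin> K" if m: "m \<in> Poly_Mapping.keys (q * p)" for m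
    proof -
      obtain a b where ab: "m = a + b" "b \<in> Poly_Mapping.keys p" using m keys_mult[of q p] by blast
      then have "mkeys b \<subseteq> mkeys m" "mkeys b \<notin> K" using p by (auto simp: J_def keys_plus_nat)
      then show ?thesis using down by blast
    qed
    then show "q * p \<in> J" using polys_closed(2)[OF q, of p] p by (simp add: J_def)
  qed (auto simp: J_def polys_01)
  moreover have "G \<subseteq> J"
  proof
    fix g assume g: "g \<in> G"
    then obtain F where F: "g = (\<Prod>v\<in>F. var v)" "finite F" "F \<notin> K" by (auto simp: G_def)
    moreover have "g \<in> carrier ?R" using G g by (rule subsetD)
    ultimately show "g \<in> J" by (simp add: J_def var_prod keys_ind)
  qed
  ultimately have IJ: "Idl\<^bsub>?R\<^esub> G \<subseteq> J" by (rule genideal_carrier(3)[OF G])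
  have JI: "p \<in> Idl\<^bsub>?R\<^esub> G" if p: "p \<in> J" for p
  proof -
    interpret R: cring ?R by (rule polys_cring)
    interpret I: ideal "Idl\<^bsub>?R\<^esub> G" ?R by (rule genideal_carrier(1)[OF G])
    have mono: "Poly_Mapping.single m c \<in> Idl\<^bsub>?R\<^esub> G" if m: "mkeys m \<subseteq> \<Union>K" "mkeys m \<notin> K" for m c
    proof -
      have "(\<Prod>v\<in>mkeys m. var v) \<in> Idl\<^bsub>?R\<^esub> G" 
        by (rule subsetD[OF genideal_carrier(2)[OF G]]) (unfold G_def, use m in \<open>auto intro!: exI[of _ "mkeys m"]\<close>)
      moreover have "Poly_Mapping.single (m - ind (mkeys m)) c \<in> carrier ?R"
        using m(1) by (intro single_carrier) (auto simp: in_keys_iff lookup_minus)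
      ultimately have "Poly_Mapping.single (m - ind (mkeys m)) c * (\<Prod>v\<in>mkeys m. var v) \<in> Idl\<^bsub>?R\<^esub> G"
        using I.I_l_closed by fastforce
      moreover have "m - ind (mkeys m) + ind (mkeys m) = m"
        by (rule poly_mapping_eqI) (auto simp: lookup_add lookup_minus lookup_ind in_keys_iff)
      ultimately show ?thesis by (simp add: var_prod mult_single)
    qed
    have "(\<Sum>m\<in>M. Poly_Mapping.single m (Poly_Mapping.lookup p m)) \<in> Idl\<^bsub>?R\<^esub> G"
      if "finite M" "M \<subseteq> Poly_Mapping.keys p" for M
      using that
    proof (induction M rule: finite_induct)
      case empty
      then show ?case using I.zero_closed by simp
    next
      case (insert m M)
      have "mkeys m \<subseteq> \<Union>K" "mkeys m \<notin> K" using p insert.prems unfolding J_def polys_carrier by blast+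
      then show ?case using insert mono[of m] I.a_closed by simp
    qed
    then have "(\<Sum>m\<in>Poly_Mapping.keys p. Poly_Mapping.single m (Poly_Mapping.lookup p m)) \<in> Idl\<^bsub>?R\<^esub> G" by simp
    moreover have "(\<Sum>m\<in>Poly_Mapping.keys p. Poly_Mapping.single m (Poly_Mapping.lookup p m)) = p"
      by (rule poly_mapping_as_sum[symmetric])
    ultimately show ?thesis by simp
  qed
  show ?thesis unfolding I using IJ JI by (auto simp: J_def)
qed

text \<open>Equality of the colon ideals, applied to the variable v of the irrelevant ideal and
  pulled back to polynomials: f_i y in (f_k : k < i) implies x_v y in (f_k : k < i).\<close>

lemma buchsbaum_complexD:
  fixes fs :: "('v, 'k::field) mpoly list"
  assumes B: "buchsbaum_complex TYPE('k) K" and fs: "sr_hsop K fs" "i < length fs"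
    and g: "\<forall>k<i. g k \<in> carrier (polys (\<Union>K))" and y: "y \<in> carrier (polys (\<Union>K))"
    and y_f: "fs ! i * y - (\<Sum>k<i. g k * fs ! k) \<in> stanley_reisner_ideal K" and v: "v \<in> \<Union>K"
  shows "\<exists>h. (\<forall>k<i. h k \<in> carrier (polys (\<Union>K))) \<and>
    var v * y - (\<Sum>k<i. h k * fs ! k) \<in> stanley_reisner_ideal K"
proof -
  have fc: "set fs \<subseteq> carrier (polys (\<Union>K))" using fs(1) by (auto simp: sr_hsop_def)
  interpret q: poly_quot "\<Union>K" "stanley_reisner_ideal K" "take i fs"
    by (rule poly_quot.intro[OF sr_ideal]) (use fc set_take_subset[of i fs] in blast)
  let ?I = "stanley_reisner_ideal K :: ('v, 'k) mpoly set"
  have L: "p \<in> q.L \<longleftrightarrow> p \<in> carrier (polys (\<Union>K)) \<and> (\<exists>g. (\<forall>k<i. g k \<in> carrier (polys (\<Union>K))) \<and>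
      p - (\<Sum>k<i. g k * fs ! k) \<in> ?I)" for p
  proof -
    have "(\<Sum>k<i. g k * take i fs ! k) = (\<Sum>k<i. g k * fs ! k)" for g by (rule sum.cong) auto
    then show ?thesis using fs(2) by (simp add: q.L_def min_def)
  qed
  have colon: "?I +>\<^bsub>q.R\<^esub> a \<in> seq_colon q.R ?I (take i fs) T \<longleftrightarrow> (\<forall>b\<in>T. b * a \<in> q.L)"
    if a: "a \<in> carrier q.R" and T: "T \<subseteq> carrier q.R" for a T
  proof -
    have "(?I +>\<^bsub>q.R\<^esub> b) \<otimes>\<^bsub>q.A\<^esub> (?I +>\<^bsub>q.R\<^esub> a) \<in> seq_ideal q.R ?I (take i fs) \<longleftrightarrow> b * a \<in> q.L" if b: "b \<in> T" for b
    proof -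
      have bc: "b \<in> carrier q.R" using b T by blast
      show ?thesis using q.rh.hom_mult[OF bc a] q.seq_ideal_iff[OF polys_closed(2)[OF bc a]] by simp
    qed
    then show ?thesis using q.rh.hom_closed[OF a] by (simp add: seq_colon_def)
  qed
  have fi: "fs ! i \<in> carrier q.R" using fc fs(2) by auto
  have irr: "(var v :: ('v, 'k) mpoly) \<in> irrelevant_ideal (\<Union>K)" "irrelevant_ideal (\<Union>K) \<subseteq> carrier (q.R)"
  proof -
    have S: "var ` \<Union>K \<subseteq> carrier q.R" by (auto intro: var_carrier)
    show "(var v :: ('v, 'k) mpoly) \<in> irrelevant_ideal (\<Union>K)" unfolding irrelevant_ideal_def
      by (rule subsetD[OF genideal_carrier(2)[OF S]]) (use v in simp)
    show "irrelevant_ideal (\<Union>K) \<subseteq> carrier (q.R)" unfolding irrelevant_ideal_def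
      by (rule subsetI) (rule ideal.Icarr[OF genideal_carrier(1)[OF S]])
  qed
  have "fs ! i * y \<in> q.L" unfolding L
    by (intro conjI exI[of _ g]) (use g y_f polys_closed(2)[OF fi y] in auto)
  then have "?I +>\<^bsub>q.R\<^esub> y \<in> seq_colon q.R ?I (take i fs) {fs ! i}" using colon[OF y, of "{fs ! i}"] fi by simp
  moreover have "seq_colon q.R ?I (take i fs) {fs ! i} = seq_colon q.R ?I (take i fs) (irrelevant_ideal (\<Union>K))"
    by (rule mp[OF spec[OF mp[OF spec[OF B[unfolded buchsbaum_complex_def], of fs] fs(1)], of i] fs(2)])
  ultimately have "var v * y \<in> q.L" using colon[OF y irr(2)] irr(1) by simp
  then show ?thesis unfolding L by blast
qed

section \<open>Rank parameters of the Stanley-Reisner ring\<close>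

context sposet
begin

abbreviation U :: "'a set" where "U \<equiv> P - {z}"
abbreviation (input) Delta :: "'a set set" where "Delta \<equiv> order_complex_bar P"

lemma finite_U: "finite U" using finite_P by simp

lemma Delta_down: "F \<in> Delta \<Longrightarrow> G \<subseteq> F \<Longrightarrow> G \<in> Delta"
  unfolding order_complex_bar_def chain_def by (auto intro: finite_subset)

lemma Union_Delta: "\<Union>Delta = U"
proof -
  have "{w} \<in> Delta" if "w \<in> U" for w using that by (auto simp: order_complex_bar_def chain_def)
  then show ?thesis by (auto simp: order_complex_bar_def)
qed

lemma empty_Delta: "{} \<in> Delta" by (simp add: order_complex_bar_def chain_def)

lemma finite_Delta: "finite Delta"
  by (rule finite_subset[of _ "Pow U"]) (use finite_U in \<open>auto simp: order_complex_bar_def\<close>)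

lemma Delta_comparable: "F \<in> Delta \<Longrightarrow> u \<in> F \<Longrightarrow> w \<in> F \<Longrightarrow> u \<le> w \<or> w \<le> u"
  by (auto simp: order_complex_bar_def chain_def)

lemma Delta_rank_inj: "F \<in> Delta \<Longrightarrow> inj_on (\<lambda>w. card (V w)) F"
proof (rule inj_onI)
  fix u w assume *: "F \<in> Delta" "u \<in> F" "w \<in> F" "card (V u) = card (V w)"
  then have "u \<in> P" "w \<in> P" by (auto simp: order_complex_bar_def)
  then show "u = w" using Delta_comparable[OF *(1-3)] card_V_less[of u w] card_V_less[of w u] *(4)
    by (auto simp: less_le)
qed

lemma card_V_pos: "w \<in> U \<Longrightarrow> 0 < card (V w)"
  using V_empty_iff finite_V by (simp add: card_gt_0_iff)

text \<open>A chain counted by the rank of t may start with \<open>z\<close>, which is no vertex of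
  the order complex; it is exchanged for t.\<close>

lemma Max_card_Delta: "Max (card ` Delta) = poset_rank P"
proof (rule Max_eqI)
  show "finite (card ` Delta)" using finite_Delta by simp
next
  fix y assume "y \<in> card ` Delta"
  then obtain F where F: "y = card F" "F \<in> Delta" by blast
  have FU: "F \<subseteq> U" using F(2) by (auto simp: order_complex_bar_def)
  have "(\<lambda>w. card (V w)) ` F \<subseteq> {1..poset_rank P}"
    using FU card_V_le card_V_pos by (fastforce simp: Suc_le_eq)
  then have "card ((\<lambda>w. card (V w)) ` F) \<le> poset_rank P" using card_mono[of "{1..poset_rank P}"] by fastforce
  then show "y \<le> poset_rank P" using card_image[OF Delta_rank_inj[OF F(2)]] F(1) by simp
next
  have "poset_rank P \<in> rk P ` P" unfolding poset_rank_def using finite_P z_P by (intro Max_in) auto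
  then obtain t where t: "t \<in> P" "poset_rank P = rk P t" by blast
  let ?S = "{card C | C. C \<subseteq> {x \<in> P. x < t} \<and> Complete_Partial_Order.chain (\<le>) C}"
  have "finite ?S" by (rule finite_subset[of _ "card ` Pow P"]) (use finite_P in auto)
  moreover have "card {} \<in> ?S" by (intro CollectI exI[of _ "{}"]) (auto simp: chain_def)
  ultimately have "rk P t \<in> ?S" unfolding rk_def by (intro Max_in) auto
  then obtain C where C: "rk P t = card C" "C \<subseteq> {x \<in> P. x < t}" "Complete_Partial_Order.chain (\<le>) C" by blast
  have fC: "finite C" using C(2) finite_P by (auto intro: finite_subset)
  have chain: "Complete_Partial_Order.chain (\<le>) (insert t C)" using C(2,3) by (auto simp: chain_def)
  show "poset_rank P \<in> card ` Delta"
  proof (cases "z \<in> C")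
    case True
    have "insert t (C - {z}) \<in> Delta" using C(2) chain fC t(1) True
      by (auto simp: order_complex_bar_def chain_def)
    moreover have "card (insert t (C - {z})) = card C"
    proof -
      have "t \<notin> C - {z}" using C(2) by auto
      then have "card (insert t (C - {z})) = Suc (card (C - {z}))" using fC by simp
      also have "\<dots> = card C" using True fC by (metis card.remove)
      finally show ?thesis .
    qed
    ultimately show ?thesis using t(2) C(1) by (metis image_eqI)
  next
    case False
    have "C \<in> Delta" using C(2,3) fC False by (auto simp: order_complex_bar_def)
    then show ?thesis using t(2) C(1) by auto
  qed
qed

text \<open>The order complex is balanced, coloured by rank; this is the sum over one colour
  class.\<close>

definition rankf :: "nat \<Rightarrow> ('a, 'k::field) mpoly" where
  "rankf i = (\<Sum>w | w \<in> U \<and> card (V w) = i. var w)"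

lemma rankf_carrier: "rankf i \<in> carrier (polys U)"
  unfolding rankf_def by (intro polys_sum var_carrier) auto

lemma lookup_rankf_mult:
  fixes p :: "('a, 'k::field) mpoly"
  shows "Poly_Mapping.lookup (rankf i * p) M =
    (\<Sum>w | w \<in> mkeys M \<and> w \<in> U \<and> card (V w) = i. Poly_Mapping.lookup p (M - esingle w))"
proof -
  have "Poly_Mapping.lookup (rankf i * p) M = (\<Sum>w | w \<in> U \<and> card (V w) = i.
      if w \<in> mkeys M then Poly_Mapping.lookup p (M - esingle w) else 0)"
    unfolding rankf_def sum_distrib_right lookup_sum lookup_var_mult ..
  also have "\<dots> = (\<Sum>w | w \<in> mkeys M \<and> w \<in> U \<and> card (V w) = i. Poly_Mapping.lookup p (M - esingle w))"
    using finite_U by (intro sum.mono_neutral_cong_right) auto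
  finally show ?thesis .
qed

abbreviation SR :: "('a, 'k::field) mpoly set" where "SR \<equiv> stanley_reisner_ideal Delta"

lemma SR_iff: "p \<in> SR \<longleftrightarrow> p \<in> carrier (polys U) \<and> (\<forall>m\<in>Poly_Mapping.keys p. mkeys m \<notin> Delta)"
  using sr_ideal_iff[of Delta p, OF Delta_down] unfolding Union_Delta by simp

lemma SR_ideal: "ideal (SR :: ('a, 'k::field) mpoly set) (polys U)"
  using sr_ideal[of Delta] unfolding Union_Delta .

text \<open>Two distinct elements of equal rank are no face, so multiplying x_w by the sum of its
  rank shows that its square lies in the ideal. Hence the finitely many squarefree monomials span
  the quotient. The order of the ranks is left free, to be adapted to each t.\<close>

lemma rankf_hsop:
  fixes ks :: "nat list"
  assumes ks: "set ks = {1..poset_rank P}" "length ks = poset_rank P"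
  shows "sr_hsop Delta (map rankf ks :: ('a, 'k::field) mpoly list)"
proof -
  let ?fs = "map rankf ks :: ('a, 'k) mpoly list"
  interpret q: poly_quot U SR ?fs
    by (rule poly_quot.intro[OF SR_ideal]) (auto intro: rankf_carrier)
  \<comment> \<open>The parameters have no constant term and the empty set is a face, so the
    constant coefficient 1 cannot be cancelled.\<close>
  have one: "1 \<notin> q.L"
  proof
    assume "1 \<in> q.L"
    then obtain g where g: "1 - (\<Sum>i<length ?fs. g i * ?fs ! i) \<in> SR" unfolding q.L_def by blast
    have "Poly_Mapping.lookup (g i * ?fs ! i) 0 = 0" if "i < length ?fs" for i
      using lookup_rankf_mult[of "ks ! i" "g i" 0] that by (simp add: mult.commute)
    then have "Poly_Mapping.lookup (1 - (\<Sum>i<length ?fs. g i * ?fs ! i)) 0 = 1"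
      by (simp add: lookup_minus lookup_sum lookup_one)
    then have "(0 :: 'a \<Rightarrow>\<^sub>0 nat) \<in> Poly_Mapping.keys (1 - (\<Sum>i<length ?fs. g i * ?fs ! i))"
      by (simp add: in_keys_iff)
    then have "mkeys (0 :: 'a \<Rightarrow>\<^sub>0 nat) \<notin> Delta" using g unfolding SR_iff by blast
    then show False using empty_Delta by simp
  qed
  have sq: "var w * var w \<in> q.L" if w: "w \<in> U" for w
  proof -
    let ?X = "{u \<in> U. card (V u) = card (V w)}"
    have "card (V w) \<in> set ks" using w card_V_le[of w] card_V_pos[OF w] unfolding ks(1) by simp
    then obtain i where i: "i < length ks" "ks ! i = card (V w)" by (auto simp: in_set_conv_nth)
    then have "rankf (card (V w)) \<in> q.L" using q.fs_in_L[of i] by simp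
    then have 1: "var w * rankf (card (V w)) \<in> q.L" using q.L_closed(2) var_carrier[OF w] by blast
    have A: "var w * var u \<in> q.L" if u: "u \<in> ?X - {w}" for u
    proof (rule q.I_subset_L)
      have "{w, u} \<notin> Delta" using Delta_rank_inj[of "{w, u}"] u by (auto simp: inj_on_def)
      moreover have "mkeys (esingle w + esingle u) = {w, u}" by (simp add: keys_plus_nat insert_commute)
      moreover have "var w * var u = (Poly_Mapping.single (esingle w + esingle u) 1 :: ('a, 'k) mpoly)"
        by (simp add: var_def mult_single)
      ultimately show "(var w * var u :: ('a, 'k) mpoly) \<in> SR" unfolding SR_iff using w u by (simp add: single_carrier)
    qed
    have B: "(\<Sum>u\<in>Y. f u) \<in> q.L" if "\<And>u. u \<in> Y \<Longrightarrow> f u \<in> q.L" for f and Y :: "'a set"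
      using that by (induction Y rule: infinite_finite_induct) (simp_all add: q.L_closed(1,3))
    have 2: "(\<Sum>u\<in>?X - {w}. var w * var u) \<in> q.L" by (rule B) (rule A)
    have "(rankf (card (V w)) :: ('a, 'k) mpoly) = var w + (\<Sum>u\<in>?X - {w}. var u)"
      unfolding rankf_def using finite_U w by (intro sum.remove) auto
    then have "(var w * var w :: ('a, 'k) mpoly) = var w * rankf (card (V w)) - (\<Sum>u\<in>?X - {w}. var w * var u)"
      by (simp add: distrib_left sum_distrib_left)
    then show ?thesis using q.L_closed(5)[OF 1 2] by simp
  qed
  let ?B = "(\<lambda>F. Poly_Mapping.single (ind F) 1 :: ('a, 'k) mpoly) ` Pow U"
  have "finite_dim_quot (polys U) SR ?fs"
  proof (rule q.finite_dim_quotI[OF one])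
    show "finite ?B" using finite_U by simp
    show "?B \<subseteq> carrier (polys U)"
    proof
      fix b assume "b \<in> ?B"
      then obtain F where F: "F \<subseteq> U" "b = Poly_Mapping.single (ind F) 1" by blast
      then show "b \<in> carrier (polys U)" using keys_ind[of F] finite_subset[OF F(1) finite_U] by (simp add: single_carrier)
    qed
    fix m :: "'a \<Rightarrow>\<^sub>0 nat" assume m: "mkeys m \<subseteq> U"
    show "Poly_Mapping.single m 1 \<in> q.L \<or> Poly_Mapping.single m 1 \<in> ?B"
    proof (cases "\<forall>w. Poly_Mapping.lookup m w \<le> 1")
      case True
      have "m = ind (mkeys m)"
      proof (rule poly_mapping_eqI)
        fix w
        have "Poly_Mapping.lookup m w \<le> 1" using True by blast
        then show "Poly_Mapping.lookup m w = Poly_Mapping.lookup (ind (mkeys m)) w" 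
          by (auto simp: lookup_ind in_keys_iff)
      qed
      then have "Poly_Mapping.single m 1 = (Poly_Mapping.single (ind (mkeys m)) 1 :: ('a, 'k) mpoly)" by simp
      then show ?thesis using m by (intro disjI2 image_eqI[of _ _ "mkeys m"]) auto
    next
      case False
      then obtain w where w: "1 < Poly_Mapping.lookup m w" by (auto simp: not_le)
      then have "w \<in> mkeys m" by (simp add: in_keys_iff)
      then have wU: "w \<in> U" by (rule subsetD[OF m])
      have "m = (m - esingle w - esingle w) + (esingle w + esingle w)"
        by (rule poly_mapping_eqI) (use w in \<open>auto simp: lookup_add lookup_minus lookup_single when_def\<close>)
      then have "(Poly_Mapping.single m 1 :: ('a, 'k) mpoly) = Poly_Mapping.single (m - esingle w - esingle w) 1 * (var w * var w)"
        by (simp add: var_def mult_single)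
      moreover have "(Poly_Mapping.single (m - esingle w - esingle w) 1 :: ('a, 'k) mpoly) \<in> carrier (polys U)"
        by (rule single_carrier, rule subset_trans[OF keys_minus_subset subset_trans[OF keys_minus_subset m]])
      ultimately show ?thesis using q.L_closed(2)[OF sq[OF wU]] by simp
    qed
  qed
  moreover have "homogeneous (\<lambda>_. 1) 1 (rankf i :: ('a, 'k) mpoly)" for i
    unfolding homogeneous_def
  proof
    fix m assume "m \<in> Poly_Mapping.keys (rankf i :: ('a, 'k) mpoly)"
    then have "(\<Sum>w | w \<in> U \<and> card (V w) = i. Poly_Mapping.lookup (var w :: ('a, 'k) mpoly) m) \<noteq> 0"
      by (simp add: rankf_def in_keys_iff lookup_sum)
    then obtain w where "Poly_Mapping.lookup (var w :: ('a, 'k) mpoly) m \<noteq> 0" by (rule sum.not_neutral_contains_not_neutral)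
    then have "m = esingle w" by (auto simp: var_def lookup_single when_def split: if_splits)
    then show "(\<Sum>v\<in>mkeys m. Poly_Mapping.lookup m v * 1) = 1" by simp
  qed
  ultimately show ?thesis unfolding sr_hsop_def Union_Delta Max_card_Delta
    using ks(2) rankf_carrier by (auto intro!: exI[of _ 1])
qed

end

definition sqfree_poly :: "'v set set \<Rightarrow> ('v set \<Rightarrow> 'k) \<Rightarrow> ('v, 'k::field) mpoly" where
  "sqfree_poly S a = (\<Sum>c\<in>S. Poly_Mapping.single (ind c) (a c))"

lemma lookup_sqfree_poly:
  assumes S: "finite S" "\<And>c. c \<in> S \<Longrightarrow> finite c"
  shows "Poly_Mapping.lookup (sqfree_poly S a) N = (if mkeys N \<in> S \<and> N = ind (mkeys N) then a (mkeys N) else 0)"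
proof -
  have "Poly_Mapping.lookup (sqfree_poly S a) N
      = (\<Sum>c\<in>S. if c = mkeys N then (if N = ind (mkeys N) then a (mkeys N) else 0) else 0)"
    unfolding sqfree_poly_def lookup_sum
    using S(2) keys_ind by (intro sum.cong) (fastforce simp: lookup_single when_def)+
  then show ?thesis using S(1) by simp
qed

lemma sqfree_poly_carrier: "(\<And>c. c \<in> S \<Longrightarrow> finite c \<and> c \<subseteq> W) \<Longrightarrow> sqfree_poly S a \<in> carrier (polys W)"
  unfolding sqfree_poly_def by (intro polys_sum single_carrier) (auto simp: keys_ind)

lemma ind_remove: "finite F \<Longrightarrow> w \<in> F \<Longrightarrow> ind F - esingle w = ind (F - {w})"
  by (rule poly_mapping_eqI) (auto simp: lookup_minus lookup_ind lookup_single when_def)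

section \<open>From weak regularity to colour regularity\<close>

context sposet
begin

lemma finite_Lk: "finite (Lk t)"
  by (rule finite_subset[of _ "Pow P"]) (use finite_P in \<open>auto simp: Lk_def\<close>)

lemma Lk_subset_U: "t \<in> P \<Longrightarrow> c \<in> Lk t \<Longrightarrow> c \<subseteq> U"
  using z_le by (auto simp: Lk_def less_le_not_le)

lemma Lk_iff:
  assumes t: "t \<in> U" and F: "F \<subseteq> M" "insert t M \<in> Delta" and r: "\<And>w. w \<in> F \<Longrightarrow> card (V t) < card (V w)"
  shows "F \<in> Lk t"
proof -
  have "t < w" if w: "w \<in> F" for w
  proof -
    have "w \<in> P" using w F by (auto simp: order_complex_bar_def)
    moreover have "w \<le> t \<or> t \<le> w" using Delta_comparable[OF F(2)] w F(1) by auto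
    ultimately show ?thesis using r[OF w] card_V_less[of w t] t by (auto simp: less_le)
  qed
  moreover have "Complete_Partial_Order.chain (\<le>) F"
    unfolding chain_def using Delta_comparable[OF F(2)] F(1) by blast
  moreover have "F \<subseteq> P" using F by (auto simp: order_complex_bar_def)
  ultimately show ?thesis by (auto simp: Lk_def)
qed

lemma colour_eq: "card (V w) = Suc (card (V t)) + k \<Longrightarrow> colour t w = k"
  by (simp add: colour_def)

text \<open>After multiplication by \<open>x\<^sub>t\<close> only the chains through \<open>t\<close> survive, so the relation holds modulo the
  Stanley-Reisner ideal; the coefficients \<open>g\<close> are read off in the degrees \<open>x\<^sub>t\<^sup>2\<close> times a chain above \<open>t\<close>.\<close>

lemma buchsbaum_colour_regular:
  assumes B: "buchsbaum_complex TYPE('k::field) Delta" and t: "t \<in> U" and n: "n + card (V t) < poset_rank P"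
  shows "colour_regular TYPE('k) t n"
  unfolding colour_regular_def
proof (intro allI impI)
  fix y :: "'a set \<Rightarrow> 'k" and \<alpha> :: "nat \<Rightarrow> 'a set \<Rightarrow> 'k"
  assume hyp: "\<forall>c\<in>Lk t. {..n} \<subseteq> colour t ` c \<longrightarrow>
    (\<Sum>w | w \<in> c \<and> colour t w = n. y (c - {w})) = (\<Sum>w | w \<in> c \<and> colour t w < n. \<alpha> (colour t w) (c - {w}))"
  let ?C = "\<lambda>c. colour t ` c" and ?f = "\<lambda>k. rankf (Suc (card (V t)) + k) :: ('a, 'k) mpoly"
  have tP: "t \<in> P" using t by simp
  \<comment> \<open>The chains allowed in the coefficient of the k-th parameter: among the colours
    up to n exactly k is missing, so that multiplication by the k-th parameter can fill it.\<close>
  define C where "C k = {c \<in> Lk t. k \<notin> ?C c \<and> {..n} - {k} \<subseteq> ?C c}" for k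
  have C: "finite (C k)" "\<And>c. c \<in> C k \<Longrightarrow> finite c" "\<And>c. c \<in> C k \<Longrightarrow> finite c \<and> c \<subseteq> U" for k
    using finite_Lk Lk_finite Lk_subset_U[OF tP] by (auto simp: C_def)
  have lk: "Poly_Mapping.lookup (sqfree_poly (C k) a) N = (if mkeys N \<in> C k \<and> N = ind (mkeys N) then a (mkeys N) else 0)"
    for k N and a :: "'a set \<Rightarrow> 'k" by (rule lookup_sqfree_poly) (use C in auto)
  have rem: "c - {w} \<in> C (colour t w)" if c: "c \<in> Lk t" "{..n} \<subseteq> ?C c" and w: "w \<in> c" for c w
    using c colour_remove[OF tP c(1) w] Lk_subset[OF c(1), of "c - {w}"] by (auto simp: C_def)
  \<comment> \<open>Coefficients are compared only at monomials that form a chain together with t.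
    There a rank variable of colour k has to complete a chain of C k to one with all colours up to
    n.\<close>
  have key: "Poly_Mapping.lookup (?f k * sqfree_poly (C k) a) M =
      (if M = ind (mkeys M) \<and> mkeys M \<in> Lk t \<and> {..n} \<subseteq> ?C (mkeys M)
       then \<Sum>w | w \<in> mkeys M \<and> colour t w = k. a (mkeys M - {w}) else 0)"
    if k: "k \<le> n" and M: "insert t (mkeys M) \<in> Delta" for k M and a :: "'a set \<Rightarrow> 'k"
  proof (cases "M = ind (mkeys M) \<and> mkeys M \<in> Lk t \<and> {..n} \<subseteq> ?C (mkeys M)")
    case True
    let ?F = "mkeys M"
    have F: "?F \<in> Lk t" "finite ?F" "{..n} \<subseteq> ?C ?F" using True by auto
    have "{w. w \<in> ?F \<and> w \<in> U \<and> card (V w) = Suc (card (V t)) + k} = {w. w \<in> ?F \<and> colour t w = k}"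
      using Lk_card_V[OF tP F(1)] Lk_subset_U[OF tP F(1)] by auto
    moreover have "Poly_Mapping.lookup (sqfree_poly (C k) a) (M - esingle w) = a (?F - {w})"
      if w: "w \<in> {w. w \<in> ?F \<and> colour t w = k}" for w
    proof -
      have "M - esingle w = ind ?F - esingle w" using True by simp
      also have "\<dots> = ind (?F - {w})" using w F(2) by (intro ind_remove) auto
      finally have e: "M - esingle w = ind (?F - {w})" .
      have "mkeys (M - esingle w) = ?F - {w}" unfolding e using F(2) by (intro keys_ind) auto
      moreover have "?F - {w} \<in> C k" using rem[OF F(1,3), of w] w by auto
      ultimately show ?thesis unfolding lk using e by simp
    qed
    ultimately show ?thesis unfolding lookup_rankf_mult using True by simp
  next
    case False
    have "Poly_Mapping.lookup (sqfree_poly (C k) a) (M - esingle w) = 0"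
      if w: "w \<in> mkeys M" "w \<in> U" "card (V w) = Suc (card (V t)) + k" for w
    proof (rule ccontr)
      assume "Poly_Mapping.lookup (sqfree_poly (C k) a) (M - esingle w) \<noteq> 0"
      then obtain c where c: "c \<in> C k" "M - esingle w = ind c"
        unfolding lk by (auto split: if_splits)
      have ct: "c \<in> Lk t" "k \<notin> ?C c" "{..n} - {k} \<subseteq> ?C c" using c(1) by (auto simp: C_def)
      have col: "colour t w = k" using colour_eq[OF w(3)] .
      have wc: "w \<notin> c" using ct(2) col by auto
      have "M = (M - esingle w) + esingle w" using minus_esingle_plus[OF w(1)] by simp
      also have "\<dots> = ind (insert w c)" unfolding c(2) using wc Lk_finite[OF ct(1)] by (simp add: ind_def add.commute)
      finally have M': "M = ind (insert w c)" .
      then have kM: "mkeys M = insert w c" using Lk_finite[OF ct(1)] by (simp add: keys_ind)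
      have "insert w c \<in> Lk t"
      proof (rule Lk_iff[OF t _ M])
        show "card (V t) < card (V u)" if "u \<in> insert w c" for u
          using that w(3) Lk_card_V[OF tP ct(1)] by auto
      qed (simp add: kM)
      moreover have "{..n} \<subseteq> ?C (insert w c)" using ct(3) col by auto
      ultimately show False using False kM M' by simp
    qed
    then have "Poly_Mapping.lookup (?f k * sqfree_poly (C k) a) M = 0"
      unfolding lookup_rankf_mult by (intro sum.neutral) auto
    then show ?thesis using False by auto
  qed
  \<comment> \<open>The ranks above that of t come first, so the parameter at position k is the one
    of colour k.\<close>
  let ?ks = "[Suc (card (V t))..<Suc (poset_rank P)] @ [1..<Suc (card (V t))]"
  let ?fs = "map rankf ?ks :: ('a, 'k) mpoly list"
  have hs: "sr_hsop Delta ?fs"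
    using card_V_le[OF tP] by (intro rankf_hsop) auto
  have fk: "?fs ! k = ?f k" if "k \<le> n" for k
  proof -
    have "k < length [Suc (card (V t))..<Suc (poset_rank P)]" using that n by simp
    then show ?thesis by (simp add: nth_append del: upt_Suc)
  qed
  let ?y = "sqfree_poly (C n) y" and ?z = "\<lambda>k. sqfree_poly (C k) (\<alpha> k)"
  let ?x = "var t :: ('a, 'k) mpoly"
  have yc: "?y \<in> carrier (polys U)" and zc: "?z k \<in> carrier (polys U)" for k using C(3) by (auto intro!: sqfree_poly_carrier)
  have xc: "?x \<in> carrier (polys U)" using t by (rule var_carrier)
  have "?f n * ?y - (\<Sum>k<n. ?f k * ?z k) \<in> carrier (polys U)"
    by (intro polys_closed polys_sum rankf_carrier yc zc)
  then have pc: "?x * (?f n * ?y - (\<Sum>k<n. ?f k * ?z k)) \<in> carrier (polys U)" using polys_closed(2) xc by blast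
  \<comment> \<open>Only monomials supported on a chain matter modulo the ideal. The factor x_t
    forces this chain to contain t, and then the hypothesis on y and \<alpha> gives the
    cancellation.\<close>
  have p0: "Poly_Mapping.lookup (?x * (?f n * ?y - (\<Sum>k<n. ?f k * ?z k))) m = 0" if m: "mkeys m \<in> Delta" for m
  proof (cases "t \<in> mkeys m")
    case True
    define M where "M = m - esingle t"
    have "insert t (mkeys M) \<subseteq> mkeys m" using True keys_minus_esingle[of m t] by (auto simp: M_def)
    then have M: "insert t (mkeys M) \<in> Delta" using Delta_down[OF m] by blast
    have "Poly_Mapping.lookup (?f n * ?y - (\<Sum>k<n. ?f k * ?z k)) M =
      Poly_Mapping.lookup (?f n * ?y) M - (\<Sum>k<n. Poly_Mapping.lookup (?f k * ?z k) M)"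
      by (simp add: lookup_minus lookup_sum)
    also have "\<dots> = 0"
    proof (cases "M = ind (mkeys M) \<and> mkeys M \<in> Lk t \<and> {..n} \<subseteq> ?C (mkeys M)")
      case True
      let ?F = "mkeys M"
      have "(\<Sum>k<n. Poly_Mapping.lookup (?f k * ?z k) M) = (\<Sum>k<n. \<Sum>w | w \<in> ?F \<and> colour t w = k. \<alpha> k (?F - {w}))"
        using key[OF _ M] True by (intro sum.cong) auto
      also have "\<dots> = (\<Sum>k<n. \<Sum>w | w \<in> {w \<in> ?F. colour t w < n} \<and> colour t w = k. \<alpha> (colour t w) (?F - {w}))"
        by (intro sum.cong) auto
      also have "\<dots> = (\<Sum>w | w \<in> ?F \<and> colour t w < n. \<alpha> (colour t w) (?F - {w}))"
        by (rule sum.group) auto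
      also have "\<dots> = (\<Sum>w | w \<in> ?F \<and> colour t w = n. y (?F - {w}))"
        using hyp True by simp
      also have "\<dots> = Poly_Mapping.lookup (?f n * ?y) M" using key[OF order_refl M, of y] True by simp
      finally show ?thesis by simp
    next
      case False
      have "Poly_Mapping.lookup (?f k * sqfree_poly (C k) a) M = 0" if "k \<le> n" for k and a :: "'a set \<Rightarrow> 'k"
        unfolding key[OF that M] by (rule if_not_P[OF False])
      then show ?thesis by simp
    qed
    finally show ?thesis using True by (simp add: lookup_var_mult M_def)
  qed (simp add: lookup_var_mult)
  have p: "?x * (?f n * ?y - (\<Sum>k<n. ?f k * ?z k)) \<in> SR"
    unfolding SR_iff using pc p0 by (auto simp: in_keys_iff)
  have "?x * (?f n * ?y - (\<Sum>k<n. ?f k * ?z k)) = ?fs ! n * (?x * ?y) - (\<Sum>k<n. (?x * ?z k) * ?fs ! k)"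
    using fk by (simp add: algebra_simps sum_distrib_left)
  then have p': "?fs ! n * (?x * ?y) - (\<Sum>k<n. (?x * ?z k) * ?fs ! k) \<in> SR" using p by simp
  have len: "n < length ?fs" using n by simp
  \<comment> \<open>The test variable is x_t again. This is the second factor x_t in the degrees
    from which g is read off.\<close>
  note D = buchsbaum_complexD[OF B hs len, unfolded Union_Delta, of "\<lambda>k. ?x * ?z k" "?x * ?y" t, OF _ _ p' t]
  obtain h where h: "\<forall>k<n. h k \<in> carrier (polys U)" "?x * (?x * ?y) - (\<Sum>k<n. h k * ?fs ! k) \<in> SR"
    using D polys_closed(2)[OF xc] yc zc by blast
  define g where "g k c = Poly_Mapping.lookup (h k) (esingle t + esingle t + ind c)" for k c
  have "y c = (\<Sum>w | w \<in> c \<and> colour t w < n. g (colour t w) (c - {w}))"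
    if c: "c \<in> Lk t" "n \<notin> ?C c" "{..<n} \<subseteq> ?C c" for c
  proof -
    define m where "m = esingle t + esingle t + ind c"
    have fc: "finite c" and tc: "t \<notin> c" using Lk_finite[OF c(1)] c(1) by (auto simp: Lk_def)
    have km: "mkeys m = insert t c" using fc by (simp add: m_def keys_plus_nat keys_ind)
    have "insert t c \<in> Delta" using Lk_insert[OF c(1) tP] t fc by (auto simp: order_complex_bar_def Ch_def)
    then have "Poly_Mapping.lookup (?x * (?x * ?y) - (\<Sum>k<n. h k * ?fs ! k)) m = 0"
      using h(2) unfolding SR_iff km[symmetric] by (auto simp: in_keys_iff)
    then have eq: "Poly_Mapping.lookup (?x * (?x * ?y)) m = (\<Sum>k<n. Poly_Mapping.lookup (h k * ?fs ! k) m)"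
      by (simp add: lookup_minus lookup_sum)
    have m1: "m - esingle t = esingle t + ind c" by (simp add: m_def add.assoc)
    have "{..n} - {n} = {..<n}" by auto
    then have "c \<in> C n" using c by (simp add: C_def)
    then have "Poly_Mapping.lookup (?x * (?x * ?y)) m = y c"
      using fc by (simp add: lookup_var_mult km m1 keys_plus_nat keys_ind lk)
    moreover have "Poly_Mapping.lookup (h k * ?fs ! k) m = (\<Sum>w | w \<in> {w \<in> c. colour t w < n} \<and> colour t w = k. g (colour t w) (c - {w}))"
      if k: "k < n" for k
    proof -
      have "h k * ?fs ! k = ?f k * h k" using fk[of k] k by (simp add: mult.commute)
      moreover have "{w. w \<in> mkeys m \<and> w \<in> U \<and> card (V w) = Suc (card (V t)) + k} = {w. w \<in> {w \<in> c. colour t w < n} \<and> colour t w = k}"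
        using Lk_card_V[OF tP c(1)] Lk_subset_U[OF tP c(1)] k unfolding km by auto
      moreover have "m - esingle w = esingle t + esingle t + ind (c - {w})" if "w \<in> c" for w
      proof -
        have "m = esingle t + esingle t + ind (c - {w}) + esingle w"
          using fc that by (simp add: m_def ind_def sum.remove[of c w] add_ac)
        then show ?thesis by simp
      qed
      ultimately show ?thesis unfolding g_def lookup_rankf_mult by (auto simp: lookup_rankf_mult intro!: sum.cong)
    qed
    ultimately have "y c = (\<Sum>k<n. \<Sum>w | w \<in> {w \<in> c. colour t w < n} \<and> colour t w = k. g (colour t w) (c - {w}))"
      using eq by simp
    also have "\<dots> = (\<Sum>w | w \<in> c \<and> colour t w < n. g (colour t w) (c - {w}))"
      using fc by (intro sum.group) auto
    finally show ?thesis .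
  qed
  then show "\<exists>g. \<forall>c\<in>Lk t. n \<notin> ?C c \<longrightarrow> {..<n} \<subseteq> ?C c \<longrightarrow>
      y c = (\<Sum>w | w \<in> c \<and> colour t w < n. g (colour t w) (c - {w}))" by blast
qed

end

section \<open>Linear systems of parameters\<close>

text \<open>The map sending u to the sum of u v times \<theta> v is injective; a left inverse,
  evaluated at the unit vectors of k^d, has the dual vectors as its coordinates.\<close>

lemma dual_basis:
  fixes \<theta> :: "'v \<Rightarrow> nat \<Rightarrow> 'k::field"
  assumes B: "finite B"
    and inj: "\<And>u. (\<And>v. v \<notin> B \<Longrightarrow> u v = 0) \<Longrightarrow> (\<And>i. i < d \<Longrightarrow> (\<Sum>v\<in>B. u v * \<theta> v i) = 0) \<Longrightarrow> (\<forall>v\<in>B. u v = 0)"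
  shows "\<exists>a. \<forall>v\<in>B. \<forall>w\<in>B. (\<Sum>i<d. \<theta> v i * a w i) = (if v = w then 1 else 0)"
proof -
  let ?S = "{u :: 'v \<Rightarrow> 'k. \<forall>v. v \<notin> B \<longrightarrow> u v = 0}"
  define lmap where "lmap u = (\<lambda>i. if i < d then \<Sum>v\<in>B. u v * \<theta> v i else 0)" for u
  have lin: "Vector_Spaces.linear fscale fscale lmap"
    by (rule fs_linearI) (auto simp: lmap_def fscale_def fun_eq_iff distrib_right sum.distrib sum_distrib_left mult.assoc)
  have sub: "fs.subspace ?S" by (rule fs.subspaceI) (auto simp: fscale_def)
  have "inj_on lmap ?S"
  proof (rule inj_onI)
    fix u u' assume u: "u \<in> ?S" "u' \<in> ?S" "lmap u = lmap u'"
    have "\<forall>v\<in>B. (u - u') v = 0"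
    proof (rule inj)
      show "(u - u') v = 0" if "v \<notin> B" for v using u that by simp
      show "(\<Sum>v\<in>B. (u - u') v * \<theta> v i) = 0" if i: "i < d" for i
        using fun_cong[OF u(3), of i] i by (simp add: lmap_def left_diff_distrib sum_subtractf)
    qed
    then have e: "u x = u' x" if "x \<in> B" for x using that by simp
    show "u = u'"
    proof
      show "u x = u' x" for x using e[of x] u(1,2) by (cases "x \<in> B") simp_all
    qed
  qed
  then obtain g where g: "Vector_Spaces.linear fscale fscale g" "\<And>u. u \<in> ?S \<Longrightarrow> g (lmap u) = u"
    using fsp.linear_exists_left_inverse_on[OF lin sub] by blast
  interpret g: Vector_Spaces.linear fscale fscale g by (rule g(1))
  define e :: "nat \<Rightarrow> nat \<Rightarrow> 'k" where "e i = (\<lambda>j. if j = i then 1 else 0)" for i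
  have "(\<Sum>i<d. \<theta> v i * g (e i) w) = (if v = w then 1 else 0)" if v: "v \<in> B" for v w
  proof -
    let ?u = "\<lambda>x. if x = v then 1 else 0 :: 'k"
    have "lmap ?u = (\<Sum>i<d. fscale (\<theta> v i) (e i))"
    proof
      fix j
      have "(\<Sum>x\<in>B. ?u x * \<theta> x j) = (\<Sum>x\<in>B. if x = v then \<theta> v j else 0)" by (rule sum.cong) auto
      then have "lmap ?u j = (if j < d then \<theta> v j else 0)" using B v by (simp add: lmap_def)
      moreover have "(\<Sum>i<d. fscale (\<theta> v i) (e i)) j = (\<Sum>i<d. if i = j then \<theta> v j else 0)"
        unfolding sum_fun_apply by (rule sum.cong) (auto simp: fscale_def e_def)
      ultimately show "lmap ?u j = (\<Sum>i<d. fscale (\<theta> v i) (e i)) j" by simp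
    qed
    moreover have "g (lmap ?u) = ?u" using v by (intro g(2)) auto
    ultimately have "(\<Sum>i<d. fscale (\<theta> v i) (g (e i))) = ?u" by (simp add: g.sum g.scale)
    then have "(\<Sum>i<d. fscale (\<theta> v i) (g (e i))) w = ?u w" by simp
    then show ?thesis by (auto simp: sum_fun_apply fscale_def)
  qed
  then show ?thesis by (intro exI[of _ "\<lambda>w i. g (e i) w"]) simp
qed

text \<open>Restriction of polynomials to the line spanned by u: x_v is sent to u v times the
  indeterminate.\<close>

definition lev :: "('v \<Rightarrow> 'k) \<Rightarrow> ('v \<Rightarrow>\<^sub>0 nat) \<Rightarrow> 'k::field poly" where
  "lev u m = (\<Prod>v\<in>mkeys m. [:0, u v:] ^ Poly_Mapping.lookup m v)"

lemma lev_evaluation: "monomial_evaluation (\<lambda>c. [:c:]) (lev (u :: 'v \<Rightarrow> 'k::field))"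
proof
  fix m m' :: "'v \<Rightarrow>\<^sub>0 nat"
  have sup: "lev u n = (\<Prod>v\<in>mkeys m \<union> mkeys m'. [:0, u v:] ^ Poly_Mapping.lookup n v)"
    if "mkeys n \<subseteq> mkeys m \<union> mkeys m'" for n
    unfolding lev_def using that by (intro prod.mono_neutral_left) (auto simp: in_keys_iff)
  have "lev u (m + m') = (\<Prod>v\<in>mkeys m \<union> mkeys m'. [:0, u v:] ^ Poly_Mapping.lookup (m + m') v)"
    by (rule sup) (auto simp: keys_plus_nat)
  also have "\<dots> = lev u m * lev u m'" by (simp add: sup lookup_add power_add prod.distrib)
  finally show "lev u (m + m') = lev u m * lev u m'" .
qed (auto simp: lev_def)

lemma mdeg_1:
  assumes "mdeg m = Suc 0" shows "\<exists>v\<in>mkeys m. m = esingle v"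
proof -
  have "mkeys m \<noteq> {}" using assms by (auto simp: mdeg_def)
  then obtain v where v: "v \<in> mkeys m" by blast
  have "mdeg (m - esingle v) = 0" using mdeg_minus_esingle[OF v] assms by simp
  then have "m = esingle v" using minus_esingle_plus[OF v] by (simp add: mdeg_eq_0)
  then show ?thesis using v by blast
qed

context sposet
begin

lemma linear_form:
  fixes p :: "('a, 'k::field) mpoly"
  assumes p: "p \<in> carrier (polys (atoms P))" "homogeneous (rk P) 1 p"
  shows "p = (\<Sum>v\<in>atoms P. const (Poly_Mapping.lookup p (esingle v)) * var v)"
proof (rule poly_mapping_eqI)
  fix m
  have rhs: "Poly_Mapping.lookup (\<Sum>v\<in>atoms P. const (Poly_Mapping.lookup p (esingle v)) * var v) m
      = (\<Sum>v\<in>atoms P. if esingle v = m then Poly_Mapping.lookup p m else 0)"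
    unfolding lookup_sum lookup_const_mult by (rule sum.cong) (auto simp: var_def lookup_single when_def)
  show "Poly_Mapping.lookup p m = Poly_Mapping.lookup (\<Sum>v\<in>atoms P. const (Poly_Mapping.lookup p (esingle v)) * var v) m"
  proof (cases "m \<in> Poly_Mapping.keys p")
    case True
    have at: "mkeys m \<subseteq> atoms P" using True p(1) by (auto simp: polys_carrier)
    have "rk P v = 1" if "v \<in> mkeys m" for v
      using rk_eq_card_V[of v] V_atom[of v] at that atoms_iff by auto
    then have "mdeg m = (\<Sum>v\<in>mkeys m. Poly_Mapping.lookup m v * rk P v)" unfolding mdeg_def by simp
    also have "\<dots> = Suc 0" using True p(2) by (simp add: homogeneous_def)
    finally have "mdeg m = Suc 0" .
    then obtain w where w: "w \<in> mkeys m" "m = esingle w" using mdeg_1 by blast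
    have "esingle v = m \<longleftrightarrow> v = w" for v
    proof
      assume "esingle v = m"
      then have "mkeys (esingle v) = mkeys m" by (rule arg_cong)
      then show "v = w" by (simp add: w(2))
    qed (simp add: w(2))
    then show ?thesis unfolding rhs using w(1) at finite_atoms by auto
  next
    case False
    then have "Poly_Mapping.lookup p m = 0" by (simp add: in_keys_iff)
    then show ?thesis unfolding rhs by (simp cong: if_cong)
  qed
qed

end

context face_ring
begin

text \<open>After restriction to t, each parameter becomes the indeterminate times the sum of u v
  \<theta> v i, which is zero by assumption.\<close>

lemma evaluation_kills_L:
  fixes u :: "'a \<Rightarrow> 'k"
  assumes t: "t \<in> P" and lin: "\<And>i. i < length fs \<Longrightarrow> fs ! i = (\<Sum>v\<in>atoms P. const (\<theta> v i) * var v)"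
    and u: "\<And>i. i < length fs \<Longrightarrow> (\<Sum>v\<in>V t. u v * \<theta> v i) = 0" and p: "p \<in> pq.L"
  shows "mev (\<lambda>c. [:c:]) (lev u) (phi t p) = 0"
proof -
  interpret ev: monomial_evaluation "\<lambda>c. [:c:]" "lev u" by (rule lev_evaluation)
  have v: "mev (\<lambda>c. [:c:]) (lev u) (phi t (var v)) = (if v \<in> V t then [:0, u v:] else 0)" if "v \<in> atoms P" for v
    using that unfolding phi_var V_atom[OF that] by (auto simp: V_def ev.single ev.zero lev_def ind_def one_pCons)
  have f0: "mev (\<lambda>c. [:c:]) (lev u) (phi t (fs ! i)) = 0" if i: "i < length fs" for i
  proof -
    have "mev (\<lambda>c. [:c:]) (lev u) (phi t (fs ! i)) = (\<Sum>v\<in>atoms P. [:\<theta> v i:] * (if v \<in> V t then [:0, u v:] else 0))"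
      unfolding lin[OF i] phi_sum phi_mult phi_const ev.sum ev.mult
      by (rule sum.cong) (auto simp: v const_def ev.single lev_def)
    also have "\<dots> = (\<Sum>v\<in>V t. [:0, u v * \<theta> v i:])"
      using finite_atoms V_subset_atoms by (intro sum.mono_neutral_cong_right) (auto simp: mult.commute)
    also have "\<dots> = [:0, \<Sum>v\<in>V t. u v * \<theta> v i:]"
      by (induction "V t" rule: infinite_finite_induct) (simp_all flip: sum.insert, rule poly_eqI, simp add: Polynomial.coeff_sum coeff_pCons sum.neutral split: nat.split)
    finally show ?thesis using u[OF i] by simp
  qed
  obtain g where g: "p - (\<Sum>i<length fs. g i * fs ! i) \<in> Id" using p unfolding pq.L_def by blast
  have "phi t (p - (\<Sum>i<length fs. g i * fs ! i)) = 0" by (rule phi_face_ideal[OF t g])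
  then have "phi t p = (\<Sum>i<length fs. phi t (g i) * phi t (fs ! i))" by (simp add: phi_diff phi_sum phi_mult)
  then show ?thesis by (simp add: ev.sum ev.mult f0)
qed

text \<open>At the face \<open>z\<close> and the zero vector the evaluation reads off the constant
  term.\<close>

lemma one_notin_L:
  assumes lin: "\<And>i. i < length fs \<Longrightarrow> fs ! i = (\<Sum>v\<in>atoms P. const (\<theta> v i) * var v)"
  shows "1 \<notin> pq.L"
proof
  assume "1 \<in> pq.L"
  then have "mev (\<lambda>c. [:c:]) (lev (\<lambda>_. 0)) (phi z 1 :: ('a, 'k) mpoly) = (0 :: 'k poly)"
    by (rule evaluation_kills_L[OF z_P lin, rotated -1]) auto
  then show False by (simp add: phi_one monomial_evaluation.one[OF lev_evaluation])
qed

text \<open>Otherwise the evaluation along u would map the quotient to k[X] with x_v going to a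
  nonzero multiple of X; the powers of x_v would stay independent, against finite dimension.\<close>

lemma lsop_injective:
  fixes u :: "'a \<Rightarrow> 'k"
  assumes lin: "\<And>i. i < length fs \<Longrightarrow> fs ! i = (\<Sum>v\<in>atoms P. const (\<theta> v i) * var v)"
    and fin: "finite_dim_quot (polys P) Id fs" and t: "t \<in> P"
    and u: "\<And>i. i < length fs \<Longrightarrow> (\<Sum>v\<in>V t. u v * \<theta> v i) = 0" and v: "v \<in> V t"
  shows "u v = 0"
proof (rule ccontr)
  assume nz: "u v \<noteq> 0"
  interpret ev: monomial_evaluation "\<lambda>c. [:c:]" "lev u" by (rule lev_evaluation)
  have va: "v \<in> atoms P" "v \<le> t" "v \<in> P" using v by (auto simp: V_def atoms_iff)
  obtain n where n: "\<And>ps :: ('a, 'k) mpoly list. set ps \<subseteq> RP \<Longrightarrow> n < length ps \<Longrightarrow>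
    (\<exists>cs. length cs = length ps \<and> (\<Sum>i<length ps. const (cs ! i) * ps ! i) \<in> pq.L \<and> (\<exists>i<length ps. cs ! i \<noteq> 0))"
    using pq.finite_dim_dependent[OF one_notin_L[OF lin] fin] by blast
  \<comment> \<open>One more power than the dimension bound allows for independent elements.\<close>
  let ?ps = "map (\<lambda>k. var v ^ k) [0..<Suc n] :: ('a, 'k) mpoly list"
  have "set ?ps \<subseteq> RP" using polys_power[OF var_carrier[OF va(3)]] by auto
  then obtain cs where cs: "(\<Sum>i<length ?ps. const (cs ! i) * ?ps ! i) \<in> pq.L" "\<exists>i<length ?ps. cs ! i \<noteq> 0"
    using n[of ?ps] by auto
  have x: "mev (\<lambda>c. [:c:]) (lev u) (phi t (var v)) = [:0, u v:]"
    using va unfolding phi_var V_atom[OF va(1)] by (simp add: ev.single lev_def ind_def one_pCons)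
  have ph: "phi t (p ^ k) = phi t p ^ k" for k and p :: "('a, 'k) mpoly" by (induction k) (auto simp: phi_one phi_mult)
  have "0 = mev (\<lambda>c. [:c:]) (lev u) (phi t (\<Sum>i<length ?ps. const (cs ! i) * ?ps ! i))"
    using evaluation_kills_L[OF t lin u cs(1)] by simp
  also have "\<dots> = (\<Sum>i<Suc n. [:cs ! i:] * [:0, u v:] ^ i)"
    unfolding phi_sum phi_mult phi_const ev.sum ev.mult
    by (rule sum.cong) (simp_all add: ph ev.power x const_def ev.single lev_def del: upt_Suc)
  also have "\<dots> = (\<Sum>i<Suc n. Polynomial.monom (cs ! i * u v ^ i) i)"
  proof (rule sum.cong[OF refl])
    fix i
    have "[:0, u v:] = Polynomial.monom (u v) 1" by (simp add: Polynomial.monom_altdef)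
    then show "[:cs ! i:] * [:0, u v:] ^ i = Polynomial.monom (cs ! i * u v ^ i) i" by (simp add: Polynomial.monom_power Polynomial.smult_monom)
  qed
  finally have z: "(\<Sum>i<Suc n. Polynomial.monom (cs ! i * u v ^ i) i) = 0" by simp
  obtain i where i: "i < Suc n" "cs ! i \<noteq> 0" using cs(2) by auto
  have "Polynomial.coeff (\<Sum>i<Suc n. Polynomial.monom (cs ! i * u v ^ i) i) i = (\<Sum>j<Suc n. if j = i then cs ! i * u v ^ i else 0)"
    unfolding Polynomial.coeff_sum by (rule sum.cong) auto
  also have "\<dots> = cs ! i * u v ^ i" using i(1) by (simp del: sum.lessThan_Suc)
  finally have "cs ! i * u v ^ i = 0" unfolding z by simp
  then show False using i nz by simp
qed

end

section \<open>The socle\<close>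

lemma homogeneous_closed:
  assumes "homogeneous w j p"
  shows "homogeneous w j q \<Longrightarrow> homogeneous w j (p + q)" "homogeneous w j (const c * p)" "homogeneous w j (- p)"
proof -
  show "homogeneous w j (p + q)" if q: "homogeneous w j q"
    unfolding homogeneous_def
  proof
    fix m assume "m \<in> Poly_Mapping.keys (p + q)"
    then have "m \<in> Poly_Mapping.keys p \<or> m \<in> Poly_Mapping.keys q" using Poly_Mapping.keys_add[of p q] by blast
    then show "(\<Sum>v\<in>mkeys m. Poly_Mapping.lookup m v * w v) = j" using assms q by (auto simp: homogeneous_def)
  qed
  show "homogeneous w j (const c * p)" "homogeneous w j (- p)"
    using assms by (simp_all add: homogeneous_def in_keys_iff lookup_const_mult)
qed

locale acyclic_face_ring = face_ring P fs + local_acyclic P d \<theta> a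
  for P :: "'a::order set" and fs :: "('a, 'k::field) mpoly list"
    and d and \<theta> :: "'a \<Rightarrow> nat \<Rightarrow> 'k" and a +
  assumes length_fs: "length fs = d"
    and fs_linear: "\<And>i. i < d \<Longrightarrow> fs ! i = (\<Sum>v\<in>atoms P. const (\<theta> v i) * var v)"
begin

text \<open>The coordinates of p, viewed as an element of the double complex at the empty chain in
  Koszul degree 0.\<close>

definition emb :: "('a, 'k) mpoly \<Rightarrow> nat set \<Rightarrow> 'a idx \<Rightarrow> 'k" where
  "emb p = (\<lambda>T (c, r, m). if T = {} \<and> c = {} then Psi p r m else 0)"

lemma emb_eqI:
  assumes f: "E J 0 0 f" and e: "\<And>r m. Psi p r m = f {} ({}, r, m)"
  shows "emb p = f"
proof (intro ext)
  fix T and x :: "'a idx"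
  obtain c r m where x: "x = (c, r, m)" by (cases x) auto
  show "emb p T x = f T x"
  proof (cases "T = {} \<and> c = {}")
    case False
    have "f T (c, r, m) = 0"
    proof (rule ccontr)
      assume "f T (c, r, m) \<noteq> 0"
      note D = E_D[OF f this]
      show False using D(2,4,7) Ch_finite[OF D(3)] False by simp
    qed
    then show ?thesis using False by (auto simp: emb_def x)
  qed (simp add: emb_def x e)
qed

lemma empty_Ch: "{} \<in> Ch r" by (simp add: Ch_def chain_def)

lemma bd_at:
  "bd u {} ({}, r, m) = (\<Sum>v\<in>atoms P. if mon r m \<and> v \<in> mkeys m
     then \<Sum>i<d. \<theta> v i * u {i} ({}, fc r (mkeys (m - esingle v)), m - esingle v) else 0)"
  unfolding bd_def kos_def by (rule sum.cong) (auto simp: sv_def iota_def empty_Ch sg_def)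

lemma Psi_fs:
  assumes g: "g \<in> RP" and i: "i < d"
  shows "Psi (g * fs ! i) r m = (\<Sum>v\<in>atoms P. if mon r m \<and> v \<in> mkeys m
     then \<theta> v i * Psi g (fc r (mkeys (m - esingle v))) (m - esingle v) else 0)"
proof -
  have "g * fs ! i = (\<Sum>v\<in>atoms P. const (\<theta> v i) * (var v * g))"
    unfolding fs_linear[OF i] sum_distrib_left by (simp add: mult_ac)
  then show ?thesis by (auto simp: Psi_sum Psi_const_mult Psi_var_mult[OF g] intro!: sum.cong)
qed

text \<open>Agrees term by term with \<open>bd_at\<close>: in coordinates the Koszul differential
  from degree 1 to degree 0 is the combination of the parameters with the given
  coefficients.\<close>

lemma Psi_sum_fs:
  assumes "\<And>i. i < d \<Longrightarrow> g i \<in> RP"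
  shows "Psi (\<Sum>i<d. g i * fs ! i) r m = (\<Sum>v\<in>atoms P. if mon r m \<and> v \<in> mkeys m
     then \<Sum>i<d. \<theta> v i * Psi (g i) (fc r (mkeys (m - esingle v))) (m - esingle v) else 0)"
proof -
  have "Psi (\<Sum>i<d. g i * fs ! i) r m = (\<Sum>i<d. \<Sum>v\<in>atoms P. if mon r m \<and> v \<in> mkeys m
     then \<theta> v i * Psi (g i) (fc r (mkeys (m - esingle v))) (m - esingle v) else 0)"
    unfolding Psi_sum using assms by (intro sum.cong) (auto simp: Psi_fs)
  also have "\<dots> = (\<Sum>v\<in>atoms P. \<Sum>i<d. if mon r m \<and> v \<in> mkeys m
     then \<theta> v i * Psi (g i) (fc r (mkeys (m - esingle v))) (m - esingle v) else 0)"
    by (rule sum.swap)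
  also have "\<dots> = (\<Sum>v\<in>atoms P. if mon r m \<and> v \<in> mkeys m
     then \<Sum>i<d. \<theta> v i * Psi (g i) (fc r (mkeys (m - esingle v))) (m - esingle v) else 0)"
    by (rule sum.cong) auto
  finally show ?thesis .
qed

lemma L_iff: "p \<in> pq.L \<longleftrightarrow> p \<in> RP \<and> (\<exists>g. (\<forall>i<d. g i \<in> RP) \<and> p - (\<Sum>i<d. g i * fs ! i) \<in> Id)"
  by (simp add: pq.L_def length_fs)

text \<open>The components of u are realised by polynomials g i. Subtracting their combination with
  the parameters leaves a polynomial with zero coordinates, hence in the face ideal.\<close>

lemma boundary_in_L:
  assumes p: "p \<in> RP" and u: "E (Suc J) (Suc 0) 0 u" and pu: "emb p = bd u"
  shows "p \<in> pq.L"
proof -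
  have "\<exists>q. q \<in> RP \<and> Psi q = (\<lambda>r m. u {i} ({}, r, m))" for i
  proof -
    have nz: "mon r m \<and> mdeg m = J" if "u {i} ({}, r, m) \<noteq> 0" for r m
      using E_D[OF u that] by simp
    have "finite {(r, m). u {i} ({}, r, m) \<noteq> 0}"
      by (rule finite_subset[OF _ finite_mon[of J]]) (use nz in auto)
    then show ?thesis using Psi_surj[of "\<lambda>r m. u {i} ({}, r, m)" J] nz by blast
  qed
  then obtain g where g: "\<And>i. g i \<in> RP" "\<And>i. Psi (g i) = (\<lambda>r m. u {i} ({}, r, m))" by metis
  have gs: "(\<Sum>i<d. g i * fs ! i) \<in> RP"
    using g(1) pq.fs_nth length_fs by (auto intro!: polys_sum polys_closed)
  have "Psi (p - (\<Sum>i<d. g i * fs ! i)) r m = 0" for r m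
  proof -
    have "Psi p r m = emb p {} ({}, r, m)" by (simp add: emb_def)
    also have "\<dots> = Psi (\<Sum>i<d. g i * fs ! i) r m"
      unfolding pu bd_at Psi_sum_fs[OF g(1)] g(2) ..
    finally show ?thesis by (simp add: Psi_diff)
  qed
  then have "p - (\<Sum>i<d. g i * fs ! i) \<in> Id" using Id_iff_Psi[OF polys_closed(3)[OF p gs]] by blast
  then show ?thesis unfolding L_iff using p g(1) by blast
qed

text \<open>The converse for homogeneous p, which carries independence from the Koszul complex over
  to the quotient ring.\<close>

lemma L_boundary:
  assumes p: "p \<in> RP" "homogeneous (rk P) J p" and L: "p \<in> pq.L"
  shows "emb p \<in> boundaries J 0"
proof -
  obtain g where g: "\<And>i. i < d \<Longrightarrow> g i \<in> RP" "p - (\<Sum>i<d. g i * fs ! i) \<in> Id" using L unfolding L_iff by blast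
  \<comment> \<open>The coefficients g i may be inhomogeneous. Only their parts of degree J - 1
    contribute in degree J, and only these fit the double complex.\<close>
  define u where "u = (\<lambda>T (c :: 'a set, r, m). if (\<exists>i<d. T = {i}) \<and> c = {} \<and> Suc (mdeg m) = J
      then Psi (g (the_elem T)) r m else 0)"
  have Eu: "E J (Suc 0) 0 u"
    unfolding E_def u_def by (auto simp: empty_Ch Psi_def split: if_splits)
  have "emb p = bd u"
  proof (rule emb_eqI[OF E_bd[OF Eu]])
    fix r m
    show "Psi p r m = bd u {} ({}, r, m)"
    proof (cases "mdeg m = J")
      case True
      have "Psi p r m = Psi (\<Sum>i<d. g i * fs ! i) r m" using Psi_face_ideal[OF g(2), of r m] by (simp add: Psi_diff)
      also have "\<dots> = bd u {} ({}, r, m)"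
      proof (subst Psi_sum_fs, rule g(1), assumption, unfold bd_at, rule sum.cong[OF refl])
        fix v assume "v \<in> atoms P"
        show "(if mon r m \<and> v \<in> mkeys m then \<Sum>i<d. \<theta> v i * Psi (g i) (fc r (mkeys (m - esingle v))) (m - esingle v) else 0) =
          (if mon r m \<and> v \<in> mkeys m then \<Sum>i<d. \<theta> v i * u {i} ({}, fc r (mkeys (m - esingle v)), m - esingle v) else 0)"
          using True mdeg_minus_esingle[of v m] by (auto simp: u_def intro!: sum.cong)
      qed
      finally show ?thesis .
    next
      case False
      have "Psi p r m = 0" using Psi_homogeneous[OF p] False by blast
      moreover have "bd u {} ({}, r, m) = 0" using E_D(6)[OF E_bd[OF Eu], of "{}" "{}" r m] False by auto
      ultimately show ?thesis by simp
    qed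
  qed
  then show ?thesis unfolding boundaries_def using Eu by blast
qed

lemma E_preimage:
  assumes f: "E J 0 0 f"
  shows "\<exists>p\<in>RP. homogeneous (rk P) J p \<and> emb p = f"
proof -
  have nz: "mon r m \<and> mdeg m = J" if "f {} ({}, r, m) \<noteq> 0" for r m using E_D[OF f that] by simp
  have "finite {(r, m). f {} ({}, r, m) \<noteq> 0}"
    by (rule finite_subset[OF _ finite_mon[of J]]) (use nz in auto)
  then obtain p where p: "p \<in> RP" "homogeneous (rk P) J p" "Psi p = (\<lambda>r m. f {} ({}, r, m))"
    using Psi_surj[of "\<lambda>r m. f {} ({}, r, m)" J] nz by blast
  have "emb p = f" by (rule emb_eqI[OF f]) (simp add: p(3))
  then show ?thesis using p by blast
qed

lemma emb_var_mult:
  assumes p: "p \<in> RP" "E J 0 0 (emb p)" and v: "v \<in> atoms P"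
  shows "emb (var v * p) = mul v (emb p)"
  by (rule emb_eqI[OF E_mul[OF p(2)]]) (auto simp: mul_def sv_def empty_Ch emb_def Psi_var_mult[OF p(1) v])

text \<open>Homogeneous representatives of socle elements, so that the socle component can be
  handled through membership in L.\<close>

definition socle_lifts :: "nat \<Rightarrow> ('a, 'k) mpoly set" where
  "socle_lifts J = {p \<in> RP. homogeneous (rk P) J p \<and> (\<forall>q\<in>irrelevant_ideal (atoms P). q * p \<in> pq.L)}"

lemma atoms_subset: "p \<in> carrier (polys (atoms P)) \<Longrightarrow> p \<in> carrier (polys P)"
  using atoms_iff unfolding polys_carrier by blast

lemma irrelevant_carrier: "(q :: ('a, 'k) mpoly) \<in> irrelevant_ideal (atoms P) \<Longrightarrow> q \<in> carrier (polys (atoms P))"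
  unfolding irrelevant_ideal_def
  by (rule ideal.Icarr[OF genideal_carrier(1)]) (auto intro: var_carrier)

lemma socle_lifts_eq:
  "face_ring_socle P fs \<inter> face_ring_component P fs J = seq_class (polys P) Id fs ` socle_lifts J"
proof -
  let ?h = "seq_class (polys P) Id fs"
  have s: "?h p \<in> face_ring_socle P fs \<longleftrightarrow> (\<forall>q\<in>irrelevant_ideal (atoms P). q * p \<in> pq.L)" if p: "p \<in> RP" for p
  proof -
    have "?h q \<otimes>\<^bsub>pq.Q\<^esub> ?h p = \<zero>\<^bsub>pq.Q\<^esub> \<longleftrightarrow> q * p \<in> pq.L" if q: "q \<in> irrelevant_ideal (atoms P)" for q
    proof -
      have qc: "q \<in> RP" by (rule atoms_subset[OF irrelevant_carrier[OF q]])
      show ?thesis using pq.cl.hom_mult[OF qc p] pq.class_0_iff[OF polys_closed(2)[OF qc p]] by simp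
    qed
    then show ?thesis using pq.cl.hom_closed[OF p] by (simp add: face_ring_socle_def Let_def)
  qed
  show ?thesis
  proof (intro equalityI subsetI)
    fix y assume y: "y \<in> face_ring_socle P fs \<inter> face_ring_component P fs J"
    then obtain p where p: "p \<in> RP" "homogeneous (rk P) J p" "y = ?h p" by (auto simp: face_ring_component_def)
    then show "y \<in> ?h ` socle_lifts J" using y s[OF p(1)] by (auto simp: socle_lifts_def)
  next
    fix y assume "y \<in> ?h ` socle_lifts J"
    then obtain p where p: "p \<in> RP" "homogeneous (rk P) J p" "y = ?h p" "\<forall>q\<in>irrelevant_ideal (atoms P). q * p \<in> pq.L"
      by (auto simp: socle_lifts_def)
    then show "y \<in> face_ring_socle P fs \<inter> face_ring_component P fs J"
      using s[OF p(1)] by (auto simp: face_ring_component_def)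
  qed
qed

lemma socle_lifts_closed:
  assumes p: "p \<in> socle_lifts J"
  shows "q \<in> socle_lifts J \<Longrightarrow> p + q \<in> socle_lifts J" "const c * p \<in> socle_lifts J" "- p \<in> socle_lifts J"
proof -
  have neg: "- (x :: ('a, 'k) mpoly) \<in> pq.L" if "x \<in> pq.L" for x
    using pq.L_closed(5)[OF pq.L_closed(3) that] by simp
  have cm: "x * (const c * p) \<in> pq.L" if "x * p \<in> pq.L" for x
    using pq.L_closed(2)[OF that const_carrier, of c] by (simp add: mult.left_commute)
  show "p + q \<in> socle_lifts J" if q: "q \<in> socle_lifts J"
    using p q homogeneous_closed(1)[of "rk P" J p q] polys_closed(1)[of p P q] pq.L_closed(1)
    by (simp add: socle_lifts_def distrib_left)
  show "const c * p \<in> socle_lifts J"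
    using p homogeneous_closed(2)[of "rk P" J p c] polys_closed(2)[OF const_carrier, of p P c] cm
    by (simp add: socle_lifts_def)
  show "- p \<in> socle_lifts J"
    using p homogeneous_closed(3)[of "rk P" J p] polys_uminus[of p P] neg by (simp add: socle_lifts_def)
qed

text \<open>The multipliers taking p into L form an ideal of S, so testing the variables of the
  atoms suffices.\<close>

lemma socle_liftsI:
  assumes p: "p \<in> RP" "homogeneous (rk P) J p" and v: "\<And>v. v \<in> atoms P \<Longrightarrow> var v * p \<in> pq.L"
  shows "p \<in> socle_lifts J"
proof -
  let ?J = "{q \<in> carrier (polys (atoms P)). q * p \<in> pq.L}"
  have "ideal ?J (polys (atoms P))"
  proof (rule polys_idealI)
    show "q + q' \<in> ?J" if "q \<in> ?J" "q' \<in> ?J" for q q'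
      using that polys_closed(1)[of q "atoms P" q'] pq.L_closed(1) by (simp add: distrib_right)
    show "x * q \<in> ?J" if "q \<in> ?J" "x \<in> carrier (polys (atoms P))" for q x
      using that polys_closed(2)[of x "atoms P" q] pq.L_closed(2)[of "q * p" x] atoms_subset[of x] by (simp add: mult.assoc)
  qed (auto simp: polys_01 pq.L_closed(3))
  moreover have "var ` atoms P \<subseteq> ?J" using v by (auto intro: var_carrier)
  ultimately have "Idl\<^bsub>polys (atoms P)\<^esub> (var ` atoms P) \<subseteq> ?J"
    by (intro genideal_carrier(3)) (auto intro: var_carrier)
  then show ?thesis using p by (auto simp: socle_lifts_def irrelevant_ideal_def)
qed

lemma one_not_L: "1 \<notin> pq.L"
  by (rule one_notin_L) (use fs_linear length_fs in simp)

lemma socle_subalgebra: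
  "subalgebra (scalars (polys P) Id fs) (seq_class (polys P) Id fs ` socle_lifts J) pq.Q"
proof -
  let ?h = "seq_class (polys P) Id fs"
  have c: "p \<in> RP" if "p \<in> socle_lifts J" for p using that by (simp add: socle_lifts_def)
  show ?thesis
  proof (rule subalgebra.intro)
    show "subgroup (?h ` socle_lifts J) (add_monoid pq.Q)"
    proof (rule pq.cl.S.add.subgroupI)
      show "?h ` socle_lifts J \<subseteq> carrier pq.Q" using pq.cl.hom_closed c by blast
      have "0 \<in> socle_lifts J"
        using pq.L_closed(3) by (simp add: socle_lifts_def polys_01 homogeneous_def)
      then show "?h ` socle_lifts J \<noteq> {}" by blast
      show "\<ominus>\<^bsub>pq.Q\<^esub> y \<in> ?h ` socle_lifts J" if y: "y \<in> ?h ` socle_lifts J" for y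
      proof -
        obtain p where p: "p \<in> socle_lifts J" "y = ?h p" using y by blast
        have "\<ominus>\<^bsub>pq.Q\<^esub> y = ?h (- p)" using pq.cl.hom_a_inv[OF c[OF p(1)]] polys_a_inv[OF c[OF p(1)]] p(2) by simp
        then show ?thesis using socle_lifts_closed(3)[OF p(1)] by blast
      qed
      show "y \<oplus>\<^bsub>pq.Q\<^esub> y' \<in> ?h ` socle_lifts J" if y: "y \<in> ?h ` socle_lifts J" "y' \<in> ?h ` socle_lifts J" for y y'
      proof -
        obtain p p' where p: "p \<in> socle_lifts J" "y = ?h p" "p' \<in> socle_lifts J" "y' = ?h p'" using y by blast
        have "y \<oplus>\<^bsub>pq.Q\<^esub> y' = ?h (p + p')" using pq.cl.hom_add[OF c[OF p(1)] c[OF p(3)]] p by simp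
        then show ?thesis using socle_lifts_closed(1)[OF p(1,3)] by blast
      qed
    qed
    show "subalgebra_axioms (scalars (polys P) Id fs) (?h ` socle_lifts J) pq.Q"
    proof
      fix k y assume k: "k \<in> scalars (polys P) Id fs" and y: "y \<in> ?h ` socle_lifts J"
      obtain e where e: "k = ?h (const e)" using k by (auto simp: scalars_def)
      obtain p where p: "p \<in> socle_lifts J" "y = ?h p" using y by blast
      have "k \<otimes>\<^bsub>pq.Q\<^esub> y = ?h (const e * p)" using pq.cl.hom_mult[OF const_carrier c[OF p(1)], of e] e p by simp
      then show "k \<otimes>\<^bsub>pq.Q\<^esub> y \<in> ?h ` socle_lifts J" using socle_lifts_closed(2)[OF p(1)] by blast
    qed
  qed
qed

text \<open>Passes from combinations indexed by positions in a list, as used for independence in a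
  ring, to those indexed by a set, as used for the Koszul classes.\<close>

lemma emb_lc:
  assumes js_: "distinct js" and e: "\<And>i. i \<in> set js \<Longrightarrow> emb (pp i) = g i"
  shows "\<exists>c. emb (\<Sum>k<length js. const (cs ! k) * pp (js ! k)) = lc (set js) c g \<and> (\<forall>k<length js. c (js ! k) = cs ! k)"
proof -
  define c where "c x = cs ! (inv_into {..<length js} ((!) js) x)" for x
  have bij: "bij_betw ((!) js) {..<length js} (set js)" by (rule bij_betw_nth[OF js_ refl refl])
  have c: "c (js ! k) = cs ! k" if "k < length js" for k
    using bij_betw_inv_into_left[OF bij, of k] that by (simp add: c_def)
  have "emb (\<Sum>k<length js. const (cs ! k) * pp (js ! k)) T x = lc (set js) c g T x" for T and x :: "'a idx"
  proof -
    obtain ch r m where x: "x = (ch, r, m)" by (cases x) auto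
    have "emb (\<Sum>k<length js. const (cs ! k) * pp (js ! k)) T x = (\<Sum>k<length js. cs ! k * emb (pp (js ! k)) T x)"
    proof (cases "T = {} \<and> ch = {}")
      case True
      then show ?thesis by (simp add: emb_def x Psi_sum Psi_const_mult)
    next
      case False
      show ?thesis unfolding emb_def x prod.case if_not_P[OF False] by simp
    qed
    also have "\<dots> = (\<Sum>k<length js. c (js ! k) * g (js ! k) T x)" using c e by (intro sum.cong) auto
    also have "\<dots> = (\<Sum>i\<in>set js. c i * g i T x)" by (rule sum.reindex_bij_betw[OF bij])
    finally show ?thesis by (simp add: lc_def)
  qed
  then show ?thesis using c by blast
qed

theorem socle_dim_bound:
  assumes fin: "finite_dim_quot (polys P) Id fs"
  shows "(d choose J) * betti_nr J \<le> socle_dim P fs J"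
proof -
  let ?h = "seq_class (polys P) Id fs" and ?K = "scalars (polys P) Id fs" and ?I = "class_index J J"
  obtain g where g: "\<And>i. i \<in> ?I \<Longrightarrow> \<exists>\<zeta>. zigzag J 0 J \<zeta> \<and> \<zeta> 0 = g i \<and> del (\<zeta> J) = 0"
    "\<And>c. lc ?I c g \<in> boundaries J 0 \<Longrightarrow> \<forall>i\<in>?I. c i = 0"
    using koszul_classes[of 0 J J] by auto
  have Eg: "E J 0 0 (g i)" if "i \<in> ?I" for i using g(1)[OF that] by (auto simp: zigzag_def)
  have "\<forall>i\<in>?I. \<exists>p\<in>RP. homogeneous (rk P) J p \<and> emb p = g i" using E_preimage[OF Eg] by blast
  then obtain pp where pp: "\<And>i. i \<in> ?I \<Longrightarrow> pp i \<in> RP" "\<And>i. i \<in> ?I \<Longrightarrow> homogeneous (rk P) J (pp i)"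
    "\<And>i. i \<in> ?I \<Longrightarrow> emb (pp i) = g i" by metis
  \<comment> \<open>The class extends to a zigzag with closed end, so its product with each atom is
    a Koszul boundary and therefore lies in L.\<close>
  have soc: "pp i \<in> socle_lifts J" if i: "i \<in> ?I" for i
  proof (rule socle_liftsI[OF pp(1)[OF i] pp(2)[OF i]])
    fix v assume v: "v \<in> atoms P"
    obtain \<zeta> where z: "zigzag J 0 J \<zeta>" "\<zeta> 0 = g i" "del (\<zeta> J) = 0" using g(1)[OF i] by blast
    obtain u where u: "E (Suc J) (Suc 0) 0 u" "mul v (\<zeta> 0) = bd u" using zigzag_mul[OF z(1,3)] by blast
    have vP: "var v \<in> RP" using v by (intro var_carrier) (simp add: atoms_iff)
    have "emb (var v * pp i) = mul v (g i)" using emb_var_mult[OF pp(1)[OF i] _ v] Eg[OF i] pp(3)[OF i] by simp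
    then have "emb (var v * pp i) = bd u" using u(2) z(2) by simp
    then show "var v * pp i \<in> pq.L" by (rule boundary_in_L[OF polys_closed(2)[OF vP pp(1)[OF i]] u(1)])
  qed
  obtain js where js_: "set js = ?I" "distinct js" using finite_distinct_list[OF class_index(1)] by blast
  let ?ps = "map pp js"
  have psc: "set ?ps \<subseteq> RP" using pp(1) js_(1) by auto
  \<comment> \<open>A relation modulo L turns into a Koszul boundary among the starts of the
    zigzags, which forces zero coefficients.\<close>
  have ind: "ring.independent pq.Q ?K (map ?h ?ps)"
  proof (rule pq.independentI[OF one_not_L psc])
    fix cs :: "'k list" assume cs: "length cs = length ?ps" "(\<Sum>i<length ?ps. const (cs ! i) * ?ps ! i) \<in> pq.L"
    let ?p = "\<Sum>k<length js. const (cs ! k) * pp (js ! k)"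
    have p: "?p \<in> pq.L" using cs(2) by simp
    obtain c where c: "emb ?p = lc (set js) c g" "\<And>k. k < length js \<Longrightarrow> c (js ! k) = cs ! k"
      using emb_lc[OF js_(2), of pp g cs] pp(3) js_(1) by blast
    have nth: "js ! k \<in> ?I" if "k < length js" for k using that js_(1) nth_mem by blast
    have "homogeneous (rk P) J ?p"
    proof -
      have "homogeneous (rk P) J (\<Sum>k\<in>X. const (cs ! k) * pp (js ! k))" if "X \<subseteq> {..<length js}" for X
        using finite_subset[OF that finite_lessThan] that
      proof (induction X rule: finite_induct)
        case (insert k X)
        then show ?case using homogeneous_closed(1)[OF homogeneous_closed(2)[OF pp(2)[OF nth]]] by simp
      qed (simp add: homogeneous_def)
      then show ?thesis by blast
    qed
    then have "emb ?p \<in> boundaries J 0" by (rule L_boundary[OF pq.L_closed(4)[OF p] _ p])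
    then have "\<forall>i\<in>?I. c i = 0" using g(2) c(1) js_(1) by simp
    then show "\<forall>i<length ?ps. cs ! i = 0" using c(2) nth by simp
  qed
  have sub: "set (map ?h ?ps) \<subseteq> ?h ` socle_lifts J" using soc js_(1) by auto
  have hc: "?h ` socle_lifts J \<subseteq> carrier pq.Q" using pq.cl.hom_closed by (auto simp: socle_lifts_def)
  note K = pq.scalars_subfield[OF one_not_L]
  \<comment> \<open>Finite dimension makes \<open>dim\<close> a true upper bound for the length of
    an independent list.\<close>
  have fd: "pq.cl.S.finite_dimension ?K (?h ` socle_lifts J)"
    by (rule pq.cl.S.subalbegra_incl_imp_finite_dimension[OF K fin[unfolded finite_dim_quot_def] socle_subalgebra hc])
  note dm = pq.cl.S.finite_dimensionE[OF K fd, unfolded over_def]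
  have "length (map ?h ?ps) \<le> pq.cl.S.dim ?K (?h ` socle_lifts J)"
    by (rule pq.cl.S.independent_length_le_dimension[OF K dm ind sub])
  moreover have "length js = (d choose J) * betti_nr J"
    using distinct_card[OF js_(2)] js_(1) class_index(2)[of J J] by simp
  ultimately show ?thesis by (simp add: socle_dim_def socle_lifts_eq)
qed

end

theorem theorem6p4:
  fixes P :: "'a::order set"
    and \<theta>s :: "('a, 'k::field) mpoly list"
    and d :: nat
  assumes "infinite (UNIV :: 'k set)"
    and "simplicial_poset P"
    and "poset_rank P = d"
    and "buchsbaum_poset TYPE('k) P"
    and "face_ring_lsop P \<theta>s"
  shows "(\<forall>j\<le>d. socle_dim P \<theta>s j
            \<ge> (d choose j) * betti TYPE('k) (order_complex_bar P) (int j - 1)) \<and>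
         (\<forall>j\<le>d. hprime TYPE('k) P j
            \<ge> int ((d choose j) * betti TYPE('k) (order_complex_bar P) (int j - 1))) \<and>
         (\<forall>j\<le>d. hnum P j
            \<ge> int (d choose j) *
               (\<Sum>i\<le>j. (- 1) ^ (j - i) * int (betti TYPE('k) (order_complex_bar P) (int i - 1))))"
proof -
  interpret sposet P by (rule sposet.intro) (fact assms(2))
  \<comment> \<open>The coefficient of the vertex v in the i-th parameter.\<close>
  define \<theta> where "\<theta> v i = Poly_Mapping.lookup (\<theta>s ! i) (esingle v)" for v i
  have ls: "length \<theta>s = d" "\<And>f. f \<in> set \<theta>s \<Longrightarrow> f \<in> carrier (polys (atoms P)) \<and> homogeneous (rk P) 1 f"
    "finite_dim_quot (polys P) (face_ideal P) \<theta>s"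
    using assms(3,5) by (auto simp: face_ring_lsop_def)
  have "atoms P \<subseteq> P" by (auto simp: atoms_iff)
  then have "set \<theta>s \<subseteq> carrier (polys P)" using ls(2) by (fastforce simp: polys_carrier)
  then interpret face_ring P \<theta>s by unfold_locales
  have lin: "\<theta>s ! i = (\<Sum>v\<in>atoms P. const (\<theta> v i) * var v)" if "i < d" for i
  proof -
    have "\<theta>s ! i \<in> set \<theta>s" using that ls(1) by simp
    from ls(2)[OF this] show ?thesis unfolding \<theta>_def by (intro linear_form) auto
  qed
  have "\<exists>a. \<forall>v\<in>V t. \<forall>w\<in>V t. (\<Sum>i<d. \<theta> v i * a w i) = (if v = w then 1 else 0)" if t: "t \<in> P" for t
  proof (rule dual_basis[OF finite_V], rule ballI)
    fix u :: "'a \<Rightarrow> 'k" and v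
    assume u: "\<And>i. i < d \<Longrightarrow> (\<Sum>v\<in>V t. u v * \<theta> v i) = 0" and v: "v \<in> V t"
    show "u v = 0" by (rule lsop_injective[OF _ ls(3) t _ v, of \<theta>]) (use lin u ls(1) in auto)
  qed
  then obtain a where a: "\<And>t v w. t \<in> P \<Longrightarrow> v \<in> V t \<Longrightarrow> w \<in> V t \<Longrightarrow>
      (\<Sum>i<d. \<theta> v i * a t w i) = (if v = w then 1 else 0)" by metis
  interpret acyclic_face_ring P \<theta>s d \<theta> a
  proof unfold_locales
    fix t q and y :: "'a set \<Rightarrow> 'k"
    assume t: "t \<in> P" "t \<noteq> z" and q: "q + card (V t) < d"
      and y: "\<And>c. c \<in> Lk t \<Longrightarrow> card c = Suc q \<Longrightarrow> cobd y c = 0"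
    show "\<exists>x. \<forall>c\<in>Lk t. card c = q \<longrightarrow> y c = cobd x c"
    proof (rule link_exact_of_regular[OF t(1) _ _ y])
      \<comment> \<open>This is where the Buchsbaum hypothesis enters; for t other than
        \<open>z\<close> it gives regularity in every colour above t.\<close>
      show "colour_regular TYPE('k) t n" if "n + card (V t) < poset_rank P" for n
        using buchsbaum_colour_regular[of t n] assms(4) t that by (simp add: buchsbaum_poset_def)
    qed (use q assms(3) in simp_all)
  qed (use a ls(1) lin in auto)
  let ?b = "\<lambda>i. int (betti_nr i)"
  have h: "int (d choose j) * (\<Sum>i\<le>j. (- 1) ^ (j - i) * ?b i) \<le> hnum P j" if "j \<le> d" for j
    using h_lower_bound that assms(3) by simp
  \<comment> \<open>The correction term in the definition of h' is the alternating sum of the lower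
    Betti numbers with reversed sign. Moving it across the bound for h leaves only the Betti number
    of index j - 1.\<close>
  have "int ((d choose j) * betti_nr j) \<le> hprime TYPE('k) P j" if j: "j \<le> d" for j
  proof -
    have "(\<Sum>i<j. (- 1) ^ (j - i) * ?b i) = - (\<Sum>i<j. (- 1) ^ (j - i - 1) * ?b i)"
      unfolding sum_negf[symmetric]
    proof (rule sum.cong[OF refl])
      fix i assume "i \<in> {..<j}"
      then have "j - i = Suc (j - i - 1)" by auto
      then have "(- 1 :: int) ^ (j - i) = - ((- 1) ^ (j - i - 1))" by (metis mult_minus1 power_Suc)
      then show "(- 1) ^ (j - i) * ?b i = - ((- 1) ^ (j - i - 1) * ?b i)" by simp
    qed
    then have "(\<Sum>i\<le>j. (- 1) ^ (j - i) * ?b i) = ?b j - (\<Sum>i<j. (- 1) ^ (j - i - 1) * ?b i)"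
      by (simp add: lessThan_Suc_atMost[symmetric])
    then show ?thesis using h[OF j] assms(3)
      by (simp add: hprime_def betti_nr_def right_diff_distrib)
  qed
  then show ?thesis using h socle_dim_bound[OF ls(3)] by (simp add: betti_nr_def)
qed

end
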